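(* For every $\delta > 0$ there exists $\zeta_0 \in H^1_{\rm per}(\mathbb{T}) \cap W^{1,\infty}(\mathbb{T})$ satisfying $$\| \zeta_0 \|_{H^1_{\rm per}} \leq \delta^2, \qquad \| \zeta_0 \|_{W^{1,\infty}} \leq \delta,$$ such that the unique local solution $\zeta \in C^0((-\tau_0,\tau_0),H^1_{\rm per}(\mathbb{T}) \cap W^{1,\infty}(\mathbb{T}))$, with $\tau_0>0$ the maximal existence time, of the evolution equation $$2 c_* \partial_t \zeta = (c_*^2 - 2 \eta_* )\, \partial_x \zeta - 2 (\zeta - \zeta |_{x = 0})\, \partial_x \zeta - \frac{1}{\pi} \int_{\mathbb{T}} \eta_*' \zeta\, dx + \frac{1}{2} \Pi_0 \partial_x^{-1} \Pi_0 \left[ \zeta + 2 (\partial_x \zeta)^2 \right]$$ with $\zeta|_{t = 0} = \zeta_0$ satisfies $$\| \zeta(t_0,\cdot) \|_{W^{1,\infty}} = 1$$ for some $t_0 \in (0,\tau_0)$.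
   Context: $\mathbb{T}=\mathbb{R}/2\pi\mathbb{Z}$; functions are real-valued. $c_* := \frac{\pi}{2\sqrt{2}}$. The peaked profile is $\eta_*(x) = \frac{1}{16}(\pi^2 - 4\pi|x| + 2x^2)$ for $x\in[-\pi,\pi]$, extended $2\pi$-periodically, with $\eta_*'(x) = -\frac14(\pi-|x|)\,{\rm sign}(x)$ on $[-\pi,\pi]$. The operator $\Pi_0 f = f - \frac{1}{2\pi}\int_{\mathbb{T}} f\,dx$ is the projection onto zero-mean functions, and $\Pi_0\partial_x^{-1}\Pi_0$ maps $f$ to the unique $2\pi$-periodic zero-mean function whose derivative is $\Pi_0 f$. $\zeta|_{x=0}$ denotes $\zeta(t,0)$. The equation governs the perturbation $\zeta$ of the peaked traveling wave $\eta_*$ in the decomposition $\eta(t,x)=\eta_*(x-\xi(t))+\zeta(t,x-\xi(t))$ of solutions of $2c_*\partial_t\eta=(c_*^2-2\eta)\partial_x\eta+\Pi_0\partial_x^{-1}\Pi_0[(\partial_x\eta)^2+\eta]$, where $\xi(t)$ is the location of the peak and $\xi'(t)=-\frac{1}{2c_*}(c_*^2-2\eta(t,\xi(t)))$, with $x-\xi(t)$ renamed $x$. *)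

theory Defs
  imports "HOL-Analysis.Analysis" "HOL-Probability.Essential_Supremum"
begin

text \<open>Functions on the torus are \<open>2\<pi>\<close>-periodic functions on the real line, integrated
  over the fundamental domain \<open>[-\<pi>, \<pi>]\<close>.\<close>

definition periodic_2pi :: "(real \<Rightarrow> real) \<Rightarrow> bool" where
  "periodic_2pi f \<longleftrightarrow> (\<forall>x. f (x + 2 * pi) = f x)"

abbreviation torus :: "real measure" where
  "torus \<equiv> lebesgue_on {-pi..pi}"

definition L2_per :: "(real \<Rightarrow> real) set" where
  "L2_per = {f. periodic_2pi f \<and> f \<in> borel_measurable torus \<and> integrable torus (\<lambda>x. (f x)\<^sup>2)}"

definition L2_norm :: "(real \<Rightarrow> real) \<Rightarrow> real" where
  "L2_norm f = sqrt (LINT x|torus. (f x)\<^sup>2)"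

definition Linf_per :: "(real \<Rightarrow> real) set" where
  "Linf_per = {f. periodic_2pi f \<and> f \<in> borel_measurable torus \<and> (\<exists>C. AE x in torus. \<bar>f x\<bar> \<le> C)}"

definition Linf_norm :: "(real \<Rightarrow> real) \<Rightarrow> real" where
  "Linf_norm f = real_of_ereal (esssup torus (\<lambda>x. ereal \<bar>f x\<bar>))"

definition test_function :: "(real \<Rightarrow> real) \<Rightarrow> bool" where
  "test_function \<phi> \<longleftrightarrow> periodic_2pi \<phi> \<and> (\<forall>n x. (deriv ^^ n) \<phi> field_differentiable (at x))"

definition has_weak_deriv :: "(real \<Rightarrow> real) \<Rightarrow> (real \<Rightarrow> real) \<Rightarrow> bool" where
  "has_weak_deriv f g \<longleftrightarrow>
     periodic_2pi f \<and> periodic_2pi g \<and> integrable torus f \<and> integrable torus g \<and>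
     (\<forall>\<phi>. test_function \<phi> \<longrightarrow>
        (LINT x|torus. f x * deriv \<phi> x) = - (LINT x|torus. g x * \<phi> x))"

text \<open>The weak derivative is unique only almost everywhere; \<open>weak_deriv f\<close> is an arbitrary
  representative, and is used below only where null sets do not matter.\<close>

definition weak_deriv :: "(real \<Rightarrow> real) \<Rightarrow> real \<Rightarrow> real" where
  "weak_deriv f = (SOME g. has_weak_deriv f g)"

text \<open>Elements of the Sobolev spaces are identified with their continuous representatives,
  so that point values such as \<open>\<zeta>(t,0)\<close> make sense and equality in the
  space is equality of functions.\<close>

definition H1_per :: "(real \<Rightarrow> real) set" where
  "H1_per = {f. continuous_on UNIV f \<and> f \<in> L2_per \<and> (\<exists>g \<in> L2_per. has_weak_deriv f g)}"

definition H1_norm :: "(real \<Rightarrow> real) \<Rightarrow> real" where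
  "H1_norm f = sqrt ((L2_norm f)\<^sup>2 + (L2_norm (weak_deriv f))\<^sup>2)"

definition W1inf_per :: "(real \<Rightarrow> real) set" where
  "W1inf_per = {f. continuous_on UNIV f \<and> f \<in> Linf_per \<and> (\<exists>g \<in> Linf_per. has_weak_deriv f g)}"

definition W1inf_norm :: "(real \<Rightarrow> real) \<Rightarrow> real" where
  "W1inf_norm f = Linf_norm f + Linf_norm (weak_deriv f)"

definition c_star :: real where
  "c_star = pi / (2 * sqrt 2)"

text \<open>The representative of \<open>x\<close> modulo \<open>2\<pi>\<close> in \<open>[-\<pi>, \<pi>)\<close>.\<close>

definition wrap :: "real \<Rightarrow> real" where
  "wrap x = x - 2 * pi * of_int \<lfloor>(x + pi) / (2 * pi)\<rfloor>"

definition eta_star :: "real \<Rightarrow> real" where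
  "eta_star x = (pi\<^sup>2 - 4 * pi * \<bar>wrap x\<bar> + 2 * (wrap x)\<^sup>2) / 16"

definition eta_star_deriv :: "real \<Rightarrow> real" where
  "eta_star_deriv x = - (1 / 4) * (pi - \<bar>wrap x\<bar>) * sgn (wrap x)"

lemma wrap_eq: "wrap x = x" if "x \<in> {-pi..<pi}"
proof -
  have "\<lfloor>(x + pi) / (2 * pi)\<rfloor> = 0"
    using that by (simp add: floor_eq_iff field_simps)
  then show ?thesis by (simp add: wrap_def)
qed

lemma wrap_pi: "wrap pi = - pi"
  by (simp add: wrap_def)

lemma eta_star_eq:
  "eta_star x = (pi\<^sup>2 - 4 * pi * \<bar>x\<bar> + 2 * x\<^sup>2) / 16" if "x \<in> {-pi..pi}"
  using that wrap_eq[of x] wrap_pi by (cases "x = pi") (auto simp: eta_star_def)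

lemma eta_star_deriv_eq:
  "eta_star_deriv x = - (1 / 4) * (pi - \<bar>x\<bar>) * sgn x" if "x \<in> {-pi..pi}"
  using that wrap_eq[of x] wrap_pi by (cases "x = pi") (auto simp: eta_star_deriv_def)

definition proj0 :: "(real \<Rightarrow> real) \<Rightarrow> real \<Rightarrow> real" where
  "proj0 f x = f x - 1 / (2 * pi) * (LINT y|torus. f y)"

text \<open>The operator \<open>\<Pi>\<^sub>0 \<partial>\<^sub>x\<^sup>-\<^sup>1 \<Pi>\<^sub>0\<close>; continuity selects the representative.\<close>

definition inv_deriv0 :: "(real \<Rightarrow> real) \<Rightarrow> real \<Rightarrow> real" where
  "inv_deriv0 f = (THE F. continuous_on UNIV F \<and> (LINT x|torus. F x) = 0 \<and>
                          has_weak_deriv F (proj0 f))"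

definition evolution_rhs :: "(real \<Rightarrow> real) \<Rightarrow> real \<Rightarrow> real" where
  "evolution_rhs u x =
     (c_star\<^sup>2 - 2 * eta_star x) * weak_deriv u x
     - 2 * (u x - u 0) * weak_deriv u x
     - 1 / pi * (LINT y|torus. eta_star_deriv y * u y)
     + 1 / 2 * inv_deriv0 (\<lambda>y. u y + 2 * (weak_deriv u y)\<^sup>2) x"

text \<open>Existence times are extended reals, since the maximal one may be infinite.\<close>

definition time_interval :: "ereal \<Rightarrow> real set" where
  "time_interval \<tau> = {t. ereal \<bar>t\<bar> < \<tau>}"

definition continuous_H1_W1inf :: "real set \<Rightarrow> (real \<Rightarrow> real \<Rightarrow> real) \<Rightarrow> bool" where
  "continuous_H1_W1inf I \<zeta> \<longleftrightarrow>
     (\<forall>t\<in>I. \<zeta> t \<in> H1_per \<inter> W1inf_per \<and>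
        ((\<lambda>s. H1_norm (\<lambda>x. \<zeta> s x - \<zeta> t x)) \<longlongrightarrow> 0) (at t within I) \<and>
        ((\<lambda>s. W1inf_norm (\<lambda>x. \<zeta> s x - \<zeta> t x)) \<longlongrightarrow> 0) (at t within I))"

text \<open>The time derivative is taken in \<open>L\<^sup>2\<close>. Along a curve that is continuous in
  \<open>W\<^sup>1\<^sup>,\<^sup>\<infinity>\<close> the right-hand side of the equation is continuous in \<open>L\<^sup>\<infinity>\<close>, so solutions in the
  sense of distributions, in \<open>L\<^sup>2\<close> and in \<open>L\<^sup>\<infinity>\<close> are the same.\<close>

definition has_time_deriv :: "(real \<Rightarrow> real \<Rightarrow> real) \<Rightarrow> (real \<Rightarrow> real) \<Rightarrow> real \<Rightarrow> bool" where
  "has_time_deriv \<zeta> D t \<longleftrightarrow> D \<in> L2_per \<and>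
     ((\<lambda>h. L2_norm (\<lambda>x. (\<zeta> (t + h) x - \<zeta> t x) / h - D x)) \<longlongrightarrow> 0) (at 0)"

definition is_solution :: "ereal \<Rightarrow> (real \<Rightarrow> real) \<Rightarrow> (real \<Rightarrow> real \<Rightarrow> real) \<Rightarrow> bool" where
  "is_solution \<tau> \<zeta>\<^sub>0 \<zeta> \<longleftrightarrow>
     continuous_H1_W1inf (time_interval \<tau>) \<zeta> \<and>
     (\<forall>t\<in>time_interval \<tau>. \<exists>D. has_time_deriv \<zeta> D t \<and>
        (AE x in torus. 2 * c_star * D x = evolution_rhs (\<zeta> t) x)) \<and>
     \<zeta> 0 = \<zeta>\<^sub>0"

text \<open>Every solution on a symmetric interval about \<open>0\<close> is a restriction of this one: this
  says both that the solution is unique and that \<open>\<tau>\<^sub>0\<close> is maximal.\<close>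

definition is_unique_maximal_solution ::
    "ereal \<Rightarrow> (real \<Rightarrow> real) \<Rightarrow> (real \<Rightarrow> real \<Rightarrow> real) \<Rightarrow> bool" where
  "is_unique_maximal_solution \<tau>\<^sub>0 \<zeta>\<^sub>0 \<zeta> \<longleftrightarrow>
     \<tau>\<^sub>0 > 0 \<and> is_solution \<tau>\<^sub>0 \<zeta>\<^sub>0 \<zeta> \<and>
     (\<forall>\<tau> \<xi>. \<tau> > 0 \<longrightarrow> is_solution \<tau> \<zeta>\<^sub>0 \<xi> \<longrightarrow>
        \<tau> \<le> \<tau>\<^sub>0 \<and> (\<forall>t\<in>time_interval \<tau>. \<xi> t = \<zeta> t))"

end

theory Submission
  imports Defs "HOL-Real_Asymp.Real_Asymp"
begin

text \<open>The peak makes the flow unstable because the slope there obeys a Riccati equation. On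
  \<open>[0, 2\<pi>]\<close> the transport coefficient is \<open>c\<^sub>*\<^sup>2 - 2\<eta>\<^sub>* = x (2\<pi> - x) / 4\<close> and
  \<open>\<eta>\<^sub>*' = - (\<pi> - x) / 4\<close>, so both peaks \<open>x = 0\<close> and \<open>x = 2\<pi>\<close> are fixed by the characteristics
  \<open>2c\<^sub>* X' = - (X (2\<pi> - X) / 4 - 2 (\<zeta>(X) - \<zeta>(0)))\<close>. With \<open>W = \<partial>\<^sub>x\<zeta>\<close> and \<open>V = \<zeta> - \<zeta>(0)\<close> taken along
  them, differentiating the equation in \<open>x\<close> gives
  \<open>2c\<^sub>* W' = (\<pi> - X) W / 2 - W\<^sup>2 + (V + m) / 2\<close>, where \<open>m\<close> depends on time only. At \<open>X = 0\<close> the linear part is \<open>+ \<pi> W / 2\<close>: a small negative slope to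
  the right of the peak grows exponentially and is helped by \<open>- W\<^sup>2\<close>. In contrast the energy
  \<open>\<integral> (\<partial>\<^sub>x\<zeta>)\<^sup>2\<close> grows at most exponentially in time with a fixed rate, so if it is tiny at first, then
  \<open>V\<close> and \<open>m\<close> stay negligible for as long as needed. Initial slopes of the form
  \<open>d (1 / (n + 2) - (1 - \<xi> / 2\<pi>)\<^bsup>n + 1\<^esup>)\<close> have size \<open>d\<close> at the peak and arbitrarily small energy.

  Existence: the Lagrangian variables, namely \<open>J = \<partial>\<^sub>\<xi>X\<close>, \<open>K = \<partial>\<^sub>\<xi>W\<close> and \<open>p = W(0)\<close>, solve an ordinary
  differential equation with a locally Lipschitz right-hand side in a Banach space of bounded
  continuous functions (\<open>maximal_solution_of_ode\<close>). As long as it lives, \<open>X\<close> is a diffeomorphism of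
  \<open>[0, 2\<pi>]\<close>, and undoing the change of variables yields a solution of the evolution equation whose
  derivative is Lipschitz in \<open>x\<close> away from the peak (\<open>zeta_is_solution\<close>).

  Uniqueness and maximality: every other solution is only bounded in \<open>W\<^sup>1\<^sup>,\<^sup>\<infinity>\<close>, so the difference of two
  solutions cannot be estimated in \<open>H\<^sup>1\<close> by differentiating the equation. Instead the \<open>L\<^sup>2\<close> norm of its
  increments over a distance \<open>h\<close> is differentiated in time, and the resulting bound is uniform after
  division by \<open>h\<^sup>2\<close> (\<open>weak_strong_uniqueness\<close>). If a solution lived longer than the constructed one, then
  its bounded slope would keep the Lagrangian variables bounded up to the end of their life, which is
  impossible (\<open>zeta_is_unique_maximal_solution\<close>).

  Conclusion (\<open>reaches_unit_norm\<close>): if the norm never reached \<open>1\<close>, then by continuity it would stay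
  below \<open>1\<close> at all positive times. If the solution outlives the time \<open>T\<close> at which the slope at the
  peak has grown to size \<open>1\<close>, this is absurd. If it does not, then the slope is bounded at positive times
  by assumption and at negative times by a comparison argument, so that the Lagrangian variables
  cannot blow up, again a contradiction.\<close>

section \<open>Ordinary differential equations in Banach spaces\<close>

text \<open>The weight \<open>exp (2 C \<bar>t\<bar>)\<close> is twice as steep as the growth rate \<open>C\<close>, so one integration in time
  gains the factor \<open>1/2\<close>. This makes Picard iteration a contraction on the whole time axis.\<close>

lemma exp_weighted_derivative_bound:
  fixes f :: "real \<Rightarrow> 'a::real_normed_vector"
  assumes "C > 0" "0 \<le> M"
    and der: "\<And>s. \<bar>s\<bar> \<le> T \<Longrightarrow> (f has_vector_derivative f' s) (at s)"
    and bnd: "\<And>s. \<bar>s\<bar> \<le> T \<Longrightarrow> norm (f' s) \<le> C * M * exp (2 * C * \<bar>s\<bar>)"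
    and t: "\<bar>t\<bar> \<le> T"
  shows "norm (f t - f 0) \<le> M / 2 * exp (2 * C * \<bar>t\<bar>)"
proof (cases "t = 0")
  case False
  define \<sigma> where "\<sigma> = sgn t"
  have \<sigma>: "\<bar>\<sigma>\<bar> = 1" "\<sigma> * \<bar>t\<bar> = t"
    using False by (auto simp: \<sigma>_def sgn_if)
  define g where "g = (\<lambda>s. f (\<sigma> * s))"
  have g: "(g has_vector_derivative (\<sigma> *\<^sub>R f' (\<sigma> * s))) (at s)" if "\<bar>s\<bar> \<le> T" for s
    unfolding g_def using that \<sigma>
    by (auto intro!: vector_diff_chain_at[of "\<lambda>s. \<sigma> * s" \<sigma> _ f, unfolded o_def]
        derivative_eq_intros der simp: abs_mult)
  define \<phi> where "\<phi> = (\<lambda>s. M / 2 * exp (2 * C * s))"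
  have \<phi>: "(\<phi> has_vector_derivative (C * M * exp (2 * C * s))) (at s)" for s
    unfolding \<phi>_def has_real_derivative_iff_has_vector_derivative[symmetric]
    by (auto intro!: derivative_eq_intros simp: field_simps)
  have "norm (g \<bar>t\<bar> - g 0) \<le> \<phi> \<bar>t\<bar> - \<phi> 0"
  proof (rule differentiable_bound_general)
    show "continuous_on {0..\<bar>t\<bar>} g"
      using t by (intro continuous_at_imp_continuous_on ballI has_vector_derivative_continuous[OF g]) auto
    show "continuous_on {0..\<bar>t\<bar>} \<phi>"
      by (auto simp: \<phi>_def intro!: continuous_intros)
    show "norm (\<sigma> *\<^sub>R f' (\<sigma> * x)) \<le> C * M * exp (2 * C * x)" if "0 < x" "x < \<bar>t\<bar>" for x
      using bnd[of "\<sigma> * x"] that \<sigma> t by (auto simp: abs_mult)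
  qed (use False t in \<open>auto intro: g \<phi>\<close>)
  then show ?thesis
    using \<sigma> \<open>0 \<le> M\<close> by (auto simp: g_def \<phi>_def)
qed (use \<open>0 \<le> M\<close> in simp)

text \<open>A bound that can always be halved must be zero. This takes the place of Gronwall's inequality for a
  function \<open>G\<close> that is only known to be bounded.\<close>

lemma exp_weighted_absorption:
  fixes G :: "real \<Rightarrow> real"
  assumes "\<And>t. t \<in> S \<Longrightarrow> 0 \<le> G t" "\<And>t. t \<in> S \<Longrightarrow> G t \<le> B" and "0 \<le> B" "0 \<le> C"
    and halve: "\<And>M t. 0 \<le> M \<Longrightarrow> (\<And>s. s \<in> S \<Longrightarrow> G s \<le> M * exp (2 * C * \<bar>s\<bar>)) \<Longrightarrow> t \<in> S \<Longrightarrow>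
      G t \<le> M / 2 * exp (2 * C * \<bar>t\<bar>)"
    and "t \<in> S"
  shows "G t = 0"
proof -
  have *: "G s \<le> B / 2 ^ n * exp (2 * C * \<bar>s\<bar>)" if "s \<in> S" for n s
    using that
  proof (induction n arbitrary: s)
    case 0
    have "B * 1 \<le> B * exp (2 * C * \<bar>s\<bar>)"
      using assms(3,4) by (intro mult_left_mono) auto
    then show ?case using assms(2)[OF 0] by simp
  next
    case (Suc n)
    show ?case
      using halve[of "B / 2 ^ n" s] Suc assms(3) by (simp add: field_simps)
  qed
  have "(\<lambda>n. B / 2 ^ n * exp (2 * C * \<bar>t\<bar>)) \<longlonglongrightarrow> 0"
    by real_asymp
  then have "G t \<le> 0"
    using *[OF \<open>t \<in> S\<close>] by (intro LIMSEQ_le_const) auto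
  then show ?thesis using assms(1)[OF \<open>t \<in> S\<close>] by simp
qed

lemma linear_differential_inequality_zero:
  fixes f :: "real \<Rightarrow> 'a::real_normed_vector"
  assumes der: "\<And>s. \<bar>s\<bar> \<le> T \<Longrightarrow> (f has_vector_derivative f' s) (at s)"
    and bnd: "\<And>s. \<bar>s\<bar> \<le> T \<Longrightarrow> norm (f' s) \<le> C * norm (f s)"
    and "f 0 = 0" "\<bar>t\<bar> \<le> T"
  shows "f t = 0"
proof -
  have "continuous_on {-T..T} f"
    by (intro continuous_at_imp_continuous_on ballI has_vector_derivative_continuous[OF der]) auto
  then have "bounded (f ` {-T..T})"
    by (intro compact_imp_bounded compact_continuous_image) auto
  then obtain B where B: "B > 0" "\<And>s. \<bar>s\<bar> \<le> T \<Longrightarrow> norm (f s) \<le> B"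
    by (auto simp: bounded_pos abs_le_iff)
  define D where "D = \<bar>C\<bar> + 1"
  have "norm (f t) = 0"
  proof (rule exp_weighted_absorption[where S = "{s. \<bar>s\<bar> \<le> T}" and G = "\<lambda>t. norm (f t)" and B = B and C = D])
    fix M t assume M: "0 \<le> M" and le: "\<And>s. s \<in> {s. \<bar>s\<bar> \<le> T} \<Longrightarrow> norm (f s) \<le> M * exp (2 * D * \<bar>s\<bar>)"
      and t: "t \<in> {s. \<bar>s\<bar> \<le> T}"
    have "norm (f' s) \<le> D * M * exp (2 * D * \<bar>s\<bar>)" if "\<bar>s\<bar> \<le> T" for s
    proof -
      have "norm (f' s) \<le> C * norm (f s)" by (rule bnd[OF that])
      also have "\<dots> \<le> D * norm (f s)" by (intro mult_right_mono) (auto simp: D_def)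
      also have "\<dots> \<le> D * (M * exp (2 * D * \<bar>s\<bar>))"
        using le that by (intro mult_left_mono) (auto simp: D_def)
      finally show ?thesis by simp
    qed
    then show "norm (f t) \<le> M / 2 * exp (2 * D * \<bar>t\<bar>)"
      using exp_weighted_derivative_bound[where f = f and f' = f' and T = T and C = D and M = M and t = t] M der t
        \<open>f 0 = 0\<close> by (auto simp: D_def)
  qed (use B assms in \<open>auto simp: D_def\<close>)
  then show ?thesis by simp
qed

lemma ex_primitive_continuous:
  fixes f :: "real \<Rightarrow> 'a::banach"
  assumes f: "continuous_on UNIV f"
  obtains g where "g 0 = 0" "\<And>t. (g has_vector_derivative f t) (at t)"
proof -
  define g where "g t = (if t \<ge> 0 then integral {0..t} f else - integral {t..0} f)" for t
  have fi: "f integrable_on {a..b}" for a b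
    by (intro integrable_continuous_interval continuous_on_subset[OF f]) auto
  have eq: "g t = integral {a..t} f - integral {a..0} f" if "a \<le> t" "a \<le> 0" for a t
    using Henstock_Kurzweil_Integration.integral_combine[of a 0 t f] Henstock_Kurzweil_Integration.integral_combine[of a t 0 f] that fi
    by (auto simp: g_def algebra_simps)
  have "(g has_vector_derivative f t) (at t)" for t
  proof -
    define a where "a = min t 0 - 1"
    have "((\<lambda>u. integral {a..u} f) has_vector_derivative f t) (at t within {a..t+1})"
      by (intro integral_has_vector_derivative continuous_on_subset[OF f]) (auto simp: a_def)
    then have "((\<lambda>u. integral {a..u} f - integral {a..0} f) has_vector_derivative f t) (at t within {a<..<t+1})"
      by (auto intro!: derivative_eq_intros intro: has_vector_derivative_within_subset)
    then have "((\<lambda>u. integral {a..u} f - integral {a..0} f) has_vector_derivative f t) (at t)"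
      by (subst (asm) at_within_open) (auto simp: a_def)
    then show ?thesis
      by (rule has_vector_derivative_transform_within_open[where S = "{a<..}"])
         (auto simp: a_def intro!: eq[symmetric])
  qed
  moreover have "g 0 = 0" by (simp add: g_def)
  ultimately show ?thesis using that by blast
qed

text \<open>The solution is sought as \<open>y\<^sub>0 + exp (2 L \<bar>t\<bar>) Z t\<close> with \<open>Z\<close> bounded and continuous. In this norm
  the Picard map is a contraction by \<open>exp_weighted_derivative_bound\<close>, for all times at once.\<close>

lemma global_solution_of_lipschitz_ode:
  fixes F :: "'a::banach \<Rightarrow> 'a"
  assumes lip: "\<And>x y. norm (F x - F y) \<le> L * norm (x - y)" and L: "L > 0"
  obtains y where "y 0 = y0" "\<And>t. (y has_vector_derivative F (y t)) (at t)"
proof -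
  have "L-lipschitz_on UNIV F"
    using L lip by (intro lipschitz_onI) (auto simp: dist_norm)
  then have contF: "continuous_on UNIV F" by (rule lipschitz_on_continuous_on)
  define e where "e t = exp (2 * L * \<bar>t\<bar>)" for t
  have e: "e t > 0" "e t \<ge> 1" "continuous_on UNIV e" for t
    using L by (auto simp: e_def intro!: continuous_intros)
  define curve where "curve Z t = y0 + e t *\<^sub>R apply_bcontfun Z t" for Z :: "real \<Rightarrow>\<^sub>C 'a" and t
  have cc: "continuous_on UNIV (\<lambda>t. F (curve Z t))" for Z
    unfolding curve_def by (intro continuous_on_compose2[OF contF] continuous_intros e) auto
  have "\<exists>g. g 0 = 0 \<and> (\<forall>t. (g has_vector_derivative F (curve Z t)) (at t))" for Z
    by (rule ex_primitive_continuous[OF cc]) blast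
  then obtain P where P: "\<And>Z. P Z 0 = 0" "\<And>Z t. (P Z has_vector_derivative F (curve Z t)) (at t)"
    by metis
  have Pcont: "continuous_on UNIV (P Z)" for Z
    by (intro continuous_at_imp_continuous_on ballI has_vector_derivative_continuous[OF P(2)])
  define \<Phi> where "\<Phi> Z = Bcontfun (\<lambda>t. P Z t /\<^sub>R e t)" for Z
  have Pbnd: "norm (P Z t) \<le> (norm (F y0) / L + norm Z) / 2 * e t" for Z t
  proof -
    have "norm (P Z t - P Z 0) \<le> (norm (F y0) / L + norm Z) / 2 * exp (2 * L * \<bar>t\<bar>)"
    proof (rule exp_weighted_derivative_bound[OF L _ P(2) _ order_refl])
      fix s
      have "norm (F (curve Z s)) \<le> norm (F y0) + norm (F (curve Z s) - F y0)"
        by (metis add.commute diff_add_cancel norm_triangle_ineq)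
      also have "\<dots> \<le> norm (F y0) + L * (e s * norm Z)"
        using lip[of "curve Z s" y0] L e(1)[of s] norm_bounded[of Z s]
        by (auto simp: curve_def intro!: order.trans[OF lip] mult_left_mono)
      also have "\<dots> \<le> norm (F y0) * e s + L * (e s * norm Z)"
        using e(2)[of s] by (simp add: mult_left_mono[where c = "norm (F y0)" and a = 1, simplified])
      finally show "norm (F (curve Z s)) \<le> L * (norm (F y0) / L + norm Z) * exp (2 * L * \<bar>s\<bar>)"
        using L by (simp add: e_def distrib_left distrib_right mult.assoc mult.commute[of "norm Z"])
    qed (use L in auto)
    then show ?thesis by (simp add: P e_def)
  qed
  have \<Phi>: "apply_bcontfun (\<Phi> Z) t = P Z t /\<^sub>R e t" for Z t
  proof -
    have "(\<lambda>t. P Z t /\<^sub>R e t) \<in> bcontfun"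
    proof (rule bcontfun_normI)
      have "e t \<noteq> 0" for t using e(1)[of t] by simp
      then show "continuous_on UNIV (\<lambda>t. P Z t /\<^sub>R e t)"
        by (intro continuous_intros Pcont e) auto
      show "norm (P Z t /\<^sub>R e t) \<le> (norm (F y0) / L + norm Z) / 2" for t
        using Pbnd[of Z t] e(1)[of t] by (simp add: field_simps)
    qed
    then show ?thesis by (simp add: \<Phi>_def Bcontfun_inverse)
  qed
  have "\<exists>!Z. \<Phi> Z = Z"
  proof (rule banach_fix_type[where c = "1/2"]; (intro allI)?)
    fix Z1 Z2 :: "real \<Rightarrow>\<^sub>C 'a"
    have "norm (\<Phi> Z1 - \<Phi> Z2) \<le> norm (Z1 - Z2) / 2"
    proof (rule norm_bound)
      fix t
      have "norm ((P Z1 t - P Z2 t) - (P Z1 0 - P Z2 0)) \<le> norm (Z1 - Z2) / 2 * exp (2 * L * \<bar>t\<bar>)"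
      proof (rule exp_weighted_derivative_bound[OF L norm_ge_zero _ _ order_refl])
        show "((\<lambda>t. P Z1 t - P Z2 t) has_vector_derivative F (curve Z1 s) - F (curve Z2 s)) (at s)" for s
          by (intro derivative_intros P)
        fix s
        have "norm (F (curve Z1 s) - F (curve Z2 s)) \<le> L * norm (curve Z1 s - curve Z2 s)"
          by (rule lip)
        also have "curve Z1 s - curve Z2 s = e s *\<^sub>R apply_bcontfun (Z1 - Z2) s"
          by (simp add: curve_def scaleR_diff_right)
        also have "norm \<dots> \<le> e s * norm (Z1 - Z2)"
          using norm_bounded[of "Z1 - Z2" s] e(1)[of s] by simp
        finally show "norm (F (curve Z1 s) - F (curve Z2 s)) \<le> L * norm (Z1 - Z2) * exp (2 * L * \<bar>s\<bar>)"
          using L by (simp add: e_def mult.assoc mult.commute[of "norm _"])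
      qed
      then show "norm (apply_bcontfun (\<Phi> Z1 - \<Phi> Z2) t) \<le> norm (Z1 - Z2) / 2"
      proof -
        assume *: "norm ((P Z1 t - P Z2 t) - (P Z1 0 - P Z2 0)) \<le> norm (Z1 - Z2) / 2 * exp (2 * L * \<bar>t\<bar>)"
        have "apply_bcontfun (\<Phi> Z1 - \<Phi> Z2) t = (P Z1 t - P Z2 t) /\<^sub>R e t"
          by (simp add: \<Phi> scaleR_diff_right)
        then have "norm (apply_bcontfun (\<Phi> Z1 - \<Phi> Z2) t) = norm (P Z1 t - P Z2 t) / e t"
          using e(1)[of t] by (simp add: divide_inverse mult.commute)
        also have "\<dots> \<le> norm (Z1 - Z2) / 2"
          using * e(1)[of t] by (subst divide_le_eq) (simp add: P e_def)
        finally show ?thesis .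
      qed
    qed
    then show "dist (\<Phi> Z1) (\<Phi> Z2) \<le> 1 / 2 * dist Z1 Z2"
      by (simp add: dist_norm)
  qed auto
  then obtain Z where Z: "\<Phi> Z = Z" by blast
  have eq: "curve Z t = y0 + P Z t" for t
    using \<Phi>[of Z t] e(1)[of t] unfolding Z by (simp add: curve_def)
  have "((\<lambda>t. y0 + P Z t) has_vector_derivative F (curve Z t)) (at t)" for t
    by (auto intro!: derivative_eq_intros P)
  moreover have "curve Z = (\<lambda>t. y0 + P Z t)" using eq by auto
  ultimately have "(curve Z has_vector_derivative F (curve Z t)) (at t)" for t by metis
  moreover have "curve Z 0 = y0" by (simp add: eq P)
  ultimately show ?thesis using that by blast
qed

definition lipschitz_on_bounded :: "('a::real_normed_vector \<Rightarrow> 'b::real_normed_vector) \<Rightarrow> bool" where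
  "lipschitz_on_bounded F \<longleftrightarrow> (\<forall>r. \<exists>L. L-lipschitz_on (cball 0 r) F)"

definition radial_retraction :: "real \<Rightarrow> 'a::real_normed_vector \<Rightarrow> 'a" where
  "radial_retraction r x = (if norm x \<le> r then x else (r / norm x) *\<^sub>R x)"

lemma norm_radial_retraction: "r \<ge> 0 \<Longrightarrow> norm (radial_retraction r x) \<le> r"
  by (auto simp: radial_retraction_def)

text \<open>In a general normed space the retraction onto a ball need not be nonexpansive; the constant \<open>2\<close>
  suffices for truncating vector fields.\<close>

lemma radial_retraction_lipschitz:
  assumes "r \<ge> 0"
  shows "norm (radial_retraction r x - radial_retraction r y) \<le> 2 * norm (x - y)"
proof -
  have one: "norm ((r / norm x) *\<^sub>R x - y) \<le> 2 * norm (x - y)" if "norm x > r" "norm y \<le> r" for x y :: 'a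
  proof -
    have "norm x > 0" using that assms by linarith
    have "(r / norm x) *\<^sub>R x - y = (x - y) + (r / norm x - 1) *\<^sub>R x"
      by (simp add: algebra_simps)
    also have "norm \<dots> \<le> norm (x - y) + \<bar>r / norm x - 1\<bar> * norm x"
      by (metis norm_scaleR norm_triangle_ineq)
    also have "\<bar>r / norm x - 1\<bar> * norm x = norm x - r"
      using that \<open>norm x > 0\<close> by (simp add: abs_if field_simps)
    also have "norm x - r \<le> norm (x - y)"
      using norm_triangle_ineq2[of x y] that by linarith
    finally show ?thesis by simp
  qed
  have two: "norm ((r / norm x) *\<^sub>R x - (r / norm y) *\<^sub>R y) \<le> 2 * norm (x - y)" if "norm x > r" "norm y > r" for x y :: 'a
  proof -
    have pos: "norm x > 0" "norm y > 0" using that assms by linarith+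
    have "(r / norm x) *\<^sub>R x - (r / norm y) *\<^sub>R y = (r / norm x) *\<^sub>R (x - y) + (r / norm x - r / norm y) *\<^sub>R y"
      by (simp add: algebra_simps)
    also have "norm \<dots> \<le> (r / norm x) * norm (x - y) + \<bar>r / norm x - r / norm y\<bar> * norm y"
      using pos assms by (intro order.trans[OF norm_triangle_ineq]) simp
    also have "\<bar>r / norm x - r / norm y\<bar> * norm y = (r / norm x) * \<bar>norm y - norm x\<bar>"
    proof -
      have "r / norm x - r / norm y = (r / norm x) * (norm y - norm x) / norm y"
        using pos by (simp add: field_simps)
      then show ?thesis using pos assms by (simp add: abs_mult)
    qed
    also have "\<dots> \<le> (r / norm x) * norm (x - y)"
      using pos assms norm_triangle_ineq3[of y x] by (intro mult_left_mono) (auto simp: norm_minus_commute)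
    also have "(r / norm x) * norm (x - y) + (r / norm x) * norm (x - y) \<le> 2 * norm (x - y)"
    proof -
      have "r / norm x \<le> 1" using that pos by simp
      then have "(r / norm x) * norm (x - y) \<le> 1 * norm (x - y)" by (intro mult_right_mono) auto
      then show ?thesis by simp
    qed
    finally show ?thesis by simp
  qed
  show ?thesis
    using one[of x y] one[of y x] two[of x y]
    by (auto simp: radial_retraction_def norm_minus_commute)
qed

lemma ode_solutions_agree:
  fixes F :: "'a::real_normed_vector \<Rightarrow> 'a"
  assumes F: "lipschitz_on_bounded F"
    and y: "\<And>s. \<bar>s\<bar> < T \<Longrightarrow> (y has_vector_derivative F (y s)) (at s)"
    and z: "\<And>s. \<bar>s\<bar> < T \<Longrightarrow> (z has_vector_derivative F (z s)) (at s)"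
    and "y 0 = z 0" and t: "\<bar>t\<bar> < T"
  shows "y t = z t"
proof -
  have "continuous_on {-\<bar>t\<bar>..\<bar>t\<bar>} y" "continuous_on {-\<bar>t\<bar>..\<bar>t\<bar>} z"
    using t by (auto intro!: continuous_at_imp_continuous_on has_vector_derivative_continuous[OF y]
       has_vector_derivative_continuous[OF z])
  then have "bounded (y ` {-\<bar>t\<bar>..\<bar>t\<bar>} \<union> z ` {-\<bar>t\<bar>..\<bar>t\<bar>})"
    by (auto intro!: compact_imp_bounded compact_continuous_image)
  then obtain r where r: "\<And>s. \<bar>s\<bar> \<le> \<bar>t\<bar> \<Longrightarrow> norm (y s) \<le> r \<and> norm (z s) \<le> r"
    by (fastforce simp: bounded_iff)
  obtain L where L: "L-lipschitz_on (cball 0 r) F"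
    using F by (auto simp: lipschitz_on_bounded_def)
  have "y t - z t = 0"
  proof (rule linear_differential_inequality_zero[where T = "\<bar>t\<bar>" and C = L and f = "\<lambda>t. y t - z t"])
    show "((\<lambda>t. y t - z t) has_vector_derivative F (y s) - F (z s)) (at s)" if "\<bar>s\<bar> \<le> \<bar>t\<bar>" for s
      using that t by (intro derivative_intros y z) auto
    show "norm (F (y s) - F (z s)) \<le> L * norm (y s - z s)" if "\<bar>s\<bar> \<le> \<bar>t\<bar>" for s
      using lipschitz_onD[OF L, of "y s" "z s"] r[OF that] by (simp add: dist_norm)
  qed (use assms in auto)
  then show ?thesis by simp
qed

text \<open>Truncate \<open>F\<close> outside the ball of radius \<open>R + 1\<close>. The global solution of the truncated equation
  agrees with \<open>y\<close>, has norm at most \<open>R\<close> on \<open>[-T, T]\<close>, and so by continuity does not feel the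
  truncation for a little longer.\<close>

lemma bounded_solution_extends:
  fixes F :: "'a::banach \<Rightarrow> 'a"
  assumes F: "lipschitz_on_bounded F" and "0 \<le> T" "norm y0 \<le> R"
    and y: "y 0 = y0" "\<And>t. \<bar>t\<bar> < T \<Longrightarrow> (y has_vector_derivative F (y t)) (at t)"
    and bnd: "\<And>t. \<bar>t\<bar> < T \<Longrightarrow> norm (y t) \<le> R"
  shows "\<exists>T'>T. \<exists>z. z 0 = y0 \<and> (\<forall>t. \<bar>t\<bar> < T' \<longrightarrow> (z has_vector_derivative F (z t)) (at t))"
proof -
  have "R \<ge> 0" using \<open>norm y0 \<le> R\<close> norm_ge_zero[of y0] by linarith
  define FR where "FR = (\<lambda>x. F (radial_retraction (R + 1) x))"
  obtain L where L: "L-lipschitz_on (cball 0 (R + 1)) F"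
    using F by (auto simp: lipschitz_on_bounded_def)
  have lip: "norm (FR x - FR z) \<le> (2 * L + 1) * norm (x - z)" for x z
  proof -
    have "norm (FR x - FR z) \<le> L * norm (radial_retraction (R + 1) x - radial_retraction (R + 1) z)"
      using lipschitz_onD[OF L, of "radial_retraction (R + 1) x" "radial_retraction (R + 1) z"] \<open>R \<ge> 0\<close>
      by (simp add: FR_def dist_norm norm_radial_retraction)
    also have "\<dots> \<le> L * (2 * norm (x - z))"
      using radial_retraction_lipschitz[of "R + 1" x z] lipschitz_on_nonneg[OF L] \<open>R \<ge> 0\<close>
      by (intro mult_left_mono) auto
    also have "\<dots> \<le> (2 * L + 1) * norm (x - z)"
      by (simp add: algebra_simps)
    finally show ?thesis .
  qed
  have FR: "lipschitz_on_bounded FR"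
    unfolding lipschitz_on_bounded_def
    by (intro allI exI[of _ "2 * L + 1"] lipschitz_onI)
      (use lip lipschitz_on_nonneg[OF L] in \<open>auto simp: dist_norm\<close>)
  obtain z where z: "z 0 = y0" "\<And>t. (z has_vector_derivative FR (z t)) (at t)"
    using global_solution_of_lipschitz_ode[where F = FR and L = "2 * L + 1" and ?y0.0 = y0]
      lip lipschitz_on_nonneg[OF L] by (metis add_nonneg_pos mult_nonneg_nonneg zero_le_numeral zero_less_one)
  have FReq: "FR x = F x" if "norm x \<le> R + 1" for x
    using that by (simp add: FR_def radial_retraction_def)
  have zc: "isCont z t" for t
    using has_vector_derivative_continuous[OF z(2)] .
  have zy: "z t = y t" if "\<bar>t\<bar> < T" for t
  proof (rule ode_solutions_agree[OF FR, of T])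
    show "(y has_vector_derivative FR (y s)) (at s)" if "\<bar>s\<bar> < T" for s
    proof -
      have "FR (y s) = F (y s)" using bnd[OF that] by (intro FReq) simp
      then show ?thesis using y(2)[OF that] by simp
    qed
    show "z 0 = y 0" using z y by simp
  qed (use z(2) that in auto)
  \<comment> \<open>by continuity the bound \<open>R\<close> extends to the closed interval\<close>
  have zle: "norm (z t) \<le> R" if "\<bar>t\<bar> \<le> T" for t
  proof (cases "T = 0")
    case True
    then show ?thesis using that z \<open>norm y0 \<le> R\<close> by auto
  next
    case False
    have "t \<in> closure {-T<..<T}"
      using that False \<open>0 \<le> T\<close> by (subst closure_greaterThanLessThan) auto
    moreover have "(\<lambda>t. norm (z t)) ` closure {-T<..<T} \<subseteq> closure ((\<lambda>t. norm (z t)) ` {-T<..<T})"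
      by (intro continuous_image_closure_subset[of UNIV])
        (auto intro!: continuous_intros continuous_at_imp_continuous_on zc)
    moreover have "closure ((\<lambda>t. norm (z t)) ` {-T<..<T}) \<subseteq> {..R}"
      by (intro closure_minimal) (auto simp: zy bnd)
    ultimately show ?thesis by auto
  qed
  have "open ((\<lambda>t. norm (z t)) -` {..<R + 1})"
    by (intro open_vimage) (auto intro!: continuous_intros continuous_at_imp_continuous_on zc)
  moreover have "{T, -T} \<subseteq> (\<lambda>t. norm (z t)) -` {..<R + 1}"
    using zle[of T] zle[of "-T"] \<open>0 \<le> T\<close> by auto
  ultimately obtain e1 e2 where e: "e1 > 0" "e2 > 0" "ball T e1 \<subseteq> (\<lambda>t. norm (z t)) -` {..<R + 1}"
    "ball (-T) e2 \<subseteq> (\<lambda>t. norm (z t)) -` {..<R + 1}"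
    by (meson insert_subset open_contains_ball)
  have "norm (z t) \<le> R + 1" if "\<bar>t\<bar> < T + min e1 e2" for t
  proof (cases "\<bar>t\<bar> \<le> T")
    case False
    then have "t \<in> ball T e1 \<or> t \<in> ball (-T) e2"
      using that by (auto simp: dist_real_def abs_if split: if_splits)
    then show ?thesis using e by force
  qed (use zle in force)
  then have "\<forall>t. \<bar>t\<bar> < T + min e1 e2 \<longrightarrow> (z has_vector_derivative F (z t)) (at t)"
    using z(2) FReq by metis
  then show ?thesis
    using z(1) e by (intro exI[of _ "T + min e1 e2"] conjI exI[of _ z]) auto
qed

text \<open>A solution that stays bounded can be continued, so a maximal life span is finite only if the norm is
  unbounded. In infinite dimensions this relies on one Lipschitz constant for each bounded set, since
  closed balls are not compact.\<close>

theorem maximal_solution_of_ode: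
  fixes F :: "'a::banach \<Rightarrow> 'a"
  assumes F: "lipschitz_on_bounded F"
  obtains \<tau> y where "0 < \<tau>" "y 0 = y0"
    "\<And>t. t \<in> time_interval \<tau> \<Longrightarrow> (y has_vector_derivative F (y t)) (at t)"
    "\<And>T R. \<tau> = ereal T \<Longrightarrow> \<exists>t. \<bar>t\<bar> < T \<and> R < norm (y t)"
proof -
  define sol where "sol T y \<longleftrightarrow> y 0 = y0 \<and> (\<forall>t. \<bar>t\<bar> < T \<longrightarrow> (y has_vector_derivative F (y t)) (at t))" for T :: real and y
  define S where "S = {T. 0 < T \<and> (\<exists>y. sol T y)}"
  define Y where "Y T = (SOME y. sol T y)" for T
  have Y: "sol T (Y T)" if "T \<in> S" for T
    using that someI_ex[of "sol T"] unfolding S_def Y_def by blast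
  obtain T0 where T0: "T0 \<in> S"
  proof -
    have "\<exists>T'>0. \<exists>z. z 0 = y0 \<and> (\<forall>t. \<bar>t\<bar> < T' \<longrightarrow> (z has_vector_derivative F (z t)) (at t))"
      by (rule bounded_solution_extends[OF F order_refl order_refl, where y = "\<lambda>_. y0"]) auto
    then show ?thesis using that unfolding S_def sol_def by blast
  qed
  define \<tau> where "\<tau> = (SUP T\<in>S. ereal T)"
  define y where "y t = Y (SOME T. T \<in> S \<and> \<bar>t\<bar> < T) t" for t
  have y: "y t = Y T t" if "T \<in> S" "\<bar>t\<bar> < T" for t T
  proof -
    define T' where "T' = (SOME T. T \<in> S \<and> \<bar>t\<bar> < T)"
    have T': "T' \<in> S" "\<bar>t\<bar> < T'"
      using someI[of "\<lambda>T. T \<in> S \<and> \<bar>t\<bar> < T" T] that by (auto simp: T'_def)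
    show ?thesis
      unfolding y_def T'_def[symmetric]
      by (rule ode_solutions_agree[OF F, of "min T T'"])
         (use Y[OF that(1)] Y[OF T'(1)] that T' in \<open>auto simp: sol_def\<close>)
  qed
  have dy: "(y has_vector_derivative F (y t)) (at t)" if "T \<in> S" "\<bar>t\<bar> < T" for t T
  proof -
    have "(Y T has_vector_derivative F (Y T t)) (at t)"
      using Y[OF that(1)] that by (auto simp: sol_def)
    then have "(y has_vector_derivative F (Y T t)) (at t)"
      by (rule has_vector_derivative_transform_within_open[where S = "{-T<..<T}"])
         (use that y in auto)
    then show ?thesis using y that by simp
  qed
  have \<tau>pos: "0 < \<tau>"
    using T0 by (auto simp: \<tau>_def less_SUP_iff S_def intro!: bexI[of _ T0])
  have y0: "y 0 = y0"
    using y[of T0 0] T0 Y[of T0] by (auto simp: S_def sol_def)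
  show ?thesis
  proof (rule that[of \<tau> y])
    show "0 < \<tau>" "y 0 = y0" by fact+
    show "(y has_vector_derivative F (y t)) (at t)" if t: "t \<in> time_interval \<tau>" for t
    proof -
      obtain T where "T \<in> S" "\<bar>t\<bar> < T"
        using t by (auto simp: time_interval_def \<tau>_def less_SUP_iff)
      then show ?thesis by (rule dy)
    qed
    fix T R assume T: "\<tau> = ereal T"
    show "\<exists>t. \<bar>t\<bar> < T \<and> R < norm (y t)"
    proof (rule ccontr)
      assume "\<not> ?thesis"
      then have bnd: "norm (y t) \<le> R" if "\<bar>t\<bar> < T" for t using that by force
      have "0 < T" using \<tau>pos T by simp
      have "\<exists>T'>T. \<exists>z. z 0 = y0 \<and> (\<forall>t. \<bar>t\<bar> < T' \<longrightarrow> (z has_vector_derivative F (z t)) (at t))"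
      proof (rule bounded_solution_extends[OF F])
        show "(y has_vector_derivative F (y t)) (at t)" if "\<bar>t\<bar> < T" for t
        proof -
          have "ereal \<bar>t\<bar> < \<tau>" using that T by simp
          then obtain T' where "T' \<in> S" "\<bar>t\<bar> < T'"
            by (auto simp: \<tau>_def less_SUP_iff)
          then show ?thesis by (rule dy)
        qed
      qed (use \<open>0 < T\<close> bnd[of 0] bnd y0 in auto)
      then obtain T' where "T' > T" "T' \<in> S"
        using \<open>0 < T\<close> by (force simp: S_def sol_def)
      then have "ereal T' \<le> \<tau>" by (auto simp: \<tau>_def intro: SUP_upper)
      then show False using T \<open>T' > T\<close> by simp
    qed
  qed
qed

section \<open>Functions with an integrable derivative\<close>

text \<open>Absolute continuity of \<open>f\<close> on \<open>[0, L]\<close> with derivative \<open>g\<close>, in the integrated form that is used to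
  work with weak derivatives.\<close>

definition primitive_on :: "real \<Rightarrow> (real \<Rightarrow> real) \<Rightarrow> (real \<Rightarrow> real) \<Rightarrow> bool" where
  "primitive_on L f g \<longleftrightarrow> g absolutely_integrable_on {0..L} \<and> (\<forall>x\<in>{0..L}. f x = f 0 + integral {0..x} g)"

definition bounded_measurable :: "real \<Rightarrow> (real \<Rightarrow> real) \<Rightarrow> bool" where
  "bounded_measurable L g \<longleftrightarrow> g \<in> borel_measurable (lebesgue_on {0..L}) \<and> (\<exists>C. \<forall>x\<in>{0..L}. \<bar>g x\<bar> \<le> C)"

lemma bounded_measurable_integrable:
  assumes "bounded_measurable L g"
  shows "g absolutely_integrable_on {0..L}"
proof -
  obtain C where "\<forall>x\<in>{0..L}. \<bar>g x\<bar> \<le> C" "g \<in> borel_measurable (lebesgue_on {0..L})"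
    using assms by (auto simp: bounded_measurable_def)
  then show ?thesis
    by (intro measurable_bounded_by_integrable_imp_absolutely_integrable[where g = "\<lambda>_. C"]) auto
qed

lemma continuous_on_bounded_abs:
  fixes f :: "real \<Rightarrow> real"
  assumes "continuous_on {a..b} f"
  shows "\<exists>M. \<forall>x\<in>{a..b}. \<bar>f x\<bar> \<le> M"
proof -
  have "bounded (f ` {a..b})" using assms by (intro compact_imp_bounded compact_continuous_image) auto
  then show ?thesis by (auto simp: bounded_iff)
qed

lemma bounded_measurable_continuous:
  "continuous_on {0..L} g \<Longrightarrow> bounded_measurable L g"
  unfolding bounded_measurable_def
  by (intro conjI continuous_on_bounded_abs continuous_imp_measurable_on_sets_lebesgue) auto

lemma bounded_measurable_add:
  assumes "bounded_measurable L f" "bounded_measurable L g"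
  shows "bounded_measurable L (\<lambda>x. f x + g x)"
proof -
  obtain A B where "\<forall>x\<in>{0..L}. \<bar>f x\<bar> \<le> A" "\<forall>x\<in>{0..L}. \<bar>g x\<bar> \<le> B"
    using assms by (auto simp: bounded_measurable_def)
  then have "\<forall>x\<in>{0..L}. \<bar>f x + g x\<bar> \<le> A + B"
    by (metis abs_triangle_ineq add_mono order_trans)
  then show ?thesis
    using assms unfolding bounded_measurable_def by (intro conjI exI borel_measurable_add) auto
qed

lemma bounded_measurable_mult:
  assumes "bounded_measurable L f" "bounded_measurable L g"
  shows "bounded_measurable L (\<lambda>x. f x * g x)"
proof -
  obtain A B where "\<forall>x\<in>{0..L}. \<bar>f x\<bar> \<le> A" "\<forall>x\<in>{0..L}. \<bar>g x\<bar> \<le> B"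
    using assms by (auto simp: bounded_measurable_def)
  then have "\<forall>x\<in>{0..L}. \<bar>f x * g x\<bar> \<le> A * B"
    unfolding abs_mult by (metis abs_ge_zero mult_mono order_trans)
  then show ?thesis
    using assms unfolding bounded_measurable_def by (intro conjI exI borel_measurable_times) auto
qed

lemma bounded_measurable_const [simp]: "bounded_measurable L (\<lambda>_. c)"
  by (intro bounded_measurable_continuous continuous_intros)

lemma bounded_measurable_cmult: "bounded_measurable L g \<Longrightarrow> bounded_measurable L (\<lambda>x. c * g x)"
  by (rule bounded_measurable_mult[OF bounded_measurable_const])

lemma bounded_measurable_diff:
  "bounded_measurable L f \<Longrightarrow> bounded_measurable L g \<Longrightarrow> bounded_measurable L (\<lambda>x. f x - g x)"
  using bounded_measurable_add[of L f "\<lambda>x. (-1) * g x"] bounded_measurable_cmult[of L g "-1"] by simp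

lemma bounded_measurable_power2: "bounded_measurable L f \<Longrightarrow> bounded_measurable L (\<lambda>x. (f x)\<^sup>2)"
  unfolding power2_eq_square by (rule bounded_measurable_mult)

lemma bounded_measurable_subinterval:
  assumes "bounded_measurable L g" "L' \<le> L"
  shows "bounded_measurable L' g"
  using assms measurable_restrict_mono[of g lebesgue "{0..L}" borel "{0..L'}"]
  by (fastforce simp: bounded_measurable_def)

lemma bounded_measurable_shift:
  assumes "bounded_measurable L g" "0 \<le> h"
  shows "bounded_measurable (L - h) (\<lambda>x. g (x + h))"
proof -
  have "(\<lambda>x. if x \<in> {0..L} then g x else 0) \<in> borel_measurable lebesgue"
    using assms by (subst borel_measurable_if) (auto simp: bounded_measurable_def)
  from borel_measurable_affine[OF this one_neq_zero, of h]
  have "(\<lambda>x. if x + h \<in> {0..L} then g (x + h) else 0) \<in> borel_measurable lebesgue"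
    unfolding real_scaleR_def mult_1 add.commute[of h] .
  then have "(\<lambda>x. if x + h \<in> {0..L} then g (x + h) else 0) \<in> borel_measurable (lebesgue_on {0..L - h})"
    by (rule measurable_restrict_space1)
  also have "?this \<longleftrightarrow> (\<lambda>x. g (x + h)) \<in> borel_measurable (lebesgue_on {0..L - h})"
    using assms by (intro measurable_cong) (auto simp: space_restrict_space)
  finally show ?thesis
    using assms by (fastforce simp: bounded_measurable_def)
qed

lemma abs_integrable_subinterval:
  fixes g :: "real \<Rightarrow> real"
  shows "g absolutely_integrable_on {0..L} \<Longrightarrow> 0 \<le> a \<Longrightarrow> b \<le> L \<Longrightarrow> g absolutely_integrable_on {a..b}"
  by (rule absolutely_integrable_on_subinterval) auto

lemma primitive_on_abs_integrable: "primitive_on L f g \<Longrightarrow> g absolutely_integrable_on {0..L}"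
  by (simp add: primitive_on_def)

lemma primitive_on_eq: "primitive_on L f g \<Longrightarrow> x \<in> {0..L} \<Longrightarrow> f x = f 0 + integral {0..x} g"
  unfolding primitive_on_def by blast

lemma primitive_on_integrable:
  "primitive_on L f g \<Longrightarrow> 0 \<le> a \<Longrightarrow> b \<le> L \<Longrightarrow> g integrable_on {a..b}"
  using abs_integrable_subinterval[OF primitive_on_abs_integrable, of L f g a b]
  by (auto simp: absolutely_integrable_on_def)

lemma primitive_on_diff_eq:
  assumes "primitive_on L f g" "0 \<le> x" "x \<le> y" "y \<le> L"
  shows "f y - f x = integral {x..y} g"
proof -
  have "g integrable_on {0..y}"
    using primitive_on_integrable[OF assms(1), of 0 y] assms by simp
  then have "integral {0..x} g + integral {x..y} g = integral {0..y} g"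
    using assms by (intro Henstock_Kurzweil_Integration.integral_combine) auto
  moreover have "f x = f 0 + integral {0..x} g" "f y = f 0 + integral {0..y} g"
    using assms by (auto intro: primitive_on_eq[OF assms(1)])
  ultimately show ?thesis by linarith
qed

lemma primitive_on_continuous:
  assumes "primitive_on L f g"
  shows "continuous_on {0..L} f"
proof -
  have "continuous_on {0..L} (\<lambda>x. f 0 + integral {0..x} g)"
    using primitive_on_integrable[OF assms, of 0 L]
    by (intro continuous_intros indefinite_integral_continuous_1) auto
  then show ?thesis
    by (rule continuous_on_eq) (rule primitive_on_eq[OF assms, symmetric])
qed

lemma primitive_on_Lipschitz:
  assumes f: "primitive_on L f g" and C: "\<And>x. x \<in> {0..L} \<Longrightarrow> \<bar>g x\<bar> \<le> C"
    and "x \<in> {0..L}" "y \<in> {0..L}"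
  shows "\<bar>f y - f x\<bar> \<le> C * \<bar>y - x\<bar>"
proof -
  have *: "\<bar>f y - f x\<bar> \<le> C * (y - x)" if "0 \<le> x" "x \<le> y" "y \<le> L" for x y
  proof -
    have "norm (integral {x..y} g) \<le> integral {x..y} (\<lambda>_. C)"
      using that by (intro Henstock_Kurzweil_Integration.integral_norm_bound_integral primitive_on_integrable[OF f]) (auto intro: C)
    then show ?thesis using primitive_on_diff_eq[OF f that] that by (simp add: mult.commute)
  qed
  show ?thesis
    using *[of x y] *[of y x] assms(3,4) by (cases "x \<le> y") (auto simp: abs_minus_commute)
qed

lemma primitive_on_add:
  assumes "primitive_on L f1 g1" "primitive_on L f2 g2"
  shows "primitive_on L (\<lambda>x. f1 x + f2 x) (\<lambda>x. g1 x + g2 x)"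
  unfolding primitive_on_def
proof (intro conjI ballI)
  show "(\<lambda>x. g1 x + g2 x) absolutely_integrable_on {0..L}"
    using assms by (intro set_integral_add(1) primitive_on_abs_integrable)
  fix x assume x: "x \<in> {0..L}"
  have "integral {0..x} (\<lambda>x. g1 x + g2 x) = integral {0..x} g1 + integral {0..x} g2"
    using x by (intro Henstock_Kurzweil_Integration.integral_add primitive_on_integrable[OF assms(1)] primitive_on_integrable[OF assms(2)]) auto
  moreover have "f1 x = f1 0 + integral {0..x} g1" "f2 x = f2 0 + integral {0..x} g2"
    using primitive_on_eq[OF assms(1) x] primitive_on_eq[OF assms(2) x] .
  ultimately show "f1 x + f2 x = f1 0 + f2 0 + integral {0..x} (\<lambda>x. g1 x + g2 x)" by simp
qed

lemma primitive_on_cmult: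
  assumes "primitive_on L f g"
  shows "primitive_on L (\<lambda>x. c * f x) (\<lambda>x. c * g x)"
  unfolding primitive_on_def
proof (intro conjI ballI)
  show "(\<lambda>x. c * g x) absolutely_integrable_on {0..L}"
    using primitive_on_abs_integrable[OF assms] by auto
  fix x assume "x \<in> {0..L}"
  from arg_cong[OF primitive_on_eq[OF assms this], of "\<lambda>y. c * y"]
  show "c * f x = c * f 0 + integral {0..x} (\<lambda>x. c * g x)"
    unfolding distrib_left integral_mult_right .
qed

lemma primitive_on_const: "primitive_on L (\<lambda>x. c) (\<lambda>x. 0)"
  by (auto simp: primitive_on_def)

lemma primitive_on_diff:
  assumes "primitive_on L f1 g1" "primitive_on L f2 g2"
  shows "primitive_on L (\<lambda>x. f1 x - f2 x) (\<lambda>x. g1 x - g2 x)"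
  using primitive_on_add[OF assms(1) primitive_on_cmult[OF assms(2), of "-1"]] by simp

lemma primitive_on_has_derivative:
  assumes "\<And>x. x \<in> {0..L} \<Longrightarrow> (f has_real_derivative g x) (at x within {0..L})" "continuous_on {0..L} g"
  shows "primitive_on L f g"
  unfolding primitive_on_def
proof (intro conjI ballI)
  show "g absolutely_integrable_on {0..L}"
    using assms(2) by (rule absolutely_integrable_continuous_real)
  fix x assume x: "x \<in> {0..L}"
  have "(g has_integral (f x - f 0)) {0..x}"
    using x
    by (intro fundamental_theorem_of_calculus)
       (auto simp: has_real_derivative_iff_has_vector_derivative[symmetric] intro!: DERIV_subset[OF assms(1)])
  then show "f x = f 0 + integral {0..x} g" by (simp add: integral_unique)
qed

lemma primitive_on_indefinite_integral:
  assumes "g absolutely_integrable_on {0..L}"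
  shows "primitive_on L (\<lambda>x. integral {0..x} g) g"
  using assms by (simp add: primitive_on_def)

lemma primitive_on_subinterval:
  assumes "primitive_on L f g" "L' \<le> L"
  shows "primitive_on L' f g"
  unfolding primitive_on_def
proof (intro conjI ballI)
  show "g absolutely_integrable_on {0..L'}"
    using abs_integrable_subinterval[OF primitive_on_abs_integrable[OF assms(1)] order_refl assms(2)] .
  show "f x = f 0 + integral {0..x} g" if "x \<in> {0..L'}" for x
    by (rule primitive_on_eq[OF assms(1)]) (use that assms(2) in auto)
qed

lemma integral_shift_real:
  fixes g :: "real \<Rightarrow> real"
  shows "integral {a..b} (\<lambda>x. g (x + h)) = integral {a + h..b + h} g"
  using integral_shift_Icc_real[of a b g h] by (simp add: o_def add.commute)

lemma primitive_on_shift: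
  assumes f: "primitive_on L f g" and "0 \<le> h"
  shows "primitive_on (L - h) (\<lambda>x. f (x + h)) (\<lambda>x. g (x + h))"
  unfolding primitive_on_def
proof (intro conjI ballI)
  have int: "(\<lambda>x. \<bar>g x\<bar>) integrable_on {h..L}" "g integrable_on {h..L}"
    using abs_integrable_subinterval[OF primitive_on_abs_integrable[OF f], of h L] assms by (auto simp: absolutely_integrable_on_def)
  then show "(\<lambda>x. g (x + h)) absolutely_integrable_on {0..L - h}"
    using integrable_shift_cbox_iff[of g h h L] integrable_shift_cbox_iff[of "\<lambda>x. \<bar>g x\<bar>" h h L]
    by (auto simp: absolutely_integrable_on_def)
  fix x assume "x \<in> {0..L - h}"
  then show "f (x + h) = f (0 + h) + integral {0..x} (\<lambda>x. g (x + h))"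
    using primitive_on_diff_eq[OF f, of h "x + h"] \<open>0 \<le> h\<close> by (simp add: integral_shift_real algebra_simps)
qed

lemma dominated_convergence_AE:
  fixes f :: "nat \<Rightarrow> real \<Rightarrow> real"
  assumes f: "\<And>k. f k integrable_on {a..b}" and N: "negligible N" and h: "h integrable_on {a..b}"
    and le: "\<And>k x. x \<in> {a..b} \<Longrightarrow> \<bar>f k x\<bar> \<le> h x"
    and conv: "\<And>x. x \<in> {a..b} - N \<Longrightarrow> (\<lambda>k. f k x) \<longlonglongrightarrow> g x"
  shows "g integrable_on {a..b}" "(\<lambda>k. integral {a..b} (f k)) \<longlonglongrightarrow> integral {a..b} g"
proof -
  define f' where "f' k x = (if x \<in> N then 0 else f k x)" for k x
  define g' where "g' x = (if x \<in> N then 0 else g x)" for x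
  have 1: "f' k integrable_on {a..b}" for k
    by (rule integrable_spike[OF f N]) (auto simp: f'_def)
  have 2: "norm (f' k x) \<le> h x" if "x \<in> {a..b}" for k x
    using le[OF that, of k] by (auto simp: f'_def)
  have 3: "(\<lambda>k. f' k x) \<longlonglongrightarrow> g' x" if "x \<in> {a..b}" for x
    using conv[of x] that by (auto simp: f'_def g'_def)
  have g': "g' integrable_on {a..b}" "(\<lambda>k. integral {a..b} (f' k)) \<longlonglongrightarrow> integral {a..b} g'"
    by (rule dominated_convergence[OF 1 h 2 3]; assumption)+
  show "g integrable_on {a..b}"
    by (rule integrable_spike[OF g'(1) N]) (auto simp: g'_def)
  have "integral {a..b} (f' k) = integral {a..b} (f k)" for k
    by (rule integral_spike[OF N]) (auto simp: f'_def)
  moreover have "integral {a..b} g' = integral {a..b} g"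
    by (rule integral_spike[OF N]) (auto simp: g'_def)
  ultimately show "(\<lambda>k. integral {a..b} (f k)) \<longlonglongrightarrow> integral {a..b} g"
    using g'(2) by simp
qed

text \<open>One half of Lebesgue's differentiation theorem, with quotients that stay inside \<open>[0, L]\<close>.\<close>

lemma primitive_on_right_derivative_AE:
  assumes f: "primitive_on L f g"
  obtains N where "negligible N"
    "\<And>x. x \<in> {0..<L} - N \<Longrightarrow> ((\<lambda>h. (f (x + h) - f x) / h) \<longlongrightarrow> g x) (at_right 0)"
proof -
  define G where "G x = (if x \<in> {0..L} then g x else 0)" for x
  have "G absolutely_integrable_on UNIV"
    unfolding G_def[abs_def] by (subst absolutely_integrable_restrict_UNIV) (rule primitive_on_abs_integrable[OF f])
  then have "G integrable_on cbox a b" for a b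
    by (meson absolutely_integrable_on_def integrable_on_subcbox subset_UNIV)
  then obtain N where N: "negligible N" and
    lim: "\<And>x e. x \<notin> N \<Longrightarrow> 0 < e \<Longrightarrow>
      \<exists>d>0. \<forall>h. 0 < h \<and> h < d \<longrightarrow> norm (integral (cbox x (x + h *\<^sub>R One)) G /\<^sub>R h ^ DIM(real) - G x) < e"
    using integrable_ccontinuous_explicit[of G] by metis
  show ?thesis
  proof (rule that[OF N])
    fix x assume x: "x \<in> {0..<L} - N"
    show "((\<lambda>h. (f (x + h) - f x) / h) \<longlongrightarrow> g x) (at_right 0)"
    proof (rule tendstoI)
      fix e :: real assume "0 < e"
      then obtain d where d: "d > 0" "\<And>h. 0 < h \<Longrightarrow> h < d \<Longrightarrow> \<bar>integral {x..x+h} G / h - G x\<bar> < e"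
        using lim[of x e] x by (auto simp: divide_inverse mult.commute)
      have "eventually (\<lambda>h. h \<in> {0<..<min d (L - x)}) (at_right 0)"
        using d x by (intro eventually_at_right_less eventually_at_rightI[of 0 "min d (L-x)"]) auto
      then show "eventually (\<lambda>h. dist ((f (x + h) - f x) / h) (g x) < e) (at_right 0)"
      proof eventually_elim
        case (elim h)
        have "integral {x..x+h} G = integral {x..x+h} g"
          using x elim by (intro integral_cong) (auto simp: G_def)
        then have "f (x + h) - f x = integral {x..x+h} G"
          using primitive_on_diff_eq[OF f, of x "x + h"] x elim by auto
        then show ?case using d(2)[of h] elim x by (simp add: dist_real_def G_def)
      qed
    qed
  qed
qed

lemma primitive_on_unique_AE:
  assumes "primitive_on L f g1" "primitive_on L f g2"
  shows "negligible {x \<in> {0..L}. g1 x \<noteq> g2 x}"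
proof -
  obtain N1 where N1: "negligible N1"
    "\<And>x. x \<in> {0..<L} - N1 \<Longrightarrow> ((\<lambda>h. (f (x + h) - f x) / h) \<longlongrightarrow> g1 x) (at_right 0)"
    using primitive_on_right_derivative_AE[OF assms(1)] by blast
  obtain N2 where N2: "negligible N2"
    "\<And>x. x \<in> {0..<L} - N2 \<Longrightarrow> ((\<lambda>h. (f (x + h) - f x) / h) \<longlongrightarrow> g2 x) (at_right 0)"
    using primitive_on_right_derivative_AE[OF assms(2)] by blast
  have "g1 x = g2 x" if "x \<in> {0..<L} - (N1 \<union> N2)" for x
    using tendsto_unique[OF _ N1(2)[of x] N2(2)[of x]] that by (auto simp: trivial_limit_at_right_real)
  then have "{x \<in> {0..L}. g1 x \<noteq> g2 x} \<subseteq> insert L (N1 \<union> N2)" by fastforce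
  then show ?thesis
    using N1(1) N2(1) by (meson negligible_Un negligible_insert negligible_subset)
qed

text \<open>For Lipschitz functions the product rule follows by letting \<open>h\<close> tend to \<open>0\<close> in the integral
  of the difference quotients of the product.\<close>

lemma primitive_on_mult_bounded:
  assumes f1: "primitive_on L f1 g1" and f2: "primitive_on L f2 g2"
    and b1: "\<And>x. x \<in> {0..L} \<Longrightarrow> \<bar>g1 x\<bar> \<le> C1" and b2: "\<And>x. x \<in> {0..L} \<Longrightarrow> \<bar>g2 x\<bar> \<le> C2"
  shows "primitive_on L (\<lambda>x. f1 x * f2 x) (\<lambda>x. g1 x * f2 x + f1 x * g2 x)"
proof (cases "0 < L")
  case False
  have "(\<lambda>x. g1 x * f2 x + f1 x * g2 x) absolutely_integrable_on {0..L}"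
  proof (rule absolutely_integrable_negligible)
    show "negligible {0..L}"
      using False by (intro negligible_subset[OF negligible_sing[of 0]]) auto
  qed
  moreover have "f1 x * f2 x = f1 0 * f2 0 + integral {0..x} (\<lambda>x. g1 x * f2 x + f1 x * g2 x)" if "x \<in> {0..L}" for x
  proof -
    have "x = 0" using that False by auto
    then show ?thesis by simp
  qed
  ultimately show ?thesis unfolding primitive_on_def by blast
next
  case True
  define F where "F = (\<lambda>x. f1 x * f2 x)"
  define G where "G = (\<lambda>x. g1 x * f2 x + f1 x * g2 x)"
  note c1 = primitive_on_continuous[OF f1] and c2 = primitive_on_continuous[OF f2]
  have bd: "bounded (f1 ` {0..L})" "bounded (f2 ` {0..L})"
    using c1 c2 by (auto intro!: compact_imp_bounded compact_continuous_image)
  obtain M1 where M1: "\<And>x. x \<in> {0..L} \<Longrightarrow> \<bar>f1 x\<bar> \<le> M1"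
    using continuous_on_bounded_abs[OF c1] by blast
  obtain M2 where M2: "\<And>x. x \<in> {0..L} \<Longrightarrow> \<bar>f2 x\<bar> \<le> M2"
    using continuous_on_bounded_abs[OF c2] by blast
  have C: "C1 \<ge> 0" "C2 \<ge> 0" "M1 \<ge> 0" "M2 \<ge> 0"
    using b1[of 0] b2[of 0] M1[of 0] M2[of 0] True by auto
  define C where "C = C1 * M2 + M1 * C2"
  have lipF: "\<bar>F y - F x\<bar> \<le> C * \<bar>y - x\<bar>" if "x \<in> {0..L}" "y \<in> {0..L}" for x y
  proof -
    have "F y - F x = (f1 y - f1 x) * f2 y + f1 x * (f2 y - f2 x)"
      by (simp add: F_def algebra_simps)
    also have "\<bar>\<dots>\<bar> \<le> \<bar>f1 y - f1 x\<bar> * \<bar>f2 y\<bar> + \<bar>f1 x\<bar> * \<bar>f2 y - f2 x\<bar>"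
      by (metis abs_mult abs_triangle_ineq)
    also have "\<dots> \<le> (C1 * \<bar>y - x\<bar>) * M2 + M1 * (C2 * \<bar>y - x\<bar>)"
      using that C by (intro add_mono mult_mono primitive_on_Lipschitz[OF f1 b1] primitive_on_Lipschitz[OF f2 b2] M1 M2) auto
    finally show ?thesis by (simp add: C_def algebra_simps)
  qed
  have cF: "continuous_on {0..L} F" unfolding F_def by (intro continuous_intros c1 c2)
  have Gabs: "G absolutely_integrable_on {0..L}"
  proof -
    have "(\<lambda>x. f2 x * g1 x) absolutely_integrable_on {0..L}" "(\<lambda>x. f1 x * g2 x) absolutely_integrable_on {0..L}"
      using c1 c2 bd
      by (auto intro!: absolutely_integrable_bounded_measurable_product_real continuous_imp_measurable_on_sets_lebesgue
          primitive_on_abs_integrable[OF f1] primitive_on_abs_integrable[OF f2])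
    then show ?thesis
      unfolding G_def by (intro set_integral_add(1)) (auto simp: mult.commute)
  qed
  have Gint: "G integrable_on {0..L}" using Gabs by (simp add: absolutely_integrable_on_def)
  obtain N1 where N1: "negligible N1"
    "\<And>x. x \<in> {0..<L} - N1 \<Longrightarrow> ((\<lambda>h. (f1 (x + h) - f1 x) / h) \<longlongrightarrow> g1 x) (at_right 0)"
    using primitive_on_right_derivative_AE[OF f1] by blast
  obtain N2 where N2: "negligible N2"
    "\<And>x. x \<in> {0..<L} - N2 \<Longrightarrow> ((\<lambda>h. (f2 (x + h) - f2 x) / h) \<longlongrightarrow> g2 x) (at_right 0)"
    using primitive_on_right_derivative_AE[OF f2] by blast
  define \<Phi> where "\<Phi> x = integral {0..x} F" for x
  have \<Phi>: "(\<Phi> has_real_derivative F x) (at x within {0..L})" if "x \<in> {0..L}" for x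
    unfolding \<Phi>_def has_real_derivative_iff_has_vector_derivative
    using integral_has_vector_derivative[OF cF that] .
  have main: "F p - F 0 - integral {0..p} G = 0" if p: "0 \<le> p" "p < L" for p
  proof -
    define h where "h k = (L - p) / (real k + 2)" for k :: nat
    have h: "0 < h k" "h k < L - p" for k
    proof -
      have "(L - p) * 1 < (L - p) * (real k + 2)"
        using p by (intro mult_strict_left_mono) auto
      then show "0 < h k" "h k < L - p" using p by (auto simp: h_def divide_less_eq)
    qed
    have "h \<longlonglongrightarrow> 0" unfolding h_def by real_asymp
    have h0: "filterlim h (at_right 0) sequentially"
      unfolding filterlim_at
    proof (intro conjI)
      show "\<forall>\<^sub>F k in sequentially. h k \<in> {0<..} \<and> h k \<noteq> 0"
        using h(1) by (intro always_eventually) (simp add: less_imp_neq[symmetric])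
    qed (fact \<open>h \<longlonglongrightarrow> 0\<close>)
    define Q where "Q k x = (F (x + h k) - F x) / h k" for k x
    have cs: "continuous_on {0..p} (\<lambda>x. F (x + h k))" for k
      using h[of k] by (intro continuous_on_compose2[OF cF] continuous_intros) auto
    have c0: "continuous_on {0..p} F" by (rule continuous_on_subset[OF cF]) (use p in auto)
    have conv: "(\<lambda>k. Q k x) \<longlonglongrightarrow> G x" if x: "x \<in> {0..p} - (N1 \<union> N2)" for x
    proof -
      have d1: "(\<lambda>k. (f1 (x + h k) - f1 x) / h k) \<longlonglongrightarrow> g1 x"
        using filterlim_compose[OF N1(2) h0, of x] x p by auto
      have d2: "(\<lambda>k. (f2 (x + h k) - f2 x) / h k) \<longlonglongrightarrow> g2 x"
        using filterlim_compose[OF N2(2) h0, of x] x p by auto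
      have "(\<lambda>k. f2 (x + h k)) \<longlonglongrightarrow> f2 (x + 0)"
      proof (rule continuous_on_tendsto_compose[OF c2])
        show "(\<lambda>k. x + h k) \<longlonglongrightarrow> x + 0" by (intro tendsto_intros \<open>h \<longlonglongrightarrow> 0\<close>)
        show "\<forall>\<^sub>F k in sequentially. x + h k \<in> {0..L}"
        proof (intro always_eventually allI)
          show "x + h k \<in> {0..L}" for k using x p h[of k] by auto
        qed
      qed (use x p in auto)
      then have "(\<lambda>k. (f1 (x + h k) - f1 x) / h k * f2 (x + h k) + f1 x * ((f2 (x + h k) - f2 x) / h k)) \<longlonglongrightarrow> g1 x * f2 x + f1 x * g2 x"
        by (intro tendsto_intros d1 d2) auto
      also have "(\<lambda>k. (f1 (x + h k) - f1 x) / h k * f2 (x + h k) + f1 x * ((f2 (x + h k) - f2 x) / h k)) = (\<lambda>k. Q k x)"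
        using h by (auto simp: Q_def F_def field_simps add_divide_distrib diff_divide_distrib)
      finally show ?thesis by (simp add: G_def)
    qed
    have lim1: "(\<lambda>k. integral {0..p} (Q k)) \<longlonglongrightarrow> integral {0..p} G"
    proof (rule dominated_convergence_AE(2)[where N = "N1 \<union> N2" and h = "\<lambda>_. C"])
      show "Q k integrable_on {0..p}" for k
        unfolding Q_def using h[of k]
        by (intro integrable_continuous_interval continuous_intros cs c0) auto
      show "\<bar>Q k x\<bar> \<le> C" if "x \<in> {0..p}" for k x
        using lipF[of x "x + h k"] h[of k] that p by (auto simp: Q_def abs_divide divide_le_eq)
    qed (use N1(1) N2(1) conv in auto)
    have Qint: "integral {0..p} (Q k) = (\<Phi> (p + h k) - \<Phi> p) / h k - (\<Phi> (0 + h k) - \<Phi> 0) / h k" for k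
    proof -
      have Fi: "F integrable_on {a..b}" if "0 \<le> a" "b \<le> L" for a b
        using that by (intro integrable_continuous_interval continuous_on_subset[OF cF]) auto
      have "integral {0..p} (Q k) = (integral {0..p} (\<lambda>x. F (x + h k)) - integral {0..p} F) / h k"
        unfolding Q_def using cs[of k] c0
        by (subst Henstock_Kurzweil_Integration.integral_divide, subst Henstock_Kurzweil_Integration.integral_diff) (auto intro!: integrable_continuous_interval)
      also have "integral {0..p} (\<lambda>x. F (x + h k)) = integral {h k..p + h k} F"
        by (simp add: integral_shift_real)
      also have "\<dots> = \<Phi> (p + h k) - \<Phi> (h k)"
        using Henstock_Kurzweil_Integration.integral_combine[of 0 "h k" "p + h k" F] Fi[of 0 "p + h k"] h[of k] p
        by (simp add: \<Phi>_def)
      finally show ?thesis by (simp add: \<Phi>_def diff_divide_distrib)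
    qed
    have lim2: "(\<lambda>k. (\<Phi> (q + h k) - \<Phi> q) / h k) \<longlonglongrightarrow> F q" if q: "0 \<le> q" "q \<le> p" for q
    proof -
      have "((\<lambda>y. (\<Phi> y - \<Phi> q) / (y - q)) \<longlongrightarrow> F q) (at q within {0..L})"
        using \<Phi>[of q] q p by (simp add: has_field_derivative_iff)
      moreover have "filterlim (\<lambda>k. q + h k) (at q within {0..L}) sequentially"
        unfolding filterlim_at
      proof
        show "\<forall>\<^sub>F k in sequentially. q + h k \<in> {0..L} \<and> q + h k \<noteq> q"
        proof (intro always_eventually allI)
          show "q + h k \<in> {0..L} \<and> q + h k \<noteq> q" for k using q p h[of k] by auto
        qed
        show "((\<lambda>k. q + h k) \<longlonglongrightarrow> q)" using tendsto_add[OF tendsto_const \<open>h \<longlonglongrightarrow> 0\<close>, of q] by simp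
      qed
      ultimately show ?thesis using filterlim_compose by fastforce
    qed
    have "(\<lambda>k. integral {0..p} (Q k)) \<longlonglongrightarrow> F p - F 0"
      unfolding Qint using p by (intro tendsto_diff lim2) auto
    from LIMSEQ_unique[OF lim1 this] show ?thesis by simp
  qed
  have contD: "continuous_on (closure {0..<L}) (\<lambda>p. F p - F 0 - integral {0..p} G)"
    using True Gint by (auto intro!: continuous_intros cF indefinite_integral_continuous_1)
  have "F p - F 0 - integral {0..p} G = 0" if "p \<in> {0..L}" for p
    by (rule continuous_constant_on_closure[OF contD]) (use main that True in auto)
  then have "F p = F 0 + integral {0..p} G" if "p \<in> {0..L}" for p
    using that by fastforce
  then have "primitive_on L F G" using Gabs unfolding primitive_on_def by blast
  then show ?thesis unfolding F_def G_def .
qed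

text \<open>Only \<open>g2\<close> is bounded here, as needed to test an integrable weak derivative against a smooth
  function. Truncating \<open>g1\<close> at height \<open>n\<close> reduces this to \<open>primitive_on_mult_bounded\<close>.\<close>

lemma primitive_on_mult:
  assumes f1: "primitive_on L f1 g1" and f2: "primitive_on L f2 g2"
    and b2: "\<And>x. x \<in> {0..L} \<Longrightarrow> \<bar>g2 x\<bar> \<le> C2"
  shows "primitive_on L (\<lambda>x. f1 x * f2 x) (\<lambda>x. g1 x * f2 x + f1 x * g2 x)"
proof -
  note c1 = primitive_on_continuous[OF f1] and c2 = primitive_on_continuous[OF f2]
  have bd: "bounded (f1 ` {0..L})" "bounded (f2 ` {0..L})"
    using c1 c2 by (auto intro!: compact_imp_bounded compact_continuous_image)
  obtain M2 where M2: "\<And>x. x \<in> {0..L} \<Longrightarrow> \<bar>f2 x\<bar> \<le> M2"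
    using continuous_on_bounded_abs[OF c2] by blast
  have g1: "g1 absolutely_integrable_on {0..L}" "g2 absolutely_integrable_on {0..L}"
    using primitive_on_abs_integrable[OF f1] primitive_on_abs_integrable[OF f2] .
  have Gabs: "(\<lambda>x. g1 x * f2 x + f1 x * g2 x) absolutely_integrable_on {0..L}"
  proof -
    have "(\<lambda>x. f2 x * g1 x) absolutely_integrable_on {0..L}" "(\<lambda>x. f1 x * g2 x) absolutely_integrable_on {0..L}"
      using g1 c1 c2 bd
      by (auto intro!: absolutely_integrable_bounded_measurable_product_real continuous_imp_measurable_on_sets_lebesgue)
    then show ?thesis
      by (intro set_integral_add(1)) (auto simp: mult.commute)
  qed
  \<comment> \<open>truncations of \<open>g1\<close>, dominated by \<open>g1\<close> itself\<close>
  define t where "t n x = max (- real n) (min (real n) (g1 x))" for n x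
  have t: "t n absolutely_integrable_on {0..L}" for n
    unfolding t_def by (intro absolutely_integrable_max_1 absolutely_integrable_min_1 g1) auto
  have tb: "\<bar>t n x\<bar> \<le> \<bar>g1 x\<bar>" "\<bar>t n x\<bar> \<le> real n" for n x
    by (auto simp: t_def)
  have tlim: "(\<lambda>n. t n x) \<longlonglongrightarrow> g1 x" for x
  proof -
    obtain k :: nat where k: "\<bar>g1 x\<bar> \<le> real k" using real_arch_simple by blast
    have "eventually (\<lambda>n. t n x = g1 x) sequentially"
      using eventually_ge_at_top[of k] by eventually_elim (use k in \<open>auto simp: t_def max_def min_def\<close>)
    then show ?thesis by (rule tendsto_eventually)
  qed
  define F where "F n x = f1 0 + integral {0..x} (t n)" for n x
  have F: "primitive_on L (F n) (t n)" for n
    unfolding primitive_on_def using t by (simp add: F_def)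
  have subi: "g absolutely_integrable_on {0..x}" if "g absolutely_integrable_on {0..L}" "x \<in> {0..L}" for g :: "real \<Rightarrow> real" and x
    using abs_integrable_subinterval[OF that(1), of 0 x] that(2) by auto
  have Flim: "(\<lambda>n. F n x) \<longlonglongrightarrow> f1 x" if x: "x \<in> {0..L}" for x
  proof -
    have "(\<lambda>n. integral {0..x} (t n)) \<longlonglongrightarrow> integral {0..x} g1"
      by (rule dominated_convergence(2)[where h = "\<lambda>x. \<bar>g1 x\<bar>"])
        (use subi[OF t x] subi[OF g1(1) x] tb tlim in \<open>auto simp: absolutely_integrable_on_def\<close>)
    then have "(\<lambda>n. F n x) \<longlonglongrightarrow> f1 0 + integral {0..x} g1"
      unfolding F_def by (intro tendsto_intros)
    then show ?thesis unfolding primitive_on_eq[OF f1 x, symmetric] .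
  qed
  define B where "B = \<bar>f1 0\<bar> + integral {0..L} (\<lambda>x. \<bar>g1 x\<bar>)"
  have FB: "\<bar>F n x\<bar> \<le> B" if x: "x \<in> {0..L}" for n x
  proof -
    have "norm (integral {0..x} (t n)) \<le> integral {0..x} (\<lambda>x. \<bar>g1 x\<bar>)"
      using subi[OF t x] subi[OF g1(1) x] tb
      by (intro Henstock_Kurzweil_Integration.integral_norm_bound_integral) (auto simp: absolutely_integrable_on_def)
    also have "\<dots> \<le> integral {0..L} (\<lambda>x. \<bar>g1 x\<bar>)"
      using subi[OF g1(1) x] g1(1) x by (intro integral_subset_le) (auto simp: absolutely_integrable_on_def)
    finally show ?thesis by (simp add: F_def B_def)
  qed
  show ?thesis
    unfolding primitive_on_def
  proof (intro conjI ballI Gabs)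
    fix x assume x: "x \<in> {0..L}"
    have pr: "primitive_on L (\<lambda>x. F n x * f2 x) (\<lambda>x. t n x * f2 x + F n x * g2 x)" for n
      by (rule primitive_on_mult_bounded[OF F f2 tb(2) b2])
    have "(\<lambda>n. integral {0..x} (\<lambda>x. t n x * f2 x + F n x * g2 x)) \<longlonglongrightarrow> integral {0..x} (\<lambda>x. g1 x * f2 x + f1 x * g2 x)"
    proof (rule dominated_convergence(2)[where h = "\<lambda>x. \<bar>g1 x\<bar> * M2 + B * \<bar>g2 x\<bar>"])
      show "(\<lambda>x. t n x * f2 x + F n x * g2 x) integrable_on {0..x}" for n
        using primitive_on_integrable[OF pr, of 0 x] x by auto
      show "(\<lambda>x. \<bar>g1 x\<bar> * M2 + B * \<bar>g2 x\<bar>) integrable_on {0..x}"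
        using subi[OF g1(1) x] subi[OF g1(2) x]
        by (auto simp: absolutely_integrable_on_def intro!: integrable_add integrable_on_mult_left integrable_on_mult_right)
      show "norm (t n y * f2 y + F n y * g2 y) \<le> \<bar>g1 y\<bar> * M2 + B * \<bar>g2 y\<bar>" if "y \<in> {0..x}" for n y
      proof -
        have "y \<in> {0..L}" using that x by auto
        then have "\<bar>t n y\<bar> * \<bar>f2 y\<bar> \<le> \<bar>g1 y\<bar> * M2" "\<bar>F n y\<bar> * \<bar>g2 y\<bar> \<le> B * \<bar>g2 y\<bar>"
          by (auto intro!: mult_mono tb M2 FB mult_right_mono)
        then show ?thesis
          using abs_triangle_ineq[of "t n y * f2 y" "F n y * g2 y"] by (simp add: abs_mult)
      qed
      show "(\<lambda>n. t n y * f2 y + F n y * g2 y) \<longlonglongrightarrow> g1 y * f2 y + f1 y * g2 y" if "y \<in> {0..x}" for y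
        using that x by (intro tendsto_intros tlim Flim) auto
    qed
    moreover have "integral {0..x} (\<lambda>x. t n x * f2 x + F n x * g2 x) = F n x * f2 x - F n 0 * f2 0" for n
      using primitive_on_eq[OF pr[of n] x] by linarith
    moreover have "(\<lambda>n. F n x * f2 x - F n 0 * f2 0) \<longlonglongrightarrow> f1 x * f2 x - f1 0 * f2 0"
      using x by (intro tendsto_intros Flim) auto
    ultimately have "integral {0..x} (\<lambda>x. g1 x * f2 x + f1 x * g2 x) = f1 x * f2 x - f1 0 * f2 0"
      using LIMSEQ_unique by simp
    then show "f1 x * f2 x = f1 0 * f2 0 + integral {0..x} (\<lambda>x. g1 x * f2 x + f1 x * g2 x)" by simp
  qed
qed

section \<open>Periodic functions\<close>

lemma periodic_2piD: "periodic_2pi f \<Longrightarrow> f (x + 2 * pi) = f x"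
  by (simp add: periodic_2pi_def)

text \<open>The spaces are defined by integrals over \<open>[-\<pi>, \<pi>]\<close>, which has the peak in its interior. All
  computations take place on \<open>[0, 2\<pi>]\<close>, where the coefficients are polynomials.\<close>

lemma abs_integrable_torus_iff:
  assumes "periodic_2pi f"
  shows "f absolutely_integrable_on {-pi..pi} \<longleftrightarrow> f absolutely_integrable_on {0..2*pi}"
proof -
  have split: "g absolutely_integrable_on {a..b} \<longleftrightarrow> g absolutely_integrable_on {a..c} \<and> g absolutely_integrable_on {c..b}"
    if "a \<le> c" "c \<le> b" for g :: "real \<Rightarrow> real" and a b c
    using absolutely_integrable_on_combine[where f = g and a = a and b = b and c = c] that
      absolutely_integrable_on_subinterval[where f = g and S = "{a..b}" and a = a and b = c]
      absolutely_integrable_on_subinterval[where f = g and S = "{a..b}" and a = c and b = b] by auto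
  have "g integrable_on {-pi..0} \<longleftrightarrow> g integrable_on {pi..2*pi}" if "periodic_2pi g" for g
    using integrable_shift_cbox_iff[of g "2*pi" pi "2*pi"] that by (simp add: periodic_2piD)
  moreover have "periodic_2pi (\<lambda>x. \<bar>f x\<bar>)" using assms by (simp add: periodic_2pi_def)
  ultimately have "f absolutely_integrable_on {-pi..0} \<longleftrightarrow> f absolutely_integrable_on {pi..2*pi}"
    using assms by (simp add: absolutely_integrable_on_def)
  then show ?thesis using split[of "-pi" 0 pi f] split[of 0 pi "2*pi" f] by auto
qed

lemma integral_torus_eq:
  assumes "periodic_2pi f" "f absolutely_integrable_on {0..2*pi}"
  shows "integral {-pi..pi} f = integral {0..2*pi} f"
proof -
  have "f integrable_on {-pi..pi}" "f integrable_on {0..2*pi}"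
    using assms abs_integrable_torus_iff by (auto simp: absolutely_integrable_on_def)
  then have "integral {-pi..pi} f = integral {-pi..0} f + integral {0..pi} f"
    "integral {0..2*pi} f = integral {0..pi} f + integral {pi..2*pi} f"
    by (simp_all add: Henstock_Kurzweil_Integration.integral_combine)
  moreover have "integral {-pi..0} f = integral {pi..2*pi} f"
    using integral_shift_cbox[of pi "2*pi" "2*pi" f] assms(1) by (simp add: periodic_2piD)
  ultimately show ?thesis by simp
qed

lemma integrable_torus_iff:
  "periodic_2pi f \<Longrightarrow> integrable torus f \<longleftrightarrow> f absolutely_integrable_on {0..2*pi}"
  unfolding abs_integrable_torus_iff[symmetric] by (simp add: set_integrable_def integrable_restrict_space)

lemma LINT_torus_eq:
  assumes "periodic_2pi f" "f absolutely_integrable_on {0..2*pi}"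
  shows "(LINT x|torus. f x) = integral {0..2*pi} f"
  using assms integrable_torus_iff[OF assms(1)] by (simp add: lebesgue_integral_eq_integral integral_torus_eq)

lemma borel_measurable_torus_iff:
  assumes f: "periodic_2pi f"
  shows "f \<in> borel_measurable torus \<longleftrightarrow> f \<in> borel_measurable (lebesgue_on {0..2*pi})"
proof -
  have *: "f \<in> borel_measurable (lebesgue_on {b..b + 2 * pi})"
    if m: "f \<in> borel_measurable (lebesgue_on {a..a + 2 * pi})"
      and per: "\<And>x. f (x + s) = f x"
      and cover: "\<And>x. x \<in> {b..b + 2 * pi} \<Longrightarrow> x \<notin> {a..a + 2 * pi} \<Longrightarrow> x + s \<in> {a..a + 2 * pi}" for a b s
  proof -
    define H where "H x = (if x \<in> {a..a + 2 * pi} then f x else 0)" for x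
    have H: "H \<in> borel_measurable lebesgue"
      using m unfolding H_def by (subst borel_measurable_if) auto
    have "(\<lambda>x. H (x + s)) \<in> borel_measurable lebesgue"
      using borel_measurable_affine[OF H one_neq_zero, of s] unfolding real_scaleR_def mult_1 add.commute[of s] .
    then have "(\<lambda>x. if x \<in> {a..a + 2 * pi} then H x else H (x + s)) \<in> borel_measurable lebesgue"
      using H by (intro measurable_If_set) auto
    then have "(\<lambda>x. if x \<in> {a..a + 2 * pi} then H x else H (x + s)) \<in> borel_measurable (lebesgue_on {b..b + 2 * pi})"
      by (rule measurable_restrict_space1)
    also have "?this \<longleftrightarrow> ?thesis"
      using cover per by (intro measurable_cong) (auto simp: space_restrict_space H_def)
    finally show ?thesis .
  qed
  have "f (x + - (2 * pi)) = f x" for x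
    using periodic_2piD[OF f, of "x - 2 * pi"] by simp
  then have "f \<in> borel_measurable (lebesgue_on {0..0 + 2 * pi})"
    if "f \<in> borel_measurable (lebesgue_on {-pi..-pi + 2 * pi})"
    by (rule *[OF that]) auto
  moreover have "f \<in> borel_measurable (lebesgue_on {-pi..-pi + 2 * pi})"
    if "f \<in> borel_measurable (lebesgue_on {0..0 + 2 * pi})"
    by (rule *[OF that periodic_2piD[OF f]]) auto
  moreover have "-pi + 2 * pi = pi" "0 + 2 * pi = 2 * pi" by auto
  ultimately show ?thesis by metis
qed

lemma AE_torus_iff:
  assumes Q: "\<And>x. Q (x + 2 * pi) \<longleftrightarrow> Q x"
  shows "(AE x in torus. Q x) \<longleftrightarrow> negligible {x \<in> {0..2*pi}. \<not> Q x}"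
proof -
  have AE: "(AE x in torus. Q x) \<longleftrightarrow> negligible {x \<in> {-pi..pi}. \<not> Q x}"
  proof -
    have "(AE x in torus. Q x) \<longleftrightarrow> (AE x in lebesgue. x \<in> {-pi..pi} \<longrightarrow> Q x)"
      by (rule AE_restrict_space_iff) auto
    also have "\<dots> \<longleftrightarrow> negligible {x. \<not> (x \<in> {-pi..pi} \<longrightarrow> Q x)}"
      unfolding eventually_ae_filter_negligible by (auto intro: negligible_subset)
    finally show ?thesis by (simp add: conj_ac)
  qed
  have tr: "negligible ((\<lambda>x. x + s) ` A)" if "negligible A" for A :: "real set" and s
    using that by (intro negligible_differentiable_image_negligible) (auto intro!: derivative_intros simp: differentiable_on_def)
  have "{x \<in> {0..2*pi}. \<not> Q x} \<subseteq> {x \<in> {-pi..pi}. \<not> Q x} \<union> (\<lambda>x. x + 2 * pi) ` {x \<in> {-pi..pi}. \<not> Q x}"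
  proof
    fix x assume x: "x \<in> {x \<in> {0..2*pi}. \<not> Q x}"
    then have "\<not> Q (x - 2 * pi)" using Q[of "x - 2 * pi"] by simp
    then have "x \<in> (\<lambda>x. x + 2 * pi) ` {x \<in> {-pi..pi}. \<not> Q x}" if "pi < x"
      using x that by (intro image_eqI[where x = "x - 2 * pi"]) auto
    then show "x \<in> {x \<in> {-pi..pi}. \<not> Q x} \<union> (\<lambda>x. x + 2 * pi) ` {x \<in> {-pi..pi}. \<not> Q x}"
      using x by (cases "pi < x") auto
  qed
  moreover have "{x \<in> {-pi..pi}. \<not> Q x} \<subseteq> {x \<in> {0..2*pi}. \<not> Q x} \<union> (\<lambda>x. x + (- (2 * pi))) ` {x \<in> {0..2*pi}. \<not> Q x}"
  proof
    fix x assume x: "x \<in> {x \<in> {-pi..pi}. \<not> Q x}"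
    then have "\<not> Q (x + 2 * pi)" using Q[of x] by simp
    then have "x \<in> (\<lambda>x. x + (- (2 * pi))) ` {x \<in> {0..2*pi}. \<not> Q x}" if "x < 0"
      using x that by (intro image_eqI[where x = "x + 2 * pi"]) auto
    then show "x \<in> {x \<in> {0..2*pi}. \<not> Q x} \<union> (\<lambda>x. x + (- (2 * pi))) ` {x \<in> {0..2*pi}. \<not> Q x}"
      using x by (cases "x < 0") auto
  qed
  ultimately show ?thesis
    unfolding AE using negligible_subset[OF negligible_Un[OF _ tr]] by blast
qed

text \<open>The value at \<open>0\<close> is used at all multiples of \<open>2\<pi>\<close>.\<close>

definition periodize :: "(real \<Rightarrow> real) \<Rightarrow> real \<Rightarrow> real" where
  "periodize f x = f (x - 2 * pi * of_int \<lfloor>x / (2 * pi)\<rfloor>)"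

lemma periodize_periodic: "periodic_2pi (periodize f)"
proof -
  have "(x + 2 * pi) / (2 * pi) = x / (2 * pi) + 1" for x :: real by (simp add: field_simps)
  then show ?thesis by (simp add: periodic_2pi_def periodize_def algebra_simps)
qed

lemma periodize_eq: "x \<in> {0..<2*pi} \<Longrightarrow> periodize f x = f x"
proof -
  assume "x \<in> {0..<2*pi}"
  then have "\<lfloor>x / (2 * pi)\<rfloor> = 0" by (simp add: floor_eq_iff)
  then show ?thesis by (simp add: periodize_def)
qed

lemma periodize_eq': "f 0 = f (2 * pi) \<Longrightarrow> x \<in> {0..2*pi} \<Longrightarrow> periodize f x = f x"
  using periodize_eq[of x f] periodize_eq[of 0 f] periodic_2piD[OF periodize_periodic, of f 0]
  by (cases "x = 2 * pi") auto

lemma periodic_2pi_reduce: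
  assumes "periodic_2pi f"
  shows "f (x - 2 * pi * of_int k) = f x"
proof -
  have nat: "f (x - 2 * pi * of_nat n) = f x" for x n
  proof (induction n)
    case (Suc n)
    have "x - 2 * pi * of_nat n = (x - 2 * pi * of_nat (Suc n)) + 2 * pi" by (simp add: algebra_simps)
    then show ?case using Suc periodic_2piD[OF assms] by metis
  qed simp
  show ?thesis
  proof (cases k)
    case (nonneg n) then show ?thesis using nat by simp
  next
    case (neg n)
    have "x - 2 * pi * of_int k - 2 * pi * of_nat (Suc n) = x"
      unfolding neg by (simp add: algebra_simps)
    then show ?thesis using nat[of "x - 2 * pi * of_int k" "Suc n"] by metis
  qed
qed

lemma reduce_mod_2pi: "x - 2 * pi * of_int \<lfloor>x / (2 * pi)\<rfloor> \<in> {0..<2*pi}"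
proof -
  have "of_int \<lfloor>x / (2 * pi)\<rfloor> \<le> x / (2 * pi)" "x / (2 * pi) < of_int \<lfloor>x / (2 * pi)\<rfloor> + 1"
    by linarith+
  then have "of_int \<lfloor>x / (2 * pi)\<rfloor> * (2 * pi) \<le> x" "x < (of_int \<lfloor>x / (2 * pi)\<rfloor> + 1) * (2 * pi)"
    by (simp_all only: pos_le_divide_eq pos_divide_less_eq pi_gt_zero mult_pos_pos zero_less_numeral)
  then show ?thesis by (simp add: algebra_simps)
qed

lemma periodic_continuous:
  assumes f: "periodic_2pi f" and c: "continuous_on {0..2*pi} f"
  shows "continuous_on UNIV f"
proof -
  have "continuous_on {-2*pi..0} f"
  proof -
    have "continuous_on {-2*pi..0} (\<lambda>x. f (x + 2 * pi))"
      by (intro continuous_on_compose2[OF c] continuous_intros) auto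
    then show ?thesis using periodic_2piD[OF f] by simp
  qed
  then have c2: "continuous_on {-2*pi..2*pi} f"
    using continuous_on_closed_Un[of "{-2*pi..0}" "{0..2*pi}" f] c by (simp add: ivl_disj_un_two_touch)
  have "isCont f x" for x
  proof -
    define k where "k = \<lfloor>x / (2 * pi)\<rfloor>"
    define y where "y = x - 2 * pi * of_int k"
    have "y \<in> {0..<2*pi}" unfolding y_def k_def by (rule reduce_mod_2pi)
    then have "isCont f y"
      using continuous_on_interior[OF c2, of y] by auto
    then have "isCont (\<lambda>x. f (x - 2 * pi * of_int k)) x"
      unfolding y_def by (intro continuous_within_compose3[where g = f and f = "\<lambda>x. x - 2 * pi * of_int k"] continuous_intros) auto
    then show ?thesis using periodic_2pi_reduce[OF f] by simp
  qed
  then show ?thesis by (simp add: continuous_at_imp_continuous_on)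
qed

section \<open>Weak derivatives\<close>

lemma primitive_on_cong_AE:
  assumes u: "primitive_on L u g" and N: "negligible {x \<in> {0..L}. h x \<noteq> g x}"
  shows "primitive_on L u h"
  unfolding primitive_on_def
proof (intro conjI ballI)
  show "h absolutely_integrable_on {0..L}"
    by (rule absolutely_integrable_spike[OF primitive_on_abs_integrable[OF u] N]) auto
  fix x assume x: "x \<in> {0..L}"
  have "integral {0..x} h = integral {0..x} g"
    by (rule integral_spike[OF N]) (use x in auto)
  then show "u x = u 0 + integral {0..x} h" using primitive_on_eq[OF u x] by simp
qed

lemma ex_primitive_continuous_real:
  fixes f :: "real \<Rightarrow> real"
  assumes "continuous_on UNIV f"
  shows "\<exists>g. g 0 = 0 \<and> (\<forall>t. (g has_real_derivative f t) (at t))"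
  using ex_primitive_continuous[OF assms] unfolding has_real_derivative_iff_has_vector_derivative by metis

text \<open>Trigonometric polynomials are closed under products and derivatives, and their periodic primitives are
  test functions. Their powers concentrate at a point, so they take the place of bump functions.\<close>

inductive trig_poly :: "(real \<Rightarrow> real) \<Rightarrow> bool" where
  trig_poly_const: "trig_poly (\<lambda>_. c)"
| trig_poly_cos: "trig_poly cos"
| trig_poly_sin: "trig_poly sin"
| trig_poly_add: "trig_poly f \<Longrightarrow> trig_poly g \<Longrightarrow> trig_poly (\<lambda>x. f x + g x)"
| trig_poly_mult: "trig_poly f \<Longrightarrow> trig_poly g \<Longrightarrow> trig_poly (\<lambda>x. f x * g x)"

lemma trig_poly_power: "trig_poly f \<Longrightarrow> trig_poly (\<lambda>x. f x ^ n)"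
  by (induction n) (auto intro: trig_poly.intros)

lemma trig_poly_has_derivative:
  "trig_poly f \<Longrightarrow> \<exists>f'. trig_poly f' \<and> (\<forall>x. (f has_real_derivative f' x) (at x))"
proof (induction rule: trig_poly.induct)
  case (trig_poly_const c)
  show ?case by (intro exI[of _ "\<lambda>_. 0"]) (auto intro: trig_poly.intros)
next
  case trig_poly_cos
  show ?case
    by (intro exI[of _ "\<lambda>x. (-1) * sin x"] conjI trig_poly.intros) (auto intro!: derivative_eq_intros)
next
  case trig_poly_sin
  show ?case by (intro exI[of _ cos]) (auto intro!: trig_poly.intros derivative_eq_intros)
next
  case (trig_poly_add f g)
  then obtain f' g' where "trig_poly f'" "trig_poly g'" "\<And>x. (f has_real_derivative f' x) (at x)"
    "\<And>x. (g has_real_derivative g' x) (at x)" by blast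
  then show ?case
    by (intro exI[of _ "\<lambda>x. f' x + g' x"]) (auto intro!: trig_poly.intros derivative_intros)
next
  case (trig_poly_mult f g)
  then obtain f' g' where "trig_poly f'" "trig_poly g'" "\<And>x. (f has_real_derivative f' x) (at x)"
    "\<And>x. (g has_real_derivative g' x) (at x)" by blast
  then show ?case
    using trig_poly_mult
    by (intro exI[of _ "\<lambda>x. f' x * g x + f x * g' x"]) (auto intro!: trig_poly.intros derivative_eq_intros)
qed

lemma trig_poly_continuous: "trig_poly f \<Longrightarrow> continuous_on S f"
  using trig_poly_has_derivative by (meson DERIV_continuous continuous_at_imp_continuous_on)

lemma trig_poly_periodic: "trig_poly f \<Longrightarrow> periodic_2pi f"
  unfolding periodic_2pi_def by (induction rule: trig_poly.induct) auto

lemma trig_poly_deriv: "trig_poly f \<Longrightarrow> trig_poly ((deriv ^^ n) f)"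
proof (induction n)
  case (Suc n)
  then obtain f' where "trig_poly f'" "\<And>x. ((deriv ^^ n) f has_real_derivative f' x) (at x)"
    using trig_poly_has_derivative by blast
  then have "trig_poly f' \<and> deriv ((deriv ^^ n) f) = f'" by (auto intro: DERIV_imp_deriv)
  then show ?case by simp
qed simp

lemma test_function_trig_primitive:
  assumes "periodic_2pi \<phi>" "trig_poly f" and d: "\<And>x. (\<phi> has_real_derivative f x) (at x)"
  shows "test_function \<phi>" "deriv \<phi> = f"
proof -
  show df: "deriv \<phi> = f" using d by (auto intro: DERIV_imp_deriv)
  have "(deriv ^^ n) \<phi> field_differentiable (at x)" for n x
  proof (cases n)
    case 0
    then show ?thesis using d by (auto simp: field_differentiable_def)
  next
    case (Suc m)
    then have "(deriv ^^ n) \<phi> = (deriv ^^ m) f" by (simp add: funpow_swap1 df del: funpow.simps add: funpow_Suc_right o_def)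
    then show ?thesis
      using trig_poly_has_derivative[OF trig_poly_deriv[OF assms(2), of m]] by (auto simp: field_differentiable_def)
  qed
  then show "test_function \<phi>" using assms(1) by (simp add: test_function_def)
qed

text \<open>A continuous function orthogonal to all trigonometric polynomials vanishes: if it is positive at
  \<open>y\<close>, then the powers of \<open>1 - cos r + cos (x - y)\<close> with a small \<open>r\<close> concentrate there.\<close>

lemma trig_poly_orthogonal_imp_nonpos:
  assumes d: "continuous_on {0..2*pi} d"
    and orth: "\<And>\<psi>. trig_poly \<psi> \<Longrightarrow> integral {0..2*pi} (\<lambda>x. d x * \<psi> x) = 0"
    and y: "0 < y" "y < 2 * pi"
  shows "d y \<le> 0"
proof (rule ccontr)
  assume "\<not> d y \<le> 0"
  define \<epsilon> where "\<epsilon> = d y / 2"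
  have \<epsilon>: "\<epsilon> > 0" "d y > \<epsilon>" using \<open>\<not> d y \<le> 0\<close> by (auto simp: \<epsilon>_def)
  obtain M where M: "\<And>x. x \<in> {0..2*pi} \<Longrightarrow> \<bar>d x\<bar> \<le> M" using continuous_on_bounded_abs[OF d] by blast
  have "M \<ge> 0" using M[of 0] by auto
  obtain e where e: "e > 0" "\<And>x. x \<in> {0..2*pi} \<Longrightarrow> \<bar>x - y\<bar> < e \<Longrightarrow> \<bar>d x - d y\<bar> < \<epsilon>"
    using d y \<epsilon>(1) unfolding continuous_on_iff by (force simp: dist_real_def)
  define r where "r = Min {e / 2, y / 2, (2 * pi - y) / 2, 1}"
  have r: "r > 0" "r < e" "r < y" "r < 2 * pi - y" "r \<le> 1"
    using e y by (auto simp: r_def min_def)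
  have r2: "r < pi / 2" using r(5) pi_gt3 by simp
  have dr: "d x \<ge> \<epsilon>" if "\<bar>x - y\<bar> \<le> r" for x
  proof -
    have "x \<in> {0..2*pi}" using that r by auto
    moreover have "\<bar>x - y\<bar> < e" using that r by linarith
    ultimately have "\<bar>d x - d y\<bar> < \<epsilon>" by (rule e(2))
    then show ?thesis unfolding \<epsilon>_def by linarith
  qed
  \<comment> \<open>\<open>\<bar>q\<bar> \<le> 1\<close> off the \<open>r\<close>-neighbourhood of \<open>y\<close>, \<open>q \<ge> 1\<close> on it, and \<open>q \<ge> 1 + \<eta>\<close> close to \<open>y\<close>\<close>
  define q where "q x = 1 - cos r + cos (x - y)" for x
  have "trig_poly (\<lambda>x. (1 - cos r) + (cos x * cos y + sin x * sin y))"
    by (intro trig_poly.intros)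
  then have tq: "trig_poly q" by (simp add: q_def[abs_def] cos_diff)
  have cosr: "0 < cos r" "cos r < 1"
    using r r2 cos_gt_zero[of r] cos_monotone_0_pi[of 0 r] pi_gt3 by auto
  have far: "\<bar>q x\<bar> \<le> 1" if x: "x \<in> {0..2*pi}" "\<bar>x - y\<bar> \<ge> r" for x
  proof -
    have "cos (x - y) = cos \<bar>x - y\<bar>" by simp
    also have "\<dots> \<le> cos r"
    proof (cases "\<bar>x - y\<bar> \<le> pi")
      case True
      then show ?thesis using x r by (intro cos_monotone_0_pi_le) auto
    next
      case False
      have "cos \<bar>x - y\<bar> = cos (2 * pi - \<bar>x - y\<bar>)" by (simp add: cos_diff)
      also have "\<dots> \<le> cos r" using x r False y by (intro cos_monotone_0_pi_le) (auto simp: abs_if split: if_splits)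
      finally show ?thesis .
    qed
    finally show ?thesis using cosr cos_ge_minus_one[of "x - y"] unfolding q_def abs_le_iff by linarith
  qed
  have near: "q x \<ge> 1" if "\<bar>x - y\<bar> \<le> r" for x
  proof -
    have "cos r \<le> cos \<bar>x - y\<bar>" using that r pi_gt3 by (intro cos_monotone_0_pi_le) auto
    then show ?thesis by (simp add: q_def)
  qed
  define \<eta> where "\<eta> = cos (r / 2) - cos r"
  have "\<eta> > 0" using r pi_gt3 cos_monotone_0_pi[of "r/2" r] by (auto simp: \<eta>_def)
  have close: "q x \<ge> 1 + \<eta>" if "\<bar>x - y\<bar> \<le> r / 2" for x
  proof -
    have "cos (r / 2) \<le> cos \<bar>x - y\<bar>" using that r pi_gt3 by (intro cos_monotone_0_pi_le) auto
    then show ?thesis by (simp add: q_def \<eta>_def)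
  qed
  have le: "\<epsilon> * (1 + \<eta>) ^ n * r \<le> 2 * pi * M" for n
  proof -
    define f where "f x = (if x \<in> {y - r/2..y + r/2} then \<epsilon> * (1 + \<eta>) ^ n else 0) - M" for x
    have "d x * q x ^ n \<ge> f x" if x: "x \<in> {0..2*pi}" for x
    proof (cases "\<bar>x - y\<bar> \<le> r")
      case True
      have 1: "1 \<le> q x ^ n" using near[OF True] by (rule one_le_power)
      have pos: "d x * q x ^ n \<ge> 0" using dr[OF True] \<epsilon> 1 by (intro mult_nonneg_nonneg) auto
      show ?thesis
      proof (cases "\<bar>x - y\<bar> \<le> r / 2")
        case True
        have "\<epsilon> * (1 + \<eta>) ^ n \<le> d x * q x ^ n"
          using dr[of x] True r \<epsilon> \<open>\<eta> > 0\<close> close[OF True] by (intro mult_mono power_mono) auto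
        moreover have "x \<in> {y - r/2..y + r/2}"
          using True unfolding atLeastAtMost_iff abs_le_iff by linarith
        ultimately show ?thesis using \<open>M \<ge> 0\<close> by (simp add: f_def)
      next
        case False
        then show ?thesis using pos \<open>M \<ge> 0\<close> by (auto simp: f_def abs_if split: if_splits)
      qed
    next
      case False
      have "\<bar>d x * q x ^ n\<bar> \<le> M * 1"
        unfolding abs_mult using M[OF x] far[OF x] False
        by (intro mult_mono) (auto simp: power_abs power_le_one)
      moreover have "f x = - M" using False r by (auto simp: f_def abs_if split: if_splits)
      ultimately show ?thesis by linarith
    qed
    moreover have fint: "(f has_integral (\<epsilon> * (1 + \<eta>) ^ n * r - 2 * pi * M)) {0..2*pi}"
    proof -
      have "((\<lambda>x. \<epsilon> * (1 + \<eta>) ^ n) has_integral (y + r/2 - (y - r/2)) *\<^sub>R (\<epsilon> * (1 + \<eta>) ^ n)) {y - r/2..y + r/2}"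
        using has_integral_const_real[of "\<epsilon> * (1 + \<eta>) ^ n" "y - r/2" "y + r/2"] r by simp
      then have "((\<lambda>x. if x \<in> {y - r/2..y + r/2} then \<epsilon> * (1 + \<eta>) ^ n else 0) has_integral r * (\<epsilon> * (1 + \<eta>) ^ n)) {0..2*pi}"
        using r by (subst has_integral_restrict) auto
      from has_integral_diff[OF this has_integral_const_real[of M 0 "2*pi"]]
      show ?thesis by (simp add: f_def[abs_def] mult.commute mult.left_commute)
    qed
    moreover have "(\<lambda>x. d x * q x ^ n) integrable_on {0..2*pi}"
      using tq by (intro integrable_continuous_interval continuous_intros d trig_poly_continuous)
    ultimately have "\<epsilon> * (1 + \<eta>) ^ n * r - 2 * pi * M \<le> integral {0..2*pi} (\<lambda>x. d x * q x ^ n)"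
      by (intro has_integral_le[OF fint integrable_integral]) auto
    then show ?thesis using orth[OF trig_poly_power[OF tq]] by simp
  qed
  have "filterlim (\<lambda>n. \<epsilon> * (1 + \<eta>) ^ n * r) at_top sequentially"
    using \<epsilon> \<open>\<eta> > 0\<close> r by real_asymp
  then obtain n where "\<epsilon> * (1 + \<eta>) ^ n * r > 2 * pi * M"
    by (auto simp: filterlim_at_top_dense eventually_sequentially)
  then show False using le[of n] by simp
qed

lemma trig_poly_orthogonal_imp_zero:
  assumes d: "continuous_on {0..2*pi} d"
    and orth: "\<And>\<psi>. trig_poly \<psi> \<Longrightarrow> integral {0..2*pi} (\<lambda>x. d x * \<psi> x) = 0"
    and x: "x \<in> {0..2*pi}"
  shows "d x = 0"
proof (rule continuous_constant_on_closure[of "{0<..<2*pi}" d])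
  show "continuous_on (closure {0<..<2*pi}) d" using d by simp
  show "d y = 0" if "y \<in> {0<..<2*pi}" for y
  proof -
    have "d y \<le> 0"
      using that by (intro trig_poly_orthogonal_imp_nonpos[OF d orth]) auto
    moreover have "- d y \<le> 0"
    proof (rule trig_poly_orthogonal_imp_nonpos[of "\<lambda>x. - d x"])
      show "integral {0..2*pi} (\<lambda>x. - d x * \<psi> x) = 0" if "trig_poly \<psi>" for \<psi>
        using orth[OF that] by simp
    qed (use that d in \<open>auto intro: continuous_intros\<close>)
    ultimately show ?thesis by simp
  qed
qed (use x in auto)

lemma test_function_has_derivative:
  assumes "test_function \<phi>"
  shows "(\<phi> has_real_derivative deriv \<phi> x) (at x)" "continuous_on S (deriv \<phi>)"
proof -
  have d: "(deriv ^^ n) \<phi> field_differentiable (at x)" for n x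
    using assms by (simp add: test_function_def)
  show "(\<phi> has_real_derivative deriv \<phi> x) (at x)"
    using d[of 0 x] by (simp add: DERIV_deriv_iff_field_differentiable)
  have "deriv \<phi> field_differentiable (at x)" for x using d[of 1 x] by simp
  then show "continuous_on S (deriv \<phi>)"
    by (meson continuous_at_imp_continuous_on field_differentiable_imp_continuous_at)
qed

text \<open>Integration by parts for a function that is merely absolutely continuous; periodicity cancels the
  boundary terms.\<close>

lemma integral_mult_test_function:
  assumes u: "primitive_on (2*pi) u g" and per: "u (2 * pi) = u 0" and \<phi>: "test_function \<phi>"
  shows "(\<lambda>x. g x * \<phi> x) absolutely_integrable_on {0..2*pi}"
    "(\<lambda>x. u x * deriv \<phi> x) absolutely_integrable_on {0..2*pi}"
    "integral {0..2*pi} (\<lambda>x. u x * deriv \<phi> x) = - integral {0..2*pi} (\<lambda>x. g x * \<phi> x)"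
proof -
  note d = test_function_has_derivative[OF \<phi>]
  have p\<phi>: "primitive_on (2*pi) \<phi> (deriv \<phi>)"
    using d by (intro primitive_on_has_derivative) (auto intro: DERIV_subset)
  obtain M where M: "\<And>x. x \<in> {0..2*pi} \<Longrightarrow> \<bar>deriv \<phi> x\<bar> \<le> M"
    using continuous_on_bounded_abs[OF d(2)] by blast
  have c\<phi>: "continuous_on {0..2*pi} \<phi>" by (rule primitive_on_continuous[OF p\<phi>])
  have "bounded (\<phi> ` {0..2*pi})" using c\<phi> by (intro compact_imp_bounded compact_continuous_image) auto
  then have "(\<lambda>x. \<phi> x * g x) absolutely_integrable_on {0..2*pi}"
    using primitive_on_abs_integrable[OF u] c\<phi>
    by (intro absolutely_integrable_bounded_measurable_product_real continuous_imp_measurable_on_sets_lebesgue) auto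
  then show i1: "(\<lambda>x. g x * \<phi> x) absolutely_integrable_on {0..2*pi}" by (simp add: mult.commute)
  show i2: "(\<lambda>x. u x * deriv \<phi> x) absolutely_integrable_on {0..2*pi}"
    using primitive_on_continuous[OF u] d(2) by (intro absolutely_integrable_continuous_real continuous_intros)
  have "\<phi> (2 * pi) = \<phi> 0"
    using \<phi> periodic_2piD[of \<phi> 0] by (simp add: test_function_def)
  moreover have "u (2*pi) * \<phi> (2*pi) = u 0 * \<phi> 0 + integral {0..2*pi} (\<lambda>x. g x * \<phi> x + u x * deriv \<phi> x)"
    by (rule primitive_on_eq[OF primitive_on_mult[OF u p\<phi> M]]) auto
  ultimately have "integral {0..2*pi} (\<lambda>x. g x * \<phi> x + u x * deriv \<phi> x) = 0"
    using per by simp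
  then show "integral {0..2*pi} (\<lambda>x. u x * deriv \<phi> x) = - integral {0..2*pi} (\<lambda>x. g x * \<phi> x)"
    using i1 i2 by (subst (asm) Henstock_Kurzweil_Integration.integral_add) (auto simp: absolutely_integrable_on_def)
qed

lemma periodic_2pi_mult: "periodic_2pi f \<Longrightarrow> periodic_2pi g \<Longrightarrow> periodic_2pi (\<lambda>x. f x * g x)"
  and periodic_2pi_add: "periodic_2pi f \<Longrightarrow> periodic_2pi g \<Longrightarrow> periodic_2pi (\<lambda>x. f x + g x)"
  and periodic_2pi_diff: "periodic_2pi f \<Longrightarrow> periodic_2pi g \<Longrightarrow> periodic_2pi (\<lambda>x. f x - g x)"
  and periodic_2pi_const: "periodic_2pi (\<lambda>_. c)"
  and periodic_2pi_power: "periodic_2pi f \<Longrightarrow> periodic_2pi (\<lambda>x. f x ^ n)"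
  by (simp_all add: periodic_2pi_def)

lemma periodic_2pi_deriv:
  assumes "test_function \<phi>"
  shows "periodic_2pi (deriv \<phi>)"
proof -
  have "deriv \<phi> (x + 2 * pi) = deriv \<phi> x" for x
  proof -
    have "((\<lambda>y. \<phi> (y + 2 * pi)) has_real_derivative deriv \<phi> (x + 2 * pi)) (at x)"
      using test_function_has_derivative(1)[OF assms, of "x + 2 * pi"] by (simp add: DERIV_shift)
    moreover have "(\<lambda>y. \<phi> (y + 2 * pi)) = \<phi>" using assms by (auto simp: test_function_def periodic_2pi_def)
    ultimately show ?thesis using DERIV_imp_deriv by metis
  qed
  then show ?thesis by (simp add: periodic_2pi_def)
qed

lemma primitive_imp_has_weak_deriv:
  assumes "periodic_2pi u" "periodic_2pi g" and u: "primitive_on (2*pi) u g"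
  shows "has_weak_deriv u g" "continuous_on UNIV u"
proof -
  have c: "continuous_on {0..2*pi} u" by (rule primitive_on_continuous[OF u])
  then show "continuous_on UNIV u" by (rule periodic_continuous[OF assms(1)])
  have per: "u (2 * pi) = u 0" using periodic_2piD[OF assms(1), of 0] by simp
  show "has_weak_deriv u g"
    unfolding has_weak_deriv_def
  proof (intro conjI allI impI)
    show "integrable torus u" "integrable torus g"
      using assms c primitive_on_abs_integrable[OF u]
      by (auto simp: integrable_torus_iff intro: absolutely_integrable_continuous_real)
    fix \<phi> assume \<phi>: "test_function \<phi>"
    note i = integral_mult_test_function[OF u per \<phi>]
    have "periodic_2pi \<phi>" using \<phi> by (simp add: test_function_def)
    then show "(LINT x|torus. u x * deriv \<phi> x) = - (LINT x|torus. g x * \<phi> x)"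
      using i assms by (simp add: LINT_torus_eq periodic_2pi_mult periodic_2pi_deriv[OF \<phi>])
  qed (use assms in auto)
qed

text \<open>The du Bois-Reymond lemma: \<open>u\<close> minus the primitive of \<open>g\<close> is orthogonal to the derivatives of all
  test functions, that is, to all trigonometric polynomials of mean zero, and is therefore constant.\<close>

lemma has_weak_deriv_imp_primitive:
  assumes c: "continuous_on UNIV u" and wd: "has_weak_deriv u g"
  shows "primitive_on (2*pi) u g"
proof -
  have pu: "periodic_2pi u" "periodic_2pi g" and g: "g absolutely_integrable_on {0..2*pi}"
    and test: "\<And>\<phi>. test_function \<phi> \<Longrightarrow> (LINT x|torus. u x * deriv \<phi> x) = - (LINT x|torus. g x * \<phi> x)"
    using wd by (auto simp: has_weak_deriv_def integrable_torus_iff[symmetric])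
  define v where "v x = u 0 + integral {0..x} g" for x
  have v: "primitive_on (2*pi) v g" unfolding v_def primitive_on_def using g by simp
  have one: "test_function (\<lambda>_. 1)"
    by (rule test_function_trig_primitive(1)[of _ "\<lambda>_. 0"]) (auto intro: trig_poly.intros simp: periodic_2pi_def)
  have "integral {0..2*pi} g = 0"
    using test[OF one] LINT_torus_eq[OF pu(2) g] by simp
  then have vper: "v (2 * pi) = v 0" by (simp add: v_def)
  define d where "d x = u x - v x" for x
  have cd: "continuous_on {0..2*pi} d"
    unfolding d_def by (intro continuous_intros primitive_on_continuous[OF v] continuous_on_subset[OF c]) auto
  have orth1: "integral {0..2*pi} (\<lambda>x. d x * deriv \<phi> x) = 0" if \<phi>: "test_function \<phi>" for \<phi>
  proof -
    note i = integral_mult_test_function[OF v vper \<phi>]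
    have p: "periodic_2pi \<phi>" using \<phi> by (simp add: test_function_def)
    have ui: "(\<lambda>x. u x * deriv \<phi> x) absolutely_integrable_on {0..2*pi}"
      by (intro absolutely_integrable_continuous_real continuous_intros continuous_on_subset[OF c]
          test_function_has_derivative[OF \<phi>]) auto
    have "integral {0..2*pi} (\<lambda>x. u x * deriv \<phi> x) = - integral {0..2*pi} (\<lambda>x. g x * \<phi> x)"
      using test[OF \<phi>] ui i(1) pu p by (simp add: LINT_torus_eq periodic_2pi_mult periodic_2pi_deriv[OF \<phi>])
    then show ?thesis
      using ui i(2) i(3) by (simp add: d_def left_diff_distrib Henstock_Kurzweil_Integration.integral_diff absolutely_integrable_on_def)
  qed
  define m where "m = integral {0..2*pi} d / (2 * pi)"
  have di: "d integrable_on {0..2*pi}" by (rule integrable_continuous_interval[OF cd])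
  have "d x - m = 0" if "x \<in> {0..2*pi}" for x
  proof (rule trig_poly_orthogonal_imp_zero[OF _ _ that])
    show "continuous_on {0..2*pi} (\<lambda>x. d x - m)" by (intro continuous_intros cd)
    fix \<psi> assume \<psi>: "trig_poly \<psi>"
    have c\<psi>: "continuous_on S \<psi>" for S by (rule trig_poly_continuous[OF \<psi>])
    \<comment> \<open>\<open>\<psi>\<close> minus its mean is the derivative of a periodic test function\<close>
    define k where "k = integral {0..2*pi} \<psi> / (2 * pi)"
    have \<psi>i: "\<psi> integrable_on {0..2*pi}" by (rule integrable_continuous_interval[OF c\<psi>])
    obtain \<phi> where \<phi>0: "\<phi> 0 = 0" and \<phi>: "\<And>x. (\<phi> has_real_derivative (\<psi> x - k)) (at x)"
    proof -
      have "continuous_on UNIV (\<lambda>x. \<psi> x - k)" by (intro continuous_intros c\<psi>)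
      then show ?thesis
        using ex_primitive_continuous_real that by metis
    qed
    have tp: "trig_poly (\<lambda>x. \<psi> x - k)"
      using trig_poly_add[OF \<psi> trig_poly_const[of "-k"]] by simp
    have "((\<lambda>x. \<psi> x - k) has_integral (\<phi> (2*pi) - \<phi> 0)) {0..2*pi}"
      using \<phi> by (intro fundamental_theorem_of_calculus)
        (auto simp: has_real_derivative_iff_has_vector_derivative[symmetric] intro: DERIV_subset)
    moreover have "((\<lambda>x. \<psi> x - k) has_integral (integral {0..2*pi} \<psi> - 2 * pi * k)) {0..2*pi}"
      using has_integral_diff[OF integrable_integral[OF \<psi>i] has_integral_const_real[of k 0 "2*pi"]] by simp
    ultimately have "\<phi> (2*pi) - \<phi> 0 = integral {0..2*pi} \<psi> - 2 * pi * k"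
      by (rule has_integral_unique)
    moreover have "2 * pi * k = integral {0..2*pi} \<psi>" by (simp add: k_def)
    ultimately have \<phi>2: "\<phi> (2 * pi) = \<phi> 0" by simp
    have "periodic_2pi \<phi>"
      unfolding periodic_2pi_def
    proof
      fix x
      have "((\<lambda>x. \<phi> (x + 2*pi) - \<phi> x) has_real_derivative 0) (at y)" for y
      proof -
        have "((\<lambda>x. \<phi> (x + 2*pi)) has_real_derivative (\<psi> (y + 2*pi) - k)) (at y)"
          using \<phi>[of "y + 2*pi"] by (simp add: DERIV_shift)
        from DERIV_diff[OF this \<phi>[of y]] show ?thesis
          using periodic_2piD[OF trig_poly_periodic[OF \<psi>], of y] by simp
      qed
      then have "\<phi> (x + 2*pi) - \<phi> x = \<phi> (0 + 2*pi) - \<phi> 0"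
        using DERIV_isconst_all[of "\<lambda>x. \<phi> (x + 2*pi) - \<phi> x" x 0] by blast
      then show "\<phi> (x + 2 * pi) = \<phi> x" using \<phi>2 by simp
    qed
    from test_function_trig_primitive[OF this tp \<phi>] orth1[of \<phi>]
    have o: "integral {0..2*pi} (\<lambda>x. d x * (\<psi> x - k)) = 0" by simp
    have dpi: "(\<lambda>x. d x * \<psi> x) integrable_on {0..2*pi}"
      by (intro integrable_continuous_interval continuous_intros cd c\<psi>)
    have "integral {0..2*pi} (\<lambda>x. d x * \<psi> x) = k * integral {0..2*pi} d"
    proof -
      have "integral {0..2*pi} (\<lambda>x. d x * \<psi> x - k * d x) = 0" using o by (simp add: algebra_simps)
      then show ?thesis
        using dpi di by (subst (asm) Henstock_Kurzweil_Integration.integral_diff) (auto intro: integrable_on_mult_right)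
    qed
    moreover have "integral {0..2*pi} (\<lambda>x. (d x - m) * \<psi> x) = integral {0..2*pi} (\<lambda>x. d x * \<psi> x) - m * integral {0..2*pi} \<psi>"
      using dpi \<psi>i unfolding left_diff_distrib
      by (subst Henstock_Kurzweil_Integration.integral_diff) (auto intro: integrable_on_mult_right)
    ultimately show "integral {0..2*pi} (\<lambda>x. (d x - m) * \<psi> x) = 0"
      by (simp add: k_def m_def)
  qed
  then have dm: "d x = m" if "x \<in> {0..2*pi}" for x
    using that by (metis eq_iff_diff_eq_0)
  moreover have "d 0 = 0" by (simp add: d_def v_def)
  moreover have "m = d 0" using dm[of 0] by simp
  ultimately have "u x - v x = 0" if "x \<in> {0..2*pi}" for x
    using that by (metis d_def)
  then have "u x = u 0 + integral {0..x} g" if "x \<in> {0..2*pi}" for x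
    using that unfolding v_def by (metis eq_iff_diff_eq_0)
  then show ?thesis using g unfolding primitive_on_def by blast
qed

text \<open>This connects the weak derivative, which is an arbitrary choice, with a concrete derivative \<open>g\<close>:
  they agree off a null set.\<close>

lemma weak_deriv_of_primitive:
  assumes per: "periodic_2pi u" and u: "primitive_on (2*pi) u g"
  shows "has_weak_deriv u (weak_deriv u)" "negligible {x \<in> {0..2*pi}. weak_deriv u x \<noteq> g x}"
    "primitive_on (2*pi) u (weak_deriv u)" "continuous_on UNIV u"
proof -
  have "negligible {x \<in> {0..2*pi}. periodize g x \<noteq> g x}"
    by (rule negligible_subset[of "{2*pi}"]) (use periodize_eq[of _ g] in force)+
  then have g': "primitive_on (2*pi) u (periodize g)"
    using u primitive_on_cong_AE by blast
  note w = primitive_imp_has_weak_deriv[OF per periodize_periodic g']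
  show wd: "has_weak_deriv u (weak_deriv u)"
    unfolding weak_deriv_def by (rule someI[of "has_weak_deriv u", OF w(1)])
  show c: "continuous_on UNIV u" by (rule w(2))
  show "primitive_on (2*pi) u (weak_deriv u)"
    by (rule has_weak_deriv_imp_primitive[OF c wd])
  then show "negligible {x \<in> {0..2*pi}. weak_deriv u x \<noteq> g x}"
    by (rule primitive_on_unique_AE[OF _ u])
qed

section \<open>Sobolev norms of periodic Lipschitz functions\<close>

text \<open>The function \<open>g\<close> is a derivative of \<open>u\<close> that is bounded everywhere on \<open>[0, 2\<pi>]\<close>, and not just almost
  everywhere.\<close>

definition lipschitz_periodic :: "(real \<Rightarrow> real) \<Rightarrow> (real \<Rightarrow> real) \<Rightarrow> bool" where
  "lipschitz_periodic u g \<longleftrightarrow> periodic_2pi u \<and> primitive_on (2*pi) u g \<and> bounded_measurable (2*pi) g"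

lemma lipschitz_periodicD:
  assumes "lipschitz_periodic u g"
  shows "periodic_2pi u" "primitive_on (2*pi) u g" "bounded_measurable (2*pi) g"
    "has_weak_deriv u (weak_deriv u)" "negligible {x \<in> {0..2*pi}. weak_deriv u x \<noteq> g x}"
    "primitive_on (2*pi) u (weak_deriv u)" "continuous_on UNIV u"
  using assms weak_deriv_of_primitive by (auto simp: lipschitz_periodic_def)

lemma lipschitz_periodic_diff:
  "lipschitz_periodic u g \<Longrightarrow> lipschitz_periodic v h \<Longrightarrow> lipschitz_periodic (\<lambda>x. u x - v x) (\<lambda>x. g x - h x)"
  by (simp add: lipschitz_periodic_def periodic_2pi_diff primitive_on_diff bounded_measurable_diff)

lemma Linf_norm_le:
  assumes "f \<in> borel_measurable torus" "AE x in torus. \<bar>f x\<bar> \<le> C" "0 \<le> C"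
  shows "Linf_norm f \<le> C"
proof -
  have "esssup torus (\<lambda>x. ereal \<bar>f x\<bar>) \<le> ereal C"
    using assms by (intro esssup_I) auto
  then show ?thesis
    using assms(3) unfolding Linf_norm_def by (cases "esssup torus (\<lambda>x. ereal \<bar>f x\<bar>)") auto
qed

lemma AE_le_Linf_norm:
  assumes "f \<in> borel_measurable torus" "AE x in torus. \<bar>f x\<bar> \<le> C"
  shows "AE x in torus. \<bar>f x\<bar> \<le> Linf_norm f"
proof -
  define e where "e = esssup torus (\<lambda>x. ereal \<bar>f x\<bar>)"
  have "e \<le> ereal C"
    unfolding e_def using assms by (intro esssup_I) auto
  then have "e \<noteq> \<infinity>" by auto
  have "AE x in torus. ereal \<bar>f x\<bar> \<le> e" unfolding e_def by (rule esssup_AE)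
  then show ?thesis
  proof eventually_elim
    case (elim x)
    then show ?case
      using \<open>e \<noteq> \<infinity>\<close> unfolding Linf_norm_def e_def[symmetric] by (cases e) auto
  qed
qed

lemma L2_norm_eq:
  assumes "periodic_2pi f" "(\<lambda>x. (f x)\<^sup>2) absolutely_integrable_on {0..2*pi}"
  shows "L2_norm f = sqrt (integral {0..2*pi} (\<lambda>x. (f x)\<^sup>2))"
  using assms by (simp add: L2_norm_def LINT_torus_eq periodic_2pi_power)

text \<open>An open set that is not empty has positive measure.\<close>

lemma continuous_le_of_AE:
  fixes f :: "real \<Rightarrow> real"
  assumes f: "continuous_on {a..b} f" and "a < b" and N: "negligible {x \<in> {a..b}. \<not> f x \<le> C}"
    and x: "x \<in> {a..b}"
  shows "f x \<le> C"
proof -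
  have "f y \<le> C" if y: "y \<in> {a<..<b}" for y
  proof (rule ccontr)
    assume "\<not> f y \<le> C"
    have "open ({a<..<b} \<inter> f -` {C<..})"
      by (rule continuous_open_preimage[OF continuous_on_subset[OF f]]) auto
    moreover have "{a<..<b} \<inter> f -` {C<..} \<noteq> {}" using y \<open>\<not> f y \<le> C\<close> by force
    ultimately have "\<not> negligible ({a<..<b} \<inter> f -` {C<..})" by (rule open_not_negligible)
    moreover have "{a<..<b} \<inter> f -` {C<..} \<subseteq> {x \<in> {a..b}. \<not> f x \<le> C}" by auto
    ultimately show False using N negligible_subset by blast
  qed
  then show ?thesis
    using continuous_le_on_closure[of "{a<..<b}" f x C] f x \<open>a < b\<close> by simp
qed

lemma lipschitz_periodic_weak_deriv:
  assumes u: "lipschitz_periodic u g"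
  shows "weak_deriv u \<in> borel_measurable torus" "periodic_2pi (weak_deriv u)"
    "weak_deriv u \<in> borel_measurable (lebesgue_on {0..2*pi})"
    "(\<And>x. x \<in> {0..2*pi} \<Longrightarrow> \<bar>g x\<bar> \<le> B) \<Longrightarrow> AE x in torus. \<bar>weak_deriv u x\<bar> \<le> B"
proof -
  note w = lipschitz_periodicD[OF u]
  show 1: "weak_deriv u \<in> borel_measurable torus" and 2: "periodic_2pi (weak_deriv u)"
    using w(4) by (auto simp: has_weak_deriv_def intro: borel_measurable_integrable)
  show "weak_deriv u \<in> borel_measurable (lebesgue_on {0..2*pi})"
    using 1 2 by (simp add: borel_measurable_torus_iff)
  assume B: "\<And>x. x \<in> {0..2*pi} \<Longrightarrow> \<bar>g x\<bar> \<le> B"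
  show "AE x in torus. \<bar>weak_deriv u x\<bar> \<le> B"
  proof (subst AE_torus_iff)
    show "negligible {x \<in> {0..2*pi}. \<not> \<bar>weak_deriv u x\<bar> \<le> B}"
      by (rule negligible_subset[OF w(5)]) (use B in fastforce)
  qed (simp add: periodic_2piD[OF 2])
qed

lemma lipschitz_periodic_abs_bounds:
  assumes u: "lipschitz_periodic u g"
  shows "\<exists>A B. \<forall>x\<in>{0..2*pi}. \<bar>u x\<bar> \<le> A \<and> \<bar>g x\<bar> \<le> B"
proof -
  note w = lipschitz_periodicD[OF u]
  obtain A where A: "\<forall>x\<in>{0..2*pi}. \<bar>u x\<bar> \<le> A"
    using continuous_on_bounded_abs[of 0 "2*pi" u] continuous_on_subset[OF w(7)] by blast
  obtain B where B: "\<forall>x\<in>{0..2*pi}. \<bar>g x\<bar> \<le> B" using w(3) by (auto simp: bounded_measurable_def)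
  show ?thesis using A B by blast
qed

lemma AE_torus_abs_le:
  assumes "periodic_2pi u" "\<And>x. x \<in> {0..2*pi} \<Longrightarrow> \<bar>u x\<bar> \<le> A"
  shows "AE x in torus. \<bar>u x\<bar> \<le> A"
proof (subst AE_torus_iff)
  have "{x \<in> {0..2 * pi}. \<not> \<bar>u x\<bar> \<le> A} = {}" using assms(2) by auto
  then show "negligible {x \<in> {0..2 * pi}. \<not> \<bar>u x\<bar> \<le> A}" by (metis negligible_empty)
qed (simp add: periodic_2piD[OF assms(1)])

lemma lipschitz_periodic_measurable:
  assumes u: "lipschitz_periodic u g"
  shows "u \<in> borel_measurable torus"
  using lipschitz_periodicD(7)[OF u]
  by (intro continuous_imp_measurable_on_sets_lebesgue) (auto intro: continuous_on_subset)

lemma W1inf_norm_le: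
  assumes u: "lipschitz_periodic u g"
    and A: "\<And>x. x \<in> {0..2*pi} \<Longrightarrow> \<bar>u x\<bar> \<le> A" and B: "\<And>x. x \<in> {0..2*pi} \<Longrightarrow> \<bar>g x\<bar> \<le> B"
  shows "W1inf_norm u \<le> A + B"
proof -
  have "0 \<le> A" "0 \<le> B" using A[of 0] B[of 0] by auto
  have "Linf_norm u \<le> A"
    by (rule Linf_norm_le[OF lipschitz_periodic_measurable[OF u]
          AE_torus_abs_le[OF lipschitz_periodicD(1)[OF u] A] \<open>0 \<le> A\<close>])
  moreover have "Linf_norm (weak_deriv u) \<le> B"
    by (rule Linf_norm_le[OF lipschitz_periodic_weak_deriv(1)[OF u] lipschitz_periodic_weak_deriv(4)[OF u B] \<open>0 \<le> B\<close>])
  ultimately show ?thesis unfolding W1inf_norm_def by simp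
qed

lemma lipschitz_periodic_spaces:
  assumes u: "lipschitz_periodic u g"
  shows "u \<in> H1_per" "u \<in> W1inf_per" "u \<in> L2_per" "(\<lambda>x. (weak_deriv u x)\<^sup>2) absolutely_integrable_on {0..2*pi}"
proof -
  note w = lipschitz_periodicD[OF u] and d = lipschitz_periodic_weak_deriv[OF u]
  note m = lipschitz_periodic_measurable[OF u]
  obtain A B where AB: "\<And>x. x \<in> {0..2*pi} \<Longrightarrow> \<bar>u x\<bar> \<le> A" "\<And>x. x \<in> {0..2*pi} \<Longrightarrow> \<bar>g x\<bar> \<le> B"
    using lipschitz_periodic_abs_bounds[OF u] by metis
  have "(\<lambda>x. (u x)\<^sup>2) absolutely_integrable_on {0..2*pi}"
    by (intro absolutely_integrable_continuous_real continuous_intros continuous_on_subset[OF w(7)]) auto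
  then show L: "u \<in> L2_per"
    using w m by (simp add: L2_per_def integrable_torus_iff periodic_2pi_power)
  have "(\<lambda>x. (g x)\<^sup>2) absolutely_integrable_on {0..2*pi}"
    by (intro bounded_measurable_integrable bounded_measurable_power2 w)
  then show wi: "(\<lambda>x. (weak_deriv u x)\<^sup>2) absolutely_integrable_on {0..2*pi}"
    by (rule absolutely_integrable_spike[OF _ w(5)]) auto
  then have "weak_deriv u \<in> L2_per"
    using d by (simp add: L2_per_def integrable_torus_iff periodic_2pi_power)
  then show "u \<in> H1_per" using w L by (auto simp: H1_per_def)
  have "u \<in> Linf_per"
    using AE_torus_abs_le[OF w(1) AB(1)] w m by (auto simp: Linf_per_def)
  moreover have "weak_deriv u \<in> Linf_per"
    using d(1,2) d(4)[OF AB(2)] by (auto simp: Linf_per_def)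
  ultimately show "u \<in> W1inf_per" using w by (auto simp: W1inf_per_def)
qed

lemma L2_norm_weak_deriv:
  assumes u: "lipschitz_periodic u g"
  shows "L2_norm (weak_deriv u) = sqrt (integral {0..2*pi} (\<lambda>x. (g x)\<^sup>2))"
proof -
  have "integral {0..2*pi} (\<lambda>x. (weak_deriv u x)\<^sup>2) = integral {0..2*pi} (\<lambda>x. (g x)\<^sup>2)"
    by (rule integral_spike[OF lipschitz_periodicD(5)[OF u]]) auto
  then show ?thesis
    using lipschitz_periodic_spaces[OF u] lipschitz_periodic_weak_deriv[OF u] by (simp add: L2_norm_eq)
qed

lemma H1_norm_eq:
  assumes u: "lipschitz_periodic u g"
  shows "H1_norm u = sqrt (integral {0..2*pi} (\<lambda>x. (u x)\<^sup>2) + integral {0..2*pi} (\<lambda>x. (g x)\<^sup>2))"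
proof -
  note w = lipschitz_periodicD[OF u]
  have i: "(\<lambda>x. (u x)\<^sup>2) absolutely_integrable_on {0..2*pi}"
    by (intro absolutely_integrable_continuous_real continuous_intros continuous_on_subset[OF w(7)]) auto
  have "(\<lambda>x. (g x)\<^sup>2) absolutely_integrable_on {0..2*pi}"
    by (intro bounded_measurable_integrable bounded_measurable_power2 w)
  then have "0 \<le> integral {0..2*pi} (\<lambda>x. (g x)\<^sup>2)" "0 \<le> integral {0..2*pi} (\<lambda>x. (u x)\<^sup>2)"
    using i by (auto intro!: Henstock_Kurzweil_Integration.integral_nonneg simp: absolutely_integrable_on_def)
  then show ?thesis
    unfolding H1_norm_def L2_norm_weak_deriv[OF u] L2_norm_eq[OF w(1) i] by simp
qed

lemma H1_norm_le:
  assumes u: "lipschitz_periodic u g"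
    and A: "\<And>x. x \<in> {0..2*pi} \<Longrightarrow> \<bar>u x\<bar> \<le> A" and B: "\<And>x. x \<in> {0..2*pi} \<Longrightarrow> \<bar>g x\<bar> \<le> A"
  shows "H1_norm u \<le> 4 * A"
proof -
  have A0: "0 \<le> A" using A[of 0] by auto
  note w = lipschitz_periodicD[OF u]
  have le: "integral {0..2*pi} (\<lambda>x. (f x)\<^sup>2) \<le> 2 * pi * A\<^sup>2"
    if f: "bounded_measurable (2*pi) f" "\<And>x. x \<in> {0..2*pi} \<Longrightarrow> \<bar>f x\<bar> \<le> A" for f
  proof -
    have "(\<lambda>x. (f x)\<^sup>2) integrable_on {0..2*pi}"
      using bounded_measurable_integrable[OF bounded_measurable_power2[OF f(1)]] by (simp add: absolutely_integrable_on_def)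
    then have "integral {0..2*pi} (\<lambda>x. (f x)\<^sup>2) \<le> integral {0..2*pi} (\<lambda>x. A\<^sup>2)"
      using f(2) by (intro integral_le) (auto simp: abs_le_square_iff[symmetric] A0)
    then show ?thesis by simp
  qed
  have "integral {0..2*pi} (\<lambda>x. (u x)\<^sup>2) + integral {0..2*pi} (\<lambda>x. (g x)\<^sup>2) \<le> 4 * pi * A\<^sup>2"
    using le[of u] le[of g] w A B bounded_measurable_continuous[OF continuous_on_subset[OF w(7)]] by force
  also have "\<dots> \<le> 16 * A\<^sup>2" using pi_less_4 by (intro mult_right_mono) auto
  also have "\<dots> = (4 * A)\<^sup>2" by (simp add: power_mult_distrib)
  finally show ?thesis
    unfolding H1_norm_eq[OF u] using A0 by (intro real_le_lsqrt) auto
qed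

text \<open>The essential bounds become pointwise ones where the functions are continuous. For the slope this
  is what turns \<open>W1inf_norm\<close> into control of the values at the peak, which is a null set.\<close>

lemma abs_le_W1inf_norm:
  assumes u: "lipschitz_periodic u g" and x: "x \<in> {0..2*pi}"
  shows "\<bar>u x\<bar> \<le> Linf_norm u" "\<bar>u x\<bar> \<le> W1inf_norm u"
    "continuous_on {0..2*pi} g \<Longrightarrow> \<bar>g x\<bar> \<le> Linf_norm (weak_deriv u)"
    "continuous_on {0..2*pi} g \<Longrightarrow> \<bar>g x\<bar> \<le> W1inf_norm u"
    "negligible {x \<in> {0..2*pi}. \<not> \<bar>weak_deriv u x\<bar> \<le> Linf_norm (weak_deriv u)}"
    "0 \<le> Linf_norm (weak_deriv u)"
proof -
  note w = lipschitz_periodicD[OF u] and d = lipschitz_periodic_weak_deriv[OF u]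
  note m = lipschitz_periodic_measurable[OF u]
  obtain A B where AB: "\<And>x. x \<in> {0..2*pi} \<Longrightarrow> \<bar>u x\<bar> \<le> A" "\<And>x. x \<in> {0..2*pi} \<Longrightarrow> \<bar>g x\<bar> \<le> B"
    using lipschitz_periodic_abs_bounds[OF u] by metis
  have "AE x in torus. \<bar>u x\<bar> \<le> Linf_norm u"
    using m AE_torus_abs_le[OF w(1) AB(1)] by (rule AE_le_Linf_norm)
  then have "negligible {x \<in> {0..2*pi}. \<not> \<bar>u x\<bar> \<le> Linf_norm u}"
    by (subst (asm) AE_torus_iff) (simp add: periodic_2piD[OF w(1)])
  then show 1: "\<bar>u x\<bar> \<le> Linf_norm u"
    using x by (intro continuous_le_of_AE[of 0 "2*pi" "\<lambda>x. \<bar>u x\<bar>"]) (auto intro!: continuous_intros continuous_on_subset[OF w(7)])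
  have "AE x in torus. \<bar>weak_deriv u x\<bar> \<le> Linf_norm (weak_deriv u)"
    using d(1) d(4)[OF AB(2)] by (rule AE_le_Linf_norm)
  then show N: "negligible {x \<in> {0..2*pi}. \<not> \<bar>weak_deriv u x\<bar> \<le> Linf_norm (weak_deriv u)}"
    by (subst (asm) AE_torus_iff) (simp add: periodic_2piD[OF d(2)])
  show 2: "0 \<le> Linf_norm (weak_deriv u)"
  proof (rule ccontr)
    assume "\<not> 0 \<le> Linf_norm (weak_deriv u)"
    then have "\<not> \<bar>weak_deriv u x\<bar> \<le> Linf_norm (weak_deriv u)" for x using abs_ge_zero[of "weak_deriv u x"] by linarith
    then have "{x \<in> {0..2*pi}. \<not> \<bar>weak_deriv u x\<bar> \<le> Linf_norm (weak_deriv u)} = {0..2*pi}" by auto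
    then have "negligible {0..2*pi}" using N by metis
    then have "negligible {0<..<2*pi}" by (rule negligible_subset) auto
    moreover have "pi \<in> {0<..<2*pi}" by simp
    then have "\<not> negligible {0<..<2*pi}" by (intro open_not_negligible[OF open_greaterThanLessThan]) blast
    ultimately show False by blast
  qed
  show 3: "\<bar>g x\<bar> \<le> Linf_norm (weak_deriv u)" if g: "continuous_on {0..2*pi} g"
  proof (rule continuous_le_of_AE[of 0 "2*pi" "\<lambda>x. \<bar>g x\<bar>"])
    show "negligible {x \<in> {0..2*pi}. \<not> \<bar>g x\<bar> \<le> Linf_norm (weak_deriv u)}"
      by (rule negligible_subset[OF negligible_Un[OF N w(5)]]) auto
  qed (use g x in \<open>auto intro: continuous_intros\<close>)
  show "\<bar>u x\<bar> \<le> W1inf_norm u" using 1 2 by (simp add: W1inf_norm_def)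
  show "continuous_on {0..2*pi} g \<Longrightarrow> \<bar>g x\<bar> \<le> W1inf_norm u"
    using 1 3 by (simp add: W1inf_norm_def)
qed

text \<open>Clamping the weak derivative at its essential bound changes it on a null set only, and makes it bounded everywhere.\<close>

lemma W1inf_perE:
  assumes "u \<in> W1inf_per"
  obtains g where "lipschitz_periodic u g" "\<And>x. \<bar>g x\<bar> \<le> Linf_norm (weak_deriv u)"
proof -
  obtain g0 where c: "continuous_on UNIV u" and g0: "g0 \<in> Linf_per" "has_weak_deriv u g0"
    using assms by (auto simp: W1inf_per_def)
  have per: "periodic_2pi u" "periodic_2pi g0" using g0 by (auto simp: has_weak_deriv_def)
  have p0: "primitive_on (2*pi) u g0" by (rule has_weak_deriv_imp_primitive[OF c g0(2)])
  obtain C where "AE x in torus. \<bar>g0 x\<bar> \<le> C" using g0 by (auto simp: Linf_per_def)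
  then have N0: "negligible {x \<in> {0..2*pi}. \<not> \<bar>g0 x\<bar> \<le> C}"
    by (subst (asm) AE_torus_iff) (simp add: periodic_2piD[OF per(2)])
  have clamp: "lipschitz_periodic u (\<lambda>x. max (-D) (min D (h x)))"
    if h: "primitive_on (2*pi) u h" and D: "negligible {x \<in> {0..2*pi}. \<not> \<bar>h x\<bar> \<le> D}" for h D
    unfolding lipschitz_periodic_def
  proof (intro conjI per(1))
    have "h \<in> borel_measurable (lebesgue_on {0..2*pi})"
      using primitive_on_abs_integrable[OF h] by (rule absolutely_integrable_imp_borel_measurable) auto
    then show "bounded_measurable (2*pi) (\<lambda>x. max (-D) (min D (h x)))"
      unfolding bounded_measurable_def by (intro conjI borel_measurable_max borel_measurable_min exI[of _ "\<bar>D\<bar>"]) auto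
    have "negligible {x \<in> {0..2*pi}. max (-D) (min D (h x)) \<noteq> h x}"
      by (rule negligible_subset[OF D]) (auto simp: max_def min_def abs_if split: if_splits)
    then show "primitive_on (2*pi) u (\<lambda>x. max (-D) (min D (h x)))" by (rule primitive_on_cong_AE[OF h])
  qed
  note l = clamp[OF p0 N0]
  note b = abs_le_W1inf_norm[OF l, of 0]
  show ?thesis
  proof (rule that)
    show "lipschitz_periodic u (\<lambda>x. max (- Linf_norm (weak_deriv u)) (min (Linf_norm (weak_deriv u)) (weak_deriv u x)))"
      using lipschitz_periodicD(6)[OF l] b by (intro clamp) auto
    show "\<bar>max (- Linf_norm (weak_deriv u)) (min (Linf_norm (weak_deriv u)) (weak_deriv u x))\<bar> \<le> Linf_norm (weak_deriv u)" for x
      using b(6) by auto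
  qed
qed

lemma W1inf_norm_triangle:
  assumes "u \<in> W1inf_per" "v \<in> W1inf_per"
  shows "W1inf_norm u \<le> W1inf_norm (\<lambda>x. u x - v x) + W1inf_norm v"
proof -
  obtain gu where u: "lipschitz_periodic u gu" using W1inf_perE[OF assms(1)] by blast
  obtain gv where v: "lipschitz_periodic v gv" "\<And>x. \<bar>gv x\<bar> \<le> Linf_norm (weak_deriv v)"
    using W1inf_perE[OF assms(2)] by blast
  define w where "w = (\<lambda>x. u x - v x)"
  have "lipschitz_periodic w (\<lambda>x. gu x - gv x)" unfolding w_def by (rule lipschitz_periodic_diff[OF u v(1)])
  then obtain gw where w: "lipschitz_periodic w gw" "\<And>x. \<bar>gw x\<bar> \<le> Linf_norm (weak_deriv w)"
    using W1inf_perE[OF lipschitz_periodic_spaces(2)] by blast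
  have "lipschitz_periodic (\<lambda>x. w x + v x) (\<lambda>x. gw x + gv x)"
    using w(1) v(1) by (simp add: lipschitz_periodic_def periodic_2pi_add primitive_on_add bounded_measurable_add)
  then have "lipschitz_periodic u (\<lambda>x. gw x + gv x)" by (simp add: w_def)
  then have "W1inf_norm u \<le> (Linf_norm w + Linf_norm v) + (Linf_norm (weak_deriv w) + Linf_norm (weak_deriv v))"
  proof (rule W1inf_norm_le)
    fix x assume x: "x \<in> {0..2*pi}"
    show "\<bar>u x\<bar> \<le> Linf_norm w + Linf_norm v"
      using abs_le_W1inf_norm(1)[OF w(1) x] abs_le_W1inf_norm(1)[OF v(1) x] by (simp add: w_def)
    show "\<bar>gw x + gv x\<bar> \<le> Linf_norm (weak_deriv w) + Linf_norm (weak_deriv v)"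
      using w(2)[of x] v(2)[of x] by linarith
  qed
  then show ?thesis by (simp add: W1inf_norm_def w_def)
qed

text \<open>The weak derivative of \<open>- w\<close> is not literally the negative of the weak derivative of \<open>w\<close>, since both
  are arbitrary choices.\<close>

lemma W1inf_norm_minus_commute:
  assumes "u \<in> W1inf_per" "v \<in> W1inf_per"
  shows "W1inf_norm (\<lambda>x. u x - v x) = W1inf_norm (\<lambda>x. v x - u x)"
proof -
  have le: "W1inf_norm (\<lambda>x. v x - u x) \<le> W1inf_norm (\<lambda>x. u x - v x)"
    if uv: "u \<in> W1inf_per" "v \<in> W1inf_per" for u v
  proof -
    obtain gu where u: "lipschitz_periodic u gu" using W1inf_perE[OF uv(1)] by blast
    obtain gv where v: "lipschitz_periodic v gv" using W1inf_perE[OF uv(2)] by blast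
    define w where "w = (\<lambda>x. u x - v x)"
    have "lipschitz_periodic w (\<lambda>x. gu x - gv x)" unfolding w_def by (rule lipschitz_periodic_diff[OF u v])
    then obtain gw where w: "lipschitz_periodic w gw" "\<And>x. \<bar>gw x\<bar> \<le> Linf_norm (weak_deriv w)"
      using W1inf_perE[OF lipschitz_periodic_spaces(2)] by blast
    have "primitive_on (2*pi) (\<lambda>_. 0) (\<lambda>_. 0)" by (rule primitive_on_const)
    then have "lipschitz_periodic (\<lambda>x. 0 - w x) (\<lambda>x. 0 - gw x)"
      using w(1) by (intro lipschitz_periodic_diff) (auto simp: lipschitz_periodic_def periodic_2pi_const)
    then have "W1inf_norm (\<lambda>x. 0 - w x) \<le> Linf_norm w + Linf_norm (weak_deriv w)"
      by (rule W1inf_norm_le) (use w abs_le_W1inf_norm(1)[OF w(1)] in auto)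
    then show ?thesis by (simp add: w_def W1inf_norm_def)
  qed
  show ?thesis using le[OF assms] le[OF assms(2,1)] by simp
qed

lemma periodic_eqI:
  assumes "periodic_2pi f" "periodic_2pi g" "\<And>x. x \<in> {0..<2*pi} \<Longrightarrow> f x = g x"
  shows "f = g"
proof
  fix x
  have "f (x - 2 * pi * of_int \<lfloor>x / (2 * pi)\<rfloor>) = g (x - 2 * pi * of_int \<lfloor>x / (2 * pi)\<rfloor>)"
    by (rule assms(3)[OF reduce_mod_2pi])
  then show "f x = g x" by (simp only: periodic_2pi_reduce[OF assms(1)] periodic_2pi_reduce[OF assms(2)])
qed

lemma inv_deriv0_properties:
  assumes per: "periodic_2pi f" and f: "f absolutely_integrable_on {0..2*pi}"
  shows "periodic_2pi (inv_deriv0 f)" "continuous_on UNIV (inv_deriv0 f)"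
    "integral {0..2*pi} (inv_deriv0 f) = 0"
    "primitive_on (2*pi) (inv_deriv0 f) (\<lambda>x. f x - integral {0..2*pi} f / (2*pi))"
proof -
  define h where "h = (\<lambda>x. f x - integral {0..2*pi} f / (2*pi))"
  have p0: "proj0 f = h" by (rule ext) (simp add: h_def proj0_def LINT_torus_eq[OF per f])
  have hper: "periodic_2pi h" unfolding h_def by (intro periodic_2pi_diff per periodic_2pi_const)
  have hi: "h absolutely_integrable_on {0..2*pi}"
    unfolding h_def using f by (intro set_integral_diff(1)) auto
  have fi: "f integrable_on {0..2*pi}" using f by (simp add: absolutely_integrable_on_def)
  have h0: "integral {0..2*pi} h = 0"
    unfolding h_def using fi by (subst Henstock_Kurzweil_Integration.integral_diff) auto
  define \<Phi> where "\<Phi> = (\<lambda>x. integral {0..x} h)"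
  have \<Phi>: "primitive_on (2*pi) \<Phi> h" unfolding \<Phi>_def by (rule primitive_on_indefinite_integral[OF hi])
  define c where "c = integral {0..2*pi} \<Phi> / (2*pi)"
  define F where "F = periodize (\<lambda>x. \<Phi> x - c)"
  have Feq: "F x = \<Phi> x - c" if "x \<in> {0..2*pi}" for x
    unfolding F_def using that h0 by (intro periodize_eq') (auto simp: \<Phi>_def)
  have F: "primitive_on (2*pi) F h"
    unfolding primitive_on_def
  proof (intro conjI ballI hi)
    show "F x = F 0 + integral {0..x} h" if "x \<in> {0..2*pi}" for x
      using Feq[OF that] Feq[of 0] by (simp add: \<Phi>_def)
  qed
  have Fper: "periodic_2pi F" unfolding F_def by (rule periodize_periodic)
  note wF = primitive_imp_has_weak_deriv[OF Fper hper F]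
  have ci: "g absolutely_integrable_on {0..2*pi}" if "continuous_on UNIV g" for g :: "real \<Rightarrow> real"
    using continuous_on_subset[OF that, of "{0..2*pi}"] by (intro absolutely_integrable_continuous_real) auto
  have \<Phi>i: "\<Phi> integrable_on {0..2*pi}"
    by (rule integrable_continuous_interval[OF primitive_on_continuous[OF \<Phi>]])
  have "integral {0..2*pi} F = integral {0..2*pi} (\<lambda>x. \<Phi> x - c)"
    by (rule integral_cong) (rule Feq)
  also have "\<dots> = 0"
    using \<Phi>i by (subst Henstock_Kurzweil_Integration.integral_diff) (auto simp: c_def)
  finally have F0: "integral {0..2*pi} F = 0" .
  have "inv_deriv0 f = F"
    unfolding inv_deriv0_def p0
  proof (rule the_equality)
    show "continuous_on UNIV F \<and> (LINT x|torus. F x) = 0 \<and> has_weak_deriv F h"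
      using wF F0 by (simp add: LINT_torus_eq[OF Fper] ci)
    fix G assume G: "continuous_on UNIV G \<and> (LINT x|torus. G x) = 0 \<and> has_weak_deriv G h"
    then have Gper: "periodic_2pi G" by (simp add: has_weak_deriv_def)
    have "G absolutely_integrable_on {0..2*pi}" using G by (intro ci) blast
    then have G0: "integral {0..2*pi} G = 0" using G LINT_torus_eq[OF Gper] by simp
    have Gp: "primitive_on (2*pi) G h" using G has_weak_deriv_imp_primitive by blast
    have GF: "G x - F x = G 0 - F 0" if "x \<in> {0..2*pi}" for x
      using primitive_on_eq[OF Gp that] primitive_on_eq[OF F that] by linarith
    have "integral {0..2*pi} (\<lambda>x. G x - F x) = integral {0..2*pi} (\<lambda>x. G 0 - F 0)"
      by (rule integral_cong) (rule GF)
    moreover have "integral {0..2*pi} (\<lambda>x. G x - F x) = 0"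
      using G0 F0 ci G wF(2) by (subst Henstock_Kurzweil_Integration.integral_diff) (auto simp: absolutely_integrable_on_def)
    ultimately have "G 0 = F 0" by simp
    then have "G x = F x" if "x \<in> {0..2*pi}" for x using GF[OF that] by simp
    then show "G = F" by (intro periodic_eqI Gper Fper) auto
  qed
  then show "periodic_2pi (inv_deriv0 f)" "continuous_on UNIV (inv_deriv0 f)"
    "integral {0..2*pi} (inv_deriv0 f) = 0"
    "primitive_on (2*pi) (inv_deriv0 f) (\<lambda>x. f x - integral {0..2*pi} f / (2*pi))"
    using Fper wF(2) F0 F by (simp_all add: h_def)
qed

section \<open>The evolution equation on the fundamental domain\<close>

lemma wrap_periodic: "wrap (x + 2 * pi) = wrap x"
proof -
  have "(x + 2 * pi + pi) / (2 * pi) = (x + pi) / (2 * pi) + 1" by (simp add: field_simps)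
  then show ?thesis by (simp add: wrap_def algebra_simps)
qed

text \<open>Seen from \<open>[0, 2\<pi>]\<close>, the corner of \<open>\<eta>\<^sub>*\<close> at the peak disappears, and the coefficient vanishes exactly
  at the two copies of the peak.\<close>

lemma transport_coefficient:
  assumes "x \<in> {0..2*pi}"
  shows "c_star\<^sup>2 - 2 * eta_star x = x * (2 * pi - x) / 4"
proof -
  have c: "c_star\<^sup>2 = pi\<^sup>2 / 8" by (simp add: c_star_def power_divide power_mult_distrib)
  show ?thesis
  proof (cases "x \<le> pi")
    case True
    then have "eta_star x = (pi\<^sup>2 - 4 * pi * x + 2 * x\<^sup>2) / 16" using assms eta_star_eq[of x] by auto
    then show ?thesis unfolding c by (simp add: field_simps power2_eq_square)
  next
    case False
    have "eta_star x = eta_star (x - 2 * pi)"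
      using wrap_periodic[of "x - 2 * pi"] by (simp add: eta_star_def)
    moreover have "eta_star (x - 2 * pi) = (pi\<^sup>2 - 4 * pi * (2 * pi - x) + 2 * (x - 2 * pi)\<^sup>2) / 16"
      using assms False eta_star_eq[of "x - 2 * pi"] by auto
    ultimately show ?thesis unfolding c by (simp add: field_simps power2_eq_square)
  qed
qed

lemma eta_star_deriv_eq_2pi:
  assumes "x \<in> {0<..<2*pi}"
  shows "eta_star_deriv x = - (pi - x) / 4"
proof (cases "x \<le> pi")
  case True
  then show ?thesis using assms by (subst eta_star_deriv_eq) (auto simp: field_simps)
next
  case False
  have "eta_star_deriv x = eta_star_deriv (x - 2 * pi)"
    using wrap_periodic[of "x - 2 * pi"] by (simp add: eta_star_deriv_def)
  then show ?thesis using assms False by (simp add: eta_star_deriv_eq)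
qed

text \<open>The right-hand side in terms of any bounded derivative \<open>g\<close> of \<open>u\<close>. The nonlocal term is described by
  its derivative and its mean, which determine it.\<close>

lemma evolution_rhs_eq:
  assumes u: "lipschitz_periodic u g"
  defines "N \<equiv> inv_deriv0 (\<lambda>y. u y + 2 * (weak_deriv u y)\<^sup>2)"
  shows "periodic_2pi (evolution_rhs u)"
    "primitive_on (2*pi) N (\<lambda>x. u x + 2 * (g x)\<^sup>2 - integral {0..2*pi} (\<lambda>x. u x + 2 * (g x)\<^sup>2) / (2*pi))"
    "integral {0..2*pi} N = 0" "continuous_on UNIV N"
    "x \<in> {0..2*pi} \<Longrightarrow> weak_deriv u x = g x \<Longrightarrow>
      evolution_rhs u x = (x * (2 * pi - x) / 4 - 2 * (u x - u 0)) * g x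
        + 1 / (4 * pi) * integral {0..2*pi} (\<lambda>y. (pi - y) * u y) + N x / 2"
proof -
  note w = lipschitz_periodicD[OF u] and d = lipschitz_periodic_weak_deriv[OF u]
  have cu: "continuous_on {0..2*pi} u" using w(7) by (rule continuous_on_subset) simp
  define f where "f = (\<lambda>y. u y + 2 * (weak_deriv u y)\<^sup>2)"
  define f' where "f' = (\<lambda>y. u y + 2 * (g y)\<^sup>2)"
  have fper: "periodic_2pi f"
    unfolding f_def by (intro periodic_2pi_add periodic_2pi_mult periodic_2pi_power periodic_2pi_const w d)
  have f'i: "f' absolutely_integrable_on {0..2*pi}"
    unfolding f'_def
    by (intro bounded_measurable_integrable bounded_measurable_add bounded_measurable_cmult bounded_measurable_power2
        bounded_measurable_continuous cu w)
  have fi: "f absolutely_integrable_on {0..2*pi}"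
    by (rule absolutely_integrable_spike[OF f'i w(5)]) (auto simp: f_def f'_def)
  have If: "integral {0..2*pi} f = integral {0..2*pi} f'"
    by (rule integral_spike[OF w(5)]) (auto simp: f_def f'_def)
  note n = inv_deriv0_properties[OF fper fi]
  have N: "N = inv_deriv0 f" by (simp add: N_def f_def)
  show "integral {0..2*pi} N = 0" "continuous_on UNIV N" unfolding N by (rule n)+
  have "primitive_on (2*pi) N (\<lambda>x. f' x - integral {0..2*pi} f' / (2*pi))"
    unfolding N using n(4) unfolding If
    by (rule primitive_on_cong_AE) (rule negligible_subset[OF w(5)], auto simp: f_def f'_def)
  then show "primitive_on (2*pi) N (\<lambda>x. u x + 2 * (g x)\<^sup>2 - integral {0..2*pi} (\<lambda>x. u x + 2 * (g x)\<^sup>2) / (2*pi))"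
    by (simp add: f'_def)
  have eper: "periodic_2pi eta_star" "periodic_2pi eta_star_deriv"
    by (simp_all add: periodic_2pi_def eta_star_def eta_star_deriv_def wrap_periodic)
  have rhs: "evolution_rhs u = (\<lambda>x. (c_star\<^sup>2 - 2 * eta_star x) * weak_deriv u x - 2 * (u x - u 0) * weak_deriv u x
     - 1 / pi * (LINT y|torus. eta_star_deriv y * u y) + 1 / 2 * N x)"
    by (rule ext) (simp add: evolution_rhs_def N_def)
  show "periodic_2pi (evolution_rhs u)"
    unfolding rhs by (intro periodic_2pi_add periodic_2pi_diff periodic_2pi_mult periodic_2pi_const eper w d n(1)[folded N])
  have neg: "negligible {0, 2 * pi}" by (intro negligible_finite) simp
  have ci: "(\<lambda>y. - (pi - y) / 4 * u y) absolutely_integrable_on {0..2*pi}"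
    by (intro absolutely_integrable_continuous_real continuous_intros cu) auto
  have eq: "eta_star_deriv y * u y = - (pi - y) / 4 * u y" if "y \<in> {0..2*pi} - {0, 2*pi}" for y
    using that by (subst eta_star_deriv_eq_2pi) auto
  have ei: "(\<lambda>y. eta_star_deriv y * u y) absolutely_integrable_on {0..2*pi}"
    by (rule absolutely_integrable_spike[OF ci neg eq])
  have "(LINT y|torus. eta_star_deriv y * u y) = integral {0..2*pi} (\<lambda>y. eta_star_deriv y * u y)"
    by (rule LINT_torus_eq[OF periodic_2pi_mult[OF eper(2) w(1)] ei])
  also have "\<dots> = integral {0..2*pi} (\<lambda>y. - (pi - y) / 4 * u y)"
    by (rule integral_spike[OF neg eq[symmetric]])
  also have "\<dots> = - (1 / 4) * integral {0..2*pi} (\<lambda>y. (pi - y) * u y)"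
  proof -
    have "(\<lambda>y. - (pi - y) / 4 * u y) = (\<lambda>y. (- (1 / 4)) * ((pi - y) * u y))"
      by (rule ext) (simp add: field_simps)
    then show ?thesis by (simp only: integral_mult_right)
  qed
  finally have L: "(LINT y|torus. eta_star_deriv y * u y) = - (1 / 4) * integral {0..2*pi} (\<lambda>y. (pi - y) * u y)" .
  assume x: "x \<in> {0..2*pi}" "weak_deriv u x = g x"
  show "evolution_rhs u x = (x * (2 * pi - x) / 4 - 2 * (u x - u 0)) * g x
        + 1 / (4 * pi) * integral {0..2*pi} (\<lambda>y. (pi - y) * u y) + N x / 2"
    unfolding rhs L x(2) transport_coefficient[OF x(1)] by (simp add: algebra_simps)
qed

lemma integral_pi_minus: "integral {0..2*pi} (\<lambda>y. pi - y) = 0"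
proof -
  have "primitive_on (2*pi) (\<lambda>y. pi * y - y\<^sup>2 / 2) (\<lambda>y. pi - y)"
    by (intro primitive_on_has_derivative continuous_intros) (auto intro!: derivative_eq_intros)
  from primitive_on_eq[OF this, of "2*pi"] show ?thesis by (simp add: power2_eq_square)
qed

lemma primitive_on_cong:
  assumes "primitive_on L f g" "\<And>x. x \<in> {0..L} \<Longrightarrow> f x = f' x"
  shows "primitive_on L f' g"
  unfolding primitive_on_def
proof (intro conjI ballI)
  show "g absolutely_integrable_on {0..L}" by (rule primitive_on_abs_integrable[OF assms(1)])
  fix x assume x: "x \<in> {0..L}"
  then have "0 \<in> {0..L}" by auto
  then show "f' x = f' 0 + integral {0..x} g"
    using primitive_on_eq[OF assms(1) x] assms(2)[OF x] assms(2)[of 0] by linarith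
qed

lemma primitive_on_taylor_bound:
  assumes f: "primitive_on L f g" and g: "\<And>x y. x \<in> {0..L} \<Longrightarrow> y \<in> {0..L} \<Longrightarrow> \<bar>g x - g y\<bar> \<le> C * \<bar>x - y\<bar>"
    and x: "x \<in> {0..L}" and y: "y \<in> {0..L}" and "0 \<le> C"
  shows "\<bar>f y - f x - g x * (y - x)\<bar> \<le> C * (y - x)\<^sup>2"
proof -
  have *: "\<bar>f b - f a - g z * (b - a)\<bar> \<le> C * (b - a)\<^sup>2"
    if "0 \<le> a" "a \<le> b" "b \<le> L" "z \<in> {a..b}" for a b z
  proof -
    have gi: "g integrable_on {a..b}" by (rule primitive_on_integrable[OF f]) (use that in auto)
    have "f b - f a - g z * (b - a) = integral {a..b} (\<lambda>x. g x - g z)"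
      using primitive_on_diff_eq[OF f that(1-3)] gi that by (subst Henstock_Kurzweil_Integration.integral_diff) auto
    also have "norm \<dots> \<le> integral {a..b} (\<lambda>_. C * (b - a))"
    proof (rule Henstock_Kurzweil_Integration.integral_norm_bound_integral)
      show "(\<lambda>x. g x - g z) integrable_on {a..b}" using gi by (intro integrable_diff) auto
      show "norm (g x - g z) \<le> C * (b - a)" if "x \<in> {a..b}" for x
      proof -
        have "\<bar>g x - g z\<bar> \<le> C * \<bar>x - z\<bar>"
          using that \<open>z \<in> {a..b}\<close> \<open>0 \<le> a\<close> \<open>b \<le> L\<close> by (intro g) auto
        also have "\<dots> \<le> C * (b - a)" using that \<open>z \<in> {a..b}\<close> \<open>0 \<le> C\<close> by (intro mult_left_mono) auto
        finally show ?thesis by simp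
      qed
    qed auto
    also have "\<dots> = C * (b - a)\<^sup>2" using that by (simp add: power2_eq_square)
    finally show ?thesis by simp
  qed
  show ?thesis
  proof (cases "x \<le> y")
    case True then show ?thesis using *[of x y x] x y by auto
  next
    case False
    have "f y - f x - g x * (y - x) = - (f x - f y - g x * (x - y))" by (simp add: algebra_simps)
    then have "\<bar>f y - f x - g x * (y - x)\<bar> = \<bar>f x - f y - g x * (x - y)\<bar>" by (simp only: abs_minus_cancel)
    then show ?thesis using *[of y x x] x y False by (simp add: power2_commute[of y x])
  qed
qed

lemma difference_quotient_tendsto:
  fixes f :: "real \<Rightarrow> 'a::real_normed_vector"
  assumes "(f has_vector_derivative f') (at t)"
  shows "((\<lambda>h. norm ((f (t + h) - f t) /\<^sub>R h - f')) \<longlongrightarrow> 0) (at 0)"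
proof -
  have "((\<lambda>h. norm (f (t + h) - f t - h *\<^sub>R f') / norm h) \<longlongrightarrow> 0) (at 0)"
    using assms unfolding has_vector_derivative_def has_derivative_at by blast
  moreover have "norm (f (t + h) - f t - h *\<^sub>R f') / norm h = norm ((f (t + h) - f t) /\<^sub>R h - f')" if "h \<noteq> 0" for h
  proof -
    have "(f (t + h) - f t) /\<^sub>R h - f' = (f (t + h) - f t - h *\<^sub>R f') /\<^sub>R h"
      using that by (simp add: algebra_simps)
    then show ?thesis by (simp add: divide_inverse mult.commute)
  qed
  then have "eventually (\<lambda>h. norm (f (t + h) - f t - h *\<^sub>R f') / norm h = norm ((f (t + h) - f t) /\<^sub>R h - f')) (at 0)"
    by (auto simp: eventually_at_filter)
  ultimately show ?thesis by (rule Lim_transform_eventually)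
qed

lemma L2_norm_le:
  assumes "periodic_2pi f" "continuous_on {0..2*pi} f" "\<And>x. x \<in> {0..2*pi} \<Longrightarrow> \<bar>f x\<bar> \<le> A"
  shows "L2_norm f \<le> 3 * A" "0 \<le> L2_norm f"
proof -
  have A: "0 \<le> A" using assms(3)[of 0] by auto
  have c: "continuous_on {0..2*pi} (\<lambda>x. (f x)\<^sup>2)" by (intro continuous_intros assms)
  have e: "L2_norm f = sqrt (integral {0..2*pi} (\<lambda>x. (f x)\<^sup>2))"
    by (rule L2_norm_eq[OF assms(1) absolutely_integrable_continuous_real[OF c]])
  have "integral {0..2*pi} (\<lambda>x. (f x)\<^sup>2) \<le> integral {0..2*pi} (\<lambda>x. A\<^sup>2)"
    using assms(3) A by (intro integral_le integrable_continuous_interval c) (auto simp: abs_le_square_iff[symmetric])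
  also have "\<dots> = 2 * pi * A\<^sup>2" by simp
  also have "\<dots> \<le> 9 * A\<^sup>2" using pi_less_4 pi_approx by (intro mult_right_mono) auto
  also have "\<dots> = (3 * A)\<^sup>2" by (simp add: power_mult_distrib)
  finally show "L2_norm f \<le> 3 * A" unfolding e using A by (intro real_le_lsqrt) auto
  show "0 \<le> L2_norm f" unfolding e
    by (intro real_sqrt_ge_zero Henstock_Kurzweil_Integration.integral_nonneg integrable_continuous_interval c) auto
qed

section \<open>A Banach space of Lagrangian variables\<close>

lemma lipschitz_on_boundedI:
  assumes "\<And>r. \<exists>L. \<forall>x y. norm x \<le> r \<longrightarrow> norm y \<le> r \<longrightarrow> norm (F x - F y) \<le> L * norm (x - y)"
  shows "lipschitz_on_bounded F"
  unfolding lipschitz_on_bounded_def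
proof
  fix r
  obtain L where L: "\<forall>x y. norm x \<le> r \<longrightarrow> norm y \<le> r \<longrightarrow> norm (F x - F y) \<le> L * norm (x - y)"
    using assms by blast
  have "norm (F x - F y) \<le> \<bar>L\<bar> * norm (x - y)" if "norm x \<le> r" "norm y \<le> r" for x y
  proof -
    have "norm (F x - F y) \<le> L * norm (x - y)" using L that by blast
    also have "\<dots> \<le> \<bar>L\<bar> * norm (x - y)" by (intro mult_right_mono) auto
    finally show ?thesis .
  qed
  then have "\<bar>L\<bar>-lipschitz_on (cball 0 r) F" by (intro lipschitz_onI) (auto simp: dist_norm)
  then show "\<exists>L. L-lipschitz_on (cball 0 r) F" by blast
qed

lemma lipschitz_on_boundedD:
  assumes "lipschitz_on_bounded F"
  shows "\<exists>L B. 0 \<le> L \<and> 0 \<le> B \<and> (\<forall>x. norm x \<le> r \<longrightarrow> norm (F x) \<le> B) \<and>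
    (\<forall>x y. norm x \<le> r \<longrightarrow> norm y \<le> r \<longrightarrow> norm (F x - F y) \<le> L * norm (x - y))"
proof -
  obtain L where L: "L-lipschitz_on (cball 0 r) F" using assms by (auto simp: lipschitz_on_bounded_def)
  have lip: "norm (F x - F y) \<le> L * norm (x - y)" if "norm x \<le> r" "norm y \<le> r" for x y
    using lipschitz_onD[OF L, of x y] that by (simp add: dist_norm)
  have "norm (F x) \<le> norm (F 0) + L * \<bar>r\<bar>" if x: "norm x \<le> r" for x
  proof -
    have r: "0 \<le> r" using norm_ge_zero[of x] x by linarith
    have "norm (F x - F 0) \<le> L * norm (x - 0)" by (rule lip) (use x r in auto)
    also have "\<dots> \<le> L * \<bar>r\<bar>" using x r lipschitz_on_nonneg[OF L] by (intro mult_left_mono) auto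
    finally show ?thesis using norm_triangle_sub[of "F x" "F 0"] by linarith
  qed
  moreover have "0 \<le> norm (F 0) + L * \<bar>r\<bar>" using lipschitz_on_nonneg[OF L] by simp
  ultimately show ?thesis using lip lipschitz_on_nonneg[OF L] by blast
qed

lemma lipschitz_on_bounded_linear:
  assumes "bounded_linear f" "lipschitz_on_bounded F"
  shows "lipschitz_on_bounded (\<lambda>x. f (F x))"
proof (rule lipschitz_on_boundedI)
  fix r
  obtain L B where L: "0 \<le> L" "\<forall>x y. norm x \<le> r \<longrightarrow> norm y \<le> r \<longrightarrow> norm (F x - F y) \<le> L * norm (x - y)"
    using lipschitz_on_boundedD[OF assms(2), of r] by blast
  obtain K where K: "0 \<le> K" "\<And>x. norm (f x) \<le> norm x * K"
    using bounded_linear.nonneg_bounded[OF assms(1)] by blast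
  have "norm (f (F x) - f (F y)) \<le> (L * K) * norm (x - y)" if "norm x \<le> r" "norm y \<le> r" for x y
  proof -
    have "norm (f (F x) - f (F y)) \<le> norm (F x - F y) * K"
      using K(2)[of "F x - F y"] bounded_linear.linear[OF assms(1)] by (simp add: linear_diff)
    also have "\<dots> \<le> (L * norm (x - y)) * K" using L that K by (intro mult_right_mono) auto
    finally show ?thesis by (simp add: algebra_simps)
  qed
  then show "\<exists>L. \<forall>x y. norm x \<le> r \<longrightarrow> norm y \<le> r \<longrightarrow> norm (f (F x) - f (F y)) \<le> L * norm (x - y)" by blast
qed

lemma lipschitz_on_bounded_bilinear:
  assumes b: "bounded_bilinear mul" and F: "lipschitz_on_bounded F" and G: "lipschitz_on_bounded G"
  shows "lipschitz_on_bounded (\<lambda>x. mul (F x) (G x))"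
proof (rule lipschitz_on_boundedI)
  interpret bounded_bilinear mul by fact
  fix r
  obtain L B where L: "0 \<le> L" "0 \<le> B" "\<forall>x. norm x \<le> r \<longrightarrow> norm (F x) \<le> B"
     "\<forall>x y. norm x \<le> r \<longrightarrow> norm y \<le> r \<longrightarrow> norm (F x - F y) \<le> L * norm (x - y)"
    using lipschitz_on_boundedD[OF F, of r] by blast
  obtain M C where M: "0 \<le> M" "0 \<le> C" "\<forall>x. norm x \<le> r \<longrightarrow> norm (G x) \<le> C"
     "\<forall>x y. norm x \<le> r \<longrightarrow> norm y \<le> r \<longrightarrow> norm (G x - G y) \<le> M * norm (x - y)"
    using lipschitz_on_boundedD[OF G, of r] by blast
  obtain K where K: "0 \<le> K" "\<And>a b. norm (mul a b) \<le> norm a * norm b * K" using nonneg_bounded by blast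
  have "norm (mul (F x) (G x) - mul (F y) (G y)) \<le> (L * C * K + B * M * K) * norm (x - y)"
    if x: "norm x \<le> r" and y: "norm y \<le> r" for x y
  proof -
    have "mul (F x) (G x) - mul (F y) (G y) = mul (F x - F y) (G x) + mul (F y) (G x - G y)"
      by (simp add: diff_left diff_right)
    also have "norm \<dots> \<le> norm (F x - F y) * norm (G x) * K + norm (F y) * norm (G x - G y) * K"
      by (intro order.trans[OF norm_triangle_ineq] add_mono K)
    also have "\<dots> \<le> (L * norm (x - y)) * C * K + B * (M * norm (x - y)) * K"
      using L M x y K(1) by (intro add_mono mult_right_mono mult_mono) auto
    finally show ?thesis by (simp add: algebra_simps)
  qed
  then show "\<exists>L. \<forall>x y. norm x \<le> r \<longrightarrow> norm y \<le> r \<longrightarrow> norm (mul (F x) (G x) - mul (F y) (G y)) \<le> L * norm (x - y)"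
    by blast
qed

lemma lipschitz_on_bounded_add:
  assumes F: "lipschitz_on_bounded F" and G: "lipschitz_on_bounded G"
  shows "lipschitz_on_bounded (\<lambda>x. F x + G x)"
proof (rule lipschitz_on_boundedI)
  fix r
  obtain L where L: "\<forall>x y. norm x \<le> r \<longrightarrow> norm y \<le> r \<longrightarrow> norm (F x - F y) \<le> L * norm (x - y)"
    using lipschitz_on_boundedD[OF F, of r] by blast
  obtain M where M: "\<forall>x y. norm x \<le> r \<longrightarrow> norm y \<le> r \<longrightarrow> norm (G x - G y) \<le> M * norm (x - y)"
    using lipschitz_on_boundedD[OF G, of r] by blast
  have "norm (F x + G x - (F y + G y)) \<le> (L + M) * norm (x - y)" if "norm x \<le> r" "norm y \<le> r" for x y
  proof -
    have "F x + G x - (F y + G y) = (F x - F y) + (G x - G y)" by simp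
    also have "norm \<dots> \<le> norm (F x - F y) + norm (G x - G y)" by (rule norm_triangle_ineq)
    also have "\<dots> \<le> L * norm (x - y) + M * norm (x - y)" using L M that by (intro add_mono) auto
    finally show ?thesis by (simp add: algebra_simps)
  qed
  then show "\<exists>L. \<forall>x y. norm x \<le> r \<longrightarrow> norm y \<le> r \<longrightarrow> norm (F x + G x - (F y + G y)) \<le> L * norm (x - y)" by blast
qed

lemma lipschitz_on_bounded_const: "lipschitz_on_bounded (\<lambda>_. c)"
  by (rule lipschitz_on_boundedI) (auto intro: exI[of _ 0])

lemma lipschitz_on_bounded_id: "lipschitz_on_bounded (\<lambda>x. x)"
  by (rule lipschitz_on_boundedI) (auto intro: exI[of _ 1])

lemma lipschitz_on_bounded_diff:
  assumes "lipschitz_on_bounded F" "lipschitz_on_bounded G"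
  shows "lipschitz_on_bounded (\<lambda>x. F x - G x)"
  using lipschitz_on_bounded_add[OF assms(1) lipschitz_on_bounded_linear[OF bounded_linear_minus[OF bounded_linear_ident] assms(2)]]
  by simp

lemma lipschitz_on_bounded_Pair:
  assumes F: "lipschitz_on_bounded F" and G: "lipschitz_on_bounded G"
  shows "lipschitz_on_bounded (\<lambda>x. (F x, G x))"
proof -
  have 1: "bounded_linear (\<lambda>x. (x, 0))" "bounded_linear (\<lambda>x. (0, x))"
    by (intro bounded_linear_Pair bounded_linear_ident bounded_linear_zero)+
  show ?thesis
    using lipschitz_on_bounded_add[OF lipschitz_on_bounded_linear[OF 1(1) F] lipschitz_on_bounded_linear[OF 1(2) G]]
    by simp
qed

subsection \<open>Products and primitives of bounded continuous functions\<close>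

instance bcontfun :: (metric_space, banach) banach ..

text \<open>Labels live in \<open>[0, 2\<pi>]\<close>. Bounded continuous functions are defined on the whole line, and
  everything that is integrated in \<open>\<xi>\<close> is continued by constants.\<close>

definition clamp_2pi :: "real \<Rightarrow> real" where
  "clamp_2pi x = max 0 (min (2 * pi) x)"

lemma clamp_2pi [simp]: "x \<in> {0..2*pi} \<Longrightarrow> clamp_2pi x = x" "clamp_2pi x \<in> {0..2*pi}"
  "0 \<le> clamp_2pi x" "clamp_2pi x \<le> 2 * pi" "clamp_2pi (clamp_2pi x) = clamp_2pi x"
  "clamp_2pi 0 = 0" "clamp_2pi (2 * pi) = 2 * pi"
  by (auto simp: clamp_2pi_def)

lemma continuous_clamp_2pi: "continuous_on S clamp_2pi"
  unfolding clamp_2pi_def by (intro continuous_intros)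

definition bmul :: "(real \<Rightarrow>\<^sub>C real) \<Rightarrow> (real \<Rightarrow>\<^sub>C real) \<Rightarrow> (real \<Rightarrow>\<^sub>C real)" where
  "bmul f g = Bcontfun (\<lambda>x. f x * g x)"

lemma bmul_apply [simp]: "apply_bcontfun (bmul f g) x = f x * g x"
proof -
  have "(\<lambda>x. f x * g x) \<in> bcontfun"
  proof (rule bcontfun_normI)
    show "norm (f x * g x) \<le> norm f * norm g" for x
      using norm_bounded[of f x] norm_bounded[of g x] by (auto simp: abs_mult intro: mult_mono)
  qed (intro continuous_intros continuous_on_apply_bcontfun)
  then show ?thesis by (simp add: bmul_def Bcontfun_inverse)
qed

lemma bounded_bilinear_bmul: "bounded_bilinear bmul"
proof
  show "\<exists>K. \<forall>a b. norm (bmul a b) \<le> norm a * norm b * K"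
  proof (intro exI[of _ 1] allI)
    fix a b :: "real \<Rightarrow>\<^sub>C real"
    show "norm (bmul a b) \<le> norm a * norm b * 1"
    proof (rule norm_bound)
      show "norm (bmul a b x) \<le> norm a * norm b * 1" for x
        using norm_bounded[of a x] norm_bounded[of b x] by (auto simp: abs_mult intro: mult_mono)
    qed
  qed
qed (auto intro!: bcontfun_eqI simp: algebra_simps)

definition bprim :: "(real \<Rightarrow>\<^sub>C real) \<Rightarrow> (real \<Rightarrow>\<^sub>C real)" where
  "bprim f = Bcontfun (\<lambda>x. integral {0..clamp_2pi x} f)"

lemma bcontfun_integrable [simp]: "apply_bcontfun (f :: real \<Rightarrow>\<^sub>C real) integrable_on {a..b}"
  by (intro integrable_continuous_interval) simp

lemma bcontfun_primitive_on:
  "primitive_on L (\<lambda>x. integral {0..x} (apply_bcontfun (f :: real \<Rightarrow>\<^sub>C real))) (apply_bcontfun f)"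
  by (intro primitive_on_indefinite_integral absolutely_integrable_continuous_real) simp

lemma abs_integral_bcontfun_le:
  fixes f :: "real \<Rightarrow>\<^sub>C real"
  assumes "a \<le> b"
  shows "\<bar>integral {a..b} f\<bar> \<le> (b - a) * norm f"
proof -
  have "norm (integral {a..b} f) \<le> integral {a..b} (\<lambda>_. norm f)"
    using norm_bounded[of f] by (intro Henstock_Kurzweil_Integration.integral_norm_bound_integral) auto
  then show ?thesis using assms by simp
qed

lemma bprim_apply [simp]: "apply_bcontfun (bprim f) x = integral {0..clamp_2pi x} f"
proof -
  have "(\<lambda>x. integral {0..clamp_2pi x} f) \<in> bcontfun"
  proof (rule bcontfun_normI)
    show "continuous_on UNIV (\<lambda>x. integral {0..clamp_2pi x} f)"
      by (rule continuous_on_compose2[OF primitive_on_continuous[OF bcontfun_primitive_on[of "2*pi" f]] continuous_clamp_2pi]) auto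
    show "norm (integral {0..clamp_2pi x} f) \<le> 2 * pi * norm f" for x
    proof -
      have "\<bar>integral {0..clamp_2pi x} f\<bar> \<le> (clamp_2pi x - 0) * norm f" by (rule abs_integral_bcontfun_le) simp
      also have "\<dots> \<le> 2 * pi * norm f" by (intro mult_right_mono) auto
      finally show ?thesis by simp
    qed
  qed
  then show ?thesis by (simp add: bprim_def Bcontfun_inverse)
qed

lemma bounded_linear_integral_bcontfun:
  assumes "a \<le> b"
  shows "bounded_linear (\<lambda>f :: real \<Rightarrow>\<^sub>C real. integral {a..b} f)"
proof (rule bounded_linear_intro[where K = "b - a"])
  fix f g :: "real \<Rightarrow>\<^sub>C real" and r :: real
  show "integral {a..b} (f + g) = integral {a..b} f + integral {a..b} g"
    by (simp add: plus_bcontfun.rep_eq Henstock_Kurzweil_Integration.integral_add)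
  show "integral {a..b} (r *\<^sub>R f) = r *\<^sub>R integral {a..b} f"
    by (simp add: scaleR_bcontfun.rep_eq)
  show "norm (integral {a..b} f) \<le> norm f * (b - a)"
    using abs_integral_bcontfun_le[OF assms, of f] by (simp add: mult.commute)
qed

lemma bounded_linear_bprim: "bounded_linear bprim"
proof (rule bounded_linear_intro[where K = "2 * pi"])
  fix f g :: "real \<Rightarrow>\<^sub>C real" and r :: real
  have l: "linear (\<lambda>f :: real \<Rightarrow>\<^sub>C real. integral {0..clamp_2pi x} f)" for x
    by (intro bounded_linear.linear bounded_linear_integral_bcontfun) simp
  show "bprim (f + g) = bprim f + bprim g"
    by (rule bcontfun_eqI) (use linear_add[OF l] in simp)
  show "bprim (r *\<^sub>R f) = r *\<^sub>R bprim f"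
    by (rule bcontfun_eqI) (use linear_scale[OF l] in simp)
  show "norm (bprim f) \<le> norm f * (2 * pi)"
  proof (rule norm_bound)
    fix x
    have "\<bar>integral {0..clamp_2pi x} f\<bar> \<le> (clamp_2pi x - 0) * norm f" by (rule abs_integral_bcontfun_le) simp
    also have "\<dots> \<le> 2 * pi * norm f" by (intro mult_right_mono) auto
    finally show "norm (bprim f x) \<le> norm f * (2 * pi)" by (simp add: mult.commute)
  qed
qed

lemma bounded_linear_apply_bcontfun: "bounded_linear (\<lambda>f :: real \<Rightarrow>\<^sub>C real. f x)"
proof (rule bounded_linear_intro[where K = 1])
  show "norm (f x) \<le> norm f * 1" for f :: "real \<Rightarrow>\<^sub>C real" using norm_bounded[of f x] by simp
qed auto

lemma bounded_linear_const_bcontfun: "bounded_linear (const_bcontfun :: real \<Rightarrow> real \<Rightarrow>\<^sub>C real)"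
  by (rule bounded_linear_intro[where K = 1]) (auto intro!: bcontfun_eqI norm_bound)

lemma bprim_eq_of_derivative:
  fixes f h :: "real \<Rightarrow>\<^sub>C real"
  assumes "\<And>x. x \<in> {0..2*pi} \<Longrightarrow> (g has_real_derivative f x) (at x within {0..2*pi})" "g 0 = 0"
    and "\<And>x. h x = g (clamp_2pi x)"
  shows "bprim f = h"
proof (rule bcontfun_eqI)
  fix x
  have "primitive_on (2*pi) g f" by (rule primitive_on_has_derivative[OF assms(1)]) auto
  from primitive_on_eq[OF this, of "clamp_2pi x"] show "bprim f x = h x"
    using assms by simp
qed

lemma bprim_has_derivative:
  assumes "x \<in> {0..2*pi}"
  shows "(bprim f has_real_derivative f x) (at x within {0..2*pi})"
proof -
  have "((\<lambda>u. integral {0..u} f) has_real_derivative f x) (at x within {0..2*pi})"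
    unfolding has_real_derivative_iff_has_vector_derivative
    using assms by (intro integral_has_vector_derivative) auto
  then show ?thesis
    by (rule has_field_derivative_transform_within[where d = 1]) (use assms in auto)
qed

section \<open>The equation in Lagrangian variables\<close>

text \<open>A state consists of \<open>J = \<partial>\<^sub>\<xi>X\<close>, \<open>K = \<partial>\<^sub>\<xi>W\<close> and the value \<open>p\<close> of \<open>W\<close> at the peak. Derivatives in \<open>\<xi>\<close> are used
  as unknowns because \<open>X\<close> is recovered from \<open>J\<close> with \<open>X(0) = 0\<close>, while a bound from below on \<open>J\<close> says
  that \<open>X\<close> is a diffeomorphism, and a bound on \<open>K\<close> says that the slope is Lipschitz in \<open>x\<close>.\<close>

type_synonym lag_state = "(real \<Rightarrow>\<^sub>C real) \<times> (real \<Rightarrow>\<^sub>C real) \<times> real"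

abbreviation lag_J :: "lag_state \<Rightarrow> (real \<Rightarrow>\<^sub>C real)" where "lag_J y \<equiv> fst y"
abbreviation lag_K :: "lag_state \<Rightarrow> (real \<Rightarrow>\<^sub>C real)" where "lag_K y \<equiv> fst (snd y)"
abbreviation lag_p :: "lag_state \<Rightarrow> real" where "lag_p y \<equiv> snd (snd y)"

definition lag_X :: "lag_state \<Rightarrow> (real \<Rightarrow>\<^sub>C real)" where
  "lag_X y = bprim (lag_J y)"

definition lag_W :: "lag_state \<Rightarrow> (real \<Rightarrow>\<^sub>C real)" where
  "lag_W y = const_bcontfun (lag_p y) + bprim (lag_K y)"

definition lag_V :: "lag_state \<Rightarrow> (real \<Rightarrow>\<^sub>C real)" where
  "lag_V y = bprim (bmul (lag_W y) (lag_J y))"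

text \<open>The projection onto mean zero under \<open>\<partial>\<^sub>x\<^sup>-\<^sup>1\<close>: when \<open>X\<close> maps \<open>[0, 2\<pi>]\<close> onto itself, \<open>V + 2 W\<^sup>2 + m\<close> is
  \<open>\<zeta> + 2 (\<partial>\<^sub>x\<zeta>)\<^sup>2\<close> minus its mean.\<close>

definition lag_m :: "lag_state \<Rightarrow> real" where
  "lag_m y = - (1 / (2 * pi)) * integral {0..2*pi} (bmul (lag_V y + 2 *\<^sub>R bmul (lag_W y) (lag_W y)) (lag_J y))"

text \<open>The \<open>x\<close>-derivative of the transport coefficient \<open>x (2\<pi> - x) / 4 - 2 (\<zeta>(x) - \<zeta>(0))\<close> along the
  characteristics. It makes \<open>J\<close> shrink where it makes \<open>K\<close> grow.\<close>

definition lag_a :: "lag_state \<Rightarrow> (real \<Rightarrow>\<^sub>C real)" where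
  "lag_a y = const_bcontfun (pi / 2) - (1 / 2) *\<^sub>R lag_X y - 2 *\<^sub>R lag_W y"

definition time_rate :: real where "time_rate = 1 / (2 * c_star)"

definition lag_field :: "lag_state \<Rightarrow> lag_state" where
  "lag_field y = time_rate *\<^sub>R (- bmul (lag_a y) (lag_J y), bmul (lag_a y) (lag_K y),
     pi / 2 * lag_p y - (lag_p y)\<^sup>2 + lag_m y / 2)"

lemma time_rate: "0 < time_rate" "2 * c_star * time_rate = 1"
  by (auto simp: time_rate_def c_star_def)

text \<open>The mean over the torus of the function whose value at \<open>X \<xi>\<close> is \<open>V \<xi>\<close>. Subtracting it from \<open>V\<close>
  gives a solution with mean zero.\<close>

definition lag_mu :: "lag_state \<Rightarrow> real" where
  "lag_mu y = (1 / (2 * pi)) * integral {0..2*pi} (bmul (lag_V y) (lag_J y))"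

text \<open>All operations involved are linear or bilinear and continuous.\<close>

lemma lipschitz_on_bounded_lag:
  shows "lipschitz_on_bounded lag_field" "lipschitz_on_bounded lag_X" "lipschitz_on_bounded lag_W"
    "lipschitz_on_bounded lag_V" "lipschitz_on_bounded lag_m" "lipschitz_on_bounded lag_a" "lipschitz_on_bounded lag_mu"
proof -
  have J: "lipschitz_on_bounded (\<lambda>y::lag_state. lag_J y)"
    by (rule lipschitz_on_bounded_linear[OF bounded_linear_fst lipschitz_on_bounded_id])
  have S: "lipschitz_on_bounded (\<lambda>y::lag_state. snd y)"
    by (rule lipschitz_on_bounded_linear[OF bounded_linear_snd lipschitz_on_bounded_id])
  have K: "lipschitz_on_bounded (\<lambda>y::lag_state. lag_K y)"
    by (rule lipschitz_on_bounded_linear[OF bounded_linear_fst S])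
  have p: "lipschitz_on_bounded (\<lambda>y::lag_state. lag_p y)"
    by (rule lipschitz_on_bounded_linear[OF bounded_linear_snd S])
  note sc = lipschitz_on_bounded_linear[OF bounded_linear_scaleR_right]
  note mul = lipschitz_on_bounded_bilinear[OF bounded_bilinear_bmul]
  note rmul = lipschitz_on_bounded_bilinear[OF bounded_bilinear_mult]
  show X: "lipschitz_on_bounded lag_X"
    unfolding lag_X_def[abs_def] by (rule lipschitz_on_bounded_linear[OF bounded_linear_bprim J])
  show W: "lipschitz_on_bounded lag_W"
    unfolding lag_W_def[abs_def]
    by (intro lipschitz_on_bounded_add lipschitz_on_bounded_linear[OF bounded_linear_const_bcontfun p]
        lipschitz_on_bounded_linear[OF bounded_linear_bprim K])
  show V: "lipschitz_on_bounded lag_V"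
    unfolding lag_V_def[abs_def] by (intro lipschitz_on_bounded_linear[OF bounded_linear_bprim] mul W J)
  show m: "lipschitz_on_bounded lag_m"
    unfolding lag_m_def[abs_def]
    by (intro rmul lipschitz_on_bounded_const lipschitz_on_bounded_linear[OF bounded_linear_integral_bcontfun]
        mul lipschitz_on_bounded_add V sc W J) simp
  show "lipschitz_on_bounded lag_mu"
    unfolding lag_mu_def[abs_def]
    by (intro rmul lipschitz_on_bounded_const lipschitz_on_bounded_linear[OF bounded_linear_integral_bcontfun]
        mul V J) simp
  show a: "lipschitz_on_bounded lag_a"
    unfolding lag_a_def[abs_def]
    by (intro lipschitz_on_bounded_diff lipschitz_on_bounded_const sc X W)
  have "lipschitz_on_bounded (\<lambda>y. lag_m y / 2)"
    using rmul[OF m lipschitz_on_bounded_const[of "1/2"]] by simp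
  moreover have "lipschitz_on_bounded (\<lambda>y. - bmul (lag_a y) (lag_J y))"
    using lipschitz_on_bounded_linear[OF bounded_linear_minus[OF bounded_linear_ident] mul[OF a J]] .
  ultimately show "lipschitz_on_bounded lag_field"
    unfolding lag_field_def[abs_def] power2_eq_square
    by (intro sc lipschitz_on_bounded_Pair mul a K lipschitz_on_bounded_add lipschitz_on_bounded_diff rmul p
        lipschitz_on_bounded_const)
qed

lemma linear_ode_square_bounds_forward:
  fixes f :: "real \<Rightarrow> real"
  assumes d: "\<And>s. 0 \<le> s \<Longrightarrow> s \<le> t \<Longrightarrow> (f has_real_derivative b s * f s) (at s)"
    and b: "\<And>s. 0 \<le> s \<Longrightarrow> s \<le> t \<Longrightarrow> \<bar>b s\<bar> \<le> C" and "0 \<le> t"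
  shows "(f 0)\<^sup>2 * exp (- (2 * C * t)) \<le> (f t)\<^sup>2" "(f t)\<^sup>2 \<le> (f 0)\<^sup>2 * exp (2 * C * t)"
proof -
  have "(f 0)\<^sup>2 * exp (2 * C * 0) \<le> (f t)\<^sup>2 * exp (2 * C * t)"
  proof (rule DERIV_nonneg_imp_nondecreasing[OF \<open>0 \<le> t\<close>])
    fix s assume s: "0 \<le> s" "s \<le> t"
    have "((\<lambda>t. (f t)\<^sup>2 * exp (2 * C * t)) has_real_derivative (2 * (C + b s) * (f s)\<^sup>2 * exp (2 * C * s))) (at s)"
      by (rule derivative_eq_intros d s refl | simp add: algebra_simps power2_eq_square)+
    moreover have "0 \<le> 2 * (C + b s) * (f s)\<^sup>2 * exp (2 * C * s)"
      using b[OF s] by (intro mult_nonneg_nonneg) auto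
    ultimately show "\<exists>y. ((\<lambda>t. (f t)\<^sup>2 * exp (2 * C * t)) has_real_derivative y) (at s) \<and> 0 \<le> y" by blast
  qed
  then show "(f 0)\<^sup>2 * exp (- (2 * C * t)) \<le> (f t)\<^sup>2" by (simp add: exp_minus field_simps)
  have "(f t)\<^sup>2 * exp (- (2 * C * t)) \<le> (f 0)\<^sup>2 * exp (- (2 * C * 0))"
  proof (rule DERIV_nonpos_imp_nonincreasing[OF \<open>0 \<le> t\<close>])
    fix s assume s: "0 \<le> s" "s \<le> t"
    have "((\<lambda>t. (f t)\<^sup>2 * exp (- (2 * C * t))) has_real_derivative (2 * (b s - C) * (f s)\<^sup>2 * exp (- (2 * C * s)))) (at s)"
      by (rule derivative_eq_intros d s refl | simp add: algebra_simps power2_eq_square)+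
    moreover have "2 * (b s - C) * (f s)\<^sup>2 * exp (- (2 * C * s)) \<le> 0"
    proof -
      have "(b s - C) * (2 * (f s)\<^sup>2 * exp (- (2 * C * s))) \<le> 0"
        using b[OF s] by (intro mult_nonpos_nonneg) auto
      then show ?thesis by (simp add: algebra_simps)
    qed
    ultimately show "\<exists>y. ((\<lambda>t. (f t)\<^sup>2 * exp (- (2 * C * t))) has_real_derivative y) (at s) \<and> y \<le> 0" by blast
  qed
  then show "(f t)\<^sup>2 \<le> (f 0)\<^sup>2 * exp (2 * C * t)" by (simp add: exp_minus field_simps)
qed

text \<open>Squares avoid any knowledge of the sign of \<open>f\<close>.\<close>

lemma linear_ode_square_bounds:
  fixes f :: "real \<Rightarrow> real"
  assumes d: "\<And>s. \<bar>s\<bar> \<le> T \<Longrightarrow> (f has_real_derivative b s * f s) (at s)"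
    and b: "\<And>s. \<bar>s\<bar> \<le> T \<Longrightarrow> \<bar>b s\<bar> \<le> C" and t: "\<bar>t\<bar> \<le> T"
  shows "(f 0)\<^sup>2 * exp (- (2 * C * \<bar>t\<bar>)) \<le> (f t)\<^sup>2 \<and> (f t)\<^sup>2 \<le> (f 0)\<^sup>2 * exp (2 * C * \<bar>t\<bar>)"
proof (cases "0 \<le> t")
  case True
  then show ?thesis
    using linear_ode_square_bounds_forward[of t f b C] d b t by auto
next
  case False
  have "((\<lambda>s. f (- s)) has_real_derivative (- b (- s)) * f (- s)) (at s)" if "0 \<le> s" "s \<le> - t" for s
    using DERIV_mirror[of f "b (-s) * f (-s)" s] d[of "-s"] that t by simp
  then show ?thesis
    using linear_ode_square_bounds_forward[of "-t" "\<lambda>s. f (- s)" "\<lambda>s. - b (- s)" C] b t False by auto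
qed

text \<open>The labels are the initial positions, so that \<open>J = 1\<close> at time \<open>0\<close>. The condition on the mean of the
  initial slope is the periodicity of the initial function.\<close>

locale lagrangian_solution =
  fixes \<tau> :: ereal and y :: "real \<Rightarrow> lag_state" and K0 :: "real \<Rightarrow>\<^sub>C real" and p0 :: real
  assumes \<tau>: "0 < \<tau>"
    and init: "y 0 = (const_bcontfun 1, K0, p0)"
    and ode: "\<And>t. t \<in> time_interval \<tau> \<Longrightarrow> (y has_vector_derivative lag_field (y t)) (at t)"
    and mean0: "integral {0..2*pi} (lag_W (y 0)) = 0"
begin

definition "J t = lag_J (y t)"
definition "K t = lag_K (y t)"
definition "p t = lag_p (y t)"
definition "X t = lag_X (y t)"
definition "W t = lag_W (y t)"
definition "V t = lag_V (y t)"
definition "m t = lag_m (y t)"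
definition "a t = lag_a (y t)"
definition "\<mu> t = lag_mu (y t)"

lemmas state_defs = J_def K_def p_def X_def W_def V_def m_def a_def \<mu>_def

abbreviation "k \<equiv> time_rate"

lemma zero_mem: "0 \<in> time_interval \<tau>" using \<tau> by (simp add: time_interval_def zero_ereal_def[symmetric])

lemma X_eq: "X t = bprim (J t)" and W_eq: "W t = const_bcontfun (p t) + bprim (K t)"
  and V_eq: "V t = bprim (bmul (W t) (J t))"
  and m_eq: "m t = - (1 / (2 * pi)) * integral {0..2*pi} (bmul (V t + 2 *\<^sub>R bmul (W t) (W t)) (J t))"
  and \<mu>_eq: "\<mu> t = (1 / (2 * pi)) * integral {0..2*pi} (bmul (V t) (J t))"
  and a_apply: "a t \<xi> = (pi - X t \<xi>) / 2 - 2 * W t \<xi>"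
  by (simp_all add: state_defs lag_X_def lag_W_def lag_V_def lag_m_def lag_a_def lag_mu_def diff_divide_distrib)

lemma at_0: "X t 0 = 0" "V t 0 = 0" "W t 0 = p t"
  by (simp_all add: X_eq V_eq W_eq)

lemma clamp_eqs: "X t (clamp_2pi \<xi>) = X t \<xi>" "W t (clamp_2pi \<xi>) = W t \<xi>" "V t (clamp_2pi \<xi>) = V t \<xi>"
  by (simp_all add: X_eq V_eq W_eq)

lemma initial: "J 0 = const_bcontfun 1" "K 0 = K0" "p 0 = p0" "X 0 \<xi> = clamp_2pi \<xi>"
  "\<xi> \<in> {0..2*pi} \<Longrightarrow> V 0 \<xi> = integral {0..\<xi>} (W 0)"
proof -
  show 1: "J 0 = const_bcontfun 1" "K 0 = K0" "p 0 = p0" by (simp_all add: state_defs init)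
  show "X 0 \<xi> = clamp_2pi \<xi>" by (simp add: X_eq 1)
  have "bmul (W 0) (J 0) = W 0" by (rule bcontfun_eqI) (simp add: 1)
  then show "\<xi> \<in> {0..2*pi} \<Longrightarrow> V 0 \<xi> = integral {0..\<xi>} (W 0)" by (simp add: V_eq)
qed

lemma dy: assumes "t \<in> time_interval \<tau>"
  shows dJ: "(J has_vector_derivative - (k *\<^sub>R bmul (a t) (J t))) (at t)"
    and dK: "(K has_vector_derivative k *\<^sub>R bmul (a t) (K t)) (at t)"
    and dp: "(p has_real_derivative k * (pi / 2 * p t - (p t)\<^sup>2 + m t / 2)) (at t)"
proof -
  note d = ode[OF assms, unfolded lag_field_def]
  from bounded_linear.has_vector_derivative[OF bounded_linear_fst d]
  show "(J has_vector_derivative - (k *\<^sub>R bmul (a t) (J t))) (at t)"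
    by (simp add: state_defs[abs_def])
  note s = bounded_linear.has_vector_derivative[OF bounded_linear_snd d]
  from bounded_linear.has_vector_derivative[OF bounded_linear_fst s]
  show "(K has_vector_derivative k *\<^sub>R bmul (a t) (K t)) (at t)"
    by (simp add: state_defs[abs_def])
  from bounded_linear.has_vector_derivative[OF bounded_linear_snd s]
  show "(p has_real_derivative k * (pi / 2 * p t - (p t)\<^sup>2 + m t / 2)) (at t)"
    by (simp add: state_defs[abs_def] has_real_derivative_iff_has_vector_derivative)
qed

lemma space_derivatives:
  assumes "\<xi> \<in> {0..2*pi}"
  shows "(X t has_real_derivative J t \<xi>) (at \<xi> within {0..2*pi})"
    "(W t has_real_derivative K t \<xi>) (at \<xi> within {0..2*pi})"
    "(V t has_real_derivative W t \<xi> * J t \<xi>) (at \<xi> within {0..2*pi})"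
proof -
  show "(X t has_real_derivative J t \<xi>) (at \<xi> within {0..2*pi})"
    unfolding X_eq by (rule bprim_has_derivative[OF assms])
  show "(V t has_real_derivative W t \<xi> * J t \<xi>) (at \<xi> within {0..2*pi})"
    using bprim_has_derivative[OF assms, of "bmul (W t) (J t)"] by (simp only: V_eq bmul_apply)
  have "((\<lambda>\<xi>. p t + bprim (K t) \<xi>) has_real_derivative 0 + K t \<xi>) (at \<xi> within {0..2*pi})"
    by (intro DERIV_add DERIV_const bprim_has_derivative assms)
  moreover have "apply_bcontfun (W t) = (\<lambda>\<xi>. p t + bprim (K t) \<xi>)"
    unfolding W_eq by (rule ext) simp
  ultimately show "(W t has_real_derivative K t \<xi>) (at \<xi> within {0..2*pi})" by simp
qed

text \<open>The derivative of \<open>x (2\<pi> - x) / 4 - 2 V\<close> along the characteristics is \<open>a J\<close>, so the flow equation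
  integrates exactly to the characteristic equation.\<close>

lemma dX:
  assumes "t \<in> time_interval \<tau>"
  shows "(X has_vector_derivative - (k *\<^sub>R bprim (bmul (a t) (J t)))) (at t)"
    "bprim (bmul (a t) (J t)) \<xi> = X t \<xi> * (2 * pi - X t \<xi>) / 4 - 2 * V t \<xi>"
proof -
  have "(X has_vector_derivative bprim (- (k *\<^sub>R bmul (a t) (J t)))) (at t)"
    using bounded_linear.has_vector_derivative[OF bounded_linear_bprim dJ[OF assms]] by (simp add: X_eq[abs_def])
  moreover have "bprim (- (k *\<^sub>R bmul (a t) (J t))) = - (k *\<^sub>R bprim (bmul (a t) (J t)))"
    using bounded_linear.linear[OF bounded_linear_bprim] by (simp add: linear_neg linear_scale)
  ultimately show "(X has_vector_derivative - (k *\<^sub>R bprim (bmul (a t) (J t)))) (at t)" by simp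
  define g where "g \<xi> = X t \<xi> * (2 * pi - X t \<xi>) / 4 - 2 * V t \<xi>" for \<xi>
  have "g \<in> bcontfun"
  proof -
    have "apply_bcontfun ((pi / 2) *\<^sub>R X t - (1/4) *\<^sub>R bmul (X t) (X t) - 2 *\<^sub>R V t) = g"
      by (rule ext) (simp add: g_def algebra_simps)
    then show ?thesis by (metis apply_bcontfun)
  qed
  have "bprim (bmul (a t) (J t)) = Bcontfun g"
  proof (rule bprim_eq_of_derivative[where g = g])
    show "(g has_real_derivative bmul (a t) (J t) \<xi>) (at \<xi> within {0..2*pi})" if "\<xi> \<in> {0..2*pi}" for \<xi>
      unfolding g_def[abs_def]
      by (rule derivative_eq_intros space_derivatives that refl | simp add: a_apply field_simps)+
    show "g 0 = 0" by (simp add: g_def at_0)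
    show "Bcontfun g \<xi> = g (clamp_2pi \<xi>)" for \<xi>
      using \<open>g \<in> bcontfun\<close> by (simp add: Bcontfun_inverse) (simp add: g_def clamp_eqs)
  qed
  then show "bprim (bmul (a t) (J t)) \<xi> = X t \<xi> * (2 * pi - X t \<xi>) / 4 - 2 * V t \<xi>"
    using \<open>g \<in> bcontfun\<close> by (simp add: Bcontfun_inverse g_def del: bprim_apply)
qed

definition dW_field :: "real \<Rightarrow> (real \<Rightarrow>\<^sub>C real)" where
  "dW_field t = const_bcontfun (pi / 2 * p t - (p t)\<^sup>2 + m t / 2) + bprim (bmul (a t) (K t))"

text \<open>The Riccati equation for the slope. The terms with \<open>a\<close> integrate exactly, as in \<open>dX\<close>.\<close>

lemma dW:
  assumes "t \<in> time_interval \<tau>"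
  shows "(W has_vector_derivative k *\<^sub>R dW_field t) (at t)"
    "dW_field t \<xi> = (pi - X t \<xi>) / 2 * W t \<xi> - (W t \<xi>)\<^sup>2 + (V t \<xi> + m t) / 2"
proof -
  have "(W has_vector_derivative const_bcontfun (k * (pi / 2 * p t - (p t)\<^sup>2 + m t / 2)) + bprim (k *\<^sub>R bmul (a t) (K t))) (at t)"
    unfolding W_eq[abs_def]
    by (intro has_vector_derivative_add bounded_linear.has_vector_derivative[OF bounded_linear_bprim]
        bounded_linear.has_vector_derivative[OF bounded_linear_const_bcontfun] dK[OF assms]
        dp[OF assms, unfolded has_real_derivative_iff_has_vector_derivative])
  moreover have "const_bcontfun (k * (pi / 2 * p t - (p t)\<^sup>2 + m t / 2)) + bprim (k *\<^sub>R bmul (a t) (K t)) = k *\<^sub>R dW_field t"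
    unfolding linear_scale[OF bounded_linear.linear[OF bounded_linear_bprim]] dW_field_def
    by (rule bcontfun_eqI) (simp add: algebra_simps)
  ultimately show "(W has_vector_derivative k *\<^sub>R dW_field t) (at t)" by simp
  define g where "g \<xi> = (pi - X t \<xi>) / 2 * W t \<xi> - (W t \<xi>)\<^sup>2 + V t \<xi> / 2 - (pi / 2 * p t - (p t)\<^sup>2)" for \<xi>
  have "g \<in> bcontfun"
  proof -
    have "apply_bcontfun ((pi / 2) *\<^sub>R W t - (1/2) *\<^sub>R bmul (X t) (W t) - bmul (W t) (W t) + (1/2) *\<^sub>R V t
        - const_bcontfun (pi / 2 * p t - (p t)\<^sup>2)) = g"
      by (rule ext) (simp add: g_def field_simps power2_eq_square)
    then show ?thesis by (metis apply_bcontfun)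
  qed
  have "bprim (bmul (a t) (K t)) = Bcontfun g"
  proof (rule bprim_eq_of_derivative[where g = g])
    show "(g has_real_derivative bmul (a t) (K t) \<xi>) (at \<xi> within {0..2*pi})" if "\<xi> \<in> {0..2*pi}" for \<xi>
      unfolding g_def[abs_def]
      by (rule derivative_eq_intros space_derivatives that refl | simp add: a_apply field_simps)+
    show "g 0 = 0" by (simp add: g_def at_0)
    show "Bcontfun g \<xi> = g (clamp_2pi \<xi>)" for \<xi>
      using \<open>g \<in> bcontfun\<close> by (simp add: Bcontfun_inverse) (simp add: g_def clamp_eqs)
  qed
  then show "dW_field t \<xi> = (pi - X t \<xi>) / 2 * W t \<xi> - (W t \<xi>)\<^sup>2 + (V t \<xi> + m t) / 2"
    using \<open>g \<in> bcontfun\<close> by (simp add: dW_field_def Bcontfun_inverse g_def field_simps del: bprim_apply)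
qed

definition force :: "real \<Rightarrow> (real \<Rightarrow>\<^sub>C real)" where
  "force t = V t + 2 *\<^sub>R bmul (W t) (W t) + const_bcontfun (m t)"

lemma dV:
  assumes "t \<in> time_interval \<tau>"
  shows "(V has_vector_derivative (k / 2) *\<^sub>R bprim (bmul (force t) (J t))) (at t)"
proof -
  have "(V has_vector_derivative bprim (bmul (W t) (- (k *\<^sub>R bmul (a t) (J t))) + bmul (k *\<^sub>R dW_field t) (J t))) (at t)"
    unfolding V_eq[abs_def]
    by (intro bounded_linear.has_vector_derivative[OF bounded_linear_bprim]
        bounded_bilinear.has_vector_derivative[OF bounded_bilinear_bmul] dW dJ assms)
  moreover have "bmul (W t) (- (k *\<^sub>R bmul (a t) (J t))) + bmul (k *\<^sub>R dW_field t) (J t) = (k / 2) *\<^sub>R bmul (force t) (J t)"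
    by (rule bcontfun_eqI) (simp add: dW(2)[OF assms] a_apply force_def field_simps power2_eq_square)
  ultimately show ?thesis
    by (simp add: linear_scale[OF bounded_linear.linear[OF bounded_linear_bprim]])
qed

end

context lagrangian_solution begin

lemma mem_interval: "s \<in> time_interval \<tau>" if "\<bar>s\<bar> \<le> \<bar>t\<bar>" "t \<in> time_interval \<tau>"
  using that unfolding time_interval_def by (auto intro: le_less_trans[of "ereal \<bar>s\<bar>" "ereal \<bar>t\<bar>"])

text \<open>The solution of the differential equation is continuous in time, hence bounded on compact time
  intervals, and all derived quantities are Lipschitz functions of it.\<close>

lemma state_bounds:
  assumes T: "T \<in> time_interval \<tau>"
  obtains C where "1 \<le> C"
    "\<And>s. \<bar>s\<bar> \<le> \<bar>T\<bar> \<Longrightarrow> norm (J s) \<le> C" "\<And>s. \<bar>s\<bar> \<le> \<bar>T\<bar> \<Longrightarrow> norm (K s) \<le> C"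
    "\<And>s. \<bar>s\<bar> \<le> \<bar>T\<bar> \<Longrightarrow> norm (X s) \<le> C" "\<And>s. \<bar>s\<bar> \<le> \<bar>T\<bar> \<Longrightarrow> norm (W s) \<le> C"
    "\<And>s. \<bar>s\<bar> \<le> \<bar>T\<bar> \<Longrightarrow> norm (V s) \<le> C" "\<And>s. \<bar>s\<bar> \<le> \<bar>T\<bar> \<Longrightarrow> norm (m s) \<le> C"
    "\<And>s. \<bar>s\<bar> \<le> \<bar>T\<bar> \<Longrightarrow> norm (a s) \<le> C"
    "\<And>s s'. \<bar>s\<bar> \<le> \<bar>T\<bar> \<Longrightarrow> \<bar>s'\<bar> \<le> \<bar>T\<bar> \<Longrightarrow> norm (X s - X s') \<le> C * \<bar>s - s'\<bar>"
    "\<And>s s'. \<bar>s\<bar> \<le> \<bar>T\<bar> \<Longrightarrow> \<bar>s'\<bar> \<le> \<bar>T\<bar> \<Longrightarrow> norm (W s - W s') \<le> C * \<bar>s - s'\<bar>"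
    "\<And>s s'. \<bar>s\<bar> \<le> \<bar>T\<bar> \<Longrightarrow> \<bar>s'\<bar> \<le> \<bar>T\<bar> \<Longrightarrow> norm (V s - V s') \<le> C * \<bar>s - s'\<bar>"
    "\<And>s s'. \<bar>s\<bar> \<le> \<bar>T\<bar> \<Longrightarrow> \<bar>s'\<bar> \<le> \<bar>T\<bar> \<Longrightarrow> norm (\<mu> s - \<mu> s') \<le> C * \<bar>s - s'\<bar>"
proof -
  have d: "(y has_vector_derivative lag_field (y s)) (at s)" if "\<bar>s\<bar> \<le> \<bar>T\<bar>" for s
    using ode mem_interval[OF that T] by blast
  have "continuous_on {-\<bar>T\<bar>..\<bar>T\<bar>} y"
    by (intro continuous_at_imp_continuous_on ballI has_vector_derivative_continuous[OF d]) auto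
  then have "bounded (y ` {-\<bar>T\<bar>..\<bar>T\<bar>})" by (intro compact_imp_bounded compact_continuous_image) auto
  then obtain r where "\<forall>s\<in>{-\<bar>T\<bar>..\<bar>T\<bar>}. norm (y s) \<le> r" by (auto simp: bounded_iff)
  then have r: "norm (y s) \<le> r" if "\<bar>s\<bar> \<le> \<bar>T\<bar>" for s using that by (auto simp: abs_le_iff)
  obtain B where B: "0 \<le> B" "\<And>z. norm z \<le> r \<Longrightarrow> norm (lag_field z) \<le> B"
    using lipschitz_on_boundedD[OF lipschitz_on_bounded_lag(1), of r] by blast
  have ylip: "norm (y s - y s') \<le> B * \<bar>s - s'\<bar>" if "\<bar>s\<bar> \<le> \<bar>T\<bar>" "\<bar>s'\<bar> \<le> \<bar>T\<bar>" for s s'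
  proof -
    have *: "norm (y b - y c) \<le> B * b - B * c" if "c < b" "\<bar>b\<bar> \<le> \<bar>T\<bar>" "\<bar>c\<bar> \<le> \<bar>T\<bar>" for b c
    proof (rule differentiable_bound_general[OF that(1)])
      show "continuous_on {c..b} y"
        using that by (intro continuous_at_imp_continuous_on ballI has_vector_derivative_continuous[OF d]) auto
      show "continuous_on {c..b} (\<lambda>t. B * t)" by (intro continuous_intros)
      show "(y has_vector_derivative lag_field (y x)) (at x)" if "c < x" "x < b" for x
        using that \<open>\<bar>b\<bar> \<le> \<bar>T\<bar>\<close> \<open>\<bar>c\<bar> \<le> \<bar>T\<bar>\<close> by (intro d) auto
      show "((\<lambda>t. B * t) has_vector_derivative B) (at x)" for x
        unfolding has_real_derivative_iff_has_vector_derivative[symmetric] by (auto intro!: derivative_eq_intros)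
      show "norm (lag_field (y x)) \<le> B" if "c < x" "x < b" for x
        using that \<open>\<bar>b\<bar> \<le> \<bar>T\<bar>\<close> \<open>\<bar>c\<bar> \<le> \<bar>T\<bar>\<close> by (intro B r) auto
    qed
    show ?thesis
      using *[of s' s] *[of s s'] that
      by (cases s s' rule: linorder_cases) (auto simp: norm_minus_commute algebra_simps)
  qed
  have bd: "\<exists>C\<ge>0. (\<forall>s. \<bar>s\<bar> \<le> \<bar>T\<bar> \<longrightarrow> norm (f (y s)) \<le> C) \<and>
     (\<forall>s s'. \<bar>s\<bar> \<le> \<bar>T\<bar> \<longrightarrow> \<bar>s'\<bar> \<le> \<bar>T\<bar> \<longrightarrow> norm (f (y s) - f (y s')) \<le> C * \<bar>s - s'\<bar>)"
    if f: "lipschitz_on_bounded f" for f :: "lag_state \<Rightarrow> 'b::real_normed_vector"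
  proof -
    obtain L D where L: "0 \<le> L" "0 \<le> D" "\<And>x. norm x \<le> r \<Longrightarrow> norm (f x) \<le> D"
      "\<And>x z. norm x \<le> r \<Longrightarrow> norm z \<le> r \<Longrightarrow> norm (f x - f z) \<le> L * norm (x - z)"
      using lipschitz_on_boundedD[OF f, of r] by blast
    have "norm (f (y s) - f (y s')) \<le> (D + L * B) * \<bar>s - s'\<bar>" if s: "\<bar>s\<bar> \<le> \<bar>T\<bar>" "\<bar>s'\<bar> \<le> \<bar>T\<bar>" for s s'
    proof -
      have "norm (f (y s) - f (y s')) \<le> L * norm (y s - y s')" by (intro L r s)
      also have "\<dots> \<le> L * (B * \<bar>s - s'\<bar>)" by (intro mult_left_mono ylip s L)
      also have "\<dots> \<le> (D + L * B) * \<bar>s - s'\<bar>" using L by (simp add: algebra_simps)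
      finally show ?thesis .
    qed
    moreover have "norm (f (y s)) \<le> D + L * B" if "\<bar>s\<bar> \<le> \<bar>T\<bar>" for s
      using L(3)[OF r[OF that]] L B by (simp add: add_increasing2)
    ultimately show ?thesis using L B by (intro exI[of _ "D + L * B"]) auto
  qed
  have Jl: "lipschitz_on_bounded (\<lambda>y::lag_state. lag_J y)"
    by (rule lipschitz_on_bounded_linear[OF bounded_linear_fst lipschitz_on_bounded_id])
  have Kl: "lipschitz_on_bounded (\<lambda>y::lag_state. lag_K y)"
    by (intro lipschitz_on_bounded_linear[OF bounded_linear_fst] lipschitz_on_bounded_linear[OF bounded_linear_snd]
        lipschitz_on_bounded_id)
  obtain C1 where C1: "C1 \<ge> 0" "\<forall>s. \<bar>s\<bar> \<le> \<bar>T\<bar> \<longrightarrow> norm (lag_J (y s)) \<le> C1" using bd[OF Jl] by blast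
  obtain C2 where C2: "C2 \<ge> 0" "\<forall>s. \<bar>s\<bar> \<le> \<bar>T\<bar> \<longrightarrow> norm (lag_K (y s)) \<le> C2" using bd[OF Kl] by blast
  obtain C3 where C3: "C3 \<ge> 0" "\<forall>s. \<bar>s\<bar> \<le> \<bar>T\<bar> \<longrightarrow> norm (lag_X (y s)) \<le> C3"
    "\<forall>s s'. \<bar>s\<bar> \<le> \<bar>T\<bar> \<longrightarrow> \<bar>s'\<bar> \<le> \<bar>T\<bar> \<longrightarrow> norm (lag_X (y s) - lag_X (y s')) \<le> C3 * \<bar>s - s'\<bar>"
    using bd[OF lipschitz_on_bounded_lag(2)] by blast
  obtain C4 where C4: "C4 \<ge> 0" "\<forall>s. \<bar>s\<bar> \<le> \<bar>T\<bar> \<longrightarrow> norm (lag_W (y s)) \<le> C4"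
    "\<forall>s s'. \<bar>s\<bar> \<le> \<bar>T\<bar> \<longrightarrow> \<bar>s'\<bar> \<le> \<bar>T\<bar> \<longrightarrow> norm (lag_W (y s) - lag_W (y s')) \<le> C4 * \<bar>s - s'\<bar>"
    using bd[OF lipschitz_on_bounded_lag(3)] by blast
  obtain C5 where C5: "C5 \<ge> 0" "\<forall>s. \<bar>s\<bar> \<le> \<bar>T\<bar> \<longrightarrow> norm (lag_V (y s)) \<le> C5"
    "\<forall>s s'. \<bar>s\<bar> \<le> \<bar>T\<bar> \<longrightarrow> \<bar>s'\<bar> \<le> \<bar>T\<bar> \<longrightarrow> norm (lag_V (y s) - lag_V (y s')) \<le> C5 * \<bar>s - s'\<bar>"
    using bd[OF lipschitz_on_bounded_lag(4)] by blast
  obtain C6 where C6: "C6 \<ge> 0" "\<forall>s. \<bar>s\<bar> \<le> \<bar>T\<bar> \<longrightarrow> norm (lag_m (y s)) \<le> C6"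
    using bd[OF lipschitz_on_bounded_lag(5)] by blast
  obtain C7 where C7: "C7 \<ge> 0" "\<forall>s. \<bar>s\<bar> \<le> \<bar>T\<bar> \<longrightarrow> norm (lag_a (y s)) \<le> C7"
    using bd[OF lipschitz_on_bounded_lag(6)] by blast
  obtain C8 where C8: "C8 \<ge> 0"
    "\<forall>s s'. \<bar>s\<bar> \<le> \<bar>T\<bar> \<longrightarrow> \<bar>s'\<bar> \<le> \<bar>T\<bar> \<longrightarrow> norm (lag_mu (y s) - lag_mu (y s')) \<le> C8 * \<bar>s - s'\<bar>"
    using bd[OF lipschitz_on_bounded_lag(7)] by blast
  define C where "C = 1 + C1 + C2 + C3 + C4 + C5 + C6 + C7 + C8"
  have le: "C1 \<le> C" "C2 \<le> C" "C3 \<le> C" "C4 \<le> C" "C5 \<le> C" "C6 \<le> C" "C7 \<le> C" "C8 \<le> C" "1 \<le> C"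
    using C1(1) C2(1) C3(1) C4(1) C5(1) C6(1) C7(1) C8(1) by (auto simp: C_def)
  have mono: "z \<le> C * \<bar>s\<bar>" if "z \<le> D * \<bar>s\<bar>" "D \<le> C" for z D s :: real
    using that mult_right_mono[OF that(2), of "\<bar>s\<bar>"] by simp
  show ?thesis
  proof (rule that[of C])
    show "1 \<le> C" by (rule le)
    fix s assume s: "\<bar>s\<bar> \<le> \<bar>T\<bar>"
    show "norm (J s) \<le> C" "norm (K s) \<le> C" "norm (X s) \<le> C" "norm (W s) \<le> C" "norm (V s) \<le> C" "norm (m s) \<le> C" "norm (a s) \<le> C"
      unfolding state_defs using C1(2) C2(2) C3(2) C4(2) C5(2) C6(2) C7(2) s le by (meson order.trans)+
    fix s' assume s': "\<bar>s'\<bar> \<le> \<bar>T\<bar>"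
    show "norm (X s - X s') \<le> C * \<bar>s - s'\<bar>" unfolding state_defs by (rule mono[OF _ le(3)]) (use C3(3) s s' in blast)
    show "norm (W s - W s') \<le> C * \<bar>s - s'\<bar>" unfolding state_defs by (rule mono[OF _ le(4)]) (use C4(3) s s' in blast)
    show "norm (V s - V s') \<le> C * \<bar>s - s'\<bar>" unfolding state_defs by (rule mono[OF _ le(5)]) (use C5(3) s s' in blast)
    show "norm (\<mu> s - \<mu> s') \<le> C * \<bar>s - s'\<bar>" unfolding state_defs by (rule mono[OF _ le(8)]) (use C8(2) s s' in blast)
  qed
qed

lemma apply_has_derivative:
  "(f has_vector_derivative f') (at t) \<Longrightarrow> ((\<lambda>t. apply_bcontfun (f t) \<xi>) has_real_derivative apply_bcontfun f' \<xi>) (at t)"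
  for f :: "real \<Rightarrow> (real \<Rightarrow>\<^sub>C real)"
  unfolding has_real_derivative_iff_has_vector_derivative
  by (rule bounded_linear.has_vector_derivative[OF bounded_linear_apply_bcontfun])

lemma dJ_apply: "t \<in> time_interval \<tau> \<Longrightarrow> ((\<lambda>t. J t \<xi>) has_real_derivative (- k * a t \<xi>) * J t \<xi>) (at t)"
  using apply_has_derivative[OF dJ] by (simp add: mult.assoc)

lemma dK_apply: "t \<in> time_interval \<tau> \<Longrightarrow> ((\<lambda>t. K t \<xi>) has_real_derivative (k * a t \<xi>) * K t \<xi>) (at t)"
  using apply_has_derivative[OF dK] by (simp add: mult.assoc)

lemma dW_apply: "t \<in> time_interval \<tau> \<Longrightarrow> ((\<lambda>t. W t \<xi>) has_real_derivative
    k * ((pi - X t \<xi>) / 2 * W t \<xi> - (W t \<xi>)\<^sup>2 + (V t \<xi> + m t) / 2)) (at t)"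
  using apply_has_derivative[OF dW(1)] by (simp add: dW(2))

lemma J_K_square_bounds:
  assumes t: "t \<in> time_interval \<tau>" and C: "\<And>s. \<bar>s\<bar> \<le> \<bar>t\<bar> \<Longrightarrow> \<bar>a s \<xi>\<bar> \<le> C"
  shows "exp (- (2 * (k * C) * \<bar>t\<bar>)) \<le> (J t \<xi>)\<^sup>2" "(J t \<xi>)\<^sup>2 \<le> exp (2 * (k * C) * \<bar>t\<bar>)"
    "(K t \<xi>)\<^sup>2 \<le> (K0 \<xi>)\<^sup>2 * exp (2 * (k * C) * \<bar>t\<bar>)"
proof -
  have le: "\<bar>- k * a s \<xi>\<bar> \<le> k * C" "\<bar>k * a s \<xi>\<bar> \<le> k * C" if "\<bar>s\<bar> \<le> \<bar>t\<bar>" for s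
    using C[OF that] time_rate(1) by (auto simp: abs_mult intro: mult_left_mono)
  have "(J 0 \<xi>)\<^sup>2 * exp (- (2 * (k * C) * \<bar>t\<bar>)) \<le> (J t \<xi>)\<^sup>2 \<and> (J t \<xi>)\<^sup>2 \<le> (J 0 \<xi>)\<^sup>2 * exp (2 * (k * C) * \<bar>t\<bar>)"
    using mem_interval[OF _ t] le
    by (intro linear_ode_square_bounds[where b = "\<lambda>s. - k * a s \<xi>" and T = "\<bar>t\<bar>"] dJ_apply) auto
  then show "exp (- (2 * (k * C) * \<bar>t\<bar>)) \<le> (J t \<xi>)\<^sup>2" "(J t \<xi>)\<^sup>2 \<le> exp (2 * (k * C) * \<bar>t\<bar>)"
    by (simp_all add: initial)
  have "(K 0 \<xi>)\<^sup>2 * exp (- (2 * (k * C) * \<bar>t\<bar>)) \<le> (K t \<xi>)\<^sup>2 \<and> (K t \<xi>)\<^sup>2 \<le> (K 0 \<xi>)\<^sup>2 * exp (2 * (k * C) * \<bar>t\<bar>)"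
    using mem_interval[OF _ t] le
    by (intro linear_ode_square_bounds[where b = "\<lambda>s. k * a s \<xi>" and T = "\<bar>t\<bar>"] dK_apply) auto
  then show "(K t \<xi>)\<^sup>2 \<le> (K0 \<xi>)\<^sup>2 * exp (2 * (k * C) * \<bar>t\<bar>)"
    by (simp add: initial)
qed

lemma J_lower_bound:
  assumes t: "t \<in> time_interval \<tau>" and C: "\<And>s. \<bar>s\<bar> \<le> \<bar>t\<bar> \<Longrightarrow> norm (a s) \<le> C"
  shows "exp (- (k * C * \<bar>t\<bar>)) \<le> J t \<xi>"
proof -
  have C': "\<bar>a s \<xi>\<bar> \<le> C" if "\<bar>s\<bar> \<le> \<bar>t\<bar>" for s
    using C[OF that] norm_bounded[of "a s" \<xi>] by simp
  have ne: "J s \<xi> \<noteq> 0" if s: "\<bar>s\<bar> \<le> \<bar>t\<bar>" for s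
  proof -
    have "exp (- (2 * (k * C) * \<bar>s\<bar>)) \<le> (J s \<xi>)\<^sup>2"
      using s by (intro J_K_square_bounds(1) mem_interval[OF s t] C') auto
    moreover have "0 < exp (- (2 * (k * C) * \<bar>s\<bar>))" by simp
    ultimately have "0 < (J s \<xi>)\<^sup>2" by linarith
    then show ?thesis by auto
  qed
  have pos: "0 < J t \<xi>"
  proof (rule ccontr)
    assume "\<not> 0 < J t \<xi>"
    have "continuous_on {-\<bar>t\<bar>..\<bar>t\<bar>} (\<lambda>s. J s \<xi>)"
      using mem_interval[OF _ t] by (intro continuous_at_imp_continuous_on ballI DERIV_isCont[OF dJ_apply]) auto
    then have c: "connected ((\<lambda>s. J s \<xi>) ` {-\<bar>t\<bar>..\<bar>t\<bar>})"
      by (rule connected_continuous_image) simp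
    have "J t \<xi> \<in> (\<lambda>s. J s \<xi>) ` {-\<bar>t\<bar>..\<bar>t\<bar>}"
      by (rule image_eqI[where x = t]) auto
    moreover have "J 0 \<xi> \<in> (\<lambda>s. J s \<xi>) ` {-\<bar>t\<bar>..\<bar>t\<bar>}"
      by (rule image_eqI[where x = 0]) auto
    ultimately have mem: "J t \<xi> \<in> (\<lambda>s. J s \<xi>) ` {-\<bar>t\<bar>..\<bar>t\<bar>}" "J 0 \<xi> \<in> (\<lambda>s. J s \<xi>) ` {-\<bar>t\<bar>..\<bar>t\<bar>}" .
    from connected_contains_Icc[OF c mem] have "{J t \<xi>..1} \<subseteq> (\<lambda>s. J s \<xi>) ` {-\<bar>t\<bar>..\<bar>t\<bar>}"
      by (simp add: initial)
    moreover have "0 \<in> {J t \<xi>..1}" using \<open>\<not> 0 < J t \<xi>\<close> by simp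
    ultimately obtain s where "\<bar>s\<bar> \<le> \<bar>t\<bar>" "J s \<xi> = 0" by (force simp: abs_le_iff)
    then show False using ne by blast
  qed
  have "(exp (- (k * C * \<bar>t\<bar>)))\<^sup>2 = exp (- (2 * (k * C) * \<bar>t\<bar>))"
    by (simp add: power2_eq_square exp_add[symmetric])
  also have "\<dots> \<le> (J t \<xi>)\<^sup>2" by (rule J_K_square_bounds(1)[OF t C'])
  finally have "(exp (- (k * C * \<bar>t\<bar>)))\<^sup>2 \<le> (J t \<xi>)\<^sup>2" .
  then show ?thesis by (rule power2_le_imp_le) (use pos in simp)
qed

lemma linear_integral: "linear (\<lambda>f :: real \<Rightarrow>\<^sub>C real. integral {0..2*pi} f)"
  by (intro bounded_linear.linear bounded_linear_integral_bcontfun) simp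

lemma integral_force:
  "integral {0..2*pi} (bmul (force t) (J t)) = m t * (X t (2*pi) - 2 * pi)"
proof -
  define A where "A = bmul (V t + 2 *\<^sub>R bmul (W t) (W t)) (J t)"
  have "bmul (force t) (J t) = A + m t *\<^sub>R J t"
    by (rule bcontfun_eqI) (simp add: force_def A_def algebra_simps)
  then have "integral {0..2*pi} (bmul (force t) (J t)) = integral {0..2*pi} A + m t * integral {0..2*pi} (J t)"
    using linear_add[OF linear_integral] linear_scale[OF linear_integral] by (metis real_scaleR_def)
  also have "integral {0..2*pi} A = - 2 * pi * m t" by (simp add: m_eq A_def)
  also have "integral {0..2*pi} (J t) = X t (2 * pi)" by (simp add: X_eq)
  also have "- 2 * pi * m t + m t * X t (2 * pi) = m t * (X t (2*pi) - 2 * pi)" by (simp add: algebra_simps)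
  finally show ?thesis .
qed

text \<open>Both identities hold initially. Their defects satisfy a homogeneous linear system: the velocity at
  \<open>X = 2\<pi>\<close> vanishes up to these defects, and \<open>m\<close> is chosen to make \<open>V (2\<pi>)\<close> stationary when
  \<open>X (2\<pi>) = 2\<pi>\<close>.\<close>

lemma invariants:
  assumes t: "t \<in> time_interval \<tau>"
  shows "X t (2*pi) = 2 * pi" "V t (2*pi) = 0"
proof -
  obtain C where C: "1 \<le> C" "\<And>s. \<bar>s\<bar> \<le> \<bar>t\<bar> \<Longrightarrow> norm (X s) \<le> C" "\<And>s. \<bar>s\<bar> \<le> \<bar>t\<bar> \<Longrightarrow> norm (m s) \<le> C"
    using state_bounds[OF t] by metis
  define f where "f s = (X s (2*pi) - 2 * pi, V s (2*pi))" for s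
  define f' where "f' s = (k * (X s (2*pi) / 4 * (X s (2*pi) - 2 * pi) + 2 * V s (2*pi)), k / 2 * (m s * (X s (2*pi) - 2 * pi)))" for s
  have "f t = 0"
  proof (rule linear_differential_inequality_zero[where f' = f' and T = "\<bar>t\<bar>" and C = "k * (2 * C + 2)"])
    fix s assume s: "\<bar>s\<bar> \<le> \<bar>t\<bar>"
    have sI: "s \<in> time_interval \<tau>" by (rule mem_interval[OF s t])
    have "((\<lambda>t. X t (2*pi)) has_real_derivative - (k * (X s (2*pi) * (2 * pi - X s (2*pi)) / 4 - 2 * V s (2*pi)))) (at s)"
      using apply_has_derivative[OF dX(1)[OF sI], of "2*pi"] dX(2)[OF sI, of "2*pi"] by simp
    then have 1: "((\<lambda>t. X t (2*pi) - 2 * pi) has_real_derivative k * (X s (2*pi) / 4 * (X s (2*pi) - 2 * pi) + 2 * V s (2*pi))) (at s)"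
      by (auto intro!: derivative_eq_intros simp: field_simps)
    have 2: "((\<lambda>t. V t (2*pi)) has_real_derivative k / 2 * (m s * (X s (2*pi) - 2 * pi))) (at s)"
      using apply_has_derivative[OF dV[OF sI], of "2*pi"] integral_force[of s] by simp
    show "(f has_vector_derivative f' s) (at s)"
      unfolding f_def[abs_def] f'_def
      using 1 2 unfolding has_real_derivative_iff_has_vector_derivative by (intro has_vector_derivative_Pair)
    have e: "\<bar>X s (2*pi) - 2 * pi\<bar> \<le> norm (f s)" "\<bar>V s (2*pi)\<bar> \<le> norm (f s)"
      using norm_fst_le[of "X s (2*pi) - 2 * pi" "V s (2*pi)"] norm_snd_le[of "V s (2*pi)" "X s (2*pi) - 2 * pi"]
      by (auto simp: f_def)
    have Xb: "\<bar>X s (2*pi)\<bar> \<le> C" "\<bar>m s\<bar> \<le> C"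
      using C(2)[OF s] norm_bounded[of "X s" "2*pi"] C(3)[OF s] by auto
    have "norm (f' s) \<le> \<bar>k * (X s (2*pi) / 4 * (X s (2*pi) - 2 * pi) + 2 * V s (2*pi))\<bar> + \<bar>k / 2 * (m s * (X s (2*pi) - 2 * pi))\<bar>"
      unfolding f'_def by (rule order.trans[OF norm_Pair_le]) simp
    also have "\<dots> = k * \<bar>X s (2*pi) / 4 * (X s (2*pi) - 2 * pi) + 2 * V s (2*pi)\<bar> + k * (1/2 * (\<bar>m s\<bar> * \<bar>X s (2*pi) - 2 * pi\<bar>))"
      using time_rate(1) by (simp add: abs_mult)
    also have "\<dots> \<le> k * (C * norm (f s) + 2 * norm (f s)) + k * (1 * (C * norm (f s)))"
    proof (intro add_mono mult_left_mono)
      have "\<bar>X s (2*pi) / 4 * (X s (2*pi) - 2 * pi) + 2 * V s (2*pi)\<bar> \<le> \<bar>X s (2*pi)\<bar> / 4 * \<bar>X s (2*pi) - 2 * pi\<bar> + 2 * \<bar>V s (2*pi)\<bar>"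
        using abs_triangle_ineq[of "X s (2*pi) / 4 * (X s (2*pi) - 2 * pi)" "2 * V s (2*pi)"] by (simp add: abs_mult)
      also have "\<dots> \<le> C * norm (f s) + 2 * norm (f s)"
        using e Xb C(1) by (intro add_mono mult_mono mult_left_mono) auto
      finally show "\<bar>X s (2*pi) / 4 * (X s (2*pi) - 2 * pi) + 2 * V s (2*pi)\<bar> \<le> C * norm (f s) + 2 * norm (f s)" .
      have "\<bar>m s\<bar> * \<bar>X s (2*pi) - 2 * pi\<bar> \<le> C * norm (f s)"
        using e Xb C(1) by (intro mult_mono) auto
      moreover have "0 \<le> \<bar>m s\<bar> * \<bar>X s (2*pi) - 2 * pi\<bar>" by simp
      ultimately show "1/2 * (\<bar>m s\<bar> * \<bar>X s (2*pi) - 2 * pi\<bar>) \<le> 1 * (C * norm (f s))"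
        by linarith
    qed (use time_rate(1) in auto)
    finally show "norm (f' s) \<le> k * (2 * C + 2) * norm (f s)" by (simp add: algebra_simps)
  next
    have "V 0 (2*pi) = 0" using initial(5)[of "2*pi"] mean0 by (simp add: state_defs)
    then show "f 0 = 0" using initial(4)[of "2*pi"] by (simp add: f_def zero_prod_def)
  qed simp
  then show "X t (2*pi) = 2 * pi" "V t (2*pi) = 0" by (auto simp: f_def zero_prod_def)
qed

lemma J_pos:
  assumes t: "t \<in> time_interval \<tau>"
  shows "0 < J t \<xi>"
proof -
  obtain C where "\<And>s. \<bar>s\<bar> \<le> \<bar>t\<bar> \<Longrightarrow> norm (a s) \<le> C" using state_bounds[OF t] by metis
  from J_lower_bound[OF t this] have "exp (- (k * C * \<bar>t\<bar>)) \<le> J t \<xi>" by blast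
  then show ?thesis using exp_gt_zero[of "- (k * C * \<bar>t\<bar>)"] by linarith
qed

end

section \<open>From Lagrangian variables to solutions\<close>

context lagrangian_solution begin

lemma X_primitive: "primitive_on (2*pi) (X t) (J t)"
  and W_primitive: "primitive_on (2*pi) (W t) (K t)"
  using space_derivatives by (auto intro!: primitive_on_has_derivative)

text \<open>All constants are merged into one, so that later estimates can be read as statements about
  Lipschitz continuity only.\<close>

lemma uniform_bounds:
  assumes T: "T \<in> time_interval \<tau>"
  obtains C where "1 \<le> C"
    "\<And>s \<xi>. \<bar>s\<bar> \<le> \<bar>T\<bar> \<Longrightarrow> 1 / C \<le> J s \<xi>" "\<And>s \<xi>. \<bar>s\<bar> \<le> \<bar>T\<bar> \<Longrightarrow> \<bar>K s \<xi>\<bar> \<le> C"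
    "\<And>s \<xi>. \<bar>s\<bar> \<le> \<bar>T\<bar> \<Longrightarrow> \<bar>W s \<xi>\<bar> \<le> C" "\<And>s \<xi>. \<bar>s\<bar> \<le> \<bar>T\<bar> \<Longrightarrow> \<bar>J s \<xi>\<bar> \<le> C"
    "\<And>s s' \<xi>. \<bar>s\<bar> \<le> \<bar>T\<bar> \<Longrightarrow> \<bar>s'\<bar> \<le> \<bar>T\<bar> \<Longrightarrow> \<bar>X s \<xi> - X s' \<xi>\<bar> \<le> C * \<bar>s - s'\<bar>"
    "\<And>s s' \<xi>. \<bar>s\<bar> \<le> \<bar>T\<bar> \<Longrightarrow> \<bar>s'\<bar> \<le> \<bar>T\<bar> \<Longrightarrow> \<bar>W s \<xi> - W s' \<xi>\<bar> \<le> C * \<bar>s - s'\<bar>"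
    "\<And>s s' \<xi>. \<bar>s\<bar> \<le> \<bar>T\<bar> \<Longrightarrow> \<bar>s'\<bar> \<le> \<bar>T\<bar> \<Longrightarrow> \<bar>V s \<xi> - V s' \<xi>\<bar> \<le> C * \<bar>s - s'\<bar>"
    "\<And>s s'. \<bar>s\<bar> \<le> \<bar>T\<bar> \<Longrightarrow> \<bar>s'\<bar> \<le> \<bar>T\<bar> \<Longrightarrow> \<bar>\<mu> s - \<mu> s'\<bar> \<le> C * \<bar>s - s'\<bar>"
proof -
  obtain B where B: "1 \<le> B" and
    bJ: "\<And>s. \<bar>s\<bar> \<le> \<bar>T\<bar> \<Longrightarrow> norm (J s) \<le> B" and bK: "\<And>s. \<bar>s\<bar> \<le> \<bar>T\<bar> \<Longrightarrow> norm (K s) \<le> B" and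
    "\<And>s. \<bar>s\<bar> \<le> \<bar>T\<bar> \<Longrightarrow> norm (X s) \<le> B" and bW: "\<And>s. \<bar>s\<bar> \<le> \<bar>T\<bar> \<Longrightarrow> norm (W s) \<le> B" and
    "\<And>s. \<bar>s\<bar> \<le> \<bar>T\<bar> \<Longrightarrow> norm (V s) \<le> B" "\<And>s. \<bar>s\<bar> \<le> \<bar>T\<bar> \<Longrightarrow> norm (m s) \<le> B" and ba: "\<And>s. \<bar>s\<bar> \<le> \<bar>T\<bar> \<Longrightarrow> norm (a s) \<le> B" and
    lX: "\<And>s s'. \<bar>s\<bar> \<le> \<bar>T\<bar> \<Longrightarrow> \<bar>s'\<bar> \<le> \<bar>T\<bar> \<Longrightarrow> norm (X s - X s') \<le> B * \<bar>s - s'\<bar>" and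
    lW: "\<And>s s'. \<bar>s\<bar> \<le> \<bar>T\<bar> \<Longrightarrow> \<bar>s'\<bar> \<le> \<bar>T\<bar> \<Longrightarrow> norm (W s - W s') \<le> B * \<bar>s - s'\<bar>" and
    lV: "\<And>s s'. \<bar>s\<bar> \<le> \<bar>T\<bar> \<Longrightarrow> \<bar>s'\<bar> \<le> \<bar>T\<bar> \<Longrightarrow> norm (V s - V s') \<le> B * \<bar>s - s'\<bar>" and
    l\<mu>: "\<And>s s'. \<bar>s\<bar> \<le> \<bar>T\<bar> \<Longrightarrow> \<bar>s'\<bar> \<le> \<bar>T\<bar> \<Longrightarrow> norm (\<mu> s - \<mu> s') \<le> B * \<bar>s - s'\<bar>"
    by (fact state_bounds[OF T])
  define C where "C = max B (exp (k * B * \<bar>T\<bar>))"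
  have C: "B \<le> C" "exp (k * B * \<bar>T\<bar>) \<le> C" "1 \<le> C" using B by (auto simp: C_def)
  have pt: "\<bar>f \<xi>\<bar> \<le> D" if "norm f \<le> D" for f :: "real \<Rightarrow>\<^sub>C real" and \<xi> D
    using norm_bounded[of f \<xi>] that by simp
  have pd: "\<bar>f \<xi> - g \<xi>\<bar> \<le> D" if "norm (f - g) \<le> D" for f g :: "real \<Rightarrow>\<^sub>C real" and \<xi> D
    using norm_bounded[of "f - g" \<xi>] that by simp
  have mono: "z \<le> C * \<bar>s\<bar>" if "z \<le> B * \<bar>s\<bar>" for z s :: real
    using that mult_right_mono[OF C(1), of "\<bar>s\<bar>"] by simp
  show ?thesis
  proof (rule that[of C])
    show "1 \<le> C" by fact
    fix s \<xi> assume s: "\<bar>s\<bar> \<le> \<bar>T\<bar>"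
    have "exp (- (k * B * \<bar>s\<bar>)) \<le> J s \<xi>"
      using s by (intro J_lower_bound mem_interval[OF s T] ba) auto
    moreover have "exp (- (k * B * \<bar>T\<bar>)) \<le> exp (- (k * B * \<bar>s\<bar>))"
      using s time_rate(1) B by simp
    moreover have "1 / C \<le> exp (- (k * B * \<bar>T\<bar>))"
      using C by (simp add: exp_minus field_simps)
    ultimately show "1 / C \<le> J s \<xi>" by linarith
    show "\<bar>K s \<xi>\<bar> \<le> C" "\<bar>W s \<xi>\<bar> \<le> C" "\<bar>J s \<xi>\<bar> \<le> C"
      using pt[OF bK[OF s]] pt[OF bW[OF s]] pt[OF bJ[OF s]] C(1) by (meson order.trans)+
    fix s' assume s': "\<bar>s'\<bar> \<le> \<bar>T\<bar>"
    show "\<bar>X s \<xi> - X s' \<xi>\<bar> \<le> C * \<bar>s - s'\<bar>" by (rule mono[OF pd[OF lX[OF s s']]])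
    show "\<bar>W s \<xi> - W s' \<xi>\<bar> \<le> C * \<bar>s - s'\<bar>" by (rule mono[OF pd[OF lW[OF s s']]])
    show "\<bar>V s \<xi> - V s' \<xi>\<bar> \<le> C * \<bar>s - s'\<bar>" by (rule mono[OF pd[OF lV[OF s s']]])
    show "\<bar>\<mu> s - \<mu> s'\<bar> \<le> C * \<bar>s - s'\<bar>" using mono[OF l\<mu>[OF s s']] by simp
  qed
qed

lemma X_increment:
  assumes c: "\<And>\<xi>. c \<le> J t \<xi>" and "0 \<le> \<xi>" "\<xi> \<le> \<xi>'" "\<xi>' \<le> 2*pi"
  shows "c * (\<xi>' - \<xi>) \<le> X t \<xi>' - X t \<xi>"
proof -
  have "integral {\<xi>..\<xi>'} (\<lambda>_. c) \<le> integral {\<xi>..\<xi>'} (J t)"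
    using c by (intro integral_le) auto
  then show ?thesis using primitive_on_diff_eq[OF X_primitive assms(2-4)] assms by (simp add: mult.commute)
qed

lemma X_strict_mono:
  assumes t: "t \<in> time_interval \<tau>" and "0 \<le> \<xi>" "\<xi> < \<xi>'" "\<xi>' \<le> 2*pi"
  shows "X t \<xi> < X t \<xi>'"
proof -
  obtain C where "1 \<le> C" "\<And>s \<xi>. \<bar>s\<bar> \<le> \<bar>t\<bar> \<Longrightarrow> 1 / C \<le> J s \<xi>" using uniform_bounds[OF t] by metis
  then have "1 / C * (\<xi>' - \<xi>) \<le> X t \<xi>' - X t \<xi>" "0 < 1 / C * (\<xi>' - \<xi>)"
    using assms by (intro X_increment mult_pos_pos; simp)+
  then show ?thesis by linarith
qed

lemma X_range:
  assumes t: "t \<in> time_interval \<tau>" and \<xi>: "\<xi> \<in> {0..2*pi}"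
  shows "X t \<xi> \<in> {0..2*pi}"
  using X_strict_mono[OF t, of 0 \<xi>] X_strict_mono[OF t, of \<xi> "2*pi"] \<xi> at_0 invariants[OF t]
  by (cases "\<xi> = 0"; cases "\<xi> = 2*pi") auto

text \<open>The inverse of \<open>X t\<close> on \<open>[0, 2\<pi>]\<close>.\<close>

definition label :: "real \<Rightarrow> real \<Rightarrow> real" where
  "label t x = (SOME \<xi>. \<xi> \<in> {0..2*pi} \<and> X t \<xi> = x)"

lemma label:
  assumes t: "t \<in> time_interval \<tau>" and x: "x \<in> {0..2*pi}"
  shows "label t x \<in> {0..2*pi}" "X t (label t x) = x"
proof -
  have "\<exists>\<xi>\<ge>0. \<xi> \<le> 2*pi \<and> X t \<xi> = x"
    using x at_0(1)[of t] invariants(1)[OF t] by (intro IVT') auto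
  then have "\<exists>\<xi>. \<xi> \<in> {0..2*pi} \<and> X t \<xi> = x" by auto
  from someI_ex[OF this] show "label t x \<in> {0..2*pi}" "X t (label t x) = x" by (auto simp: label_def)
qed

lemma label_X:
  assumes t: "t \<in> time_interval \<tau>" and \<xi>: "\<xi> \<in> {0..2*pi}"
  shows "label t (X t \<xi>) = \<xi>"
  using label[OF t X_range[OF t \<xi>]] X_strict_mono[OF t, of \<xi> "label t (X t \<xi>)"]
    X_strict_mono[OF t, of "label t (X t \<xi>)" \<xi>] \<xi>
  by (metis atLeastAtMost_iff less_irrefl linorder_neqE_linordered_idom)

lemma label_ends:
  assumes t: "t \<in> time_interval \<tau>"
  shows "label t 0 = 0" "label t (2*pi) = 2 * pi"
  using label_X[OF t, of 0] label_X[OF t, of "2*pi"] at_0 invariants[OF t] by auto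

lemma label_increment:
  assumes t: "t \<in> time_interval \<tau>" and C: "1 \<le> C" "\<And>\<xi>. 1 / C \<le> J t \<xi>" and \<xi>: "\<xi> \<in> {0..2*pi}" "\<xi>' \<in> {0..2*pi}"
  shows "\<bar>\<xi>' - \<xi>\<bar> \<le> C * \<bar>X t \<xi>' - X t \<xi>\<bar>"
proof -
  have *: "\<bar>\<xi>' - \<xi>\<bar> \<le> C * \<bar>X t \<xi>' - X t \<xi>\<bar>" if "\<xi> \<in> {0..2*pi}" "\<xi>' \<in> {0..2*pi}" "\<xi> \<le> \<xi>'" for \<xi> \<xi>'
  proof -
    have "1 / C * (\<xi>' - \<xi>) \<le> X t \<xi>' - X t \<xi>" using that by (intro X_increment C) auto
    then have "\<xi>' - \<xi> \<le> C * (X t \<xi>' - X t \<xi>)" using C(1) by (simp add: field_simps)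
    also have "\<dots> \<le> C * \<bar>X t \<xi>' - X t \<xi>\<bar>" using C(1) by (intro mult_left_mono) auto
    finally show ?thesis using that by simp
  qed
  show ?thesis using *[OF \<xi>] *[OF \<xi>(2,1)] by (cases "\<xi> \<le> \<xi>'") (auto simp: abs_minus_commute)
qed

lemma label_Lipschitz:
  assumes t: "t \<in> time_interval \<tau>" and C: "1 \<le> C" "\<And>\<xi>. 1 / C \<le> J t \<xi>" and x: "x \<in> {0..2*pi}" "x' \<in> {0..2*pi}"
  shows "\<bar>label t x' - label t x\<bar> \<le> C * \<bar>x' - x\<bar>"
  using label_increment[OF t C label(1)[OF t x(1)] label(1)[OF t x(2)]] label(2)[OF t] x by simp

lemma label_continuous:
  assumes t: "t \<in> time_interval \<tau>"
  shows "continuous_on {0..2*pi} (label t)"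
proof -
  obtain C where C: "1 \<le> C" "\<And>s \<xi>. \<bar>s\<bar> \<le> \<bar>t\<bar> \<Longrightarrow> 1 / C \<le> J s \<xi>" using uniform_bounds[OF t] by metis
  have "C-lipschitz_on {0..2*pi} (label t)"
    using C label_Lipschitz[OF t C(1)] by (intro lipschitz_onI) (auto simp: dist_real_def)
  then show ?thesis by (rule lipschitz_on_continuous_on)
qed

text \<open>Substitution \<open>x = X t \<xi>\<close>, with the Jacobian \<open>J t\<close>.\<close>

lemma change_of_variables:
  fixes h :: "real \<Rightarrow>\<^sub>C real"
  assumes t: "t \<in> time_interval \<tau>"
  shows "primitive_on (2*pi) (\<lambda>x. bprim (bmul h (J t)) (label t x)) (\<lambda>x. h (label t x))"
    "integral {0..2*pi} (\<lambda>x. h (label t x)) = integral {0..2*pi} (bmul h (J t))"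
proof -
  define g where "g = (\<lambda>x. h (label t x))"
  have g: "continuous_on {0..2*pi} g"
    unfolding g_def by (rule continuous_on_compose2[OF continuous_on_apply_bcontfun[of UNIV] label_continuous[OF t]]) auto
  define G where "G = (\<lambda>x. integral {0..x} g)"
  have G: "(G has_real_derivative g x) (at x within {0..2*pi})" if "x \<in> {0..2*pi}" for x
    unfolding G_def has_real_derivative_iff_has_vector_derivative by (rule integral_has_vector_derivative[OF g that])
  have GX: "((\<lambda>\<xi>. G (X t \<xi>)) has_real_derivative bmul h (J t) \<xi>) (at \<xi> within {0..2*pi})" if \<xi>: "\<xi> \<in> {0..2*pi}" for \<xi>
  proof -
    have "(G has_real_derivative g (X t \<xi>)) (at (X t \<xi>) within X t ` {0..2*pi})"
      using X_range[OF t] by (intro DERIV_subset[OF G[OF X_range[OF t \<xi>]]]) auto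
    from DERIV_image_chain[OF this space_derivatives(1)[OF \<xi>]]
    show ?thesis by (simp add: o_def g_def label_X[OF t \<xi>])
  qed
  have eq: "bprim (bmul h (J t)) \<xi> = G (X t \<xi>)" if "\<xi> \<in> {0..2*pi}" for \<xi>
  proof -
    have "primitive_on (2*pi) (\<lambda>\<xi>. G (X t \<xi>)) (bmul h (J t))"
      by (rule primitive_on_has_derivative[OF GX continuous_on_apply_bcontfun])
    from primitive_on_eq[OF this that] show ?thesis using that at_0[of t] by (simp add: G_def)
  qed
  have "primitive_on (2*pi) G g"
    unfolding G_def by (intro primitive_on_indefinite_integral absolutely_integrable_continuous_real g)
  then show "primitive_on (2*pi) (\<lambda>x. bprim (bmul h (J t)) (label t x)) (\<lambda>x. h (label t x))"
    unfolding g_def[symmetric]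
    by (rule primitive_on_cong) (use eq[OF label(1)[OF t]] label(2)[OF t] in simp)
  show "integral {0..2*pi} (\<lambda>x. h (label t x)) = integral {0..2*pi} (bmul h (J t))"
    using eq[of "2*pi"] invariants(1)[OF t] by (simp add: G_def g_def)
qed

definition slope :: "real \<Rightarrow> real \<Rightarrow> real" where "slope t x = W t (label t x)"
definition profile :: "real \<Rightarrow> real \<Rightarrow> real" where "profile t x = V t (label t x) - \<mu> t"
definition zeta :: "real \<Rightarrow> real \<Rightarrow> real" where "zeta t = periodize (profile t)"

lemma slope_continuous: "t \<in> time_interval \<tau> \<Longrightarrow> continuous_on {0..2*pi} (slope t)"
  unfolding slope_def
  by (rule continuous_on_compose2[OF continuous_on_apply_bcontfun[of UNIV] label_continuous]) auto

lemma profile_primitive: "t \<in> time_interval \<tau> \<Longrightarrow> primitive_on (2*pi) (profile t) (slope t)"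
  using primitive_on_diff[OF change_of_variables(1)[of t "W t"] primitive_on_const[of "2*pi" "\<mu> t"]]
  by (simp add: profile_def[abs_def] slope_def[abs_def] V_eq)

lemma zeta_eq: "t \<in> time_interval \<tau> \<Longrightarrow> x \<in> {0..2*pi} \<Longrightarrow> zeta t x = profile t x"
  unfolding zeta_def by (intro periodize_eq') (simp_all add: profile_def label_ends at_0 invariants)

lemma zeta_lipschitz_periodic:
  assumes t: "t \<in> time_interval \<tau>"
  shows "lipschitz_periodic (zeta t) (slope t)"
  unfolding lipschitz_periodic_def
proof (intro conjI)
  show "periodic_2pi (zeta t)" unfolding zeta_def by (rule periodize_periodic)
  show "primitive_on (2*pi) (zeta t) (slope t)"
    by (rule primitive_on_cong[OF profile_primitive[OF t]]) (simp add: zeta_eq[OF t])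
  show "bounded_measurable (2*pi) (slope t)" by (rule bounded_measurable_continuous[OF slope_continuous[OF t]])
qed

text \<open>In the Eulerian variable the slope is Lipschitz in both time and space. In time this requires
  comparing values along one particle and then moving back to the same position.\<close>

lemma eulerian_bounds:
  assumes T: "T \<in> time_interval \<tau>"
  obtains C where "1 \<le> C" "\<And>s x. \<bar>s\<bar> \<le> \<bar>T\<bar> \<Longrightarrow> x \<in> {0..2*pi} \<Longrightarrow> \<bar>slope s x\<bar> \<le> C"
    "\<And>s x x'. \<bar>s\<bar> \<le> \<bar>T\<bar> \<Longrightarrow> x \<in> {0..2*pi} \<Longrightarrow> x' \<in> {0..2*pi} \<Longrightarrow> \<bar>slope s x - slope s x'\<bar> \<le> C * \<bar>x - x'\<bar>"
    "\<And>s s' x. \<bar>s\<bar> \<le> \<bar>T\<bar> \<Longrightarrow> \<bar>s'\<bar> \<le> \<bar>T\<bar> \<Longrightarrow> x \<in> {0..2*pi} \<Longrightarrow> \<bar>slope s x - slope s' x\<bar> \<le> C * \<bar>s - s'\<bar>"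
    "\<And>s s' x. \<bar>s\<bar> \<le> \<bar>T\<bar> \<Longrightarrow> \<bar>s'\<bar> \<le> \<bar>T\<bar> \<Longrightarrow> x \<in> {0..2*pi} \<Longrightarrow> \<bar>profile s x - profile s' x\<bar> \<le> C * \<bar>s - s'\<bar>"
    "\<And>s s' \<xi>. \<bar>s\<bar> \<le> \<bar>T\<bar> \<Longrightarrow> \<bar>s'\<bar> \<le> \<bar>T\<bar> \<Longrightarrow> \<bar>X s \<xi> - X s' \<xi>\<bar> \<le> C * \<bar>s - s'\<bar>"
proof -
  obtain C where C: "1 \<le> C" and cJ: "\<And>s \<xi>. \<bar>s\<bar> \<le> \<bar>T\<bar> \<Longrightarrow> 1 / C \<le> J s \<xi>" and cK: "\<And>s \<xi>. \<bar>s\<bar> \<le> \<bar>T\<bar> \<Longrightarrow> \<bar>K s \<xi>\<bar> \<le> C"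
    and cW: "\<And>s \<xi>. \<bar>s\<bar> \<le> \<bar>T\<bar> \<Longrightarrow> \<bar>W s \<xi>\<bar> \<le> C" and "\<And>s \<xi>. \<bar>s\<bar> \<le> \<bar>T\<bar> \<Longrightarrow> \<bar>J s \<xi>\<bar> \<le> C"
    and lX: "\<And>s s' \<xi>. \<bar>s\<bar> \<le> \<bar>T\<bar> \<Longrightarrow> \<bar>s'\<bar> \<le> \<bar>T\<bar> \<Longrightarrow> \<bar>X s \<xi> - X s' \<xi>\<bar> \<le> C * \<bar>s - s'\<bar>"
    and lW: "\<And>s s' \<xi>. \<bar>s\<bar> \<le> \<bar>T\<bar> \<Longrightarrow> \<bar>s'\<bar> \<le> \<bar>T\<bar> \<Longrightarrow> \<bar>W s \<xi> - W s' \<xi>\<bar> \<le> C * \<bar>s - s'\<bar>"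
    and lV: "\<And>s s' \<xi>. \<bar>s\<bar> \<le> \<bar>T\<bar> \<Longrightarrow> \<bar>s'\<bar> \<le> \<bar>T\<bar> \<Longrightarrow> \<bar>V s \<xi> - V s' \<xi>\<bar> \<le> C * \<bar>s - s'\<bar>"
    and l\<mu>: "\<And>s s'. \<bar>s\<bar> \<le> \<bar>T\<bar> \<Longrightarrow> \<bar>s'\<bar> \<le> \<bar>T\<bar> \<Longrightarrow> \<bar>\<mu> s - \<mu> s'\<bar> \<le> C * \<bar>s - s'\<bar>"
    by (fact uniform_bounds[OF T])
  have mem: "s \<in> time_interval \<tau>" if "\<bar>s\<bar> \<le> \<bar>T\<bar>" for s by (rule mem_interval[OF that T])
  have P: "\<bar>slope s x\<bar> \<le> C" if "\<bar>s\<bar> \<le> \<bar>T\<bar>" for s x using cW[OF that] by (simp add: slope_def)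
  have Px: "\<bar>slope s x - slope s x'\<bar> \<le> C * C * \<bar>x - x'\<bar>"
    if s: "\<bar>s\<bar> \<le> \<bar>T\<bar>" and x: "x \<in> {0..2*pi}" "x' \<in> {0..2*pi}" for s x x'
  proof -
    have "\<bar>slope s x - slope s x'\<bar> \<le> C * \<bar>label s x - label s x'\<bar>"
      unfolding slope_def by (rule primitive_on_Lipschitz[OF W_primitive cK[OF s]]) (use label[OF mem[OF s]] x in auto)
    also have "\<dots> \<le> C * (C * \<bar>x - x'\<bar>)"
      using C by (intro mult_left_mono label_Lipschitz[OF mem[OF s] C cJ[OF s]] x) auto
    finally show ?thesis by simp
  qed
  have Pt: "\<bar>slope s x - slope s' x\<bar> \<le> (C + C * C * C) * \<bar>s - s'\<bar>"
    and Zt: "\<bar>profile s x - profile s' x\<bar> \<le> (2 * C + C * C) * \<bar>s - s'\<bar>"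
    if s: "\<bar>s\<bar> \<le> \<bar>T\<bar>" "\<bar>s'\<bar> \<le> \<bar>T\<bar>" and x: "x \<in> {0..2*pi}" for s s' x
  proof -
    \<comment> \<open>follow the particle that is at \<open>x\<close> at time \<open>s\<close>\<close>
    define \<xi> where "\<xi> = label s x"
    define z where "z = X s' \<xi>"
    have \<xi>: "\<xi> \<in> {0..2*pi}" "X s \<xi> = x" using label[OF mem[OF s(1)] x] by (auto simp: \<xi>_def)
    have z: "z \<in> {0..2*pi}" "label s' z = \<xi>" "\<bar>z - x\<bar> \<le> C * \<bar>s - s'\<bar>"
      using X_range[OF mem[OF s(2)] \<xi>(1)] label_X[OF mem[OF s(2)] \<xi>(1)] lX[OF s, of \<xi>] \<xi>(2)
      by (auto simp: z_def abs_minus_commute)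
    have "slope s x - slope s' x = (W s \<xi> - W s' \<xi>) + (slope s' z - slope s' x)"
      by (simp add: slope_def z(2) \<xi>_def)
    also have "\<bar>\<dots>\<bar> \<le> C * \<bar>s - s'\<bar> + C * C * \<bar>z - x\<bar>"
      by (rule order.trans[OF abs_triangle_ineq]) (intro add_mono lW s Px z x)
    also have "\<dots> \<le> C * \<bar>s - s'\<bar> + C * C * (C * \<bar>s - s'\<bar>)"
      using C z(3) by (intro add_left_mono mult_left_mono) auto
    finally show "\<bar>slope s x - slope s' x\<bar> \<le> (C + C * C * C) * \<bar>s - s'\<bar>" by (simp add: algebra_simps)
    have "profile s x - profile s' x = ((V s \<xi> - V s' \<xi>) + (\<mu> s' - \<mu> s)) + (profile s' z - profile s' x)"
      by (simp add: profile_def z(2) \<xi>_def)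
    also have "\<bar>\<dots>\<bar> \<le> (C * \<bar>s - s'\<bar> + C * \<bar>s' - s\<bar>) + C * \<bar>z - x\<bar>"
      by (rule order.trans[OF abs_triangle_ineq], rule add_mono, rule order.trans[OF abs_triangle_ineq])
        (intro add_mono lV l\<mu> s primitive_on_Lipschitz[OF profile_primitive[OF mem[OF s(2)]] P[OF s(2)]] x z)+
    also have "\<dots> \<le> (C * \<bar>s - s'\<bar> + C * \<bar>s' - s\<bar>) + C * (C * \<bar>s - s'\<bar>)"
      using C z(3) by (intro add_left_mono mult_left_mono) auto
    finally show "\<bar>profile s x - profile s' x\<bar> \<le> (2 * C + C * C) * \<bar>s - s'\<bar>"
      by (simp add: algebra_simps abs_minus_commute)
  qed
  define D where "D = C * C + (C + C * C * C) + (2 * C + C * C)"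
  have pos: "0 \<le> C * C" "0 \<le> C * C * C" using C by auto
  have D: "C \<le> D" "C * C \<le> D" "C + C * C * C \<le> D" "2 * C + C * C \<le> D" "1 \<le> D"
    using C pos unfolding D_def by linarith+
  have mono: "z \<le> D * \<bar>s\<bar>" if "z \<le> E * \<bar>s\<bar>" "E \<le> D" for z s E :: real
    using that mult_right_mono[OF that(2), of "\<bar>s\<bar>"] by simp
  show ?thesis
  proof (rule that[of D])
    show "1 \<le> D" by fact
    show "\<bar>slope s x\<bar> \<le> D" if "\<bar>s\<bar> \<le> \<bar>T\<bar>" for s x using P[OF that, of x] D(1) by linarith
    show "\<bar>slope s x - slope s x'\<bar> \<le> D * \<bar>x - x'\<bar>"
      if "\<bar>s\<bar> \<le> \<bar>T\<bar>" "x \<in> {0..2*pi}" "x' \<in> {0..2*pi}" for s x x'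
      by (rule mono[OF Px[OF that] D(2)])
    show "\<bar>slope s x - slope s' x\<bar> \<le> D * \<bar>s - s'\<bar>"
      if "\<bar>s\<bar> \<le> \<bar>T\<bar>" "\<bar>s'\<bar> \<le> \<bar>T\<bar>" "x \<in> {0..2*pi}" for s s' x
      by (rule mono[OF Pt[OF that] D(3)])
    show "\<bar>profile s x - profile s' x\<bar> \<le> D * \<bar>s - s'\<bar>"
      if "\<bar>s\<bar> \<le> \<bar>T\<bar>" "\<bar>s'\<bar> \<le> \<bar>T\<bar>" "x \<in> {0..2*pi}" for s s' x
      by (rule mono[OF Zt[OF that] D(4)])
    show "\<bar>X s \<xi> - X s' \<xi>\<bar> \<le> D * \<bar>s - s'\<bar>" if "\<bar>s\<bar> \<le> \<bar>T\<bar>" "\<bar>s'\<bar> \<le> \<bar>T\<bar>" for s s' \<xi>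
      by (rule mono[OF lX[OF that] D(1)])
  qed
qed

end

context lagrangian_solution begin

lemma larger_time:
  assumes "t \<in> time_interval \<tau>"
  obtains T where "T \<in> time_interval \<tau>" "\<bar>t\<bar> < T"
proof -
  obtain T where T: "ereal \<bar>t\<bar> < ereal T" "ereal T < \<tau>"
    using assms ereal_dense2[of "ereal \<bar>t\<bar>" \<tau>] by (auto simp: time_interval_def)
  then have "\<bar>t\<bar> < T" "\<bar>T\<bar> = T" by auto
  then show ?thesis using T that[of T] by (simp add: time_interval_def)
qed

lemma eventually_abs_le:
  assumes "\<bar>t\<bar> < (T::real)"
  shows "eventually (\<lambda>s. \<bar>s\<bar> \<le> \<bar>T\<bar>) (at t within S)" "eventually (\<lambda>h. \<bar>t + h\<bar> \<le> \<bar>T\<bar>) (at 0)"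
proof -
  have "eventually (\<lambda>s. s \<in> {-T<..<T}) (at t within S)"
    by (rule topological_tendstoD[OF tendsto_ident_at]) (use assms in auto)
  then show "eventually (\<lambda>s. \<bar>s\<bar> \<le> \<bar>T\<bar>) (at t within S)" by eventually_elim auto
  have "((\<lambda>h. t + h) \<longlongrightarrow> t + 0) (at 0)" by (intro tendsto_intros)
  then have "eventually (\<lambda>h. t + h \<in> {-T<..<T}) (at 0)"
    using assms by (intro topological_tendstoD) auto
  then show "eventually (\<lambda>h. \<bar>t + h\<bar> \<le> \<bar>T\<bar>) (at 0)" by eventually_elim auto
qed

lemma zeta_continuous: "continuous_H1_W1inf (time_interval \<tau>) zeta"
  unfolding continuous_H1_W1inf_def
proof (intro ballI conjI)
  fix t assume t: "t \<in> time_interval \<tau>"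
  show "zeta t \<in> H1_per \<inter> W1inf_per"
    using lipschitz_periodic_spaces[OF zeta_lipschitz_periodic[OF t]] by blast
  obtain T where T: "T \<in> time_interval \<tau>" "\<bar>t\<bar> < T" using larger_time[OF t] .
  obtain C where C: "1 \<le> C" and "\<And>s x. \<bar>s\<bar> \<le> \<bar>T\<bar> \<Longrightarrow> x \<in> {0..2*pi} \<Longrightarrow> \<bar>slope s x\<bar> \<le> C"
    "\<And>s x x'. \<bar>s\<bar> \<le> \<bar>T\<bar> \<Longrightarrow> x \<in> {0..2*pi} \<Longrightarrow> x' \<in> {0..2*pi} \<Longrightarrow> \<bar>slope s x - slope s x'\<bar> \<le> C * \<bar>x - x'\<bar>"
    and P: "\<And>s s' x. \<bar>s\<bar> \<le> \<bar>T\<bar> \<Longrightarrow> \<bar>s'\<bar> \<le> \<bar>T\<bar> \<Longrightarrow> x \<in> {0..2*pi} \<Longrightarrow> \<bar>slope s x - slope s' x\<bar> \<le> C * \<bar>s - s'\<bar>"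
    and Z: "\<And>s s' x. \<bar>s\<bar> \<le> \<bar>T\<bar> \<Longrightarrow> \<bar>s'\<bar> \<le> \<bar>T\<bar> \<Longrightarrow> x \<in> {0..2*pi} \<Longrightarrow> \<bar>profile s x - profile s' x\<bar> \<le> C * \<bar>s - s'\<bar>"
    and "\<And>s s' \<xi>. \<bar>s\<bar> \<le> \<bar>T\<bar> \<Longrightarrow> \<bar>s'\<bar> \<le> \<bar>T\<bar> \<Longrightarrow> \<bar>X s \<xi> - X s' \<xi>\<bar> \<le> C * \<bar>s - s'\<bar>"
    by (fact eulerian_bounds[OF T(1)])
  have bnd: "0 \<le> H1_norm (\<lambda>x. zeta s x - zeta t x) \<and> H1_norm (\<lambda>x. zeta s x - zeta t x) \<le> (4 * C) * \<bar>s - t\<bar> \<and>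
    0 \<le> W1inf_norm (\<lambda>x. zeta s x - zeta t x) \<and> W1inf_norm (\<lambda>x. zeta s x - zeta t x) \<le> (2 * C) * \<bar>s - t\<bar>"
    if s: "\<bar>s\<bar> \<le> \<bar>T\<bar>" for s
  proof -
    have sI: "s \<in> time_interval \<tau>" by (rule mem_interval[OF s T(1)])
    have tT: "\<bar>t\<bar> \<le> \<bar>T\<bar>" using T by simp
    note l = lipschitz_periodic_diff[OF zeta_lipschitz_periodic[OF sI] zeta_lipschitz_periodic[OF t]]
    have 1: "\<bar>zeta s x - zeta t x\<bar> \<le> C * \<bar>s - t\<bar>" "\<bar>slope s x - slope t x\<bar> \<le> C * \<bar>s - t\<bar>" if "x \<in> {0..2*pi}" for x
      using Z[OF s tT that] P[OF s tT that] by (simp_all add: zeta_eq[OF sI that] zeta_eq[OF t that])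
    have "0 \<le> W1inf_norm (\<lambda>x. zeta s x - zeta t x)"
      using abs_le_W1inf_norm(2)[OF l, of 0] by simp
    moreover have "0 \<le> H1_norm (\<lambda>x. zeta s x - zeta t x)" by (simp add: H1_norm_def)
    moreover have "H1_norm (\<lambda>x. zeta s x - zeta t x) \<le> 4 * (C * \<bar>s - t\<bar>)" by (rule H1_norm_le[OF l 1])
    moreover have "W1inf_norm (\<lambda>x. zeta s x - zeta t x) \<le> C * \<bar>s - t\<bar> + C * \<bar>s - t\<bar>" by (rule W1inf_norm_le[OF l 1])
    ultimately show ?thesis by simp
  qed
  have lim: "((\<lambda>s. D * \<bar>s - t\<bar>) \<longlongrightarrow> 0) (at t within time_interval \<tau>)" for D
    by (rule tendsto_eq_intros refl | simp)+
  note ev = eventually_abs_le(1)[OF T(2), of "time_interval \<tau>"]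
  show "((\<lambda>s. H1_norm (\<lambda>x. zeta s x - zeta t x)) \<longlongrightarrow> 0) (at t within time_interval \<tau>)"
    by (rule tendsto_sandwich[OF _ _ tendsto_const lim[of "4 * C"]]) (use ev bnd in \<open>auto elim: eventually_mono\<close>)
  show "((\<lambda>s. W1inf_norm (\<lambda>x. zeta s x - zeta t x)) \<longlongrightarrow> 0) (at t within time_interval \<tau>)"
    by (rule tendsto_sandwich[OF _ _ tendsto_const lim[of "2 * C"]]) (use ev bnd in \<open>auto elim: eventually_mono\<close>)
qed

lemma integral_WJ: "t \<in> time_interval \<tau> \<Longrightarrow> integral {0..2*pi} (bmul (W t) (J t)) = 0"
  using invariants(2)[of t] by (simp add: V_eq)

text \<open>The integrand is the derivative of \<open>V\<^sup>2 / 2\<close>.\<close>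

lemma integral_WVJ:
  assumes t: "t \<in> time_interval \<tau>"
  shows "integral {0..2*pi} (bmul (bmul (W t) (V t)) (J t)) = 0"
proof -
  have "primitive_on (2*pi) (\<lambda>\<xi>. (V t \<xi>)\<^sup>2 / 2) (bmul (bmul (W t) (V t)) (J t))"
  proof (rule primitive_on_has_derivative[OF _ continuous_on_apply_bcontfun])
    fix \<xi> assume \<xi>: "\<xi> \<in> {0..2*pi}"
    show "((\<lambda>\<xi>. (V t \<xi>)\<^sup>2 / 2) has_real_derivative bmul (bmul (W t) (V t)) (J t) \<xi>) (at \<xi> within {0..2*pi})"
      by (rule derivative_eq_intros space_derivatives(3)[OF \<xi>] refl | simp)+
  qed
  from primitive_on_eq[OF this, of "2*pi"] show ?thesis using invariants(2)[OF t] at_0 by simp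
qed

text \<open>The antiderivative that appears in the nonlocal term, expressed in labels.\<close>

definition "force_prim t = bprim (bmul (force t) (J t))"

definition "mean_rate t = (1 / (2 * pi)) * integral {0..2*pi}
  (bmul (V t) (- (k *\<^sub>R bmul (a t) (J t))) + bmul ((k / 2) *\<^sub>R force_prim t) (J t))"

text \<open>The time derivative of \<open>\<zeta>\<close> at a fixed position: the derivative of \<open>V - \<mu>\<close> along the particle minus
  the convective term.\<close>

definition "rate t x = (k / 2) * force_prim t (label t x) - mean_rate t
   + slope t x * (k * (x * (2 * pi - x) / 4 - 2 * V t (label t x)))"

lemma d\<mu>: assumes "t \<in> time_interval \<tau>" shows "(\<mu> has_vector_derivative mean_rate t) (at t)"
proof -
  have bl: "bounded_linear (\<lambda>f :: real \<Rightarrow>\<^sub>C real. (1 / (2 * pi)) * integral {0..2*pi} f)"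
    using bounded_linear_compose[OF bounded_linear_mult_right[of "1 / (2 * pi)"] bounded_linear_integral_bcontfun[of 0 "2*pi"]]
    by simp
  show ?thesis
    unfolding \<mu>_eq[abs_def] mean_rate_def
    using dV[OF assms] unfolding force_prim_def[symmetric]
    by (intro bounded_linear.has_vector_derivative[OF bl]
        bounded_bilinear.has_vector_derivative[OF bounded_bilinear_bmul] dJ assms)
qed

lemma rate_continuous:
  assumes t: "t \<in> time_interval \<tau>"
  shows "continuous_on {0..2*pi} (rate t)" "rate t 0 = rate t (2*pi)"
proof -
  have c: "continuous_on {0..2*pi} (\<lambda>x. f (label t x))" for f :: "real \<Rightarrow>\<^sub>C real"
    by (rule continuous_on_compose2[OF continuous_on_apply_bcontfun[of UNIV] label_continuous[OF t]]) auto
  show "continuous_on {0..2*pi} (rate t)"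
    unfolding rate_def by (intro continuous_intros c slope_continuous t) simp_all
  have "force_prim t (2*pi) = 0" using integral_force[of t] invariants[OF t] by (simp add: force_prim_def)
  then show "rate t 0 = rate t (2*pi)"
    by (simp add: rate_def label_ends[OF t] invariants[OF t] at_0) (simp add: force_prim_def)
qed

text \<open>The difference quotient at a fixed position converges uniformly. It is compared with the one along the
  particle, and the displacement is absorbed by a Taylor expansion of \<open>\<zeta>\<close> in \<open>x\<close>, which is of second order
  because the slope is Lipschitz.\<close>

lemma zeta_has_time_deriv:
  assumes t: "t \<in> time_interval \<tau>"
  shows "has_time_deriv zeta (periodize (rate t)) t"
proof -
  define D where "D = periodize (rate t)"
  have D: "D x = rate t x" if "x \<in> {0..2*pi}" for x
    unfolding D_def using that rate_continuous(2)[OF t] by (rule periodize_eq'[rotated])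
  have Dper: "periodic_2pi D" unfolding D_def by (rule periodize_periodic)
  have Dc: "continuous_on {0..2*pi} D" using rate_continuous(1)[OF t] by (rule continuous_on_eq) (simp add: D)
  have "D \<in> borel_measurable torus"
    using periodic_continuous[OF Dper Dc] by (intro continuous_imp_measurable_on_sets_lebesgue) (auto intro: continuous_on_subset)
  moreover have "(\<lambda>x. (D x)\<^sup>2) absolutely_integrable_on {0..2*pi}"
    by (intro absolutely_integrable_continuous_real continuous_intros Dc)
  ultimately have DL2: "D \<in> L2_per"
    using Dper by (simp add: L2_per_def integrable_torus_iff periodic_2pi_power)
  obtain T where T: "T \<in> time_interval \<tau>" "\<bar>t\<bar> < T" using larger_time[OF t] .
  have tT: "\<bar>t\<bar> \<le> \<bar>T\<bar>" using T by simp
  obtain C where C: "1 \<le> C" and Pb: "\<And>s x. \<bar>s\<bar> \<le> \<bar>T\<bar> \<Longrightarrow> x \<in> {0..2*pi} \<Longrightarrow> \<bar>slope s x\<bar> \<le> C"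
    and Px: "\<And>s x x'. \<bar>s\<bar> \<le> \<bar>T\<bar> \<Longrightarrow> x \<in> {0..2*pi} \<Longrightarrow> x' \<in> {0..2*pi} \<Longrightarrow> \<bar>slope s x - slope s x'\<bar> \<le> C * \<bar>x - x'\<bar>"
    and Pt: "\<And>s s' x. \<bar>s\<bar> \<le> \<bar>T\<bar> \<Longrightarrow> \<bar>s'\<bar> \<le> \<bar>T\<bar> \<Longrightarrow> x \<in> {0..2*pi} \<Longrightarrow> \<bar>slope s x - slope s' x\<bar> \<le> C * \<bar>s - s'\<bar>"
    and "\<And>s s' x. \<bar>s\<bar> \<le> \<bar>T\<bar> \<Longrightarrow> \<bar>s'\<bar> \<le> \<bar>T\<bar> \<Longrightarrow> x \<in> {0..2*pi} \<Longrightarrow> \<bar>profile s x - profile s' x\<bar> \<le> C * \<bar>s - s'\<bar>"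
    and lX: "\<And>s s' \<xi>. \<bar>s\<bar> \<le> \<bar>T\<bar> \<Longrightarrow> \<bar>s'\<bar> \<le> \<bar>T\<bar> \<Longrightarrow> \<bar>X s \<xi> - X s' \<xi>\<bar> \<le> C * \<bar>s - s'\<bar>"
    by (fact eulerian_bounds[OF T(1)])
  define V' where "V' = (k / 2) *\<^sub>R force_prim t"
  define X' where "X' = - (k *\<^sub>R bprim (bmul (a t) (J t)))"
  define eV where "eV h = norm ((V (t + h) - V t) /\<^sub>R h - V')" for h
  define eX where "eX h = norm ((X (t + h) - X t) /\<^sub>R h - X')" for h
  define e\<mu> where "e\<mu> h = norm ((\<mu> (t + h) - \<mu> t) /\<^sub>R h - mean_rate t)" for h
  define E where "E h = eV h + e\<mu> h + C * eX h + (C * C * C + C * C) * \<bar>h\<bar>" for h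
  have "(eV \<longlongrightarrow> 0) (at 0)" "(eX \<longlongrightarrow> 0) (at 0)" "(e\<mu> \<longlongrightarrow> 0) (at 0)"
    unfolding eV_def eX_def e\<mu>_def V'_def X'_def force_prim_def
    by (intro difference_quotient_tendsto dV dX d\<mu> t)+
  then have "(E \<longlongrightarrow> 0 + 0 + C * 0 + (C * C * C + C * C) * \<bar>0\<bar>) (at 0)"
    unfolding E_def by (intro tendsto_intros)
  then have E0: "((\<lambda>h. 3 * E h) \<longlongrightarrow> 0) (at 0)" by (auto intro!: tendsto_eq_intros)
  have bound: "\<bar>(zeta (t + h) x - zeta t x) / h - D x\<bar> \<le> E h"
    if h: "h \<noteq> 0" "\<bar>t + h\<bar> \<le> \<bar>T\<bar>" and x: "x \<in> {0..2*pi}" for h x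
  proof -
    have thI: "t + h \<in> time_interval \<tau>" by (rule mem_interval[OF h(2) T(1)])
    \<comment> \<open>compare both times along the particle that is at \<open>x\<close> at time \<open>t\<close>\<close>
    define \<xi> where "\<xi> = label t x"
    define z where "z = X (t + h) \<xi>"
    have \<xi>: "\<xi> \<in> {0..2*pi}" "X t \<xi> = x" using label[OF t x] by (auto simp: \<xi>_def)
    have z: "z \<in> {0..2*pi}" "label (t + h) z = \<xi>" "\<bar>z - x\<bar> \<le> C * \<bar>h\<bar>"
      using X_range[OF thI \<xi>(1)] label_X[OF thI \<xi>(1)] lX[OF h(2) tT, of \<xi>] \<xi>(2) by (auto simp: z_def)
    define r where "r = profile (t + h) z - profile (t + h) x - slope t x * (z - x)"
    have "r = (profile (t + h) z - profile (t + h) x - slope (t + h) x * (z - x)) + (slope (t + h) x - slope t x) * (z - x)"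
      by (simp add: r_def algebra_simps)
    also have "\<bar>\<dots>\<bar> \<le> C * (z - x)\<^sup>2 + (C * \<bar>h\<bar>) * \<bar>z - x\<bar>"
    proof (rule order.trans[OF abs_triangle_ineq], rule add_mono)
      show "\<bar>profile (t + h) z - profile (t + h) x - slope (t + h) x * (z - x)\<bar> \<le> C * (z - x)\<^sup>2"
        using C by (intro primitive_on_taylor_bound[OF profile_primitive[OF thI] Px[OF h(2)]] x z) auto
      have "\<bar>slope (t + h) x - slope t x\<bar> \<le> C * \<bar>h\<bar>" using Pt[OF h(2) tT x] by simp
      then show "\<bar>(slope (t + h) x - slope t x) * (z - x)\<bar> \<le> C * \<bar>h\<bar> * \<bar>z - x\<bar>"
        unfolding abs_mult by (intro mult_right_mono) auto
    qed
    also have "\<dots> = C * (\<bar>z - x\<bar> * \<bar>z - x\<bar>) + (C * \<bar>h\<bar>) * \<bar>z - x\<bar>"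
      by (simp add: power2_eq_square abs_mult_self_eq)
    also have "\<dots> \<le> C * ((C * \<bar>h\<bar>) * (C * \<bar>h\<bar>)) + (C * \<bar>h\<bar>) * (C * \<bar>h\<bar>)"
      using C z(3) by (intro add_mono mult_left_mono mult_mono) auto
    also have "\<dots> = ((C * C * C + C * C) * \<bar>h\<bar>) * \<bar>h\<bar>" by (simp add: algebra_simps)
    finally have r: "\<bar>r / h\<bar> \<le> (C * C * C + C * C) * \<bar>h\<bar>"
      using h(1) by (simp add: abs_divide divide_le_eq)
    have X'\<xi>: "X' \<xi> = - (k * (x * (2 * pi - x) / 4 - 2 * V t \<xi>))"
      unfolding X'_def using dX(2)[OF t, of \<xi>] \<xi>(2) by (simp del: bprim_apply)
    have zd: "zeta (t + h) x - zeta t x = (V (t + h) \<xi> - V t \<xi>) - (\<mu> (t + h) - \<mu> t) - slope t x * (z - x) - r"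
    proof -
      have "profile (t + h) z = V (t + h) \<xi> - \<mu> (t + h)" "profile t x = V t \<xi> - \<mu> t"
        by (simp_all only: profile_def z(2) \<xi>_def)
      then show ?thesis
        unfolding zeta_eq[OF thI x] zeta_eq[OF t x] r_def by (simp add: algebra_simps)
    qed
    have a1: "((V (t + h) - V t) /\<^sub>R h - V') \<xi> = (V (t + h) \<xi> - V t \<xi>) / h - (k / 2) * force_prim t \<xi>"
      unfolding V'_def minus_bcontfun.rep_eq scaleR_bcontfun.rep_eq real_scaleR_def divide_inverse[of _ h]
      by (simp only: mult.commute)
    have a2: "((X (t + h) - X t) /\<^sub>R h - X') \<xi> = (z - x) / h + k * (x * (2 * pi - x) / 4 - 2 * V t \<xi>)"
      unfolding minus_bcontfun.rep_eq scaleR_bcontfun.rep_eq X'\<xi> \<xi>(2) z_def[symmetric]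
      unfolding real_scaleR_def divide_inverse[of _ h] by (simp only: mult.commute diff_minus_eq_add)
    have "(zeta (t + h) x - zeta t x) / h - D x = ((V (t + h) - V t) /\<^sub>R h - V') \<xi>
        - ((\<mu> (t + h) - \<mu> t) /\<^sub>R h - mean_rate t) - slope t x * ((X (t + h) - X t) /\<^sub>R h - X') \<xi> - r / h"
    proof -
      have *: "(v - w - s * q - r) / h - (u - m + s * c) = (v / h - u) - (w / h - m) - s * (q / h + c) - r / h"
        for v w s q u m c :: real
        by (simp add: diff_divide_distrib distrib_left)
      show ?thesis
        unfolding zd D[OF x] rate_def \<xi>_def[symmetric] a1 a2 real_scaleR_def
        using *[of "V (t + h) \<xi> - V t \<xi>" "\<mu> (t + h) - \<mu> t" "slope t x" "z - x" "k / 2 * force_prim t \<xi>" "mean_rate t"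
            "k * (x * (2 * pi - x) / 4 - 2 * V t \<xi>)"]
        by (simp only: divide_inverse_commute[of "\<mu> (t + h) - \<mu> t" h])
    qed
    also have "\<bar>\<dots>\<bar> \<le> eV h + e\<mu> h + C * eX h + (C * C * C + C * C) * \<bar>h\<bar>"
    proof -
      have 1: "\<bar>((V (t + h) - V t) /\<^sub>R h - V') \<xi>\<bar> \<le> eV h" "\<bar>((X (t + h) - X t) /\<^sub>R h - X') \<xi>\<bar> \<le> eX h"
        unfolding eV_def eX_def using norm_bounded[of "(V (t + h) - V t) /\<^sub>R h - V'" \<xi>]
          norm_bounded[of "(X (t + h) - X t) /\<^sub>R h - X'" \<xi>] by (simp_all del: minus_bcontfun.rep_eq)
      have 2: "\<bar>(\<mu> (t + h) - \<mu> t) /\<^sub>R h - mean_rate t\<bar> \<le> e\<mu> h" by (simp add: e\<mu>_def)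
      have 3: "\<bar>slope t x * ((X (t + h) - X t) /\<^sub>R h - X') \<xi>\<bar> \<le> C * eX h"
        unfolding abs_mult using C by (intro mult_mono Pb[OF tT x] 1) auto
      show ?thesis using 1(1) 2 3 r by linarith
    qed
    finally show ?thesis by (simp add: E_def)
  qed
  have ev: "eventually (\<lambda>h. 0 \<le> L2_norm (\<lambda>x. (zeta (t + h) x - zeta t x) / h - D x) \<and>
      L2_norm (\<lambda>x. (zeta (t + h) x - zeta t x) / h - D x) \<le> 3 * E h) (at 0)"
    using eventually_abs_le(2)[OF T(2)] eventually_neq_at_within[of 0 0 UNIV]
  proof eventually_elim
    case (elim h)
    have thI: "t + h \<in> time_interval \<tau>" by (rule mem_interval[OF elim(1) T(1)])
    note z1 = lipschitz_periodicD[OF zeta_lipschitz_periodic[OF thI]] and z2 = lipschitz_periodicD[OF zeta_lipschitz_periodic[OF t]]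
    have per: "periodic_2pi (\<lambda>x. (zeta (t + h) x - zeta t x) / h - D x)"
      using z1(1) z2(1) Dper by (simp add: periodic_2pi_def)
    have c: "continuous_on {0..2*pi} (\<lambda>x. (zeta (t + h) x - zeta t x) / h - D x)"
      using elim by (intro continuous_intros Dc continuous_on_subset[OF z1(7)] continuous_on_subset[OF z2(7)]) auto
    show ?case using L2_norm_le[OF per c bound[OF elim(2,1)]] by blast
  qed
  have "((\<lambda>h. L2_norm (\<lambda>x. (zeta (t + h) x - zeta t x) / h - D x)) \<longlongrightarrow> 0) (at 0)"
    by (rule tendsto_sandwich[OF _ _ tendsto_const E0]) (use ev in \<open>auto elim: eventually_mono\<close>)
  then show ?thesis using DL2 by (simp add: has_time_deriv_def D_def)
qed

text \<open>The mean of \<open>\<zeta>\<close> evolves with the rate that is prescribed by the term with \<open>\<eta>\<^sub>*'\<close>; its contribution,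
  the constant of integration in the nonlocal term and \<open>mean_rate\<close> combine exactly.\<close>

lemma rate_eq_rhs:
  assumes t: "t \<in> time_interval \<tau>" and x: "x \<in> {0..2*pi}" "weak_deriv (zeta t) x = slope t x"
  shows "2 * c_star * rate t x = evolution_rhs (zeta t) x"
proof -
  note l = zeta_lipschitz_periodic[OF t]
  define N where "N = inv_deriv0 (\<lambda>y. zeta t y + 2 * (weak_deriv (zeta t) y)\<^sup>2)"
  define M where "M = integral {0..2*pi} (\<lambda>x. zeta t x + 2 * (slope t x)\<^sup>2) / (2*pi)"
  note ev = evolution_rhs_eq[OF l, folded N_def M_def]
  have cl: "continuous_on {0..2*pi} (\<lambda>x. f (label t x))" for f :: "real \<Rightarrow>\<^sub>C real"
    by (rule continuous_on_compose2[OF continuous_on_apply_bcontfun[of UNIV] label_continuous[OF t]]) auto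
  note ii = integrable_continuous_interval
  define h where "h = V t + 2 *\<^sub>R bmul (W t) (W t)"
  have hx: "zeta t x + 2 * (slope t x)\<^sup>2 = h (label t x) - \<mu> t" if "x \<in> {0..2*pi}" for x
    using that by (simp add: zeta_eq[OF t] profile_def slope_def h_def power2_eq_square)
  have "integral {0..2*pi} (\<lambda>x. zeta t x + 2 * (slope t x)\<^sup>2) = integral {0..2*pi} (\<lambda>x. h (label t x) - \<mu> t)"
    by (rule integral_cong) (rule hx)
  also have "\<dots> = integral {0..2*pi} (bmul h (J t)) - 2 * pi * \<mu> t"
    by (subst Henstock_Kurzweil_Integration.integral_diff) (auto intro: ii cl change_of_variables(2)[OF t])
  finally have M: "M = - m t - \<mu> t"
    by (simp add: M_def m_eq h_def[symmetric] diff_divide_distrib)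
  have Nx: "N x = N 0 + force_prim t (label t x)" if x: "x \<in> {0..2*pi}" for x
  proof -
    have "N x = N 0 + integral {0..x} (\<lambda>x. zeta t x + 2 * (slope t x)\<^sup>2 - M)" by (rule primitive_on_eq[OF ev(2) x])
    also have "integral {0..x} (\<lambda>x. zeta t x + 2 * (slope t x)\<^sup>2 - M) = integral {0..x} (\<lambda>x. force t (label t x))"
      by (rule integral_cong) (use hx x M in \<open>auto simp: force_def h_def\<close>)
    also have "\<dots> = force_prim t (label t x) - force_prim t (label t 0)"
      using primitive_on_eq[OF change_of_variables(1)[OF t, of "force t"] x] by (simp only: force_prim_def)
    also have "force_prim t (label t 0) = 0" by (simp add: label_ends[OF t] force_prim_def)
    finally show ?thesis by simp
  qed
  have N0: "N 0 = - integral {0..2*pi} (bmul (force_prim t) (J t)) / (2*pi)"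
  proof -
    have "0 = integral {0..2*pi} N" by (rule ev(3)[symmetric])
    also have "\<dots> = integral {0..2*pi} (\<lambda>x. N 0 + force_prim t (label t x))"
      by (rule integral_cong) (rule Nx)
    also have "\<dots> = 2 * pi * N 0 + integral {0..2*pi} (bmul (force_prim t) (J t))"
      by (subst Henstock_Kurzweil_Integration.integral_add) (auto intro: ii cl change_of_variables(2)[OF t])
    finally show ?thesis by (simp add: field_simps)
  qed
  define Q where "Q = const_bcontfun pi - X t"
  define A where "A = integral {0..2*pi} (bmul (bmul Q (V t)) (J t))"
  have A: "integral {0..2*pi} (\<lambda>y. (pi - y) * zeta t y) = A"
  proof -
    have "integral {0..2*pi} (\<lambda>y. (pi - y) * zeta t y) = integral {0..2*pi} (\<lambda>y. bmul Q (V t) (label t y) - \<mu> t * (pi - y))"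
      by (rule integral_cong) (simp add: zeta_eq[OF t] profile_def Q_def label(2)[OF t] algebra_simps)
    also have "\<dots> = integral {0..2*pi} (\<lambda>y. bmul Q (V t) (label t y)) - integral {0..2*pi} (\<lambda>y. \<mu> t * (pi - y))"
      by (intro Henstock_Kurzweil_Integration.integral_diff ii cl continuous_intros)
    also have "integral {0..2*pi} (\<lambda>y. \<mu> t * (pi - y)) = \<mu> t * integral {0..2*pi} (\<lambda>y. pi - y)"
      by (rule integral_mult_right)
    finally show ?thesis using integral_pi_minus change_of_variables(2)[OF t, of "bmul Q (V t)"] by (simp only: A_def mult_zero_right diff_zero)
  qed
  have "bmul (V t) (W t) = bmul (W t) (V t)" by (rule bcontfun_eqI) simp
  then have VWJ: "integral {0..2*pi} (bmul (bmul (V t) (W t)) (J t)) = 0" by (simp only: integral_WVJ[OF t])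
  have md: "mean_rate t = k / (4 * pi) * (integral {0..2*pi} (bmul (force_prim t) (J t)) - A)"
  proof -
    have "bmul (V t) (- (k *\<^sub>R bmul (a t) (J t))) + bmul ((k / 2) *\<^sub>R force_prim t) (J t)
        = (k / 2) *\<^sub>R bmul (force_prim t) (J t) - (k / 2) *\<^sub>R bmul (bmul Q (V t)) (J t) + (2 * k) *\<^sub>R bmul (bmul (V t) (W t)) (J t)"
      by (rule bcontfun_eqI) (simp add: a_apply Q_def field_simps del: bprim_apply)
    then have "integral {0..2*pi} (bmul (V t) (- (k *\<^sub>R bmul (a t) (J t))) + bmul ((k / 2) *\<^sub>R force_prim t) (J t))
        = (k / 2) * integral {0..2*pi} (bmul (force_prim t) (J t)) - (k / 2) * A + (2 * k) * integral {0..2*pi} (bmul (bmul (V t) (W t)) (J t))"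
      unfolding A_def by (simp only: linear_add[OF linear_integral] linear_diff[OF linear_integral] linear_scale[OF linear_integral] real_scaleR_def)
    then show ?thesis unfolding mean_rate_def VWJ by (simp only: mult_zero_right add_0_right) (simp add: field_simps del: bmul_apply)
  qed
  have zz: "zeta t x - zeta t 0 = V t (label t x)"
    using x by (simp add: zeta_eq[OF t] profile_def label_ends[OF t] at_0)
  have "rate t x = k * evolution_rhs (zeta t) x"
    unfolding ev(5)[OF x] A Nx[OF x(1)] N0 rate_def md zz by (simp add: field_simps del: bmul_apply)
  then show ?thesis using time_rate(2) by (simp add: mult.assoc[symmetric])
qed

theorem zeta_is_solution: "is_solution \<tau> (zeta 0) zeta"
  unfolding is_solution_def
proof (intro conjI ballI zeta_continuous refl)
  fix t assume t: "t \<in> time_interval \<tau>"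
  note l = zeta_lipschitz_periodic[OF t]
  show "\<exists>D. has_time_deriv zeta D t \<and> (AE x in torus. 2 * c_star * D x = evolution_rhs (zeta t) x)"
  proof (intro exI conjI)
    show "has_time_deriv zeta (periodize (rate t)) t" by (rule zeta_has_time_deriv[OF t])
    show "AE x in torus. 2 * c_star * periodize (rate t) x = evolution_rhs (zeta t) x"
    proof (subst AE_torus_iff)
      show "negligible {x \<in> {0..2*pi}. \<not> 2 * c_star * periodize (rate t) x = evolution_rhs (zeta t) x}"
        by (rule negligible_subset[OF lipschitz_periodicD(5)[OF l]])
          (use rate_eq_rhs[OF t] periodize_eq'[OF rate_continuous(2)[OF t]] in force)
    qed (simp add: periodic_2piD[OF evolution_rhs_eq(1)[OF l]] periodic_2piD[OF periodize_periodic])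
  qed
qed

end

section \<open>Square integrable functions on an interval\<close>

definition square_integrable :: "real \<Rightarrow> (real \<Rightarrow> real) \<Rightarrow> bool" where
  "square_integrable L f \<longleftrightarrow> f \<in> borel_measurable (lebesgue_on {0..L}) \<and> (\<lambda>x. (f x)\<^sup>2) integrable_on {0..L}"

lemma square_integrable_bounded: "bounded_measurable L f \<Longrightarrow> square_integrable L f"
  using bounded_measurable_integrable[OF bounded_measurable_power2[of L f]]
  by (simp add: square_integrable_def bounded_measurable_def absolutely_integrable_on_def)

lemma square_integrable_mult:
  assumes "square_integrable L f" "square_integrable L g"
  shows "(\<lambda>x. f x * g x) integrable_on {0..L}"
proof (rule measurable_bounded_by_integrable_imp_integrable_real)
  show "(\<lambda>x. f x * g x) \<in> borel_measurable (lebesgue_on {0..L})"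
    using assms by (auto simp: square_integrable_def)
  show "(\<lambda>x. ((f x)\<^sup>2 + (g x)\<^sup>2) / 2) integrable_on {0..L}"
    using assms by (auto simp: square_integrable_def intro!: integrable_add integrable_on_divide)
  show "\<bar>f x * g x\<bar> \<le> ((f x)\<^sup>2 + (g x)\<^sup>2) / 2" for x
  proof -
    have "0 \<le> (\<bar>f x\<bar> - \<bar>g x\<bar>)\<^sup>2" by simp
    then show ?thesis by (simp add: power2_diff abs_mult)
  qed
qed simp

lemma square_integrable_add:
  assumes "square_integrable L f" "square_integrable L g"
  shows "square_integrable L (\<lambda>x. f x + g x)"
proof -
  have "(\<lambda>x. (f x)\<^sup>2 + (g x)\<^sup>2 + 2 * (f x * g x)) integrable_on {0..L}"
    using assms square_integrable_mult[OF assms]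
    by (auto simp: square_integrable_def intro!: integrable_add integrable_on_mult_right)
  then show ?thesis using assms by (auto simp: square_integrable_def power2_sum mult.assoc)
qed

lemma square_integrable_cmult: "square_integrable L f \<Longrightarrow> square_integrable L (\<lambda>x. c * f x)"
  by (auto simp: square_integrable_def power_mult_distrib intro!: integrable_on_mult_right)

lemma square_integrable_diff:
  "square_integrable L f \<Longrightarrow> square_integrable L g \<Longrightarrow> square_integrable L (\<lambda>x. f x - g x)"
  using square_integrable_add[of L f "\<lambda>x. (-1) * g x"] square_integrable_cmult[of L g "-1"] by simp

lemma integral_square_nonneg: "0 \<le> integral {0..L} (\<lambda>x. (f x)\<^sup>2)" for f :: "real \<Rightarrow> real"
  by (cases "(\<lambda>x. (f x)\<^sup>2) integrable_on {0..L}")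
    (auto intro!: Henstock_Kurzweil_Integration.integral_nonneg simp: not_integrable_integral)

lemma square_integrable_subinterval:
  assumes "square_integrable L f" "L' \<le> L"
  shows "square_integrable L' f" "integral {0..L'} (\<lambda>x. (f x)\<^sup>2) \<le> integral {0..L} (\<lambda>x. (f x)\<^sup>2)"
proof -
  have i: "(\<lambda>x. (f x)\<^sup>2) integrable_on {0..L'}"
    by (rule integrable_on_subinterval[of _ "{0..L}"]) (use assms in \<open>auto simp: square_integrable_def\<close>)
  have "f \<in> borel_measurable (lebesgue_on {0..L'})"
    by (rule measurable_restrict_mono[of f lebesgue "{0..L}"]) (use assms in \<open>auto simp: square_integrable_def\<close>)
  then show "square_integrable L' f" using i by (simp add: square_integrable_def)
  show "integral {0..L'} (\<lambda>x. (f x)\<^sup>2) \<le> integral {0..L} (\<lambda>x. (f x)\<^sup>2)"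
    using i assms by (intro integral_subset_le) (auto simp: square_integrable_def)
qed

lemma square_integrable_shift:
  assumes f: "square_integrable L f" and h: "0 \<le> h" "h \<le> L"
  shows "square_integrable (L - h) (\<lambda>x. f (x + h))"
    "integral {0..L - h} (\<lambda>x. (f (x + h))\<^sup>2) \<le> integral {0..L} (\<lambda>x. (f x)\<^sup>2)"
proof -
  have "(\<lambda>x. if x \<in> {0..L} then f x else 0) \<in> borel_measurable lebesgue"
    using f by (subst borel_measurable_if) (auto simp: square_integrable_def)
  from borel_measurable_affine[OF this one_neq_zero, of h]
  have "(\<lambda>x. if x + h \<in> {0..L} then f (x + h) else 0) \<in> borel_measurable lebesgue"
    unfolding real_scaleR_def mult_1 add.commute[of h] .
  then have "(\<lambda>x. if x + h \<in> {0..L} then f (x + h) else 0) \<in> borel_measurable (lebesgue_on {0..L - h})"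
    by (rule measurable_restrict_space1)
  also have "?this \<longleftrightarrow> (\<lambda>x. f (x + h)) \<in> borel_measurable (lebesgue_on {0..L - h})"
    using h by (intro measurable_cong) (auto simp: space_restrict_space)
  finally have m: "(\<lambda>x. f (x + h)) \<in> borel_measurable (lebesgue_on {0..L - h})" .
  have i: "(\<lambda>x. (f x)\<^sup>2) integrable_on {h..L}"
    by (rule integrable_on_subinterval[of _ "{0..L}"]) (use f h in \<open>auto simp: square_integrable_def\<close>)
  then have "(\<lambda>x. (f (x + h))\<^sup>2) integrable_on {0..L - h}"
    using integrable_shift_cbox_iff[of "\<lambda>x. (f x)\<^sup>2" h h L] by simp
  then show "square_integrable (L - h) (\<lambda>x. f (x + h))" using m by (simp add: square_integrable_def)
  have "integral {0..L - h} (\<lambda>x. (f (x + h))\<^sup>2) = integral {h..L} (\<lambda>x. (f x)\<^sup>2)"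
    using integral_shift_real[of 0 "L - h" "\<lambda>x. (f x)\<^sup>2" h] by simp
  also have "\<dots> \<le> integral {0..L} (\<lambda>x. (f x)\<^sup>2)"
    using i f h by (intro integral_subset_le) (auto simp: square_integrable_def)
  finally show "integral {0..L - h} (\<lambda>x. (f (x + h))\<^sup>2) \<le> integral {0..L} (\<lambda>x. (f x)\<^sup>2)" .
qed

lemma integral_square_add:
  assumes f: "square_integrable L f" and g: "square_integrable L g"
  shows "integral {0..L} (\<lambda>x. (f x + c * g x)\<^sup>2)
    = integral {0..L} (\<lambda>x. (f x)\<^sup>2) + 2 * c * integral {0..L} (\<lambda>x. f x * g x) + c\<^sup>2 * integral {0..L} (\<lambda>x. (g x)\<^sup>2)"
proof -
  have "integral {0..L} (\<lambda>x. (f x + c * g x)\<^sup>2) = integral {0..L} (\<lambda>x. ((f x)\<^sup>2 + (2 * c) * (f x * g x)) + c\<^sup>2 * (g x)\<^sup>2)"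
    by (rule integral_cong) (simp add: power2_sum power_mult_distrib)
  also have "\<dots> = integral {0..L} (\<lambda>x. (f x)\<^sup>2 + (2 * c) * (f x * g x)) + integral {0..L} (\<lambda>x. c\<^sup>2 * (g x)\<^sup>2)"
    using f g square_integrable_mult[OF f g]
    by (intro Henstock_Kurzweil_Integration.integral_add integrable_add integrable_on_mult_right) (auto simp: square_integrable_def)
  also have "integral {0..L} (\<lambda>x. (f x)\<^sup>2 + (2 * c) * (f x * g x)) = integral {0..L} (\<lambda>x. (f x)\<^sup>2) + integral {0..L} (\<lambda>x. (2 * c) * (f x * g x))"
    using f square_integrable_mult[OF f g]
    by (intro Henstock_Kurzweil_Integration.integral_add integrable_on_mult_right) (auto simp: square_integrable_def)
  finally show ?thesis by simp
qed

lemma integral_Cauchy_Schwarz: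
  assumes f: "square_integrable L f" and g: "square_integrable L g"
  shows "(integral {0..L} (\<lambda>x. f x * g x))\<^sup>2 \<le> integral {0..L} (\<lambda>x. (f x)\<^sup>2) * integral {0..L} (\<lambda>x. (g x)\<^sup>2)"
proof -
  define A B I where "A = integral {0..L} (\<lambda>x. (f x)\<^sup>2)" and "B = integral {0..L} (\<lambda>x. (g x)\<^sup>2)"
    and "I = integral {0..L} (\<lambda>x. f x * g x)"
  have q: "0 \<le> A + 2 * c * I + c\<^sup>2 * B" for c
    unfolding A_def B_def I_def using integral_square_add[OF f g, of c] integral_square_nonneg by metis
  have AB: "0 \<le> A" "0 \<le> B" unfolding A_def B_def by (rule integral_square_nonneg)+
  have "I\<^sup>2 \<le> A * B"
  proof (cases "B = 0")
    case True
    have "I = 0"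
    proof (rule ccontr)
      assume "I \<noteq> 0"
      then show False using q[of "- (A + 1) / (2 * I)"] True by (simp add: field_simps)
    qed
    then show ?thesis using AB by simp
  next
    case False
    then show ?thesis using q[of "- I / B"] AB by (simp add: field_simps power2_eq_square)
  qed
  then show ?thesis by (simp add: A_def B_def I_def)
qed

lemma abs_integral_mult_le:
  assumes f: "square_integrable L f" and g: "square_integrable L g"
  shows "\<bar>integral {0..L} (\<lambda>x. f x * g x)\<bar> \<le> (integral {0..L} (\<lambda>x. (f x)\<^sup>2) + integral {0..L} (\<lambda>x. (g x)\<^sup>2)) / 2"
    "\<bar>integral {0..L} (\<lambda>x. f x * g x)\<bar> \<le> sqrt (integral {0..L} (\<lambda>x. (f x)\<^sup>2)) * sqrt (integral {0..L} (\<lambda>x. (g x)\<^sup>2))"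
proof -
  have "0 \<le> integral {0..L} (\<lambda>x. (f x + 1 * g x)\<^sup>2)" "0 \<le> integral {0..L} (\<lambda>x. (f x + (-1) * g x)\<^sup>2)"
    by (rule integral_square_nonneg)+
  then show "\<bar>integral {0..L} (\<lambda>x. f x * g x)\<bar> \<le> (integral {0..L} (\<lambda>x. (f x)\<^sup>2) + integral {0..L} (\<lambda>x. (g x)\<^sup>2)) / 2"
    unfolding integral_square_add[OF f g] by (simp add: abs_le_iff)
  have "\<bar>integral {0..L} (\<lambda>x. f x * g x)\<bar> = sqrt ((integral {0..L} (\<lambda>x. f x * g x))\<^sup>2)" by simp
  also have "\<dots> \<le> sqrt (integral {0..L} (\<lambda>x. (f x)\<^sup>2) * integral {0..L} (\<lambda>x. (g x)\<^sup>2))"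
    by (intro real_sqrt_le_mono integral_Cauchy_Schwarz f g)
  finally show "\<bar>integral {0..L} (\<lambda>x. f x * g x)\<bar> \<le> sqrt (integral {0..L} (\<lambda>x. (f x)\<^sup>2)) * sqrt (integral {0..L} (\<lambda>x. (g x)\<^sup>2))"
    by (simp add: real_sqrt_mult)
qed

lemma integral_square_sum_le:
  assumes f: "square_integrable L f" and g: "square_integrable L g"
  shows "integral {0..L} (\<lambda>x. (f x + g x)\<^sup>2) \<le> 2 * integral {0..L} (\<lambda>x. (f x)\<^sup>2) + 2 * integral {0..L} (\<lambda>x. (g x)\<^sup>2)"
    "integral {0..L} (\<lambda>x. (f x - g x)\<^sup>2) \<le> 2 * integral {0..L} (\<lambda>x. (f x)\<^sup>2) + 2 * integral {0..L} (\<lambda>x. (g x)\<^sup>2)"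
  using integral_square_add[OF f g, of 1] integral_square_add[OF f g, of "-1"] abs_integral_mult_le(1)[OF f g]
  by (simp_all add: abs_le_iff)

text \<open>The square of the \<open>L\<^sup>2\<close> norm is differentiable along a curve that is differentiable in \<open>L\<^sup>2\<close>. The curve
  is given by \<open>b\<close>, with the value \<open>a\<close> at \<open>h = 0\<close> and the derivative \<open>d\<close>.\<close>

lemma square_integral_has_derivative:
  assumes a: "square_integrable L a" and d: "square_integrable L d"
    and b: "eventually (\<lambda>h. square_integrable L (b h)) (at 0)"
    and lim: "((\<lambda>h. integral {0..L} (\<lambda>x. ((b h x - a x) / h - d x)\<^sup>2)) \<longlongrightarrow> 0) (at 0)"
  shows "((\<lambda>h. (integral {0..L} (\<lambda>x. (b h x)\<^sup>2) - integral {0..L} (\<lambda>x. (a x)\<^sup>2)) / h) \<longlongrightarrow> 2 * integral {0..L} (\<lambda>x. a x * d x)) (at 0)"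
proof -
  define r where "r h = integral {0..L} (\<lambda>x. ((b h x - a x) / h - d x)\<^sup>2)" for h
  define A D where "A = integral {0..L} (\<lambda>x. (a x)\<^sup>2)" and "D = integral {0..L} (\<lambda>x. (d x)\<^sup>2)"
  define I where "I = integral {0..L} (\<lambda>x. a x * d x)"
  have r0: "(r \<longlongrightarrow> 0) (at 0)" using lim unfolding r_def[abs_def] .
  have est: "eventually (\<lambda>h. norm ((integral {0..L} (\<lambda>x. (b h x)\<^sup>2) - A) / h - 2 * I)
      \<le> 2 * (sqrt A * sqrt (r h)) + \<bar>h\<bar> * (2 * D + 2 * r h)) (at 0)"
    using b eventually_neq_at_within[of 0 0 UNIV]
  proof eventually_elim
    case (elim h)
    define \<rho> where "\<rho> = (\<lambda>x. (b h x - a x) / h - d x)"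
    have "square_integrable L (\<lambda>x. (1 / h) * (b h x - a x) - d x)"
      by (intro square_integrable_diff square_integrable_cmult elim a d)
    then have \<rho>: "square_integrable L \<rho>" by (simp add: \<rho>_def)
    have dr: "square_integrable L (\<lambda>x. d x + \<rho> x)" by (intro square_integrable_add d \<rho>)
    have "integral {0..L} (\<lambda>x. (b h x)\<^sup>2) = integral {0..L} (\<lambda>x. (a x + h * (d x + \<rho> x))\<^sup>2)"
      using elim(2) by (intro integral_cong) (simp add: \<rho>_def)
    also have "\<dots> = A + 2 * h * integral {0..L} (\<lambda>x. a x * (d x + \<rho> x)) + h\<^sup>2 * integral {0..L} (\<lambda>x. (d x + \<rho> x)\<^sup>2)"
      unfolding integral_square_add[OF a dr] A_def ..
    also have "integral {0..L} (\<lambda>x. a x * (d x + \<rho> x)) = I + integral {0..L} (\<lambda>x. a x * \<rho> x)"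
      unfolding distrib_left I_def
      by (intro Henstock_Kurzweil_Integration.integral_add square_integrable_mult a d \<rho>)
    finally have "(integral {0..L} (\<lambda>x. (b h x)\<^sup>2) - A) / h - 2 * I
        = 2 * integral {0..L} (\<lambda>x. a x * \<rho> x) + h * integral {0..L} (\<lambda>x. (d x + \<rho> x)\<^sup>2)"
      using elim(2) by (simp add: field_simps power2_eq_square)
    also have "norm \<dots> \<le> 2 * \<bar>integral {0..L} (\<lambda>x. a x * \<rho> x)\<bar> + \<bar>h\<bar> * integral {0..L} (\<lambda>x. (d x + \<rho> x)\<^sup>2)"
      by (rule order.trans[OF norm_triangle_ineq]) (simp add: abs_mult integral_square_nonneg)
    also have "\<dots> \<le> 2 * (sqrt A * sqrt (r h)) + \<bar>h\<bar> * (2 * D + 2 * r h)"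
      using abs_integral_mult_le(2)[OF a \<rho>] integral_square_sum_le(1)[OF d \<rho>]
      by (intro add_mono mult_left_mono) (auto simp: A_def D_def r_def \<rho>_def)
    finally show ?case .
  qed
  have "((\<lambda>h. 2 * (sqrt A * sqrt (r h)) + \<bar>h\<bar> * (2 * D + 2 * r h)) \<longlongrightarrow> 2 * (sqrt A * sqrt 0) + \<bar>0\<bar> * (2 * D + 2 * 0)) (at 0)"
    by (intro tendsto_intros r0)
  then have "((\<lambda>h. (integral {0..L} (\<lambda>x. (b h x)\<^sup>2) - A) / h - 2 * I) \<longlongrightarrow> 0) (at 0)"
    by (intro Lim_null_comparison[OF est]) simp
  then show ?thesis unfolding A_def I_def by (simp add: LIM_zero_iff)
qed

section \<open>Difference quotients of Lipschitz functions\<close>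

lemma integral_square_increment_le:
  assumes F: "primitive_on L F z" and z: "bounded_measurable L z" and xy: "0 \<le> x" "x \<le> y" "y \<le> L"
  shows "(F y - F x)\<^sup>2 \<le> (y - x) * integral {x..y} (\<lambda>x. (z x)\<^sup>2)"
proof -
  have sq: "square_integrable (y - x) (\<lambda>s. z (s + x))" "square_integrable (y - x) (\<lambda>s. 1)"
    using bounded_measurable_shift[OF bounded_measurable_subinterval[OF z xy(3)] xy(1)]
    by (auto intro!: square_integrable_bounded)
  have "F y - F x = integral {x..y} z" by (rule primitive_on_diff_eq[OF F xy])
  also have "\<dots> = integral {0..y - x} (\<lambda>s. z (s + x) * 1)" using integral_shift_real[of 0 "y - x" z x] by simp
  finally have "(F y - F x)\<^sup>2 = (integral {0..y - x} (\<lambda>s. z (s + x) * 1))\<^sup>2" by simp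
  also have "\<dots> \<le> integral {0..y - x} (\<lambda>s. (z (s + x))\<^sup>2) * integral {0..y - x} (\<lambda>s. 1\<^sup>2)"
    by (rule integral_Cauchy_Schwarz[OF sq])
  also have "integral {0..y - x} (\<lambda>s. (z (s + x))\<^sup>2) = integral {x..y} (\<lambda>x. (z x)\<^sup>2)"
    using integral_shift_real[of 0 "y - x" "\<lambda>x. (z x)\<^sup>2" x] by simp
  finally show ?thesis using xy by (simp add: mult.commute)
qed

text \<open>Integrating \<open>integral_square_increment_le\<close> over \<open>x\<close>: each point of \<open>[0, L]\<close> is counted on a set of
  length at most \<open>h\<close>.\<close>

lemma integral_square_increment_total:
  assumes F: "primitive_on L F z" and z: "bounded_measurable L z" and h: "0 \<le> h" "h \<le> L"
  shows "integral {0..L - h} (\<lambda>x. (F (x + h) - F x)\<^sup>2) \<le> h\<^sup>2 * integral {0..L} (\<lambda>x. (z x)\<^sup>2)"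
proof -
  define Z where "Z x = integral {0..x} (\<lambda>x. (z x)\<^sup>2)" for x
  have zi: "(\<lambda>x. (z x)\<^sup>2) absolutely_integrable_on {0..L}"
    by (intro bounded_measurable_integrable bounded_measurable_power2 z)
  have Zp: "primitive_on L Z (\<lambda>x. (z x)\<^sup>2)" unfolding Z_def by (rule primitive_on_indefinite_integral[OF zi])
  have Zc: "continuous_on {0..L} Z" by (rule primitive_on_continuous[OF Zp])
  have Zinc: "Z y - Z x = integral {x..y} (\<lambda>x. (z x)\<^sup>2)" if "0 \<le> x" "x \<le> y" "y \<le> L" for x y
    by (rule primitive_on_diff_eq[OF Zp that])
  have Znn: "0 \<le> integral {x..y} (\<lambda>x. (z x)\<^sup>2)" if "0 \<le> x" "y \<le> L" for x y
    using primitive_on_integrable[OF Zp that] by (intro Henstock_Kurzweil_Integration.integral_nonneg) auto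
  have Zb: "0 \<le> Z x" "Z x \<le> Z L" if "x \<in> {0..L}" for x
    using Znn[of 0 x] Znn[of x L] Zinc[of x L] that by (auto simp: Z_def)
  have Fc: "continuous_on {0..L} F" by (rule primitive_on_continuous[OF F])
  have sh: "continuous_on {0..L - h} (\<lambda>x. f (x + h))" "continuous_on {0..L - h} f"
    if "continuous_on {0..L} f" for f :: "real \<Rightarrow> real"
    using h by (auto intro!: continuous_on_compose2[OF that] continuous_intros)
  have "integral {0..L - h} (\<lambda>x. (F (x + h) - F x)\<^sup>2) \<le> integral {0..L - h} (\<lambda>x. h * (Z (x + h) - Z x))"
  proof (rule integral_le)
    show "(\<lambda>x. (F (x + h) - F x)\<^sup>2) integrable_on {0..L - h}" "(\<lambda>x. h * (Z (x + h) - Z x)) integrable_on {0..L - h}"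
      by (intro integrable_continuous_interval continuous_intros sh Fc Zc)+
    show "(F (x + h) - F x)\<^sup>2 \<le> h * (Z (x + h) - Z x)" if "x \<in> {0..L - h}" for x
      using integral_square_increment_le[OF F z, of x "x + h"] Zinc[of x "x + h"] that h by simp
  qed
  also have "\<dots> = h * (integral {h..L} Z - integral {0..L - h} Z)"
  proof -
    have "integral {0..L - h} (\<lambda>x. Z (x + h) - Z x) = integral {0..L - h} (\<lambda>x. Z (x + h)) - integral {0..L - h} Z"
      by (intro Henstock_Kurzweil_Integration.integral_diff integrable_continuous_interval sh Zc)
    then show ?thesis using integral_shift_real[of 0 "L - h" Z h] by simp
  qed
  also have "integral {h..L} Z - integral {0..L - h} Z \<le> h * Z L"
  proof -
    have i: "Z integrable_on {a..b}" if "0 \<le> a" "b \<le> L" for a b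
      using that by (intro integrable_continuous_interval continuous_on_subset[OF Zc]) auto
    have 1: "integral {0..h} Z + integral {h..L} Z = integral {0..L} Z" "integral {0..L - h} Z + integral {L - h..L} Z = integral {0..L} Z"
      using h by (auto intro!: Henstock_Kurzweil_Integration.integral_combine i)
    have 2: "0 \<le> integral {0..h} Z" using h Zb by (intro Henstock_Kurzweil_Integration.integral_nonneg i) auto
    have "integral {L - h..L} Z \<le> integral {L - h..L} (\<lambda>_. Z L)" using h Zb by (intro integral_le i) auto
    then have "integral {L - h..L} Z \<le> h * Z L" using h by simp
    then show ?thesis using 1 2 by linarith
  qed
  finally show ?thesis using h by (simp add: Z_def power2_eq_square mult_left_mono)
qed

text \<open>The converse of \<open>integral_square_increment_total\<close>: the difference quotients converge almost everywhere to
  the derivative and are dominated by its bound.\<close>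

lemma integral_square_derivative_le:
  assumes F: "primitive_on L F z" and z: "bounded_measurable L z" and "0 < L"
    and le: "\<And>h. 0 < h \<Longrightarrow> h < L \<Longrightarrow> integral {0..L - h} (\<lambda>x. (F (x + h) - F x)\<^sup>2) \<le> h\<^sup>2 * K"
  shows "integral {0..L} (\<lambda>x. (z x)\<^sup>2) \<le> K"
proof -
  obtain C where C: "\<And>x. x \<in> {0..L} \<Longrightarrow> \<bar>z x\<bar> \<le> C" using z unfolding bounded_measurable_def by blast
  obtain N where N: "negligible N"
    "\<And>x. x \<in> {0..<L} - N \<Longrightarrow> ((\<lambda>h. (F (x + h) - F x) / h) \<longlongrightarrow> z x) (at_right 0)"
    using primitive_on_right_derivative_AE[OF F] by blast
  define h where "h n = L / (real n + 2)" for n :: nat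
  have h: "0 < h n" "h n < L" for n
    using \<open>0 < L\<close> by (auto simp: h_def divide_less_eq intro: less_le_trans[of L "L * 2"])
  have h0: "h \<longlonglongrightarrow> 0" unfolding h_def by real_asymp
  have hr: "filterlim h (at_right 0) sequentially"
    unfolding filterlim_at
  proof (intro conjI)
    show "\<forall>\<^sub>F k in sequentially. h k \<in> {0<..} \<and> h k \<noteq> 0"
      using h(1) by (intro always_eventually) (simp add: less_imp_neq[symmetric])
  qed (fact h0)
  define q where "q n x = (if x \<in> {0..L - h n} then ((F (x + h n) - F x) / h n)\<^sup>2 else 0)" for n x
  have Fc: "continuous_on {0..L} F" by (rule primitive_on_continuous[OF F])
  have qint: "(q n has_integral integral {0..L - h n} (\<lambda>x. ((F (x + h n) - F x) / h n)\<^sup>2)) {0..L}" for n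
  proof -
    have "continuous_on {0..L - h n} (\<lambda>x. ((F (x + h n) - F x) / h n)\<^sup>2)"
      using h[of n] by (intro continuous_intros continuous_on_compose2[OF Fc, of _ "\<lambda>x. x + h n"] continuous_on_subset[OF Fc]) auto
    then have "((\<lambda>x. ((F (x + h n) - F x) / h n)\<^sup>2) has_integral integral {0..L - h n} (\<lambda>x. ((F (x + h n) - F x) / h n)\<^sup>2)) {0..L - h n}"
      by (intro integrable_integral integrable_continuous_interval)
    then show ?thesis
      unfolding q_def using h[of n] by (subst has_integral_restrict) auto
  qed
  have qb: "\<bar>q n x\<bar> \<le> C\<^sup>2" if x: "x \<in> {0..L}" for n x
  proof (cases "x \<in> {0..L - h n}")
    case True
    have "\<bar>F (x + h n) - F x\<bar> \<le> C * \<bar>x + h n - x\<bar>"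
      using True h[of n] by (intro primitive_on_Lipschitz[OF F C]) auto
    then have "\<bar>(F (x + h n) - F x) / h n\<bar> \<le> C" using h[of n] by (simp add: abs_divide divide_le_eq)
    then have "((F (x + h n) - F x) / h n)\<^sup>2 \<le> C\<^sup>2" by (rule power2_le_iff_abs_le[THEN iffD2, rotated]) (use C[OF x] in auto)
    then show ?thesis using True by (simp add: q_def)
  next
    case False
    then have "q n x = 0" by (simp only: q_def if_False)
    then show ?thesis by simp
  qed
  have "(\<lambda>n. integral {0..L} (q n)) \<longlonglongrightarrow> integral {0..L} (\<lambda>x. (z x)\<^sup>2)"
  proof (rule dominated_convergence_AE(2)[where N = "insert L N" and h = "\<lambda>_. C\<^sup>2"])
    show "q n integrable_on {0..L}" for n using qint by blast
    show "negligible (insert L N)" using N(1) by simp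
    show "(\<lambda>n. q n x) \<longlonglongrightarrow> (z x)\<^sup>2" if x: "x \<in> {0..L} - insert L N" for x
    proof -
      have xL: "x < L" "0 \<le> x" using x by auto
      have "(\<lambda>n. (F (x + h n) - F x) / h n) \<longlonglongrightarrow> z x"
        by (rule filterlim_compose[OF N(2) hr]) (use x in auto)
      then have lim: "(\<lambda>n. ((F (x + h n) - F x) / h n)\<^sup>2) \<longlonglongrightarrow> (z x)\<^sup>2" by (intro tendsto_intros)
      have "eventually (\<lambda>n. h n < L - x) sequentially"
        using order_tendstoD(2)[OF h0, of "L - x"] xL by simp
      then have "eventually (\<lambda>n. ((F (x + h n) - F x) / h n)\<^sup>2 = q n x) sequentially"
        by eventually_elim (use xL in \<open>auto simp: q_def\<close>)
      then show ?thesis using lim by (rule Lim_transform_eventually[rotated])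
    qed
  qed (use qb in auto)
  moreover have "integral {0..L} (q n) \<le> K" for n
  proof -
    have "integral {0..L} (q n) = integral {0..L - h n} (\<lambda>x. (1 / (h n)\<^sup>2) * (F (x + h n) - F x)\<^sup>2)"
      using integral_unique[OF qint[of n]] by (simp add: power_divide)
    also have "\<dots> = (1 / (h n)\<^sup>2) * integral {0..L - h n} (\<lambda>x. (F (x + h n) - F x)\<^sup>2)"
      by (rule integral_mult_right)
    also have "\<dots> \<le> (1 / (h n)\<^sup>2) * ((h n)\<^sup>2 * K)" by (intro mult_left_mono le h) auto
    also have "\<dots> = K" using h(1)[of n] by simp
    finally show ?thesis .
  qed
  ultimately show ?thesis by (intro LIMSEQ_le_const2) auto
qed

section \<open>Weak-strong uniqueness\<close>

lemma integral_linear_combination4: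
  fixes f1 f2 f3 f4 :: "real \<Rightarrow> real"
  assumes "f1 integrable_on S" "f2 integrable_on S" "f3 integrable_on S" "f4 integrable_on S"
  shows "((\<lambda>x. c1 * f1 x + c2 * f2 x + c3 * f3 x + c4 * f4 x) has_integral
    (c1 * integral S f1 + c2 * integral S f2 + c3 * integral S f3 + c4 * integral S f4)) S"
  by (intro has_integral_add has_integral_mult_right integrable_integral assms)

lemma square_sum4_le: "(p + q + r + s)\<^sup>2 \<le> 4 * (p\<^sup>2 + q\<^sup>2 + r\<^sup>2 + s\<^sup>2)" for p q r s :: real
proof -
  have "4 * (p\<^sup>2 + q\<^sup>2 + r\<^sup>2 + s\<^sup>2) - (p + q + r + s)\<^sup>2
    = (p - q)\<^sup>2 + (p - r)\<^sup>2 + (p - s)\<^sup>2 + (q - r)\<^sup>2 + (q - s)\<^sup>2 + (r - s)\<^sup>2"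
    by (simp add: power2_eq_square algebra_simps)
  moreover have "\<dots> \<ge> 0" by (intro add_nonneg_nonneg) auto
  ultimately show ?thesis by linarith
qed

text \<open>The constants of the individual terms in \<open>rhs_increment_estimate\<close>: the first summand belongs to the
  transport term, the others come from the inequality \<open>\<bar>x y\<bar> \<le> (x\<^sup>2 + y\<^sup>2) / 2\<close> for the remaining ones.\<close>

definition stability_constant :: "real \<Rightarrow> real \<Rightarrow> real" where
  "stability_constant B \<Lambda> = (pi / 2 + 2 * B) + (1 + (4 * (pi / 2 + 2 * B)\<^sup>2 + 144 * B\<^sup>2 + 64 * pi\<^sup>2 * \<Lambda>\<^sup>2 + 32 * pi\<^sup>2)) / 2"

lemma stability_constant_pos: "0 \<le> B \<Longrightarrow> 0 < stability_constant B \<Lambda>"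
  unfolding stability_constant_def by (intro add_pos_nonneg) (auto intro!: add_nonneg_nonneg add_pos_nonneg)

text \<open>The heart of the uniqueness proof. The difference \<open>w\<close> of the solutions satisfies
  \<open>2c\<^sub>* \<partial>\<^sub>tw = b \<partial>\<^sub>xw - 2 (w - w(0)) P + const + nonlocal term\<close>, where \<open>b\<close> is the transport coefficient of
  the rough solution \<open>u\<close> and \<open>P\<close> the slope of the smooth one. Increments over \<open>h\<close> are multiplied by the
  increment of \<open>w\<close>. The transport term is integrated by parts, which costs only the Lipschitz constant of
  \<open>b\<close>. In every other term the increment falls on a factor that is Lipschitz or has a square integrable
  derivative, so each factor of \<open>h\<close> is paid for by \<open>\<integral> (\<partial>\<^sub>xw)\<^sup>2\<close>. The interval \<open>[0, 2\<pi> - h]\<close> keeps both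
  points of an increment on the same side of the peak, where \<open>P\<close> may jump.\<close>

lemma rhs_increment_estimate:
  assumes u: "lipschitz_periodic u g" and v: "lipschitz_periodic v P"
    and gB: "\<And>x. x \<in> {0..2*pi} \<Longrightarrow> \<bar>g x\<bar> \<le> B" and PB: "\<And>x. x \<in> {0..2*pi} \<Longrightarrow> \<bar>P x\<bar> \<le> B"
    and PL: "\<And>x y. x \<in> {0..2*pi} \<Longrightarrow> y \<in> {0..2*pi} \<Longrightarrow> \<bar>P x - P y\<bar> \<le> \<Lambda> * \<bar>x - y\<bar>"
    and h: "0 < h" "h < 2 * pi"
    and d: "negligible {x \<in> {0..2*pi}. 2 * c_star * d x \<noteq> evolution_rhs u x - evolution_rhs v x}"
  defines "w \<equiv> (\<lambda>x. u x - v x)" and "z \<equiv> (\<lambda>x. g x - P x)"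
  shows "\<bar>2 * c_star * integral {0..2*pi - h} (\<lambda>x. (w (x + h) - w x) * (d (x + h) - d x))\<bar>
     \<le> stability_constant B \<Lambda> * h\<^sup>2 * integral {0..2*pi} (\<lambda>x. (z x)\<^sup>2)"
proof -
  define L where "L = 2 * pi - h"
  define G where "G = integral {0..2*pi} (\<lambda>x. (z x)\<^sup>2)"
  have B0: "0 \<le> B" using gB[of 0] by auto
  have G0: "0 \<le> G" unfolding G_def by (rule integral_square_nonneg)
  note U = lipschitz_periodicD[OF u] and V = lipschitz_periodicD[OF v]
  note Ev = evolution_rhs_eq[OF u] and Ew = evolution_rhs_eq[OF v]
  have zm: "bounded_measurable (2*pi) z" unfolding z_def by (intro bounded_measurable_diff U V)
  have wp: "primitive_on (2*pi) w z" unfolding w_def z_def by (intro primitive_on_diff U V)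
  have wc: "continuous_on {0..2*pi} w" by (rule primitive_on_continuous[OF wp])
  have wper: "w (2*pi) = w 0"
    using periodic_2piD[OF U(1), of 0] periodic_2piD[OF V(1), of 0] by (simp add: w_def)
  have uc: "continuous_on {0..2*pi} u" by (rule primitive_on_continuous[OF U(2)])
  \<comment> \<open>the difference \<open>N\<close> of the nonlocal terms is a primitive of \<open>A\<close>, whose \<open>L\<^sup>2\<close> norm is controlled by \<open>G\<close>\<close>
  define Nu where "Nu = inv_deriv0 (\<lambda>y. u y + 2 * (weak_deriv u y)\<^sup>2)"
  define Nv where "Nv = inv_deriv0 (\<lambda>y. v y + 2 * (weak_deriv v y)\<^sup>2)"
  define N where "N = (\<lambda>x. Nu x - Nv x)"
  define \<omega> where "\<omega> = (\<lambda>x. w x - w 0)"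
  define r where "r = (\<lambda>x. \<omega> x + 2 * (z x * (g x + P x)))"
  define c where "c = integral {0..2*pi} r / (2*pi)"
  define A where "A = (\<lambda>x. r x - c)"
  have \<omega>c: "continuous_on {0..2*pi} \<omega>" unfolding \<omega>_def by (intro continuous_intros wc)
  have rm: "bounded_measurable (2*pi) r"
    unfolding r_def
    by (intro bounded_measurable_add bounded_measurable_cmult bounded_measurable_mult bounded_measurable_continuous[OF \<omega>c] zm U V)
  have Am: "bounded_measurable (2*pi) A" unfolding A_def by (intro bounded_measurable_diff rm bounded_measurable_const)
  have Np: "primitive_on (2*pi) N A"
  proof -
    define Mu Mv where "Mu = integral {0..2*pi} (\<lambda>x. u x + 2 * (g x)\<^sup>2)" and "Mv = integral {0..2*pi} (\<lambda>x. v x + 2 * (P x)\<^sup>2)"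
    have bi: "f integrable_on {0..2*pi}" if "bounded_measurable (2*pi) f" for f
      using bounded_measurable_integrable[OF that] by (simp add: absolutely_integrable_on_def)
    have m: "bounded_measurable (2*pi) (\<lambda>x. u x + 2 * (g x)\<^sup>2)" "bounded_measurable (2*pi) (\<lambda>x. v x + 2 * (P x)\<^sup>2)"
      by (intro bounded_measurable_add bounded_measurable_cmult bounded_measurable_power2 U V
          bounded_measurable_continuous[OF uc] bounded_measurable_continuous[OF primitive_on_continuous[OF V(2)]])+
    have eq: "r x = (u x + 2 * (g x)\<^sup>2) - (v x + 2 * (P x)\<^sup>2) - w 0" for x
      by (simp add: r_def \<omega>_def w_def z_def power2_eq_square algebra_simps)
    have "integral {0..2*pi} r = integral {0..2*pi} (\<lambda>x. (u x + 2 * (g x)\<^sup>2) - (v x + 2 * (P x)\<^sup>2) - w 0)"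
      by (rule integral_cong) (rule eq)
    also have "\<dots> = Mu - Mv - 2 * pi * w 0"
      unfolding Mu_def Mv_def
      using Henstock_Kurzweil_Integration.integral_diff[OF bi[OF bounded_measurable_diff[OF m]] integrable_const_ivl[of "w 0" 0 "2*pi"]]
        Henstock_Kurzweil_Integration.integral_diff[OF bi[OF m(1)] bi[OF m(2)]] by simp
    finally have c: "c = Mu / (2*pi) - Mv / (2*pi) - w 0" by (simp add: c_def diff_divide_distrib)
    have "A x = (u x + 2 * (g x)\<^sup>2 - Mu / (2*pi)) - (v x + 2 * (P x)\<^sup>2 - Mv / (2*pi))" for x
      unfolding A_def eq c by simp
    then have "A = (\<lambda>x. (u x + 2 * (g x)\<^sup>2 - Mu / (2*pi)) - (v x + 2 * (P x)\<^sup>2 - Mv / (2*pi)))" by blast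
    then show ?thesis
      unfolding N_def using primitive_on_diff[OF Ev(2) Ew(2)] by (simp add: Nu_def Nv_def Mu_def Mv_def)
  qed
  have I\<omega>: "integral {0..2*pi} (\<lambda>x. (\<omega> x)\<^sup>2) \<le> 4 * pi\<^sup>2 * G"
  proof -
    have "(\<omega> x)\<^sup>2 \<le> 2 * pi * G" if x: "x \<in> {0..2*pi}" for x
    proof -
      have "(\<omega> x)\<^sup>2 \<le> (x - 0) * integral {0..x} (\<lambda>x. (z x)\<^sup>2)"
        unfolding \<omega>_def using x by (intro integral_square_increment_le[OF wp zm]) auto
      also have "\<dots> \<le> 2 * pi * G"
        using x square_integrable_subinterval(2)[OF square_integrable_bounded[OF zm], of x] integral_square_nonneg[of x z]
        by (intro mult_mono) (auto simp: G_def)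
      finally show ?thesis .
    qed
    then have "integral {0..2*pi} (\<lambda>x. (\<omega> x)\<^sup>2) \<le> integral {0..2*pi} (\<lambda>x. 2 * pi * G)"
      by (intro integral_le integrable_continuous_interval continuous_intros \<omega>c) auto
    then show ?thesis by (simp add: power2_eq_square mult.assoc)
  qed
  have sq: "square_integrable (2*pi) f" if "bounded_measurable (2*pi) f" for f
    by (rule square_integrable_bounded[OF that])
  have Ir: "integral {0..2*pi} (\<lambda>x. (r x)\<^sup>2) \<le> (8 * pi\<^sup>2 + 32 * B\<^sup>2) * G"
  proof -
    have m: "bounded_measurable (2*pi) (\<lambda>x. 2 * (z x * (g x + P x)))"
      by (intro bounded_measurable_add bounded_measurable_cmult bounded_measurable_mult zm U V)
    have "integral {0..2*pi} (\<lambda>x. (r x)\<^sup>2) \<le> 2 * integral {0..2*pi} (\<lambda>x. (\<omega> x)\<^sup>2) + 2 * integral {0..2*pi} (\<lambda>x. (2 * (z x * (g x + P x)))\<^sup>2)"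
      unfolding r_def by (intro integral_square_sum_le(1) sq m bounded_measurable_continuous[OF \<omega>c])
    also have "integral {0..2*pi} (\<lambda>x. (2 * (z x * (g x + P x)))\<^sup>2) \<le> integral {0..2*pi} (\<lambda>x. (16 * B\<^sup>2) * (z x)\<^sup>2)"
    proof (rule integral_le)
      show "(\<lambda>x. (2 * (z x * (g x + P x)))\<^sup>2) integrable_on {0..2*pi}" "(\<lambda>x. (16 * B\<^sup>2) * (z x)\<^sup>2) integrable_on {0..2*pi}"
        using sq[OF m] sq[OF zm] by (auto simp: square_integrable_def intro: integrable_on_mult_right)
      show "(2 * (z x * (g x + P x)))\<^sup>2 \<le> (16 * B\<^sup>2) * (z x)\<^sup>2" if "x \<in> {0..2*pi}" for x
      proof -
        have "\<bar>g x + P x\<bar> \<le> \<bar>2 * B\<bar>" using gB[OF that] PB[OF that] B0 by linarith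
        then have "(g x + P x)\<^sup>2 \<le> (2 * B)\<^sup>2" by (simp only: abs_le_square_iff)
        then have "4 * (z x)\<^sup>2 * (g x + P x)\<^sup>2 \<le> 4 * (z x)\<^sup>2 * (2 * B)\<^sup>2" by (intro mult_left_mono) auto
        moreover have "(2 * (z x * (g x + P x)))\<^sup>2 = 4 * (z x)\<^sup>2 * (g x + P x)\<^sup>2"
          by (simp only: power_mult_distrib) simp
        moreover have "4 * (z x)\<^sup>2 * (2 * B)\<^sup>2 = (16 * B\<^sup>2) * (z x)\<^sup>2"
          by (simp add: power2_eq_square)
        ultimately show ?thesis by simp
      qed
    qed
    also have "integral {0..2*pi} (\<lambda>x. (16 * B\<^sup>2) * (z x)\<^sup>2) = (16 * B\<^sup>2) * G"
      unfolding G_def by (rule integral_mult_right)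
    finally show ?thesis using I\<omega> by (simp add: algebra_simps)
  qed
  have IA: "integral {0..2*pi} (\<lambda>x. (A x)\<^sup>2) \<le> (32 * pi\<^sup>2 + 128 * B\<^sup>2) * G"
  proof -
    have "integral {0..2*pi} (\<lambda>x. (A x)\<^sup>2) \<le> 2 * integral {0..2*pi} (\<lambda>x. (r x)\<^sup>2) + 2 * integral {0..2*pi} (\<lambda>x. c\<^sup>2)"
      unfolding A_def by (intro integral_square_sum_le(2) sq rm bounded_measurable_const)
    also have "integral {0..2*pi} (\<lambda>x. c\<^sup>2) \<le> integral {0..2*pi} (\<lambda>x. (r x)\<^sup>2)"
    proof -
      have "(integral {0..2*pi} (\<lambda>x. r x * 1))\<^sup>2 \<le> integral {0..2*pi} (\<lambda>x. (r x)\<^sup>2) * integral {0..2*pi} (\<lambda>x. 1\<^sup>2)"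
        by (intro integral_Cauchy_Schwarz sq rm bounded_measurable_const)
      then show ?thesis by (simp add: c_def power_divide power2_eq_square field_simps)
    qed
    finally show ?thesis using mult_left_mono[OF Ir, of 4] by (simp add: algebra_simps)
  qed
  \<comment> \<open>\<open>b\<close> vanishes at both ends, so integration by parts leaves a boundary term of order \<open>h\<^sup>2\<close> only\<close>
  define b where "b = (\<lambda>x. (pi / 2 * x - x\<^sup>2 / 4) - 2 * (u x - u 0))"
  define B1 where "B1 = pi / 2 + 2 * B"
  have B1: "0 \<le> B1" using B0 by (simp add: B1_def)
  have bp: "primitive_on (2*pi) b (\<lambda>x. (pi / 2 - x / 2) - 2 * (g x - 0))"
    unfolding b_def
    by (intro primitive_on_diff primitive_on_cmult primitive_on_const U primitive_on_has_derivative[of "2*pi" "\<lambda>x. pi / 2 * x - x\<^sup>2 / 4"])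
       (auto intro!: derivative_eq_intros continuous_intros)
  have bb: "\<bar>(pi / 2 - x / 2) - 2 * (g x - 0)\<bar> \<le> B1" if "x \<in> {0..2*pi}" for x
    using gB[OF that] that unfolding B1_def by (auto simp: abs_le_iff)
  have bm: "bounded_measurable (2*pi) (\<lambda>x. (pi / 2 - x / 2) - 2 * (g x - 0))"
    by (intro bounded_measurable_diff bounded_measurable_cmult bounded_measurable_const U
        bounded_measurable_continuous[of _ "\<lambda>x. pi/2 - x/2"] continuous_intros) auto
  have b0: "b 0 = 0" "b (2*pi) = 0"
    using periodic_2piD[OF U(1), of 0] by (simp_all add: b_def power2_eq_square)
  have bL: "\<bar>b y - b x\<bar> \<le> B1 * \<bar>y - x\<bar>" if "x \<in> {0..2*pi}" "y \<in> {0..2*pi}" for x y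
    by (rule primitive_on_Lipschitz[OF bp bb that])
  define \<Delta> where "\<Delta> = (\<lambda>x. w (x + h) - w x)"
  define \<Delta>z where "\<Delta>z = (\<lambda>x. z (x + h) - z x)"
  have L: "0 \<le> h" "h \<le> 2 * pi" "0 \<le> L" "L \<le> 2 * pi" "L = 2 * pi - h" using h by (auto simp: L_def)
  have mem: "x \<in> {0..2*pi}" "x + h \<in> {0..2*pi}" if "x \<in> {0..L}" for x using that h by (auto simp: L_def)
  have \<Delta>p: "primitive_on L \<Delta> \<Delta>z"
    unfolding \<Delta>_def \<Delta>z_def L(5)
    by (intro primitive_on_diff primitive_on_shift wp primitive_on_subinterval[OF wp] L) (use h in simp)
  have \<Delta>c: "continuous_on {0..L} \<Delta>" by (rule primitive_on_continuous[OF \<Delta>p])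
  have zs: "bounded_measurable L (\<lambda>x. z (x + h))" unfolding L(5) by (rule bounded_measurable_shift[OF zm L(1)])
  have zL: "bounded_measurable L z" by (rule bounded_measurable_subinterval[OF zm L(4)])
  have \<Delta>zm: "bounded_measurable L \<Delta>z" unfolding \<Delta>z_def by (intro bounded_measurable_diff zs zL)
  have I\<Delta>: "integral {0..L} (\<lambda>x. (\<Delta> x)\<^sup>2) \<le> h\<^sup>2 * G"
    unfolding \<Delta>_def G_def L(5) by (rule integral_square_increment_total[OF wp zm L(1,2)])
  have I\<Delta>0: "0 \<le> integral {0..L} (\<lambda>x. (\<Delta> x)\<^sup>2)" by (rule integral_square_nonneg)
  have T1: "\<bar>integral {0..L} (\<lambda>x. \<Delta> x * (b x * \<Delta>z x))\<bar> \<le> B1 * h\<^sup>2 * G"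
  proof -
    obtain M where M: "\<And>x. x \<in> {0..L} \<Longrightarrow> \<bar>\<Delta>z x\<bar> \<le> M" using \<Delta>zm unfolding bounded_measurable_def by blast
    have M0: "0 \<le> M" using M[of 0] L by force
    obtain M' where M': "\<And>x. x \<in> {0..L} \<Longrightarrow> \<bar>\<Delta> x\<bar> \<le> M'" using continuous_on_bounded_abs[OF \<Delta>c] by blast
    have bpL: "primitive_on L b (\<lambda>x. (pi / 2 - x / 2) - 2 * (g x - 0))" by (rule primitive_on_subinterval[OF bp L(4)])
    have p2: "primitive_on L (\<lambda>x. \<Delta> x * \<Delta> x) (\<lambda>x. \<Delta>z x * \<Delta> x + \<Delta> x * \<Delta>z x)"
      by (rule primitive_on_mult[OF \<Delta>p \<Delta>p M])
    have p2b: "\<bar>\<Delta>z x * \<Delta> x + \<Delta> x * \<Delta>z x\<bar> \<le> 2 * (M * M')" if x: "x \<in> {0..L}" for x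
    proof -
      have "\<bar>\<Delta>z x * \<Delta> x\<bar> \<le> M * M'" unfolding abs_mult using M[OF x] M'[OF x] M0 by (intro mult_mono) auto
      moreover have "\<Delta> x * \<Delta>z x = \<Delta>z x * \<Delta> x" by simp
      ultimately show ?thesis by linarith
    qed
    have p3: "primitive_on L (\<lambda>x. b x * (\<Delta> x * \<Delta> x)) (\<lambda>x. ((pi / 2 - x / 2) - 2 * (g x - 0)) * (\<Delta> x * \<Delta> x) + b x * (\<Delta>z x * \<Delta> x + \<Delta> x * \<Delta>z x))"
      by (rule primitive_on_mult[OF bpL p2 p2b])
    define b' where "b' = (\<lambda>x. (pi / 2 - x / 2) - 2 * (g x - 0))"
    have bdm: "bounded_measurable L (\<lambda>x. b' x * (\<Delta> x * \<Delta> x))" "bounded_measurable L (\<lambda>x. \<Delta> x * (b x * \<Delta>z x))"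
      unfolding b'_def
      by (intro bounded_measurable_mult bounded_measurable_subinterval[OF bm L(4)] bounded_measurable_continuous[OF \<Delta>c] \<Delta>zm
          bounded_measurable_continuous[OF primitive_on_continuous[OF bpL]])+
    have int: "f integrable_on {0..L}" if "bounded_measurable L f" for f
      using bounded_measurable_integrable[OF that] by (simp add: absolutely_integrable_on_def)
    have "b L * (\<Delta> L * \<Delta> L) = b 0 * (\<Delta> 0 * \<Delta> 0) + integral {0..L} (\<lambda>x. b' x * (\<Delta> x * \<Delta> x) + b x * (\<Delta>z x * \<Delta> x + \<Delta> x * \<Delta>z x))"
      unfolding b'_def by (rule primitive_on_eq[OF p3]) (use L in auto)
    also have "integral {0..L} (\<lambda>x. b' x * (\<Delta> x * \<Delta> x) + b x * (\<Delta>z x * \<Delta> x + \<Delta> x * \<Delta>z x))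
        = integral {0..L} (\<lambda>x. b' x * (\<Delta> x * \<Delta> x) + 2 * (\<Delta> x * (b x * \<Delta>z x)))"
      by (rule integral_cong) (simp add: algebra_simps)
    also have "\<dots> = integral {0..L} (\<lambda>x. b' x * (\<Delta> x * \<Delta> x)) + 2 * integral {0..L} (\<lambda>x. \<Delta> x * (b x * \<Delta>z x))"
      using Henstock_Kurzweil_Integration.integral_add[OF int[OF bdm(1)] integrable_on_mult_right[OF int[OF bdm(2)], of 2]] by simp
    finally have eq: "2 * integral {0..L} (\<lambda>x. \<Delta> x * (b x * \<Delta>z x)) = b L * (\<Delta> L)\<^sup>2 - integral {0..L} (\<lambda>x. b' x * (\<Delta> x * \<Delta> x))"
      unfolding b0(1) power2_eq_square by linarith
    have "\<bar>b L * (\<Delta> L)\<^sup>2\<bar> \<le> (B1 * h) * (h * G)"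
      unfolding abs_mult
    proof (intro mult_mono)
      show "\<bar>b L\<bar> \<le> B1 * h" using bL[of "2*pi" L] b0 L h by (auto simp: L_def)
      have "(\<Delta> L)\<^sup>2 = (w (2*pi) - w L)\<^sup>2" by (simp add: \<Delta>_def L_def)
      also have "\<dots> \<le> (2 * pi - L) * integral {L..2*pi} (\<lambda>x. (z x)\<^sup>2)"
        using L by (intro integral_square_increment_le[OF wp zm]) auto
      also have "\<dots> \<le> h * G"
      proof -
        have "integral {L..2*pi} (\<lambda>x. (z x)\<^sup>2) \<le> G"
          unfolding G_def using sq[OF zm] L
          by (intro integral_subset_le) (auto simp: square_integrable_def intro: integrable_on_subinterval[of _ "{0..2*pi}"])
        then show ?thesis using h by (simp add: L_def mult_left_mono)
      qed
      finally show "\<bar>(\<Delta> L)\<^sup>2\<bar> \<le> h * G" by simp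
    qed (use B1 h in auto)
    moreover have "\<bar>integral {0..L} (\<lambda>x. b' x * (\<Delta> x * \<Delta> x))\<bar> \<le> B1 * (h\<^sup>2 * G)"
    proof -
      have "norm (integral {0..L} (\<lambda>x. b' x * (\<Delta> x * \<Delta> x))) \<le> integral {0..L} (\<lambda>x. B1 * (\<Delta> x)\<^sup>2)"
      proof (rule Henstock_Kurzweil_Integration.integral_norm_bound_integral[OF int[OF bdm(1)]])
        show "(\<lambda>x. B1 * (\<Delta> x)\<^sup>2) integrable_on {0..L}"
          by (intro integrable_continuous_interval continuous_intros \<Delta>c)
        show "norm (b' x * (\<Delta> x * \<Delta> x)) \<le> B1 * (\<Delta> x)\<^sup>2" if "x \<in> {0..L}" for x
          using bb[OF mem(1)[OF that]] by (simp add: b'_def abs_mult power2_eq_square mult_right_mono)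
      qed
      also have "\<dots> = B1 * integral {0..L} (\<lambda>x. (\<Delta> x)\<^sup>2)" by (rule integral_mult_right)
      also have "\<dots> \<le> B1 * (h\<^sup>2 * G)" by (intro mult_left_mono I\<Delta> B1)
      finally show ?thesis by simp
    qed
    moreover have "(B1 * h) * (h * G) = B1 * (h\<^sup>2 * G)" by (simp add: power2_eq_square algebra_simps)
    moreover have "B1 * h\<^sup>2 * G = B1 * (h\<^sup>2 * G)" by simp
    ultimately show ?thesis using eq by (simp only: abs_le_iff) linarith
  qed
  define Q where "Q = (\<lambda>x. (b (x + h) - b x) * z (x + h) - 2 * (\<omega> (x + h) * P (x + h) - \<omega> x * P x) + (N (x + h) - N x) / 2)"
  have Nc: "continuous_on {0..2*pi} N" by (rule primitive_on_continuous[OF Np])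
  have shc: "continuous_on {0..L} (\<lambda>x. f (x + h))" "continuous_on {0..L} f" if "continuous_on {0..2*pi} f" for f :: "real \<Rightarrow> real"
    using mem by (auto intro!: continuous_on_compose2[OF that] continuous_intros)
  have bc: "continuous_on {0..2*pi} b" by (rule primitive_on_continuous[OF bp])
  have Pm: "bounded_measurable L (\<lambda>x. P (x + h))" "bounded_measurable L P"
    using bounded_measurable_shift[OF V(3) L(1)] bounded_measurable_subinterval[OF V(3) L(4)] by (simp_all add: L_def)
  have Qm: "bounded_measurable L Q"
  proof -
    note bcs = bounded_measurable_continuous[OF shc(1)] bounded_measurable_continuous[OF shc(2)]
    have "bounded_measurable L (\<lambda>x. (b (x + h) - b x) * z (x + h) - 2 * (\<omega> (x + h) * P (x + h) - \<omega> x * P x) + (1/2) * (N (x + h) - N x))"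
      by (intro bounded_measurable_add bounded_measurable_diff bounded_measurable_mult bounded_measurable_cmult
          bcs[OF bc] bcs[OF Nc] bcs[OF \<omega>c] zs Pm)
    then show ?thesis by (simp add: Q_def)
  qed
  have IQ: "integral {0..L} (\<lambda>x. (Q x)\<^sup>2) \<le> (4 * B1\<^sup>2 + 144 * B\<^sup>2 + 64 * pi\<^sup>2 * \<Lambda>\<^sup>2 + 32 * pi\<^sup>2) * (h\<^sup>2 * G)"
  proof -
    define S where "S = (\<lambda>x. (4 * B1\<^sup>2 * h\<^sup>2) * (z (x + h))\<^sup>2 + (16 * B\<^sup>2) * (\<Delta> x)\<^sup>2 + (16 * \<Lambda>\<^sup>2 * h\<^sup>2) * (\<omega> x)\<^sup>2 + 1 * (N (x + h) - N x)\<^sup>2)"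
    have sz: "square_integrable L (\<lambda>x. z (x + h))" "square_integrable L \<omega>"
      by (rule square_integrable_bounded, rule zs) (rule square_integrable_bounded[OF bounded_measurable_continuous[OF shc(2)[OF \<omega>c]]])
    have iS: "(S has_integral ((4 * B1\<^sup>2 * h\<^sup>2) * integral {0..L} (\<lambda>x. (z (x + h))\<^sup>2) + (16 * B\<^sup>2) * integral {0..L} (\<lambda>x. (\<Delta> x)\<^sup>2)
        + (16 * \<Lambda>\<^sup>2 * h\<^sup>2) * integral {0..L} (\<lambda>x. (\<omega> x)\<^sup>2) + 1 * integral {0..L} (\<lambda>x. (N (x + h) - N x)\<^sup>2))) {0..L}"
      unfolding S_def
    proof (rule integral_linear_combination4)
      show "(\<lambda>x. (z (x + h))\<^sup>2) integrable_on {0..L}" "(\<lambda>x. (\<omega> x)\<^sup>2) integrable_on {0..L}"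
        using sz by (auto simp: square_integrable_def)
    qed (intro integrable_continuous_interval continuous_intros \<Delta>c shc[OF Nc])+
    have pt: "(Q x)\<^sup>2 \<le> S x" if x: "x \<in> {0..L}" for x
    proof -
      note m = mem[OF x]
      have e: "Q x = (b (x + h) - b x) * z (x + h) + (- 2 * \<Delta> x * P (x + h)) + (- 2 * \<omega> x * (P (x + h) - P x)) + (N (x + h) - N x) / 2"
        by (simp add: Q_def \<Delta>_def \<omega>_def algebra_simps)
      have s1: "((b (x + h) - b x) * z (x + h))\<^sup>2 \<le> B1\<^sup>2 * h\<^sup>2 * (z (x + h))\<^sup>2"
      proof -
        have "\<bar>b (x + h) - b x\<bar> \<le> \<bar>B1 * h\<bar>" using bL[OF m] h B1 by (simp add: abs_mult)
        then have "(b (x + h) - b x)\<^sup>2 \<le> (B1 * h)\<^sup>2" by (simp only: abs_le_square_iff)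
        then show ?thesis by (simp add: power_mult_distrib mult_right_mono)
      qed
      have s2: "(- 2 * \<Delta> x * P (x + h))\<^sup>2 \<le> 4 * B\<^sup>2 * (\<Delta> x)\<^sup>2"
      proof -
        have "(P (x + h))\<^sup>2 \<le> B\<^sup>2" using PB[OF m(2)] B0 by (simp add: abs_le_square_iff[symmetric])
        then have "(4 * (\<Delta> x)\<^sup>2) * (P (x + h))\<^sup>2 \<le> (4 * (\<Delta> x)\<^sup>2) * B\<^sup>2" by (intro mult_left_mono) auto
        then show ?thesis by (simp add: power_mult_distrib algebra_simps)
      qed
      have s3: "(- 2 * \<omega> x * (P (x + h) - P x))\<^sup>2 \<le> 4 * \<Lambda>\<^sup>2 * h\<^sup>2 * (\<omega> x)\<^sup>2"
      proof -
        have "\<bar>P (x + h) - P x\<bar> \<le> \<bar>\<Lambda> * h\<bar>" using PL[OF m(2,1)] h by (simp add: abs_mult order.trans[OF _ mult_right_mono[OF abs_ge_self]])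
        then have "(P (x + h) - P x)\<^sup>2 \<le> (\<Lambda> * h)\<^sup>2" by (simp only: abs_le_square_iff)
        then have "(4 * (\<omega> x)\<^sup>2) * (P (x + h) - P x)\<^sup>2 \<le> (4 * (\<omega> x)\<^sup>2) * (\<Lambda> * h)\<^sup>2" by (intro mult_left_mono) auto
        moreover have "(- 2 * \<omega> x * (P (x + h) - P x))\<^sup>2 = (4 * (\<omega> x)\<^sup>2) * (P (x + h) - P x)\<^sup>2"
          by (simp only: power_mult_distrib) simp
        moreover have "(4 * (\<omega> x)\<^sup>2) * (\<Lambda> * h)\<^sup>2 = 4 * \<Lambda>\<^sup>2 * h\<^sup>2 * (\<omega> x)\<^sup>2"
          by (simp add: power_mult_distrib)
        ultimately show ?thesis by simp
      qed
      have "(Q x)\<^sup>2 \<le> 4 * (((b (x + h) - b x) * z (x + h))\<^sup>2 + (- 2 * \<Delta> x * P (x + h))\<^sup>2 + (- 2 * \<omega> x * (P (x + h) - P x))\<^sup>2 + ((N (x + h) - N x) / 2)\<^sup>2)"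
        unfolding e by (rule square_sum4_le)
      also have "\<dots> \<le> S x" unfolding S_def using s1 s2 s3 by (simp add: power_divide)
      finally show ?thesis .
    qed
    have "integral {0..L} (\<lambda>x. (Q x)\<^sup>2) \<le> integral {0..L} S"
      using square_integrable_bounded[OF Qm] iS pt by (intro integral_le) (auto simp: square_integrable_def)
    also have "integral {0..L} S \<le> (4 * B1\<^sup>2 * h\<^sup>2) * G + (16 * B\<^sup>2) * (h\<^sup>2 * G) + (16 * \<Lambda>\<^sup>2 * h\<^sup>2) * (4 * pi\<^sup>2 * G)
        + 1 * (h\<^sup>2 * ((32 * pi\<^sup>2 + 128 * B\<^sup>2) * G))"
      unfolding integral_unique[OF iS]
    proof (intro add_mono mult_left_mono I\<Delta>)
      show "integral {0..L} (\<lambda>x. (z (x + h))\<^sup>2) \<le> G"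
        unfolding G_def L(5) by (rule square_integrable_shift(2)[OF sq[OF zm] L(1,2)])
      show "integral {0..L} (\<lambda>x. (\<omega> x)\<^sup>2) \<le> 4 * pi\<^sup>2 * G"
        using I\<omega> square_integrable_subinterval(2)[OF sq[OF bounded_measurable_continuous[OF \<omega>c]] L(4)] by linarith
      have "integral {0..L} (\<lambda>x. (N (x + h) - N x)\<^sup>2) \<le> h\<^sup>2 * integral {0..2*pi} (\<lambda>x. (A x)\<^sup>2)"
        unfolding L(5) by (rule integral_square_increment_total[OF Np Am L(1,2)])
      also have "\<dots> \<le> h\<^sup>2 * ((32 * pi\<^sup>2 + 128 * B\<^sup>2) * G)" by (intro mult_left_mono IA) auto
      finally show "integral {0..L} (\<lambda>x. (N (x + h) - N x)\<^sup>2) \<le> h\<^sup>2 * ((32 * pi\<^sup>2 + 128 * B\<^sup>2) * G)" .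
    qed auto
    also have "\<dots> = (4 * B1\<^sup>2 + 144 * B\<^sup>2 + 64 * pi\<^sup>2 * \<Lambda>\<^sup>2 + 32 * pi\<^sup>2) * (h\<^sup>2 * G)" by (simp add: algebra_simps)
    finally show ?thesis .
  qed
  \<comment> \<open>off the null set \<open>E\<close> and its translate, the constants cancel in the increment of \<open>d\<close>\<close>
  define E where "E = {x \<in> {0..2*pi}. 2 * c_star * d x \<noteq> evolution_rhs u x - evolution_rhs v x}
     \<union> {x \<in> {0..2*pi}. weak_deriv u x \<noteq> g x} \<union> {x \<in> {0..2*pi}. weak_deriv v x \<noteq> P x}"
  have E: "negligible E" unfolding E_def by (intro negligible_Un d U V)
  have Es: "negligible ((\<lambda>x. x - h) ` E)"
    using E by (intro negligible_differentiable_image_negligible) (auto intro!: derivative_intros simp: differentiable_on_def)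
  define \<kappa> where "\<kappa> = 1 / (4 * pi) * integral {0..2*pi} (\<lambda>y. (pi - y) * u y) - 1 / (4 * pi) * integral {0..2*pi} (\<lambda>y. (pi - y) * v y)"
  have dx: "2 * c_star * d x = b x * z x - 2 * (\<omega> x * P x) + \<kappa> + N x / 2" if x: "x \<in> {0..2*pi}" "x \<notin> E" for x
  proof -
    have "2 * c_star * d x = evolution_rhs u x - evolution_rhs v x" "weak_deriv u x = g x" "weak_deriv v x = P x"
      using x by (auto simp: E_def)
    then show ?thesis
      using Ev(5)[OF x(1)] Ew(5)[OF x(1)]
      by (simp add: b_def z_def \<omega>_def w_def \<kappa>_def N_def Nu_def Nv_def diff_divide_distrib power2_eq_square algebra_simps)
  qed
  have incr: "\<Delta> x * (2 * c_star * (d (x + h) - d x)) = \<Delta> x * (b x * \<Delta>z x) + \<Delta> x * Q x"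
    if "x \<in> {0..L} - (E \<union> (\<lambda>x. x - h) ` E)" for x
  proof -
    have x: "x \<in> {0..L}" "x \<notin> E" and xh: "x + h \<notin> E"
      using that by (auto simp: image_iff)
    have "2 * c_star * (d (x + h) - d x) = 2 * c_star * d (x + h) - 2 * c_star * d x" by (simp add: algebra_simps)
    also have "\<dots> = b x * \<Delta>z x + Q x"
      unfolding dx[OF mem(1)[OF x(1)] x(2)] dx[OF mem(2)[OF x(1)] xh] Q_def \<Delta>z_def
      by (simp add: algebra_simps diff_divide_distrib)
    finally show ?thesis by (simp add: distrib_left)
  qed
  have int: "f integrable_on {0..L}" if "bounded_measurable L f" for f
    using bounded_measurable_integrable[OF that] by (simp add: absolutely_integrable_on_def)
  have \<Delta>m: "bounded_measurable L \<Delta>" by (rule bounded_measurable_continuous[OF \<Delta>c])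
  have "2 * c_star * integral {0..L} (\<lambda>x. \<Delta> x * (d (x + h) - d x)) = integral {0..L} (\<lambda>x. 2 * c_star * (\<Delta> x * (d (x + h) - d x)))"
    by (rule integral_mult_right[symmetric])
  also have "\<dots> = integral {0..L} (\<lambda>x. \<Delta> x * (b x * \<Delta>z x) + \<Delta> x * Q x)"
    by (rule integral_spike[OF negligible_Un[OF E Es]]) (use incr in \<open>simp add: algebra_simps\<close>)
  also have "\<dots> = integral {0..L} (\<lambda>x. \<Delta> x * (b x * \<Delta>z x)) + integral {0..L} (\<lambda>x. \<Delta> x * Q x)"
    by (intro Henstock_Kurzweil_Integration.integral_add int bounded_measurable_mult \<Delta>m \<Delta>zm Qm bounded_measurable_continuous[OF shc(2)[OF bc]])
  finally have eq: "2 * c_star * integral {0..L} (\<lambda>x. \<Delta> x * (d (x + h) - d x))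
      = integral {0..L} (\<lambda>x. \<Delta> x * (b x * \<Delta>z x)) + integral {0..L} (\<lambda>x. \<Delta> x * Q x)" .
  have "\<bar>integral {0..L} (\<lambda>x. \<Delta> x * Q x)\<bar> \<le> (integral {0..L} (\<lambda>x. (\<Delta> x)\<^sup>2) + integral {0..L} (\<lambda>x. (Q x)\<^sup>2)) / 2"
    by (intro abs_integral_mult_le square_integrable_bounded \<Delta>m Qm)
  also have "\<dots> \<le> (h\<^sup>2 * G + (4 * B1\<^sup>2 + 144 * B\<^sup>2 + 64 * pi\<^sup>2 * \<Lambda>\<^sup>2 + 32 * pi\<^sup>2) * (h\<^sup>2 * G)) / 2"
    using I\<Delta> IQ by simp
  finally have "\<bar>2 * c_star * integral {0..L} (\<lambda>x. \<Delta> x * (d (x + h) - d x))\<bar>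
      \<le> B1 * h\<^sup>2 * G + (h\<^sup>2 * G + (4 * B1\<^sup>2 + 144 * B\<^sup>2 + 64 * pi\<^sup>2 * \<Lambda>\<^sup>2 + 32 * pi\<^sup>2) * (h\<^sup>2 * G)) / 2"
    using eq T1 by linarith
  also have "\<dots> = stability_constant B \<Lambda> * h\<^sup>2 * G"
    unfolding stability_constant_def B1_def[symmetric] by (simp add: algebra_simps add_divide_distrib)
  finally show ?thesis by (simp add: \<Delta>_def L_def G_def)
qed

text \<open>Only the derivative of \<open>u\<close>, the differences \<open>u x - u 0\<close> and functionals that annihilate constants enter
  the right-hand side.\<close>

lemma evolution_rhs_add_const:
  assumes u: "lipschitz_periodic u P" and v: "lipschitz_periodic v P"
    and uv: "\<And>x. x \<in> {0..2*pi} \<Longrightarrow> u x = v x + c"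
  shows "negligible {x \<in> {0..2*pi}. evolution_rhs u x \<noteq> evolution_rhs v x}"
proof -
  note U = lipschitz_periodicD[OF u] and V = lipschitz_periodicD[OF v]
  note Eu = evolution_rhs_eq[OF u] and Ev = evolution_rhs_eq[OF v]
  define Nu where "Nu = inv_deriv0 (\<lambda>y. u y + 2 * (weak_deriv u y)\<^sup>2)"
  define Nv where "Nv = inv_deriv0 (\<lambda>y. v y + 2 * (weak_deriv v y)\<^sup>2)"
  have vc: "continuous_on {0..2*pi} v" by (rule primitive_on_continuous[OF V(2)])
  have int: "f integrable_on {0..2*pi}" if "bounded_measurable (2*pi) f" for f
    using bounded_measurable_integrable[OF that] by (simp add: absolutely_integrable_on_def)
  have vi: "(\<lambda>x. v x + 2 * (P x)\<^sup>2) integrable_on {0..2*pi}"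
    by (intro int bounded_measurable_add bounded_measurable_cmult bounded_measurable_power2 V bounded_measurable_continuous[OF vc])
  have "integral {0..2*pi} (\<lambda>x. u x + 2 * (P x)\<^sup>2) = integral {0..2*pi} (\<lambda>x. (v x + 2 * (P x)\<^sup>2) + c)"
    by (rule integral_cong) (simp add: uv)
  also have "\<dots> = integral {0..2*pi} (\<lambda>x. v x + 2 * (P x)\<^sup>2) + 2 * pi * c"
    using Henstock_Kurzweil_Integration.integral_add[OF vi integrable_const_ivl[of c 0 "2*pi"]] by simp
  finally have M: "integral {0..2*pi} (\<lambda>x. u x + 2 * (P x)\<^sup>2) / (2*pi) = integral {0..2*pi} (\<lambda>x. v x + 2 * (P x)\<^sup>2) / (2*pi) + c"
    by (simp add: add_divide_distrib)
  have N: "Nu x - Nv x = Nu 0 - Nv 0" if x: "x \<in> {0..2*pi}" for x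
  proof -
    have "integral {0..x} (\<lambda>x. u x + 2 * (P x)\<^sup>2 - integral {0..2*pi} (\<lambda>x. u x + 2 * (P x)\<^sup>2) / (2*pi))
       = integral {0..x} (\<lambda>x. v x + 2 * (P x)\<^sup>2 - integral {0..2*pi} (\<lambda>x. v x + 2 * (P x)\<^sup>2) / (2*pi))"
      unfolding M by (rule integral_cong) (use uv x in auto)
    then show ?thesis
      using primitive_on_eq[OF Eu(2) x] primitive_on_eq[OF Ev(2) x] unfolding Nu_def Nv_def by linarith
  qed
  have Nc: "Nu integrable_on {0..2*pi}" "Nv integrable_on {0..2*pi}"
    unfolding Nu_def Nv_def using Eu(4) Ev(4)
    by (auto intro!: integrable_continuous_interval intro: continuous_on_subset)
  have "integral {0..2*pi} (\<lambda>x. Nu 0 - Nv 0) = integral {0..2*pi} (\<lambda>x. Nu x - Nv x)"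
    by (rule integral_cong) (rule N[symmetric])
  also have "\<dots> = 0"
    using Henstock_Kurzweil_Integration.integral_diff[OF Nc] Eu(3) Ev(3) by (simp add: Nu_def Nv_def)
  finally have "Nu 0 - Nv 0 = 0" by simp
  then have NN: "Nu x = Nv x" if "x \<in> {0..2*pi}" for x using N[OF that] by simp
  have "integral {0..2*pi} (\<lambda>y. (pi - y) * u y) = integral {0..2*pi} (\<lambda>y. (pi - y) * v y + c * (pi - y))"
    by (rule integral_cong) (simp add: uv algebra_simps)
  also have "\<dots> = integral {0..2*pi} (\<lambda>y. (pi - y) * v y) + integral {0..2*pi} (\<lambda>y. c * (pi - y))"
    by (intro Henstock_Kurzweil_Integration.integral_add integrable_continuous_interval continuous_intros vc)
  also have "integral {0..2*pi} (\<lambda>y. c * (pi - y)) = c * integral {0..2*pi} (\<lambda>y. pi - y)" by (rule integral_mult_right)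
  finally have \<kappa>: "integral {0..2*pi} (\<lambda>y. (pi - y) * u y) = integral {0..2*pi} (\<lambda>y. (pi - y) * v y)"
    by (simp add: integral_pi_minus)
  have "evolution_rhs u x = evolution_rhs v x"
    if x: "x \<in> {0..2*pi}" "weak_deriv u x = P x" "weak_deriv v x = P x" for x
    unfolding Eu(5)[OF x(1,2)] Ev(5)[OF x(1,3)] \<kappa>
    using NN[OF x(1)] uv[OF x(1)] uv[of 0] by (simp add: Nu_def Nv_def)
  then show ?thesis
    by (intro negligible_subset[OF negligible_Un[OF U(5) V(5)]]) blast
qed

text \<open>Let \<open>G\<close> be the integral of the square of \<open>\<partial>\<^sub>x (u - v)\<close>. By \<open>rhs_increment_estimate\<close> the time derivative
  of the \<open>L\<^sup>2\<close> norm squared of an increment is at most a constant times \<open>h\<^sup>2 G\<close>. Integrating in time, dividing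
  by \<open>h\<^sup>2\<close> and letting \<open>h\<close> tend to \<open>0\<close> bounds \<open>G t\<close> by the time integral of \<open>G\<close>, so that \<open>G = 0\<close> by
  \<open>exp_weighted_absorption\<close>. Gronwall's inequality is not applicable
  directly, because only the boundedness of \<open>G\<close> in time is known.\<close>

theorem weak_strong_uniqueness:
  assumes T: "0 \<le> T" "T < T1" and "0 \<le> B"
    and uW: "\<And>t. \<bar>t\<bar> < T1 \<Longrightarrow> u t \<in> W1inf_per" and uB: "\<And>t. \<bar>t\<bar> \<le> T \<Longrightarrow> W1inf_norm (u t) \<le> B"
    and ueq: "\<And>t. \<bar>t\<bar> < T1 \<Longrightarrow> \<exists>D. has_time_deriv u D t \<and> (AE x in torus. 2 * c_star * D x = evolution_rhs (u t) x)"
    and v: "\<And>t. \<bar>t\<bar> < T1 \<Longrightarrow> lipschitz_periodic (v t) (P t)"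
    and PB: "\<And>t x. \<bar>t\<bar> \<le> T \<Longrightarrow> x \<in> {0..2*pi} \<Longrightarrow> \<bar>P t x\<bar> \<le> B"
    and PL: "\<And>t x y. \<bar>t\<bar> \<le> T \<Longrightarrow> x \<in> {0..2*pi} \<Longrightarrow> y \<in> {0..2*pi} \<Longrightarrow> \<bar>P t x - P t y\<bar> \<le> \<Lambda> * \<bar>x - y\<bar>"
    and veq: "\<And>t. \<bar>t\<bar> < T1 \<Longrightarrow> \<exists>D. has_time_deriv v D t \<and> (AE x in torus. 2 * c_star * D x = evolution_rhs (v t) x)"
    and init: "u 0 = v 0" and t: "\<bar>t\<bar> \<le> T"
  shows "u t = v t"
proof -
  define gu where "gu t = (SOME g. lipschitz_periodic (u t) g \<and> (\<forall>x. \<bar>g x\<bar> \<le> Linf_norm (weak_deriv (u t))))" for t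
  have gu: "lipschitz_periodic (u t) (gu t)" "\<bar>gu t x\<bar> \<le> Linf_norm (weak_deriv (u t))" if "\<bar>t\<bar> < T1" for t x
  proof -
    have "\<exists>g. lipschitz_periodic (u t) g \<and> (\<forall>x. \<bar>g x\<bar> \<le> Linf_norm (weak_deriv (u t)))"
      using W1inf_perE[OF uW[OF that]] by metis
    from someI_ex[OF this] show "lipschitz_periodic (u t) (gu t)" "\<bar>gu t x\<bar> \<le> Linf_norm (weak_deriv (u t))"
      by (auto simp: gu_def)
  qed
  have guB: "\<bar>gu t x\<bar> \<le> B" if "\<bar>t\<bar> \<le> T" for t x
  proof -
    have t1: "\<bar>t\<bar> < T1" using that T by simp
    have "0 \<le> Linf_norm (u t)" using abs_le_W1inf_norm(1)[OF gu(1)[OF t1], of 0] by simp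
    then show ?thesis using gu(2)[OF t1, of x] uB[OF that] by (simp add: W1inf_norm_def)
  qed
  define w where "w t = (\<lambda>x. u t x - v t x)" for t
  define z where "z t = (\<lambda>x. gu t x - P t x)" for t
  have w: "lipschitz_periodic (w t) (z t)" if "\<bar>t\<bar> < T1" for t
    unfolding w_def z_def by (intro lipschitz_periodic_diff gu v that)
  note wD = lipschitz_periodicD[OF w]
  define G where "G t = integral {0..2*pi} (\<lambda>x. (z t x)\<^sup>2)" for t
  obtain Du where Du: "\<And>t. \<bar>t\<bar> < T1 \<Longrightarrow> has_time_deriv u (Du t) t \<and> (AE x in torus. 2 * c_star * Du t x = evolution_rhs (u t) x)"
    using ueq by metis
  obtain Dv where Dv: "\<And>t. \<bar>t\<bar> < T1 \<Longrightarrow> has_time_deriv v (Dv t) t \<and> (AE x in torus. 2 * c_star * Dv t x = evolution_rhs (v t) x)"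
    using veq by metis
  define d where "d t = (\<lambda>x. Du t x - Dv t x)" for t
  have L2: "periodic_2pi D" "square_integrable (2*pi) D" if "D \<in> L2_per" for D
    using that by (auto simp: L2_per_def square_integrable_def borel_measurable_torus_iff integrable_torus_iff
        periodic_2pi_power absolutely_integrable_on_def)
  have DL: "Du t \<in> L2_per" "Dv t \<in> L2_per" if "\<bar>t\<bar> < T1" for t
    using Du[OF that] Dv[OF that] by (auto simp: has_time_deriv_def)
  have dsq: "square_integrable (2*pi) (d t)" if "\<bar>t\<bar> < T1" for t
    unfolding d_def by (intro square_integrable_diff L2 DL that)
  have sql: "square_integrable (2*pi) f" if "lipschitz_periodic f g" for f g
    by (intro square_integrable_bounded bounded_measurable_continuous primitive_on_continuous[OF lipschitz_periodicD(2)[OF that]])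
  have near: "eventually (\<lambda>h. \<bar>t + h\<bar> < T1) (at 0)" if "\<bar>t\<bar> < T1" for t
  proof -
    have "((\<lambda>h. \<bar>t + h\<bar>) \<longlongrightarrow> \<bar>t + 0\<bar>) (at 0)" by (intro tendsto_intros)
    then show ?thesis using order_tendstoD(2)[of "\<lambda>h. \<bar>t + h\<bar>" "\<bar>t + 0\<bar>"] that by simp
  qed
  \<comment> \<open>the curve \<open>w\<close> is differentiable in \<open>L\<^sup>2(0, 2\<pi>)\<close>\<close>
  define \<rho> where "\<rho> t h = (\<lambda>x. (w (t + h) x - w t x) / h - d t x)" for t h
  have \<rho>sq: "square_integrable (2*pi) (\<rho> t h)" if "\<bar>t\<bar> < T1" "\<bar>t + h\<bar> < T1" for t h
  proof -
    have "square_integrable (2*pi) (\<lambda>x. (1/h) * (w (t + h) x - w t x) - d t x)"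
      by (intro square_integrable_diff square_integrable_cmult dsq sql[OF w] that)
    then show ?thesis by (simp add: \<rho>_def)
  qed
  have \<rho>0: "((\<lambda>h. integral {0..2*pi} (\<lambda>x. (\<rho> t h x)\<^sup>2)) \<longlongrightarrow> 0) (at 0)" if t: "\<bar>t\<bar> < T1" for t
  proof -
    define Lu where "Lu h = L2_norm (\<lambda>x. (u (t + h) x - u t x) / h - Du t x)" for h
    define Lv where "Lv h = L2_norm (\<lambda>x. (v (t + h) x - v t x) / h - Dv t x)" for h
    have "(Lu \<longlongrightarrow> 0) (at 0)" "(Lv \<longlongrightarrow> 0) (at 0)"
      using Du[OF t] Dv[OF t] unfolding has_time_deriv_def Lu_def[abs_def] Lv_def[abs_def] by auto
    then have "((\<lambda>h. 2 * (Lu h)\<^sup>2 + 2 * (Lv h)\<^sup>2) \<longlongrightarrow> 2 * 0\<^sup>2 + 2 * 0\<^sup>2) (at 0)" by (intro tendsto_intros)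
    then have lim: "((\<lambda>h. 2 * (Lu h)\<^sup>2 + 2 * (Lv h)\<^sup>2) \<longlongrightarrow> 0) (at 0)" by simp
    have quot: "L2_norm (\<lambda>x. (f (t + h) x - f t x) / h - D x) ^ 2 = integral {0..2*pi} (\<lambda>x. ((f (t + h) x - f t x) / h - D x)\<^sup>2)
        \<and> square_integrable (2*pi) (\<lambda>x. (f (t + h) x - f t x) / h - D x)"
      if f: "\<And>t. \<bar>t\<bar> < T1 \<Longrightarrow> lipschitz_periodic (f t) (g t)" and D: "D \<in> L2_per" and h: "\<bar>t + h\<bar> < T1" for f g D h
    proof -
      have "square_integrable (2*pi) (\<lambda>x. (1/h) * (f (t + h) x - f t x) - D x)"
        by (intro square_integrable_diff square_integrable_cmult sql[OF f] L2 D h t)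
      then have sq: "square_integrable (2*pi) (\<lambda>x. (f (t + h) x - f t x) / h - D x)" by simp
      have per: "periodic_2pi (\<lambda>x. (f (t + h) x - f t x) / h - D x)"
        using lipschitz_periodicD(1)[OF f[OF h]] lipschitz_periodicD(1)[OF f[OF t]] L2(1)[OF D] by (simp add: periodic_2pi_def)
      have "(\<lambda>x. ((f (t + h) x - f t x) / h - D x)\<^sup>2) absolutely_integrable_on {0..2*pi}"
        using sq by (auto simp: square_integrable_def intro!: nonnegative_absolutely_integrable_1)
      then show ?thesis using L2_norm_eq[OF per] sq integral_square_nonneg by simp
    qed
    have "eventually (\<lambda>h. norm (integral {0..2*pi} (\<lambda>x. (\<rho> t h x)\<^sup>2)) \<le> 2 * (Lu h)\<^sup>2 + 2 * (Lv h)\<^sup>2) (at 0)"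
      using near[OF t]
    proof eventually_elim
      case (elim h)
      note qu = quot[of u gu "Du t" h, OF gu(1) DL(1)[OF t] elim] and qv = quot[of v P "Dv t" h, OF v DL(2)[OF t] elim]
      have "integral {0..2*pi} (\<lambda>x. (\<rho> t h x)\<^sup>2)
         = integral {0..2*pi} (\<lambda>x. (((u (t + h) x - u t x) / h - Du t x) - ((v (t + h) x - v t x) / h - Dv t x))\<^sup>2)"
        by (rule integral_cong) (simp add: \<rho>_def w_def d_def diff_divide_distrib add_divide_distrib algebra_simps)
      also have "\<dots> \<le> 2 * (Lu h)\<^sup>2 + 2 * (Lv h)\<^sup>2"
        using integral_square_sum_le(2)[OF conjunct2[OF qu] conjunct2[OF qv]] qu qv by (simp add: Lu_def Lv_def)
      finally show ?case using integral_square_nonneg by simp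
    qed
    then show ?thesis using lim by (rule Lim_null_comparison)
  qed
  have dneg: "negligible {x \<in> {0..2*pi}. 2 * c_star * d t x \<noteq> evolution_rhs (u t) x - evolution_rhs (v t) x}"
    if t: "\<bar>t\<bar> < T1" for t
  proof -
    have AE: "negligible {x \<in> {0..2*pi}. \<not> 2 * c_star * D x = evolution_rhs f x}"
      if "AE x in torus. 2 * c_star * D x = evolution_rhs f x" "D \<in> L2_per" "lipschitz_periodic f g" for D f g
      using that(1) by (subst (asm) AE_torus_iff)
        (simp_all add: periodic_2piD[OF L2(1)[OF that(2)]] periodic_2piD[OF evolution_rhs_eq(1)[OF that(3)]])
    show ?thesis
      by (rule negligible_subset[OF negligible_Un[OF AE[OF conjunct2[OF Du[OF t]] DL(1)[OF t] gu(1)[OF t]]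
              AE[OF conjunct2[OF Dv[OF t]] DL(2)[OF t] v[OF t]]]])
         (auto simp: d_def algebra_simps)
  qed
  define C where "C = stability_constant B \<Lambda> / c_star"
  have cs: "0 < c_star" by (simp add: c_star_def)
  have C: "0 < C" using stability_constant_pos[OF \<open>0 \<le> B\<close>] cs by (simp add: C_def)
  have G0: "G t = 0" if t: "\<bar>t\<bar> \<le> T" for t
  proof (rule exp_weighted_absorption[where G = G and t = t and S = "{t. \<bar>t\<bar> \<le> T}" and B = "8 * pi * B\<^sup>2" and C = C])
    fix s assume "s \<in> {t. \<bar>t\<bar> \<le> T}"
    then have s: "\<bar>s\<bar> \<le> T" "\<bar>s\<bar> < T1" using T by auto
    show "0 \<le> G s" unfolding G_def by (rule integral_square_nonneg)
    have "G s \<le> integral {0..2*pi} (\<lambda>x. (2 * B)\<^sup>2)"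
      unfolding G_def
    proof (rule integral_le)
      show "(\<lambda>x. (z s x)\<^sup>2) integrable_on {0..2*pi}"
        using square_integrable_bounded[OF wD(3)[OF s(2)]] by (simp add: square_integrable_def)
      show "(z s x)\<^sup>2 \<le> (2 * B)\<^sup>2" if "x \<in> {0..2*pi}" for x
      proof -
        have "\<bar>z s x\<bar> \<le> \<bar>2 * B\<bar>" using guB[OF s(1), of x] PB[OF s(1) that] unfolding z_def by linarith
        then show ?thesis by (simp only: abs_le_square_iff)
      qed
    qed (rule integrable_const_ivl)
    then show "G s \<le> 8 * pi * B\<^sup>2" by (simp add: power_mult_distrib)
  next
    fix M t assume M: "0 \<le> M" and le: "\<And>s. s \<in> {t. \<bar>t\<bar> \<le> T} \<Longrightarrow> G s \<le> M * exp (2 * C * \<bar>s\<bar>)" and "t \<in> {t. \<bar>t\<bar> \<le> T}"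
    then have t: "\<bar>t\<bar> \<le> T" "\<bar>t\<bar> < T1" using T by auto
    show "G t \<le> M / 2 * exp (2 * C * \<bar>t\<bar>)"
      unfolding G_def
    proof (rule integral_square_derivative_le[OF wD(2,3)[OF t(2)]])
      fix h :: real assume h: "0 < h" "h < 2 * pi"
      define L where "L = 2 * pi - h"
      have L: "0 \<le> h" "h \<le> 2 * pi" "L \<le> 2 * pi" using h by (auto simp: L_def)
      have inc: "square_integrable L (\<lambda>x. f (x + h) - f x)" if "square_integrable (2*pi) f" for f
        using square_integrable_shift(1)[OF that L(1,2)] square_integrable_subinterval(1)[OF that L(3)]
        by (auto simp: L_def intro: square_integrable_diff)
      define e where "e s = integral {0..L} (\<lambda>x. (w s (x + h) - w s x)\<^sup>2)" for s
      define e' where "e' s = 2 * integral {0..L} (\<lambda>x. (w s (x + h) - w s x) * (d s (x + h) - d s x))" for s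
      have de: "(e has_real_derivative e' s) (at s)" if s: "\<bar>s\<bar> < T1" for s
        unfolding DERIV_def e_def e'_def
      proof (rule square_integral_has_derivative)
        show "square_integrable L (\<lambda>x. w s (x + h) - w s x)" "square_integrable L (\<lambda>x. d s (x + h) - d s x)"
          by (intro inc sql[OF w] dsq s)+
        show "eventually (\<lambda>\<eta>. square_integrable L (\<lambda>x. w (s + \<eta>) (x + h) - w (s + \<eta>) x)) (at 0)"
          using near[OF s] by eventually_elim (intro inc sql[OF w])
        have "eventually (\<lambda>\<eta>. norm (integral {0..L} (\<lambda>x. ((w (s + \<eta>) (x + h) - w (s + \<eta>) x - (w s (x + h) - w s x)) / \<eta> - (d s (x + h) - d s x))\<^sup>2))
             \<le> 4 * integral {0..2*pi} (\<lambda>x. (\<rho> s \<eta> x)\<^sup>2)) (at 0)"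
          using near[OF s]
        proof eventually_elim
          case (elim \<eta>)
          note r = \<rho>sq[OF s elim]
          have "integral {0..L} (\<lambda>x. ((w (s + \<eta>) (x + h) - w (s + \<eta>) x - (w s (x + h) - w s x)) / \<eta> - (d s (x + h) - d s x))\<^sup>2)
              = integral {0..L} (\<lambda>x. (\<rho> s \<eta> (x + h) - \<rho> s \<eta> x)\<^sup>2)"
            by (rule integral_cong) (simp add: \<rho>_def diff_divide_distrib add_divide_distrib algebra_simps)
          also have "\<dots> \<le> 2 * integral {0..L} (\<lambda>x. (\<rho> s \<eta> (x + h))\<^sup>2) + 2 * integral {0..L} (\<lambda>x. (\<rho> s \<eta> x)\<^sup>2)"
            using square_integrable_shift(1)[OF r L(1,2)] square_integrable_subinterval(1)[OF r L(3)]
            by (intro integral_square_sum_le(2)) (auto simp: L_def)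
          also have "\<dots> \<le> 4 * integral {0..2*pi} (\<lambda>x. (\<rho> s \<eta> x)\<^sup>2)"
            using square_integrable_shift(2)[OF r L(1,2)] square_integrable_subinterval(2)[OF r L(3)] by (simp add: L_def)
          finally show ?case using integral_square_nonneg by simp
        qed
        moreover have "((\<lambda>\<eta>. 4 * integral {0..2*pi} (\<lambda>x. (\<rho> s \<eta> x)\<^sup>2)) \<longlongrightarrow> 0) (at 0)"
          using tendsto_mult[OF tendsto_const[of 4] \<rho>0[OF s]] by simp
        ultimately show "((\<lambda>\<eta>. integral {0..L} (\<lambda>x. ((w (s + \<eta>) (x + h) - w (s + \<eta>) x - (w s (x + h) - w s x)) / \<eta> - (d s (x + h) - d s x))\<^sup>2)) \<longlongrightarrow> 0) (at 0)"
          by (rule Lim_null_comparison)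
      qed
      have e'b: "\<bar>e' s\<bar> \<le> C * (h\<^sup>2 * M) * exp (2 * C * \<bar>s\<bar>)" if s: "\<bar>s\<bar> \<le> T" for s
      proof -
        have s1: "\<bar>s\<bar> < T1" using s T by simp
        have "\<bar>c_star * e' s\<bar> \<le> stability_constant B \<Lambda> * h\<^sup>2 * G s"
          using rhs_increment_estimate[OF gu(1)[OF s1] v[OF s1] guB[OF s] PB[OF s] PL[OF s] h dneg[OF s1]]
          by (simp add: e'_def w_def z_def L_def G_def algebra_simps)
        then have "\<bar>e' s\<bar> \<le> C * h\<^sup>2 * G s"
          using cs by (simp add: C_def abs_mult field_simps)
        also have "\<dots> \<le> C * h\<^sup>2 * (M * exp (2 * C * \<bar>s\<bar>))"
          using C s by (intro mult_left_mono le) auto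
        finally show ?thesis by (simp add: algebra_simps)
      qed
      have "norm (e t - e 0) \<le> (h\<^sup>2 * M) / 2 * exp (2 * C * \<bar>t\<bar>)"
      proof (rule exp_weighted_derivative_bound[where f' = e' and T = T])
        show "(e has_vector_derivative e' s) (at s)" if "\<bar>s\<bar> \<le> T" for s
          using de[of s] that T by (simp add: has_real_derivative_iff_has_vector_derivative)
      qed (use C M e'b t in auto)
      moreover have "e 0 = 0" by (simp add: e_def w_def init)
      ultimately show "integral {0..2*pi - h} (\<lambda>x. (w t (x + h) - w t x)\<^sup>2) \<le> h\<^sup>2 * (M / 2 * exp (2 * C * \<bar>t\<bar>))"
        by (simp add: e_def L_def algebra_simps)
    qed simp
  qed (use t C \<open>0 \<le> B\<close> in auto)
  \<comment> \<open>hence \<open>w\<close> is constant in space, and then both right-hand sides agree, which fixes the constant\<close>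
  have wconst: "w t x = w t 0" if t: "\<bar>t\<bar> \<le> T" and x: "x \<in> {0..2*pi}" for t x
  proof -
    have t1: "\<bar>t\<bar> < T1" using t T by simp
    have "(w t x - w t 0)\<^sup>2 \<le> (x - 0) * integral {0..x} (\<lambda>x. (z t x)\<^sup>2)"
      using x by (intro integral_square_increment_le[OF wD(2,3)[OF t1]]) auto
    also have "integral {0..x} (\<lambda>x. (z t x)\<^sup>2) = 0"
      using square_integrable_subinterval(2)[OF square_integrable_bounded[OF wD(3)[OF t1]], of x] G0[OF t] x
        integral_square_nonneg[of x "z t"] by (simp add: G_def)
    finally show ?thesis by simp
  qed
  define \<mu> where "\<mu> t = integral {0..2*pi} (w t)" for t
  have wi: "w t integrable_on {0..2*pi}" if "\<bar>t\<bar> < T1" for t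
    by (rule integrable_continuous_interval[OF primitive_on_continuous[OF wD(2)[OF that]]])
  have d0: "negligible {x \<in> {0..2*pi}. d t x \<noteq> 0}" if t: "\<bar>t\<bar> \<le> T" for t
  proof -
    have t1: "\<bar>t\<bar> < T1" using t T by simp
    have eq: "u t x = v t x + w t 0" if "x \<in> {0..2*pi}" for x using wconst[OF t that] by (simp add: w_def)
    have "primitive_on (2*pi) (\<lambda>x. v t x + w t 0) (\<lambda>x. P t x + 0)"
      by (intro primitive_on_add primitive_on_const lipschitz_periodicD[OF v[OF t1]])
    then have "primitive_on (2*pi) (\<lambda>x. v t x + w t 0) (P t)" by simp
    then have "primitive_on (2*pi) (u t) (P t)" by (rule primitive_on_cong) (simp add: eq)
    then have uP: "lipschitz_periodic (u t) (P t)"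
      using lipschitz_periodicD[OF v[OF t1]] lipschitz_periodicD[OF gu(1)[OF t1]] by (simp add: lipschitz_periodic_def)
    show ?thesis
      by (rule negligible_subset[OF negligible_Un[OF dneg[OF t1] evolution_rhs_add_const[OF uP v[OF t1] eq]]])
         (use cs in auto)
  qed
  have d\<mu>: "(\<mu> has_vector_derivative 0) (at t)" if t: "\<bar>t\<bar> \<le> T" for t
  proof -
    have t1: "\<bar>t\<bar> < T1" using t T by simp
    have "eventually (\<lambda>h. norm ((\<mu> (t + h) - \<mu> t) / h) \<le> sqrt (integral {0..2*pi} (\<lambda>x. (\<rho> t h x)\<^sup>2)) * sqrt (2 * pi)) (at 0)"
      using near[OF t1]
    proof eventually_elim
      case (elim h)
      have "(\<mu> (t + h) - \<mu> t) / h = integral {0..2*pi} (\<lambda>x. (w (t + h) x - w t x) / h)"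
        using wi[OF t1] wi[OF elim] by (simp add: \<mu>_def Henstock_Kurzweil_Integration.integral_diff)
      also have "\<dots> = integral {0..2*pi} (\<lambda>x. \<rho> t h x * 1)"
        by (rule integral_spike[OF d0[OF t]]) (auto simp: \<rho>_def)
      finally have "norm ((\<mu> (t + h) - \<mu> t) / h) = \<bar>integral {0..2*pi} (\<lambda>x. \<rho> t h x * 1)\<bar>" by simp
      also have "\<dots> \<le> sqrt (integral {0..2*pi} (\<lambda>x. (\<rho> t h x)\<^sup>2)) * sqrt (integral {0..2*pi} (\<lambda>x. 1\<^sup>2))"
        by (intro abs_integral_mult_le(2) \<rho>sq[OF t1 elim] square_integrable_bounded) simp
      finally show ?case by simp
    qed
    moreover have "((\<lambda>h. sqrt (integral {0..2*pi} (\<lambda>x. (\<rho> t h x)\<^sup>2)) * sqrt (2 * pi)) \<longlongrightarrow> sqrt 0 * sqrt (2 * pi)) (at 0)"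
      by (intro tendsto_intros \<rho>0[OF t1])
    then have "((\<lambda>h. sqrt (integral {0..2*pi} (\<lambda>x. (\<rho> t h x)\<^sup>2)) * sqrt (2 * pi)) \<longlongrightarrow> 0) (at 0)" by simp
    ultimately have "((\<lambda>h. (\<mu> (t + h) - \<mu> t) / h) \<longlongrightarrow> 0) (at 0)"
      by (rule Lim_null_comparison)
    then show ?thesis
      unfolding has_real_derivative_iff_has_vector_derivative[symmetric] DERIV_def .
  qed
  have "\<mu> t = 0"
  proof (rule linear_differential_inequality_zero[where f' = "\<lambda>_. 0" and C = 0, OF d\<mu> _ _ t])
    show "\<mu> 0 = 0" by (simp add: \<mu>_def w_def init)
  qed auto
  moreover have "\<mu> t = integral {0..2*pi} (\<lambda>x. w t 0)"
    unfolding \<mu>_def by (rule integral_cong) (rule wconst[OF t])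
  ultimately have "w t 0 = 0" by simp
  then have "u t x = v t x" if "x \<in> {0..2*pi}" for x using wconst[OF t that] by (simp add: w_def)
  moreover have "\<bar>t\<bar> < T1" using t T by simp
  ultimately show ?thesis
    by (intro periodic_eqI lipschitz_periodicD(1)[OF gu(1)] lipschitz_periodicD(1)[OF v]) auto
qed

section \<open>Maximality and uniqueness of the constructed solution\<close>

lemma W1inf_norm_continuous_of_solution:
  assumes "is_solution \<tau> z \<xi>"
  shows "continuous_on (time_interval \<tau>) (\<lambda>t. W1inf_norm (\<xi> t))"
  unfolding continuous_on_def
proof
  fix t assume t: "t \<in> time_interval \<tau>"
  have W: "\<xi> s \<in> W1inf_per" if "s \<in> time_interval \<tau>" for s
    using assms that by (auto simp: is_solution_def continuous_H1_W1inf_def)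
  have lim: "((\<lambda>s. W1inf_norm (\<lambda>x. \<xi> s x - \<xi> t x)) \<longlongrightarrow> 0) (at t within time_interval \<tau>)"
    using assms t by (auto simp: is_solution_def continuous_H1_W1inf_def)
  have "eventually (\<lambda>s. s \<in> time_interval \<tau>) (at t within time_interval \<tau>)"
    by (simp add: eventually_at_filter)
  then have "eventually (\<lambda>s. norm (W1inf_norm (\<xi> s) - W1inf_norm (\<xi> t)) \<le> W1inf_norm (\<lambda>x. \<xi> s x - \<xi> t x)) (at t within time_interval \<tau>)"
  proof eventually_elim
    case (elim s)
    show ?case
      using W1inf_norm_triangle[OF W[OF elim] W[OF t]] W1inf_norm_triangle[OF W[OF t] W[OF elim]]
        W1inf_norm_minus_commute[OF W[OF elim] W[OF t]] by simp
  qed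
  then have "((\<lambda>s. W1inf_norm (\<xi> s) - W1inf_norm (\<xi> t)) \<longlongrightarrow> 0) (at t within time_interval \<tau>)"
    using lim by (rule Lim_null_comparison)
  then show "((\<lambda>s. W1inf_norm (\<xi> s)) \<longlongrightarrow> W1inf_norm (\<xi> t)) (at t within time_interval \<tau>)"
    by (rule LIM_zero_cancel)
qed

lemma W1inf_norm_bounded_of_solution:
  assumes "is_solution \<tau> z \<xi>" and "ereal T < \<tau>"
  obtains R where "\<And>t. \<bar>t\<bar> \<le> T \<Longrightarrow> W1inf_norm (\<xi> t) \<le> R"
proof -
  have "{-T..T} \<subseteq> time_interval \<tau>"
    using assms(2) le_less_trans[of "ereal \<bar>t\<bar>" "ereal T" \<tau> for t] by (auto simp: time_interval_def abs_le_iff)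
  then have "continuous_on {-T..T} (\<lambda>t. W1inf_norm (\<xi> t))"
    by (rule continuous_on_subset[OF W1inf_norm_continuous_of_solution[OF assms(1)]])
  then obtain R where R: "\<forall>t\<in>{-T..T}. \<bar>W1inf_norm (\<xi> t)\<bar> \<le> R"
    using continuous_on_bounded_abs[of "-T" T] by blast
  have "W1inf_norm (\<xi> t) \<le> R" if "\<bar>t\<bar> \<le> T" for t
    using bspec[OF R, of t] that by (simp add: abs_le_iff)
  then show ?thesis by (rule that)
qed

locale maximal_lagrangian_solution = lagrangian_solution +
  assumes blow_up: "\<And>T R. \<tau> = ereal T \<Longrightarrow> \<exists>t. \<bar>t\<bar> < T \<and> R < norm (y t)"
begin

lemma slope_X: "t \<in> time_interval \<tau> \<Longrightarrow> \<xi> \<in> {0..2*pi} \<Longrightarrow> slope t (X t \<xi>) = W t \<xi>"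
  by (simp add: slope_def label_X)

lemma abs_W_le_norm:
  assumes t: "t \<in> time_interval \<tau>" and \<xi>: "\<xi> \<in> {0..2*pi}"
  shows "\<bar>W t \<xi>\<bar> \<le> W1inf_norm (zeta t)"
  using abs_le_W1inf_norm(4)[OF zeta_lipschitz_periodic[OF t] X_range[OF t \<xi>] slope_continuous[OF t]]
  by (simp add: slope_X[OF t \<xi>])

text \<open>A bound on the slope bounds the coefficient \<open>a\<close> of the linear equations for \<open>J\<close> and \<open>K\<close>, hence the whole
  state, which contradicts \<open>blow_up\<close>.\<close>

lemma unbounded_slope_of_finite_life:
  assumes T: "\<tau> = ereal T" and M: "\<And>t \<xi>. \<bar>t\<bar> < T \<Longrightarrow> \<xi> \<in> {0..2*pi} \<Longrightarrow> \<bar>W t \<xi>\<bar> \<le> M"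
  shows False
proof -
  have Tpos: "0 < T" using \<tau> T by simp
  have mem: "t \<in> time_interval \<tau>" if "\<bar>t\<bar> < T" for t using that T by (simp add: time_interval_def)
  have M': "\<bar>W t \<xi>\<bar> \<le> M" if "\<bar>t\<bar> < T" for t \<xi>
    using M[OF that, of "clamp_2pi \<xi>"] by (simp add: clamp_eqs)
  have R0: "0 \<le> M" using M'[of 0 0] Tpos by simp
  define C where "C = pi / 2 + 2 * M"
  have C0: "0 \<le> C" using R0 by (simp add: C_def)
  have aC: "\<bar>a t \<xi>\<bar> \<le> C" if t: "\<bar>t\<bar> < T" for t \<xi>
  proof -
    have "X t \<xi> \<in> {0..2*pi}" using X_range[OF mem[OF t], of "clamp_2pi \<xi>"] by (simp add: clamp_eqs)
    then show ?thesis using M'[OF t, of \<xi>] unfolding a_apply C_def abs_le_iff by (simp add: field_simps)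
  qed
  define E where "E = exp (2 * (k * C) * T)"
  have E1: "1 \<le> E" using C0 Tpos time_rate(1) by (simp add: E_def)
  have "norm (y t) \<le> E + norm K0 * E + M" if t: "\<bar>t\<bar> < T" for t
  proof -
    have aC': "\<bar>a s \<xi>\<bar> \<le> C" if "\<bar>s\<bar> \<le> \<bar>t\<bar>" for s \<xi> using aC that t by simp
    have le: "exp (2 * (k * C) * \<bar>t\<bar>) \<le> E"
      unfolding E_def using C0 time_rate(1) t by (simp add: mult_left_mono)
    have EE: "E \<le> E\<^sup>2" using E1 by (simp add: power2_eq_square)
    have "norm (J t) \<le> E"
    proof (rule norm_bound)
      fix \<xi>
      have "(J t \<xi>)\<^sup>2 \<le> E\<^sup>2" using J_K_square_bounds(2)[OF mem[OF t] aC'] le EE by (meson order_trans)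
      then show "norm (J t \<xi>) \<le> E" using E1 by (simp add: abs_le_square_iff[symmetric])
    qed
    moreover have "norm (K t) \<le> norm K0 * E"
    proof (rule norm_bound)
      fix \<xi>
      have "(K t \<xi>)\<^sup>2 \<le> (K0 \<xi>)\<^sup>2 * exp (2 * (k * C) * \<bar>t\<bar>)"
        by (rule J_K_square_bounds(3)[OF mem[OF t] aC'])
      also have "\<dots> \<le> (norm K0)\<^sup>2 * E\<^sup>2"
      proof (intro mult_mono)
        have "\<bar>K0 \<xi>\<bar> \<le> \<bar>norm K0\<bar>" using norm_bounded[of K0 \<xi>] by simp
        then show "(K0 \<xi>)\<^sup>2 \<le> (norm K0)\<^sup>2" by (simp only: abs_le_square_iff)
      qed (use le EE in auto)
      finally have "(K t \<xi>)\<^sup>2 \<le> (norm K0 * E)\<^sup>2" by (simp add: power_mult_distrib)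
      then have "\<bar>K t \<xi>\<bar> \<le> \<bar>norm K0 * E\<bar>" by (simp only: abs_le_square_iff)
      then show "norm (K t \<xi>) \<le> norm K0 * E" using E1 by simp
    qed
    moreover have "\<bar>p t\<bar> \<le> M" using M'[OF t, of 0] by (simp add: at_0)
    moreover have "norm (y t) \<le> norm (J t) + (norm (K t) + \<bar>p t\<bar>)"
    proof -
      have "norm (y t) \<le> norm (fst (y t)) + norm (snd (y t))" by (metis norm_Pair_le prod.collapse)
      moreover have "norm (snd (y t)) \<le> norm (fst (snd (y t))) + norm (snd (snd (y t)))" by (metis norm_Pair_le prod.collapse)
      ultimately show ?thesis by (simp add: J_def K_def p_def)
    qed
    ultimately show ?thesis by simp
  qed
  then show False using blow_up[OF T, of "E + norm K0 * E + M"] by (metis not_le)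
qed

lemma solution_agrees_with_zeta:
  assumes s: "is_solution \<tau>' (zeta 0) \<xi>" and t: "t \<in> time_interval \<tau>" "t \<in> time_interval \<tau>'"
  shows "\<xi> t = zeta t"
proof -
  obtain T1 where T1: "ereal \<bar>t\<bar> < ereal T1" "ereal T1 < min \<tau> \<tau>'"
    using ereal_dense2[of "ereal \<bar>t\<bar>" "min \<tau> \<tau>'"] t by (auto simp: time_interval_def)
  have mem: "r \<in> time_interval \<tau>" "r \<in> time_interval \<tau>'" if "\<bar>r\<bar> < T1" for r
    using T1(2) that unfolding time_interval_def by (auto intro: less_trans[of _ "ereal T1"])
  obtain R where R: "\<And>r. \<bar>r\<bar> \<le> \<bar>t\<bar> \<Longrightarrow> W1inf_norm (\<xi> r) \<le> R"
    by (rule W1inf_norm_bounded_of_solution[OF s, of "\<bar>t\<bar>"]) (use t(2) in \<open>auto simp: time_interval_def\<close>)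
  obtain C where C: "1 \<le> C" and C1: "\<And>s x. \<bar>s\<bar> \<le> \<bar>t\<bar> \<Longrightarrow> x \<in> {0..2*pi} \<Longrightarrow> \<bar>slope s x\<bar> \<le> C"
    and C2: "\<And>s x x'. \<bar>s\<bar> \<le> \<bar>t\<bar> \<Longrightarrow> x \<in> {0..2*pi} \<Longrightarrow> x' \<in> {0..2*pi} \<Longrightarrow> \<bar>slope s x - slope s x'\<bar> \<le> C * \<bar>x - x'\<bar>"
    and "\<And>s s' x. \<bar>s\<bar> \<le> \<bar>t\<bar> \<Longrightarrow> \<bar>s'\<bar> \<le> \<bar>t\<bar> \<Longrightarrow> x \<in> {0..2*pi} \<Longrightarrow> \<bar>slope s x - slope s' x\<bar> \<le> C * \<bar>s - s'\<bar>"
    and "\<And>s s' x. \<bar>s\<bar> \<le> \<bar>t\<bar> \<Longrightarrow> \<bar>s'\<bar> \<le> \<bar>t\<bar> \<Longrightarrow> x \<in> {0..2*pi} \<Longrightarrow> \<bar>profile s x - profile s' x\<bar> \<le> C * \<bar>s - s'\<bar>"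
    and "\<And>s s' \<xi>. \<bar>s\<bar> \<le> \<bar>t\<bar> \<Longrightarrow> \<bar>s'\<bar> \<le> \<bar>t\<bar> \<Longrightarrow> \<bar>X s \<xi> - X s' \<xi>\<bar> \<le> C * \<bar>s - s'\<bar>"
    by (fact eulerian_bounds[OF t(1)])
  show ?thesis
  proof (rule weak_strong_uniqueness[where T = "\<bar>t\<bar>" and ?T1.0 = T1 and B = "max R C" and P = slope and \<Lambda> = C and u = \<xi> and v = zeta])
    show "\<xi> r \<in> W1inf_per" if "\<bar>r\<bar> < T1" for r
      using s mem(2)[OF that] by (auto simp: is_solution_def continuous_H1_W1inf_def)
    show "\<exists>D. has_time_deriv \<xi> D r \<and> (AE x in torus. 2 * c_star * D x = evolution_rhs (\<xi> r) x)" if "\<bar>r\<bar> < T1" for r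
      using s mem(2)[OF that] by (auto simp: is_solution_def)
    show "\<exists>D. has_time_deriv zeta D r \<and> (AE x in torus. 2 * c_star * D x = evolution_rhs (zeta r) x)" if "\<bar>r\<bar> < T1" for r
      using zeta_is_solution mem(1)[OF that] by (auto simp: is_solution_def)
    show "lipschitz_periodic (zeta r) (slope r)" if "\<bar>r\<bar> < T1" for r
      by (rule zeta_lipschitz_periodic[OF mem(1)[OF that]])
    show "W1inf_norm (\<xi> r) \<le> max R C" if "\<bar>r\<bar> \<le> \<bar>t\<bar>" for r using R[OF that] by simp
    show "\<bar>slope r x\<bar> \<le> max R C" if "\<bar>r\<bar> \<le> \<bar>t\<bar>" "x \<in> {0..2*pi}" for r x using C1[OF that] by simp
    show "\<bar>slope r x - slope r x'\<bar> \<le> C * \<bar>x - x'\<bar>" if "\<bar>r\<bar> \<le> \<bar>t\<bar>" "x \<in> {0..2*pi}" "x' \<in> {0..2*pi}" for r x x'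
      by (rule C2[OF that])
    show "\<xi> 0 = zeta 0" using s by (simp add: is_solution_def)
  qed (use T1 C in auto)
qed

theorem zeta_is_unique_maximal_solution: "is_unique_maximal_solution \<tau> (zeta 0) zeta"
  unfolding is_unique_maximal_solution_def
proof (intro conjI allI impI \<tau> zeta_is_solution)
  fix \<tau>' \<xi> assume pos: "0 < \<tau>'" and s: "is_solution \<tau>' (zeta 0) \<xi>"
  show le: "\<tau>' \<le> \<tau>"
  proof (rule ccontr)
    assume "\<not> \<tau>' \<le> \<tau>"
    then have lt: "\<tau> < \<tau>'" by simp
    then obtain T where T: "\<tau> = ereal T" using \<tau> by (cases \<tau>) auto
    obtain R where R: "\<And>t. \<bar>t\<bar> \<le> T \<Longrightarrow> W1inf_norm (\<xi> t) \<le> R"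
      by (rule W1inf_norm_bounded_of_solution[OF s lt[unfolded T]]) blast
    have "\<bar>W t x\<bar> \<le> R" if t: "\<bar>t\<bar> < T" and x: "x \<in> {0..2*pi}" for t x
    proof -
      have m: "t \<in> time_interval \<tau>" "t \<in> time_interval \<tau>'"
        using t lt T by (auto simp: time_interval_def intro: less_trans[of _ "ereal T"])
      show ?thesis
        using abs_W_le_norm[OF m(1) x] R[of t] t by (simp add: solution_agrees_with_zeta[OF s m])
    qed
    then show False by (rule unbounded_slope_of_finite_life[OF T])
  qed
  show "\<forall>t\<in>time_interval \<tau>'. \<xi> t = zeta t"
  proof
    fix t assume t: "t \<in> time_interval \<tau>'"
    then have "t \<in> time_interval \<tau>" using le by (auto simp: time_interval_def)
    then show "\<xi> t = zeta t" by (rule solution_agrees_with_zeta[OF s _ t])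
  qed
qed

end

section \<open>Energy and smallness\<close>

lemma exponential_growth_bound:
  fixes f :: "real \<Rightarrow> real"
  assumes d: "\<And>s. \<bar>s\<bar> \<le> \<bar>t\<bar> \<Longrightarrow> (f has_real_derivative f' s) (at s)"
    and b: "\<And>s. \<bar>s\<bar> \<le> \<bar>t\<bar> \<Longrightarrow> \<bar>f' s\<bar> \<le> c * f s"
  shows "f t \<le> f 0 * exp (c * \<bar>t\<bar>)"
proof -
  have *: "g r \<le> g 0 * exp (c * r)"
    if r: "0 \<le> r" and dg: "\<And>s. 0 \<le> s \<Longrightarrow> s \<le> r \<Longrightarrow> (g has_real_derivative g' s) (at s)"
      and bg: "\<And>s. 0 \<le> s \<Longrightarrow> s \<le> r \<Longrightarrow> g' s \<le> c * g s" for g g' :: "real \<Rightarrow> real" and r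
  proof -
    have "g r * exp (- (c * r)) \<le> g 0 * exp (- (c * 0))"
    proof (rule DERIV_nonpos_imp_nonincreasing[OF r])
      fix s assume s: "0 \<le> s" "s \<le> r"
      have "((\<lambda>s. g s * exp (- (c * s))) has_real_derivative ((g' s - c * g s) * exp (- (c * s)))) (at s)"
        by (rule derivative_eq_intros dg s refl | simp add: algebra_simps)+
      moreover have "(g' s - c * g s) * exp (- (c * s)) \<le> 0"
        using bg[OF s] by (intro mult_nonpos_nonneg) auto
      ultimately show "\<exists>y. ((\<lambda>s. g s * exp (- (c * s))) has_real_derivative y) (at s) \<and> y \<le> 0" by blast
    qed
    then show ?thesis by (simp add: exp_minus field_simps)
  qed
  show ?thesis
  proof (cases "0 \<le> t")
    case True
    then show ?thesis using *[of t f f'] d b by (simp add: abs_le_iff)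
  next
    case False
    have "((\<lambda>s. f (- s)) has_real_derivative - f' (- s)) (at s)" if "0 \<le> s" "s \<le> - t" for s
      using DERIV_mirror[of f "f' (-s)" s] d[of "-s"] that by simp
    then show ?thesis
      using *[of "-t" "\<lambda>s. f (- s)" "\<lambda>s. - f' (- s)"] b[of "- s" for s] False by (simp add: abs_le_iff)
  qed
qed

text \<open>At its first zero a function that was negative before cannot have a negative derivative.\<close>

lemma negative_until_first_zero:
  fixes g :: "real \<Rightarrow> real"
  assumes d: "\<And>s. 0 \<le> s \<Longrightarrow> s \<le> S \<Longrightarrow> (g has_real_derivative g' s) (at s)"
    and "g 0 < 0" and z: "\<And>s. 0 \<le> s \<Longrightarrow> s \<le> S \<Longrightarrow> g s = 0 \<Longrightarrow> g' s < 0" and "0 \<le> S"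
  shows "g S < 0"
proof (rule ccontr)
  assume "\<not> g S < 0"
  have c: "continuous_on {0..S} g"
    by (intro DERIV_continuous_on) (auto intro: d has_field_derivative_at_within)
  define Z where "Z = {s \<in> {0..S}. g s = 0}"
  have "\<exists>s\<ge>0. s \<le> S \<and> g s = 0" using \<open>\<not> g S < 0\<close> \<open>g 0 < 0\<close> \<open>0 \<le> S\<close> c by (intro IVT') auto
  then have "Z \<noteq> {}" by (auto simp: Z_def)
  moreover have "compact Z"
  proof -
    have "Z = {0..S} \<inter> g -` {0}" by (auto simp: Z_def)
    moreover have "closed ({0..S} \<inter> g -` {0})" by (rule continuous_closed_preimage[OF c]) auto
    ultimately have "closed Z" by simp
    moreover have "bounded Z" by (rule bounded_subset[of "{0..S}"]) (auto simp: Z_def)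
    ultimately show ?thesis by (simp add: compact_eq_bounded_closed)
  qed
  ultimately obtain r where r: "r \<in> Z" "\<And>s. s \<in> Z \<Longrightarrow> r \<le> s"
    using compact_attains_inf[of Z] by blast
  have r0: "0 < r" "r \<le> S" "g r = 0" using r(1) \<open>g 0 < 0\<close> by (auto simp: Z_def less_le)
  have neg: "g s < 0" if s: "0 \<le> s" "s < r" for s
  proof (rule ccontr)
    assume "\<not> g s < 0"
    then have "\<exists>q\<ge>0. q \<le> s \<and> g q = 0"
      using \<open>g 0 < 0\<close> s r0 by (intro IVT' continuous_on_subset[OF c]) auto
    then obtain q where "0 \<le> q" "q \<le> s" "g q = 0" by blast
    then have "q \<in> Z" using s r0 by (auto simp: Z_def)
    from r(2)[OF this] show False using \<open>q \<le> s\<close> s by simp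
  qed
  have "\<exists>e>0. \<forall>h>0. h < e \<longrightarrow> g r < g (r - h)"
    using DERIV_neg_dec_left[OF d z] r0 by simp
  then obtain e where e: "0 < e" "\<And>h. 0 < h \<Longrightarrow> h < e \<Longrightarrow> g r < g (r - h)" by blast
  define h where "h = min (e / 2) r"
  have "g r < g (r - h)" by (rule e(2)) (use e r0 in \<open>auto simp: h_def\<close>)
  moreover have "g (r - h) < 0" by (rule neg) (use e r0 in \<open>auto simp: h_def\<close>)
  ultimately show False using r0 by simp
qed

context lagrangian_solution begin

text \<open>In Eulerian variables this is \<open>\<integral> (\<partial>\<^sub>x\<zeta>)\<^sup>2\<close>.\<close>

definition energy :: "real \<Rightarrow> real" where
  "energy t = integral {0..2*pi} (bmul (bmul (W t) (W t)) (J t))"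

lemma energy_nonneg:
  assumes t: "t \<in> time_interval \<tau>"
  shows "0 \<le> energy t"
proof -
  have "0 \<le> W t \<xi> * W t \<xi> * J t \<xi>" for \<xi> using J_pos[OF t, of \<xi>] by simp
  then show ?thesis unfolding energy_def by (intro integral_nonneg bcontfun_integrable) simp
qed

text \<open>The cubic terms cancel between the stretching of \<open>J\<close> and the term \<open>- W\<^sup>2\<close> in the Riccati equation, and
  the terms with \<open>V\<close> and \<open>m\<close> integrate to zero. What remains is bounded by the energy itself.\<close>

lemma energy_has_derivative:
  assumes t: "t \<in> time_interval \<tau>"
  defines "D \<equiv> k * integral {0..2*pi} (bmul (const_bcontfun (pi / 2) - (1/2) *\<^sub>R X t) (bmul (bmul (W t) (W t)) (J t)))"
  shows "(energy has_real_derivative D) (at t)" "\<bar>D\<bar> \<le> (k * pi / 2) * energy t"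
proof -
  define F where "F = bmul (const_bcontfun (pi / 2) - (1/2) *\<^sub>R X t) (bmul (bmul (W t) (W t)) (J t))"
  define A where "A = bmul (W t) (J t)"
  define B where "B = bmul (bmul (W t) (V t)) (J t)"
  have "((\<lambda>t. bmul (bmul (W t) (W t)) (J t)) has_vector_derivative
      bmul (bmul (W t) (W t)) (- (k *\<^sub>R bmul (a t) (J t))) + bmul (bmul (W t) (k *\<^sub>R dW_field t) + bmul (k *\<^sub>R dW_field t) (W t)) (J t)) (at t)"
    by (intro bounded_bilinear.has_vector_derivative[OF bounded_bilinear_bmul] dW dJ t)
  moreover have "bmul (bmul (W t) (W t)) (- (k *\<^sub>R bmul (a t) (J t))) + bmul (bmul (W t) (k *\<^sub>R dW_field t) + bmul (k *\<^sub>R dW_field t) (W t)) (J t)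
      = k *\<^sub>R F + k *\<^sub>R B + (k * m t) *\<^sub>R A"
    by (rule bcontfun_eqI) (simp add: F_def A_def B_def dW(2)[OF t] a_apply field_simps power2_eq_square)
  ultimately have "((\<lambda>t. bmul (bmul (W t) (W t)) (J t)) has_vector_derivative k *\<^sub>R F + k *\<^sub>R B + (k * m t) *\<^sub>R A) (at t)" by simp
  from bounded_linear.has_vector_derivative[OF bounded_linear_integral_bcontfun[of 0 "2*pi"] this]
  have "(energy has_real_derivative integral {0..2*pi} (k *\<^sub>R F + k *\<^sub>R B + (k * m t) *\<^sub>R A)) (at t)"
    by (simp add: energy_def[abs_def] has_real_derivative_iff_has_vector_derivative)
  moreover have "integral {0..2*pi} (k *\<^sub>R F + k *\<^sub>R B + (k * m t) *\<^sub>R A) = D"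
    using integral_WJ[OF t] integral_WVJ[OF t]
    by (simp only: linear_add[OF linear_integral] linear_scale[OF linear_integral] A_def B_def F_def D_def) simp
  ultimately show "(energy has_real_derivative D) (at t)" by simp
  have "norm (integral {0..2*pi} F) \<le> integral {0..2*pi} (\<lambda>\<xi>. pi / 2 * bmul (bmul (W t) (W t)) (J t) \<xi>)"
  proof (rule integral_norm_bound_integral)
    show "(\<lambda>\<xi>. pi / 2 * bmul (bmul (W t) (W t)) (J t) \<xi>) integrable_on {0..2*pi}"
      by (intro integrable_on_mult_right bcontfun_integrable)
    fix \<xi> assume "\<xi> \<in> {0..2*pi}"
    then have "X t \<xi> \<in> {0..2*pi}" by (rule X_range[OF t])
    then have "\<bar>pi / 2 - X t \<xi> / 2\<bar> \<le> pi / 2" by (simp add: abs_le_iff field_simps)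
    then have "\<bar>pi / 2 - X t \<xi> / 2\<bar> * (W t \<xi> * W t \<xi> * J t \<xi>) \<le> pi / 2 * (W t \<xi> * W t \<xi> * J t \<xi>)"
      using J_pos[OF t, of \<xi>] by (intro mult_right_mono) auto
    then show "norm (F \<xi>) \<le> pi / 2 * bmul (bmul (W t) (W t)) (J t) \<xi>"
      using J_pos[OF t, of \<xi>] by (simp add: F_def abs_mult)
  qed simp
  also have "\<dots> = pi / 2 * energy t" unfolding energy_def by (rule integral_mult_right)
  finally show "\<bar>D\<bar> \<le> (k * pi / 2) * energy t"
    using time_rate(1) by (simp add: D_def F_def[symmetric] abs_mult)
qed

lemma energy_growth:
  assumes t: "t \<in> time_interval \<tau>"
  shows "energy t \<le> energy 0 * exp (k * pi / 2 * \<bar>t\<bar>)"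
  by (rule exponential_growth_bound[OF energy_has_derivative[OF mem_interval[OF _ t]]])

text \<open>For each \<open>e\<close> one has \<open>\<bar>W\<bar> \<le> e / 2 + W\<^sup>2 / (2 e)\<close>, and \<open>V\<close> is the integral of \<open>W J\<close>. The constants are
  rounded generously.\<close>

lemma small_energy_bounds:
  assumes t: "t \<in> time_interval \<tau>" and e: "0 < e" "e \<le> 1" and E: "energy t \<le> e\<^sup>2"
  shows "\<xi> \<in> {0..2*pi} \<Longrightarrow> \<bar>V t \<xi>\<bar> \<le> 5 * e" "\<bar>m t\<bar> \<le> 6 * e" "\<bar>\<mu> t\<bar> \<le> 5 * e"
proof -
  let ?Q = "bmul (bmul (W t) (W t)) (J t)"
  have Qpos: "0 \<le> ?Q \<xi>" for \<xi> using J_pos[OF t, of \<xi>] by simp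
  show V: "\<bar>V t \<xi>\<bar> \<le> 5 * e" if \<xi>: "\<xi> \<in> {0..2*pi}" for \<xi>
  proof -
    have "norm (integral {0..\<xi>} (bmul (W t) (J t))) \<le> integral {0..\<xi>} (\<lambda>x. e / 2 * J t x + 1 / (2 * e) * ?Q x)"
    proof (rule integral_norm_bound_integral)
      show "(\<lambda>x. e / 2 * J t x + 1 / (2 * e) * ?Q x) integrable_on {0..\<xi>}"
        by (intro integrable_add integrable_on_mult_right bcontfun_integrable)
      fix x
      have "0 \<le> (\<bar>W t x\<bar> - e)\<^sup>2 / (2 * e)" using e by simp
      also have "\<dots> = e / 2 + 1 / (2 * e) * (W t x * W t x) - \<bar>W t x\<bar>"
        using e by (simp add: power2_diff field_simps power2_eq_square)
      finally have "\<bar>W t x\<bar> * J t x \<le> (e / 2 + 1 / (2 * e) * (W t x * W t x)) * J t x"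
        using J_pos[OF t, of x] by (intro mult_right_mono) auto
      then show "norm (bmul (W t) (J t) x) \<le> e / 2 * J t x + 1 / (2 * e) * ?Q x"
        using J_pos[OF t, of x] by (simp add: abs_mult algebra_simps)
    qed simp
    also have "\<dots> = e / 2 * integral {0..\<xi>} (J t) + 1 / (2 * e) * integral {0..\<xi>} ?Q"
      by (subst Henstock_Kurzweil_Integration.integral_add)
        (intro integrable_on_mult_right bcontfun_integrable | simp only: integral_mult_right)+
    also have "\<dots> \<le> e / 2 * (2 * pi) + 1 / (2 * e) * e\<^sup>2"
    proof (intro add_mono mult_left_mono)
      show "integral {0..\<xi>} (J t) \<le> 2 * pi" using X_range[OF t \<xi>] \<xi> by (simp add: X_eq)
      have "integral {0..\<xi>} ?Q \<le> integral {0..2*pi} ?Q"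
        using \<xi> Qpos by (intro integral_subset_le bcontfun_integrable) auto
      then show "integral {0..\<xi>} ?Q \<le> e\<^sup>2" using E by (simp add: energy_def)
    qed (use e in auto)
    also have "\<dots> = (pi + 1 / 2) * e" using e by (simp add: power2_eq_square field_simps)
    also have "\<dots> \<le> 5 * e" using e pi_less_4 by (intro mult_right_mono) auto
    finally show ?thesis using \<xi> by (simp add: V_eq)
  qed
  have intJ: "integral {0..2*pi} (J t) = 2 * pi" using invariants(1)[OF t] by (simp add: X_eq)
  have "norm (integral {0..2*pi} (bmul (V t + 2 *\<^sub>R bmul (W t) (W t)) (J t))) \<le> integral {0..2*pi} (\<lambda>x. 5 * e * J t x + 2 * ?Q x)"
  proof (rule integral_norm_bound_integral)
    show "(\<lambda>x. 5 * e * J t x + 2 * ?Q x) integrable_on {0..2*pi}"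
      by (intro integrable_add integrable_on_mult_right bcontfun_integrable)
    fix x assume x: "x \<in> {0..2*pi}"
    have "\<bar>V t x + 2 * (W t x * W t x)\<bar> \<le> \<bar>V t x\<bar> + \<bar>2 * (W t x * W t x)\<bar>" by (rule abs_triangle_ineq)
    also have "\<bar>2 * (W t x * W t x)\<bar> = 2 * (W t x * W t x)" by simp
    finally have "\<bar>V t x + 2 * (W t x * W t x)\<bar> \<le> 5 * e + 2 * (W t x * W t x)" using V[OF x] by linarith
    then have "\<bar>V t x + 2 * (W t x * W t x)\<bar> * J t x \<le> (5 * e + 2 * (W t x * W t x)) * J t x"
      using J_pos[OF t, of x] by (intro mult_right_mono) auto
    moreover have "norm (bmul (V t + 2 *\<^sub>R bmul (W t) (W t)) (J t) x) = \<bar>V t x + 2 * (W t x * W t x)\<bar> * J t x"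
      using J_pos[OF t, of x] by (simp add: abs_mult)
    moreover have "(5 * e + 2 * (W t x * W t x)) * J t x = 5 * e * J t x + 2 * ?Q x" by (simp add: distrib_right)
    ultimately show "norm (bmul (V t + 2 *\<^sub>R bmul (W t) (W t)) (J t) x) \<le> 5 * e * J t x + 2 * ?Q x" by simp
  qed simp
  also have "\<dots> = 5 * e * integral {0..2*pi} (J t) + 2 * integral {0..2*pi} ?Q"
    by (subst Henstock_Kurzweil_Integration.integral_add)
      (intro integrable_on_mult_right bcontfun_integrable | simp only: integral_mult_right)+
  also have "\<dots> \<le> 5 * e * (2 * pi) + 2 * e" 
  proof -
    have "e\<^sup>2 \<le> e" using e by (simp add: power2_eq_square)
    then show ?thesis using E by (simp add: intJ energy_def)
  qed
  also have "\<dots> \<le> 6 * e * (2 * pi)" using e pi_ge_two by (simp add: field_simps)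
  finally show "\<bar>m t\<bar> \<le> 6 * e" by (simp add: m_eq abs_mult field_simps)
  have "norm (integral {0..2*pi} (bmul (V t) (J t))) \<le> integral {0..2*pi} (\<lambda>x. 5 * e * J t x)"
  proof (rule integral_norm_bound_integral)
    show "(\<lambda>x. 5 * e * J t x) integrable_on {0..2*pi}" by (intro integrable_on_mult_right bcontfun_integrable)
    show "norm (bmul (V t) (J t) x) \<le> 5 * e * J t x" if "x \<in> {0..2*pi}" for x
      using V[OF that] J_pos[OF t, of x] by (simp add: abs_mult)
  qed simp
  also have "\<dots> = 5 * e * (2 * pi)" by (simp only: integral_mult_right intJ)
  finally show "\<bar>\<mu> t\<bar> \<le> 5 * e" by (simp add: \<mu>_eq abs_mult field_simps)
qed

lemma initial_norm_bounds:
  assumes e: "0 < e" "e \<le> 1" and E: "energy 0 \<le> e\<^sup>2" and d: "\<And>\<xi>. \<xi> \<in> {0..2*pi} \<Longrightarrow> \<bar>W 0 \<xi>\<bar> \<le> d"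
  shows "W1inf_norm (zeta 0) \<le> 10 * e + d" "H1_norm (zeta 0) \<le> 30 * e"
proof -
  note z = zeta_lipschitz_periodic[OF zero_mem] and b = small_energy_bounds[OF zero_mem e E]
  have le: "\<bar>zeta 0 x\<bar> \<le> 10 * e" if x: "x \<in> {0..2*pi}" for x
    using b(1)[OF label(1)[OF zero_mem x]] b(3) by (simp add: zeta_eq[OF zero_mem x] profile_def)
  show "W1inf_norm (zeta 0) \<le> 10 * e + d"
    by (rule W1inf_norm_le[OF z le]) (use d[OF label(1)[OF zero_mem]] in \<open>auto simp: slope_def\<close>)
  have "integral {0..2*pi} (\<lambda>x. (slope 0 x)\<^sup>2) = energy 0"
    using change_of_variables(2)[OF zero_mem, of "bmul (W 0) (W 0)"] by (simp add: slope_def energy_def power2_eq_square)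
  moreover have "integral {0..2*pi} (\<lambda>x. (zeta 0 x)\<^sup>2) \<le> integral {0..2*pi} (\<lambda>x. (10 * e)\<^sup>2)"
  proof (rule integral_le)
    show "(\<lambda>x. (zeta 0 x)\<^sup>2) integrable_on {0..2*pi}"
      by (intro integrable_continuous_interval continuous_intros continuous_on_subset[OF lipschitz_periodicD(7)[OF z]]) auto
    show "(zeta 0 x)\<^sup>2 \<le> (10 * e)\<^sup>2" if "x \<in> {0..2*pi}" for x
    proof -
      have "\<bar>zeta 0 x\<bar> \<le> \<bar>10 * e\<bar>" using le[OF that] e by simp
      then show ?thesis by (simp only: abs_le_square_iff)
    qed
  qed (rule integrable_const_ivl)
  moreover have "integral {0..2*pi} (\<lambda>x. (10 * e)\<^sup>2) \<le> 800 * e\<^sup>2"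
    using pi_less_4 by (simp add: power_mult_distrib mult_right_mono)
  moreover have "(30 * e)\<^sup>2 = 900 * e\<^sup>2" by (simp add: power_mult_distrib)
  ultimately have "integral {0..2*pi} (\<lambda>x. (zeta 0 x)\<^sup>2) + integral {0..2*pi} (\<lambda>x. (slope 0 x)\<^sup>2) \<le> (30 * e)\<^sup>2"
    using E zero_le_power2[of e] by linarith
  then have "sqrt (integral {0..2*pi} (\<lambda>x. (zeta 0 x)\<^sup>2) + integral {0..2*pi} (\<lambda>x. (slope 0 x)\<^sup>2)) \<le> sqrt ((30 * e)\<^sup>2)"
    by (rule real_sqrt_le_mono)
  also have "sqrt ((30 * e)\<^sup>2) = 30 * e" using e unfolding real_sqrt_abs by simp
  finally show "H1_norm (zeta 0) \<le> 30 * e" by (simp only: H1_norm_eq[OF z])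
qed

end

section \<open>Growth of the slope at the peak\<close>

lemma integral_one_minus_power:
  "integral {0..2*pi} (\<lambda>x. (1 - x / (2*pi)) ^ n) = 2 * pi / (real n + 1)"
  "\<xi> \<in> {0..2*pi} \<Longrightarrow> integral {0..\<xi>} (\<lambda>x. (1 - x / (2*pi)) ^ n) = 2 * pi / (real n + 1) * (1 - (1 - \<xi> / (2*pi)) ^ Suc n)"
proof -
  have p: "primitive_on (2*pi) (\<lambda>x. - 2 * pi / (real n + 1) * (1 - x / (2*pi)) ^ Suc n) (\<lambda>x. (1 - x / (2*pi)) ^ n)"
  proof (rule primitive_on_has_derivative)
    fix x :: real
    have "((\<lambda>x. - 2 * pi / (real n + 1) * (1 - x / (2*pi)) ^ Suc n) has_real_derivative
        - 2 * pi / (real n + 1) * ((1 + real n) * ((0 - 1 / (2*pi)) * (1 - x / (2*pi)) ^ n))) (at x within {0..2*pi})"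
      by (intro DERIV_cmult DERIV_power_Suc DERIV_diff DERIV_const DERIV_cdivide DERIV_ident)
    moreover have "- 2 * pi / (real n + 1) * ((1 + real n) * ((0 - 1 / (2*pi)) * q)) = q" for q :: real
    proof -
      define c where "c = real n + 1"
      have "c \<noteq> 0" and c: "1 + real n = c" "real n + 1 = c" by (auto simp: c_def)
      show ?thesis unfolding c using \<open>c \<noteq> 0\<close> by simp
    qed
    ultimately show "((\<lambda>x. - 2 * pi / (real n + 1) * (1 - x / (2*pi)) ^ Suc n) has_real_derivative (1 - x / (2*pi)) ^ n) (at x within {0..2*pi})"
      by simp
  qed (intro continuous_intros, simp)
  show 1: "\<xi> \<in> {0..2*pi} \<Longrightarrow> integral {0..\<xi>} (\<lambda>x. (1 - x / (2*pi)) ^ n) = 2 * pi / (real n + 1) * (1 - (1 - \<xi> / (2*pi)) ^ Suc n)" for \<xi>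
    using primitive_on_eq[OF p, of \<xi>] by (simp add: algebra_simps)
  show "integral {0..2*pi} (\<lambda>x. (1 - x / (2*pi)) ^ n) = 2 * pi / (real n + 1)"
    using 1[of "2*pi"] by simp
qed

text \<open>The negative part of this profile is concentrated near \<open>\<xi> = 0\<close>, which makes its energy small although its value at \<open>0\<close> is about \<open>- d\<close>. The constant \<open>1 / (n + 2)\<close> is the mean
  of the power, so that the profile has mean zero.\<close>

lemma initial_slope:
  fixes d :: real and n :: nat
  obtains K0 :: "real \<Rightarrow>\<^sub>C real" and p0 where "p0 = d * (1 / (real n + 2) - 1)"
    "\<And>\<xi>. \<xi> \<in> {0..2*pi} \<Longrightarrow> lag_W (const_bcontfun 1, K0, p0) \<xi> = d * (1 / (real n + 2) - (1 - \<xi> / (2*pi)) ^ Suc n)"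
    "integral {0..2*pi} (lag_W (const_bcontfun 1, K0, p0)) = 0"
    "integral {0..2*pi} (\<lambda>\<xi>. (lag_W (const_bcontfun 1, K0, p0) \<xi>)\<^sup>2) \<le> 2 * pi * d\<^sup>2 / (real n + 1)"
proof -
  define p0 where "p0 = d * (1 / (real n + 2) - 1)"
  define c where "c = d * (real n + 1) / (2 * pi)"
  define f where "f \<xi> = c * (1 - clamp_2pi \<xi> / (2*pi)) ^ n" for \<xi>
  have "f \<in> bcontfun"
  proof (rule bcontfun_normI)
    show "continuous_on UNIV f"
      unfolding f_def[abs_def] by (intro continuous_intros continuous_clamp_2pi) simp
    show "norm (f \<xi>) \<le> \<bar>c\<bar> * 1" for \<xi>
    proof -
      have "clamp_2pi \<xi> / (2*pi) \<le> 1" by (subst divide_le_eq_1_pos) auto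
      then have q: "0 \<le> 1 - clamp_2pi \<xi> / (2*pi)" "1 - clamp_2pi \<xi> / (2*pi) \<le> 1" by simp_all
      have "0 \<le> (1 - clamp_2pi \<xi> / (2*pi)) ^ n" by (rule zero_le_power[OF q(1)])
      moreover have "(1 - clamp_2pi \<xi> / (2*pi)) ^ n \<le> 1" by (rule power_le_one[OF q])
      ultimately show ?thesis unfolding f_def real_norm_def abs_mult by (intro mult_left_mono) auto
    qed
  qed
  then have f: "apply_bcontfun (Bcontfun f) = f" by (rule Bcontfun_inverse)
  define Y where "Y = lag_W (const_bcontfun 1, Bcontfun f, p0)"
  define q where "q \<xi> = 1 - \<xi> / (2*pi)" for \<xi>
  have W: "Y \<xi> = d * (1 / (real n + 2) - q \<xi> ^ Suc n)" if \<xi>: "\<xi> \<in> {0..2*pi}" for \<xi>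
  proof -
    have "integral {0..\<xi>} f = integral {0..\<xi>} (\<lambda>x. c * (1 - x / (2*pi)) ^ n)"
      by (rule integral_cong) (use \<xi> in \<open>simp add: f_def\<close>)
    also have "\<dots> = c * (2 * pi / (real n + 1) * (1 - (1 - \<xi> / (2*pi)) ^ Suc n))"
      by (simp only: integral_mult_right integral_one_minus_power(2)[OF \<xi>])
    also have "\<dots> = d * (1 - q \<xi> ^ Suc n)" by (simp add: c_def q_def del: power_Suc)
    finally show ?thesis using \<xi> by (simp add: Y_def lag_W_def f p0_def algebra_simps del: power_Suc)
  qed
  have qi: "(\<lambda>\<xi>. q \<xi> ^ j) integrable_on {0..2*pi}" for j
    unfolding q_def by (intro integrable_continuous_interval continuous_intros) simp
  have qI: "integral {0..2*pi} (\<lambda>\<xi>. q \<xi> ^ j) = 2 * pi / (real j + 1)" for j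
    unfolding q_def by (rule integral_one_minus_power)
  have "integral {0..2*pi} Y = integral {0..2*pi} (\<lambda>\<xi>. d * (1 / (real n + 2) - q \<xi> ^ Suc n))"
    by (rule integral_cong) (rule W)
  also have "\<dots> = d * (integral {0..2*pi} (\<lambda>\<xi>. 1 / (real n + 2)) - integral {0..2*pi} (\<lambda>\<xi>. q \<xi> ^ Suc n))"
    unfolding integral_mult_right
    by (subst Henstock_Kurzweil_Integration.integral_diff[OF integrable_const_ivl qi]) (rule refl)
  also have "\<dots> = 0" unfolding qI by (simp add: field_simps)
  finally have mean: "integral {0..2*pi} Y = 0" .
  define b where "b = 1 / (real n + 2)"
  \<comment> \<open>\<open>\<integral>(b - q\<^sup>j)\<^sup>2 = \<integral>q\<^bsup>2j\<^esup> - 2\<pi>b\<^sup>2\<close> because \<open>b\<close> is the mean of \<open>q\<^sup>j\<close>\<close>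
  have "integral {0..2*pi} (\<lambda>\<xi>. (Y \<xi>)\<^sup>2) = integral {0..2*pi} (\<lambda>\<xi>. d\<^sup>2 * q \<xi> ^ (2 * Suc n) + (2 * d * b * Y \<xi> - d\<^sup>2 * b\<^sup>2))"
  proof (rule integral_cong)
    fix \<xi> :: real assume "\<xi> \<in> {0..2*pi}"
    have "(d * (b - Q))\<^sup>2 = d\<^sup>2 * Q\<^sup>2 + (2 * d * b * (d * (b - Q)) - d\<^sup>2 * b\<^sup>2)" for Q
      by (simp add: power2_eq_square algebra_simps)
    then show "(Y \<xi>)\<^sup>2 = d\<^sup>2 * q \<xi> ^ (2 * Suc n) + (2 * d * b * Y \<xi> - d\<^sup>2 * b\<^sup>2)"
      unfolding W[OF \<open>\<xi> \<in> {0..2*pi}\<close>] power_even_eq b_def[symmetric] .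
  qed
  also have "\<dots> = d\<^sup>2 * integral {0..2*pi} (\<lambda>\<xi>. q \<xi> ^ (2 * Suc n))
      + (2 * d * b * integral {0..2*pi} Y - integral {0..2*pi} (\<lambda>\<xi>. d\<^sup>2 * b\<^sup>2))"
  proof -
    have i: "(\<lambda>\<xi>. d\<^sup>2 * q \<xi> ^ (2 * Suc n)) integrable_on {0..2*pi}" "(\<lambda>\<xi>. 2 * d * b * Y \<xi>) integrable_on {0..2*pi}"
      "(\<lambda>\<xi>. d\<^sup>2 * b\<^sup>2) integrable_on {0..2*pi}"
      by (intro integrable_on_mult_right qi bcontfun_integrable integrable_const_ivl)+
    show ?thesis
      using Henstock_Kurzweil_Integration.integral_add[OF i(1) integrable_diff[OF i(2,3)]]
        Henstock_Kurzweil_Integration.integral_diff[OF i(2,3)]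
      by (simp only: integral_mult_right)
  qed
  also have "\<dots> \<le> d\<^sup>2 * (2 * pi / (real n + 1))"
  proof -
    have "2 * pi / (real (2 * Suc n) + 1) \<le> 2 * pi / (real n + 1)" by (intro divide_left_mono) auto
    then have "d\<^sup>2 * (2 * pi / (real (2 * Suc n) + 1)) \<le> d\<^sup>2 * (2 * pi / (real n + 1))"
      by (rule mult_left_mono) simp
    moreover have "integral {0..2*pi} (\<lambda>\<xi>. d\<^sup>2 * b\<^sup>2) = 2 * pi * (d\<^sup>2 * b\<^sup>2)" by simp
    moreover have "0 \<le> 2 * pi * (d\<^sup>2 * b\<^sup>2)" by simp
    ultimately show ?thesis unfolding mean qI by linarith
  qed
  finally have sq: "integral {0..2*pi} (\<lambda>\<xi>. (Y \<xi>)\<^sup>2) \<le> 2 * pi * d\<^sup>2 / (real n + 1)" by (simp add: mult.commute)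
  show ?thesis
    by (rule that[of p0 "Bcontfun f", folded Y_def, OF p0_def W[unfolded q_def] mean sq])
qed

context maximal_lagrangian_solution begin

text \<open>The time \<open>T\<close> is so large that exponential growth with the rate \<open>k \<pi> / 2\<close> turns \<open>- d / 4\<close> into \<open>- 1\<close>. The
  smallness of \<open>e\<close> keeps \<open>V\<close> and \<open>m\<close> below both \<open>d\<close> and the barrier \<open>exp (- 5 k T)\<close> up to time \<open>T\<close>.
  If the life span is at most \<open>T\<close>, then backwards in time the Riccati equation pushes the slope upwards, and
  the danger is that it escapes to \<open>+ \<infinity>\<close>. The positive part of the initial slope is below \<open>exp (- 5 k T)\<close>, and
  growing at the rate \<open>5 k\<close> it stays below \<open>1\<close> up to time \<open>T\<close>.\<close>

lemma reaches_unit_norm: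
  assumes d: "0 < d" "d \<le> 1 / 2" and T: "0 \<le> T" "4 / d \<le> exp (k * pi / 2 * T)"
    and e: "0 < e" "e \<le> d / 16" "6 * e \<le> exp (- (5 * k * T))"
    and W0: "\<And>\<xi>. \<xi> \<in> {0..2*pi} \<Longrightarrow> - d \<le> W 0 \<xi>" "\<And>\<xi>. \<xi> \<in> {0..2*pi} \<Longrightarrow> W 0 \<xi> < exp (- (5 * k * T))"
    and p0: "p0 \<le> - d / 2"
    and E: "energy 0 * exp (k * pi / 2 * T) \<le> e\<^sup>2"
    and small: "W1inf_norm (zeta 0) < 1"
  shows "\<exists>t. 0 < t \<and> ereal t < \<tau> \<and> W1inf_norm (zeta t) = 1"
proof (rule ccontr)
  assume no: "\<not> ?thesis"
  have k: "0 < k" by (rule time_rate)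
  have e1: "e \<le> 1 / 32" using e d by simp
  have lt1: "W1inf_norm (zeta t) < 1" if t: "0 \<le> t" "ereal t < \<tau>" for t
  proof (rule ccontr)
    assume "\<not> W1inf_norm (zeta t) < 1"
    moreover have "{0..t} \<subseteq> time_interval \<tau>"
    proof
      fix s assume "s \<in> {0..t}"
      then have "ereal \<bar>s\<bar> \<le> ereal t" by simp
      then show "s \<in> time_interval \<tau>" unfolding time_interval_def using t(2) by (simp only: le_less_trans mem_Collect_eq)
    qed
    then have "continuous_on {0..t} (\<lambda>t. W1inf_norm (zeta t))"
      by (rule continuous_on_subset[OF W1inf_norm_continuous_of_solution[OF zeta_is_solution]])
    ultimately have "\<exists>s\<ge>0. s \<le> t \<and> W1inf_norm (zeta s) = 1"
      using small t by (intro IVT') auto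
    then obtain s where s: "0 \<le> s" "s \<le> t" "W1inf_norm (zeta s) = 1" by blast
    then have "s \<noteq> 0" "ereal s < \<tau>" using small t le_less_trans[of "ereal s" "ereal t" \<tau>] by auto
    then show False using no s by auto
  qed
  have W1: "\<bar>W t \<xi>\<bar> < 1" if "0 \<le> t" "ereal t < \<tau>" "\<xi> \<in> {0..2*pi}" for t \<xi>
    using abs_W_le_norm[of t \<xi>] lt1[of t] that by (simp add: time_interval_def)
  \<comment> \<open>up to time \<open>T\<close> the lower order terms are negligible\<close>
  have small_terms: "\<bar>m t\<bar> \<le> 6 * e" "\<xi> \<in> {0..2*pi} \<Longrightarrow> \<bar>(V t \<xi> + m t) / 2\<bar> \<le> 6 * e"
    if t: "t \<in> time_interval \<tau>" "\<bar>t\<bar> \<le> T" for t \<xi>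
  proof -
    have "energy t \<le> energy 0 * exp (k * pi / 2 * \<bar>t\<bar>)" by (rule energy_growth[OF t(1)])
    also have "\<dots> \<le> energy 0 * exp (k * pi / 2 * T)"
      using t k energy_nonneg[OF zero_mem] by (intro mult_left_mono) (auto intro: mult_left_mono)
    finally have Et: "energy t \<le> e\<^sup>2" using E by simp
    note b = small_energy_bounds[OF t(1) e(1) _ Et]
    show "\<bar>m t\<bar> \<le> 6 * e" using b(2) e1 by simp
    show "\<xi> \<in> {0..2*pi} \<Longrightarrow> \<bar>(V t \<xi> + m t) / 2\<bar> \<le> 6 * e" using b(1)[of \<xi>] b(2) e1 e(1) by (simp add: abs_le_iff)
  qed
  show False
  proof (cases "ereal T < \<tau>")
    case True
    have TI: "T \<in> time_interval \<tau>" using True T by (simp add: time_interval_def)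
    \<comment> \<open>the shift by \<open>4 * e\<close> absorbs the term with \<open>m\<close>, because \<open>m / 2 \<le> 3 * e \<le> 2 * pi * e\<close>\<close>
    define c where "c = k * pi / 2"
    define g where "g t = (p t + 4 * e) * exp (- (c * t))" for t
    have "g T \<le> g 0"
    proof (rule DERIV_nonpos_imp_nonincreasing[OF T(1)])
      fix s assume s: "0 \<le> s" "s \<le> T"
      have sI: "s \<in> time_interval \<tau>" by (rule mem_interval[OF _ TI]) (use s in auto)
      define p' where "p' = k * (pi / 2 * p s - (p s)\<^sup>2 + m s / 2)"
      have "(g has_real_derivative ((p' - c * (p s + 4 * e)) * exp (- (c * s)))) (at s)"
        unfolding g_def[abs_def] p'_def
        by (rule derivative_eq_intros dp[OF sI] refl | simp add: algebra_simps)+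
      moreover have "p' - c * (p s + 4 * e) \<le> 0"
      proof -
        have "m s / 2 \<le> 3 * e" using small_terms(1)[OF sI] s by simp
        also have "\<dots> \<le> 2 * pi * e" using pi_ge_two e(1) by (intro mult_right_mono) auto
        finally have "m s / 2 \<le> 2 * pi * e" .
        then have "- (p s)\<^sup>2 + (m s / 2 - 2 * pi * e) \<le> 0" using zero_le_power2[of "p s"] by linarith
        then have "k * (- (p s)\<^sup>2 + (m s / 2 - 2 * pi * e)) \<le> 0" using k by (simp add: mult_le_0_iff)
        then show ?thesis by (simp add: p'_def c_def algebra_simps)
      qed
      then have "(p' - c * (p s + 4 * e)) * exp (- (c * s)) \<le> 0" by (intro mult_nonpos_nonneg) auto
      ultimately show "\<exists>y. (g has_real_derivative y) (at s) \<and> y \<le> 0" by blast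
    qed
    also have "g 0 \<le> - d / 4" using p0 e by (simp add: g_def initial)
    finally have "p T + 4 * e \<le> - d / 4 * exp (c * T)" by (simp add: g_def exp_minus field_simps)
    also have "\<dots> \<le> - d / 4 * (4 / d)" using T d by (intro mult_left_mono_neg) (auto simp: c_def)
    also have "\<dots> = - 1" using d by simp
    finally have "p T \<le> - 1" using e by simp
    then show False using W1[OF T(1) True, of 0] by (simp add: at_0)
  next
    case False
    then obtain S where S: "\<tau> = ereal S" "S \<le> T" using \<tau> by (cases \<tau>) auto
    have mem: "t \<in> time_interval \<tau>" if "\<bar>t\<bar> < S" for t using that S by (simp add: time_interval_def)
    have "\<bar>W t \<xi>\<bar> \<le> 3" if t: "\<bar>t\<bar> < S" and \<xi>: "\<xi> \<in> {0..2*pi}" for t \<xi>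
    proof (cases "0 \<le> t")
      case True
      then show ?thesis using W1[OF True _ \<xi>] t S by simp
    next
      case False
      define r where "r = - t"
      have r: "0 \<le> r" "r < S" using False t by (auto simp: r_def)
      define w where "w s = W (- s) \<xi>" for s
      define b where "b s = (pi - X (- s) \<xi>) / 2" for s
      define f where "f s = (V (- s) \<xi> + m (- s)) / 2" for s
      have dw: "(w has_real_derivative k * ((w s)\<^sup>2 - b s * w s - f s)) (at s)"
        and bs: "\<bar>b s\<bar> \<le> pi / 2" and fs: "\<bar>f s\<bar> \<le> 6 * e" if s: "0 \<le> s" "s \<le> r" for s
      proof -
        have sI: "- s \<in> time_interval \<tau>" by (rule mem) (use s r in auto)
        have "((\<lambda>s. W (- s) \<xi>) has_real_derivative - (k * ((pi - X (- s) \<xi>) / 2 * W (- s) \<xi> - (W (- s) \<xi>)\<^sup>2 + (V (- s) \<xi> + m (- s)) / 2))) (at s)"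
          using DERIV_mirror[of "\<lambda>t. W t \<xi>" _ s] dW_apply[OF sI, of \<xi>] by blast
        moreover have "- (k * ((pi - X (- s) \<xi>) / 2 * W (- s) \<xi> - (W (- s) \<xi>)\<^sup>2 + (V (- s) \<xi> + m (- s)) / 2)) = k * ((w s)\<^sup>2 - b s * w s - f s)"
          by (simp add: w_def b_def f_def algebra_simps)
        ultimately show "(w has_real_derivative k * ((w s)\<^sup>2 - b s * w s - f s)) (at s)" by (simp add: w_def[abs_def])
        show "\<bar>b s\<bar> \<le> pi / 2" using X_range[OF sI \<xi>] by (simp add: b_def abs_le_iff)
        show "\<bar>f s\<bar> \<le> 6 * e" unfolding f_def by (rule small_terms(2)[OF sI _ \<xi>]) (use s r S in auto)
      qed
      \<comment> \<open>barriers: \<open>\<beta>\<close> from above and the constant \<open>- 3\<close> from below\<close>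
      define \<beta> where "\<beta> s = exp (5 * k * (s - T))" for s
      have \<beta>: "0 < \<beta> s" "\<beta> s \<le> 1" "6 * e \<le> \<beta> s" if s: "0 \<le> s" "s \<le> r" for s
      proof -
        show "0 < \<beta> s" by (simp add: \<beta>_def)
        show "\<beta> s \<le> 1" using s r S k by (simp add: \<beta>_def mult_le_0_iff)
        have "exp (- (5 * k * T)) \<le> \<beta> s" using s k by (simp add: \<beta>_def right_diff_distrib)
        then show "6 * e \<le> \<beta> s" using e by simp
      qed
      have "w r - \<beta> r < 0"
      proof (rule negative_until_first_zero[where g = "\<lambda>s. w s - \<beta> s" and S = r and g' = "\<lambda>s. k * ((w s)\<^sup>2 - b s * w s - f s) - 5 * k * \<beta> s"])
        fix s assume s: "0 \<le> s" "s \<le> r"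
        have "(\<beta> has_real_derivative 5 * k * \<beta> s) (at s)"
          unfolding \<beta>_def[abs_def] by (rule derivative_eq_intros refl | simp)+
        then show "((\<lambda>s. w s - \<beta> s) has_real_derivative k * ((w s)\<^sup>2 - b s * w s - f s) - 5 * k * \<beta> s) (at s)"
          by (intro DERIV_diff dw s)
        assume "w s - \<beta> s = 0"
        then have w: "w s = \<beta> s" by simp
        have "(\<beta> s)\<^sup>2 \<le> 1 * \<beta> s" using \<beta>[OF s] by (simp add: power2_eq_square)
        moreover have "- b s * \<beta> s \<le> pi / 2 * \<beta> s" using bs[OF s] \<beta>(1)[OF s] by (intro mult_right_mono) (auto simp: abs_le_iff)
        moreover have "pi / 2 * \<beta> s < 2 * \<beta> s" using pi_less_4 \<beta>(1)[OF s] by simp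
        moreover have "- f s \<le> \<beta> s" using fs[OF s] \<beta>(3)[OF s] by simp
        ultimately have "(w s)\<^sup>2 - b s * w s - f s - 5 * \<beta> s < 0" unfolding w using \<beta>(1)[OF s] by linarith
        then have "k * ((w s)\<^sup>2 - b s * w s - f s - 5 * \<beta> s) < 0" using k by (simp add: mult_less_0_iff)
        then show "k * ((w s)\<^sup>2 - b s * w s - f s) - 5 * k * \<beta> s < 0" by (simp add: algebra_simps)
      next
        show "w 0 - \<beta> 0 < 0" using W0(2)[OF \<xi>] by (simp add: w_def \<beta>_def)
      qed (rule r)
      moreover have "- w r - 3 < 0"
      proof (rule negative_until_first_zero[where g = "\<lambda>s. - w s - 3" and S = r and g' = "\<lambda>s. - (k * ((w s)\<^sup>2 - b s * w s - f s))"])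
        fix s assume s: "0 \<le> s" "s \<le> r"
        show "((\<lambda>s. - w s - 3) has_real_derivative - (k * ((w s)\<^sup>2 - b s * w s - f s))) (at s)"
          using DERIV_diff[OF DERIV_minus[OF dw[OF s]] DERIV_const[of 3]] by simp
        assume "- w s - 3 = 0"
        then have w: "w s = - 3" by simp
        have "- (3 * b s) \<le> 6" using bs[OF s] pi_less_4 by (simp add: abs_le_iff)
        then have "0 < (w s)\<^sup>2 - b s * w s - f s" using fs[OF s] e1 unfolding w by (simp add: abs_le_iff)
        then show "- (k * ((w s)\<^sup>2 - b s * w s - f s)) < 0" using k by simp
      next
        show "- w 0 - 3 < 0" using W0(1)[OF \<xi>] d by (simp add: w_def)
      qed (rule r)
      moreover have "\<beta> r \<le> 1" using \<beta>(2) r by simp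
      ultimately show ?thesis by (simp add: w_def r_def abs_le_iff)
    qed
    then show False by (rule unbounded_slope_of_finite_life[OF S(1)])
  qed
qed

end

theorem theorem4:
  fixes \<delta> :: real
  assumes "\<delta> > 0"
  shows "\<exists>\<zeta>\<^sub>0. \<zeta>\<^sub>0 \<in> H1_per \<inter> W1inf_per \<and>
           H1_norm \<zeta>\<^sub>0 \<le> \<delta>\<^sup>2 \<and> W1inf_norm \<zeta>\<^sub>0 \<le> \<delta> \<and>
           (\<exists>\<tau>\<^sub>0 \<zeta>. is_unique_maximal_solution \<tau>\<^sub>0 \<zeta>\<^sub>0 \<zeta> \<and>
             (\<exists>t\<^sub>0. 0 < t\<^sub>0 \<and> ereal t\<^sub>0 < \<tau>\<^sub>0 \<and> W1inf_norm (\<zeta> t\<^sub>0) = 1))"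
proof -
  define d where "d = min (\<delta> / 2) (1 / 2)"
  have d: "0 < d" "d \<le> 1 / 2" "d \<le> \<delta> / 2" using assms by (auto simp: d_def)
  define k where "k = time_rate"
  have k: "0 < k" by (simp add: k_def time_rate)
  \<comment> \<open>the time in which the linear instability amplifies by the factor \<open>4 / d\<close>\<close>
  define T where "T = ln (4 / d) / (k * pi / 2)"
  have T: "0 \<le> T" "exp (k * pi / 2 * T) = 4 / d" using d k by (auto simp: T_def)
  define r where "r = exp (- (5 * k * T))"
  have r: "0 < r" by (simp add: r_def)
  \<comment> \<open>the first two bounds are for the growth of the slope, the others for the norms of the initial function\<close>
  define e where "e = Min {d / 16, r / 6, \<delta> / 20, \<delta>\<^sup>2 / 30}"
  have e: "0 < e" "e \<le> d / 16" "6 * e \<le> r" "e \<le> \<delta> / 20" "e \<le> \<delta>\<^sup>2 / 30"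
    using d r assms by (auto simp: e_def)
  have e1: "e \<le> 1 / 32" using e d by simp
  obtain n where n: "2 * pi * d\<^sup>2 / (real n + 1) * (4 / d) \<le> e\<^sup>2" "d / (real n + 2) < r"
  proof -
    obtain n :: nat where nn: "max (2 * pi * d\<^sup>2 * (4 / d) / e\<^sup>2) (d / r) \<le> real n"
      using real_arch_simple by blast
    have "2 * pi * d\<^sup>2 * (4 / d) / e\<^sup>2 \<le> real n" using nn by (rule max.boundedE)
    then have "2 * pi * d\<^sup>2 * (4 / d) \<le> real n * e\<^sup>2" using e by (subst (asm) pos_divide_le_eq) auto
    also have "\<dots> \<le> e\<^sup>2 * (real n + 1)" by (simp add: algebra_simps)
    finally have "2 * pi * d\<^sup>2 * (4 / d) / (real n + 1) \<le> e\<^sup>2" by (subst pos_divide_le_eq) auto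
    then have "2 * pi * d\<^sup>2 / (real n + 1) * (4 / d) \<le> e\<^sup>2" by (simp only: times_divide_eq_left)
    moreover have "d \<le> real n * r" using nn r by (simp add: divide_le_eq)
    then have "d < r * (real n + 2)" using r by (simp add: algebra_simps)
    then have "d / (real n + 2) < r" by (subst pos_divide_less_eq) auto
    ultimately show ?thesis by (rule that)
  qed
  obtain K0 :: "real \<Rightarrow>\<^sub>C real" and p0 where p0: "p0 = d * (1 / (real n + 2) - 1)"
    and W0: "\<And>\<xi>. \<xi> \<in> {0..2*pi} \<Longrightarrow> lag_W (const_bcontfun 1, K0, p0) \<xi> = d * (1 / (real n + 2) - (1 - \<xi> / (2*pi)) ^ Suc n)"
    and mean: "integral {0..2*pi} (lag_W (const_bcontfun 1, K0, p0)) = 0"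
    and sq: "integral {0..2*pi} (\<lambda>\<xi>. (lag_W (const_bcontfun 1, K0, p0) \<xi>)\<^sup>2) \<le> 2 * pi * d\<^sup>2 / (real n + 1)"
    by (rule initial_slope[of d n]) (rule that)
  obtain \<tau> y where "0 < \<tau>" "y 0 = (const_bcontfun 1, K0, p0)"
    "\<And>t. t \<in> time_interval \<tau> \<Longrightarrow> (y has_vector_derivative lag_field (y t)) (at t)"
    "\<And>T R. \<tau> = ereal T \<Longrightarrow> \<exists>t. \<bar>t\<bar> < T \<and> R < norm (y t)"
    by (rule maximal_solution_of_ode[OF lipschitz_on_bounded_lag(1), of "(const_bcontfun 1, K0, p0)"]) blast
  then interpret L: maximal_lagrangian_solution \<tau> y K0 p0
    using mean by unfold_locales auto
  have W: "L.W 0 \<xi> = d * (1 / (real n + 2) - (1 - \<xi> / (2*pi)) ^ Suc n)" if "\<xi> \<in> {0..2*pi}" for \<xi>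
    using W0[OF that] by (simp add: L.W_def L.init)
  have Wb: "- d \<le> L.W 0 \<xi>" "L.W 0 \<xi> \<le> d / (real n + 2)" if \<xi>: "\<xi> \<in> {0..2*pi}" for \<xi>
  proof -
    define q where "q = (1 - \<xi> / (2*pi)) ^ Suc n"
    have base: "0 \<le> 1 - \<xi> / (2*pi)" "1 - \<xi> / (2*pi) \<le> 1" using \<xi> by (simp_all add: field_simps)
    have q: "0 \<le> q" "q \<le> 1" unfolding q_def by (rule zero_le_power[OF base(1)]) (rule power_le_one[OF base])
    have "d * (1 / (real n + 2) - q) \<le> d * (1 / (real n + 2))" using d q by (intro mult_left_mono) auto
    moreover have "d * (- 1) \<le> d * (1 / (real n + 2) - q)"
    proof (intro mult_left_mono)
      have "0 \<le> 1 / (real n + 2)" by simp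
      then show "- 1 \<le> 1 / (real n + 2) - q" using q by linarith
    qed (use d in auto)
    ultimately show "- d \<le> L.W 0 \<xi>" "L.W 0 \<xi> \<le> d / (real n + 2)" unfolding W[OF \<xi>] q_def[symmetric] by auto
  qed
  have abs: "\<bar>L.W 0 \<xi>\<bar> \<le> d" if "\<xi> \<in> {0..2*pi}" for \<xi>
  proof -
    have "d / (real n + 2) \<le> d / 1" using d by (intro divide_left_mono) auto
    then show ?thesis using Wb[OF that] by (simp add: abs_le_iff)
  qed
  have "L.energy 0 = integral {0..2*pi} (\<lambda>\<xi>. (lag_W (const_bcontfun 1, K0, p0) \<xi>)\<^sup>2)"
    unfolding L.energy_def L.initial L.W_def L.init by (rule integral_cong) (simp add: power2_eq_square)
  then have "L.energy 0 \<le> 2 * pi * d\<^sup>2 / (real n + 1)" using sq by simp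
  then have "L.energy 0 * (4 / d) \<le> 2 * pi * d\<^sup>2 / (real n + 1) * (4 / d)" using d by (intro mult_right_mono) auto
  then have E: "L.energy 0 * (4 / d) \<le> e\<^sup>2" using n(1) by simp
  have "L.energy 0 * 1 \<le> L.energy 0 * (4 / d)"
    using d L.energy_nonneg[OF L.zero_mem] by (intro mult_left_mono) (auto simp: field_simps)
  then have E0: "L.energy 0 \<le> e\<^sup>2" using E by simp
  note b = L.initial_norm_bounds[OF e(1) _ E0 abs]
  have "p0 \<le> - d / 2"
  proof -
    have "1 / (real n + 2) - 1 \<le> - (1 / 2)" by (simp add: field_simps)
    then have "d * (1 / (real n + 2) - 1) \<le> d * - (1 / 2)" using d by (intro mult_left_mono) auto
    then show ?thesis by (simp add: p0)
  qed
  then have "\<exists>t. 0 < t \<and> ereal t < \<tau> \<and> W1inf_norm (L.zeta t) = 1"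
    by (intro L.reaches_unit_norm[of d T e])
       (use d e T E Wb(1) le_less_trans[OF Wb(2) n(2)] b(1) e1 in \<open>auto simp: k_def r_def add.commute\<close>)
  moreover have "L.zeta 0 \<in> H1_per \<inter> W1inf_per"
    using lipschitz_periodic_spaces[OF L.zeta_lipschitz_periodic[OF L.zero_mem]] by blast
  moreover have "H1_norm (L.zeta 0) \<le> \<delta>\<^sup>2" "W1inf_norm (L.zeta 0) \<le> \<delta>"
    using b e d e1 by auto
  ultimately show ?thesis using L.zeta_is_unique_maximal_solution by blast
qed

end
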